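(* Let $-A$ be the generator of a $C_0$-semigroup $(T(t))_{t\ge0}$ on a Banach space $X$ such that $\mathbb{C}_-\subseteq\rho(A)$, and let $\alpha,\gamma\in[0,\infty)$. Then the following conditions are equivalent: (1) there exists a $C\ge0$ such that $\|T(t)\|_{\mathcal{L}(X_\gamma,X)}\le C(t^\alpha+1)$ for all $t\ge0$; (2) there exist $p,q\in[1,\infty]$ with $p\le q$ and a $C'\ge0$ such that $$\|(a+i\cdot+A)^{-1}\|_{\mathcal{M}_{p,q}(\mathbb{R};\mathcal{L}(X_\gamma,X))}\le C'(a^{-\alpha}+1)\qquad(a\in(0,\infty)).$$
   Context: Banach spaces are nonzero and over $\mathbb{C}$; $\mathcal{L}(Y,X)$ denotes the bounded operators from $Y$ to $X$; $\mathbb{C}_-=\{\mathrm{Re}(\lambda)<0\}$; $\rho(A)$ is the resolvent set. For $\gamma\in[0,\infty)$, $X_\gamma:=D((\omega+A)^\gamma)$ is the fractional domain with its graph norm, where $\omega$ is any fixed real number larger than the growth bound $\omega_0(T)$, so that $\omega+A$ is sectorial; up to equivalence of norms $X_\gamma$ does not depend on $\omega$. $(a+i\cdot+A)^{-1}$ denotes the map $\xi\mapsto(a+i\xi+A)^{-1}$, restricted to $X_\gamma$. The inequality in (2) includes the assertion that this map belongs to $\mathcal{M}_{p,q}(\mathbb{R};\mathcal{L}(X_\gamma,X))$. Fourier multipliers (with $Y$ a Banach space, here $Y=X_\gamma$): the Fourier transform is $\mathcal{F}f(\xi)=\hat f(\xi)=\int_{\mathbb{R}}e^{-i\xi t}f(t)\,dt$.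 A map $m:\mathbb{R}\to\mathcal{L}(Y,X)$ is $Y$-strongly measurable if $\xi\mapsto m(\xi)y$ is strongly measurable for all $y\in Y$, and of moderate growth if there are $\beta\in(0,\infty)$ and $h\in L^1(\mathbb{R})$ with $(1+|\xi|)^{-\beta}\|m(\xi)\|_{\mathcal{L}(Y,X)}\le h(\xi)$. For such $m$, $T_m:\mathcal{S}(\mathbb{R};Y)\to\mathcal{S}'(\mathbb{R};X)$ is $T_mf=\mathcal{F}^{-1}(m\hat f)$. For $p\in[1,\infty)$ and $q\in[1,\infty]$, $\mathcal{M}_{p,q}(\mathbb{R};\mathcal{L}(Y,X))$ is the set of all such $m$ for which $T_m$ extends to a bounded operator from $L^p(\mathbb{R};Y)$ to $L^q(\mathbb{R};X)$, with $\|m\|_{\mathcal{M}_{p,q}}$ the operator norm. For $p=q=\infty$: $m\in\mathcal{M}_{\infty,\infty}(\mathbb{R};\mathcal{L}(Y,X))$ if there is a $Y$-strongly measurable $K:\mathbb{R}\to\mathcal{L}(Y,X)$ with $K(\cdot)y\in L^1(\mathbb{R};X)$ and $m(\xi)y=\mathcal{F}(K(\cdot)y)(\xi)$ for all $y\in Y$, $\xi\in\mathbb{R}$, and a constant $C_0\ge0$ such that $T_mf(t):=\int_{\mathbb{R}}K(t-s)f(s)\,ds$ satisfies $\|T_mf\|_{L^\infty(\mathbb{R};X)}\le C_0\|f\|_{L^\infty(\mathbb{R};Y)}$ for all $Y$-valued simple functions $f$; $\|m\|_{\mathcal{M}_{\infty,\infty}}$ is the minimal such $C_0$. *)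

theory Defs
  imports "HOL-Analysis.Analysis"
begin

section \<open>Complex Banach spaces\<close>

class complex_banach = banach +
  fixes scaleC :: "complex \<Rightarrow> 'a \<Rightarrow> 'a"  (infixr "*\<^sub>C" 75)
  assumes scaleC_add_right: "c *\<^sub>C (x + y) = c *\<^sub>C x + c *\<^sub>C y"
    and scaleC_add_left: "(c + d) *\<^sub>C x = c *\<^sub>C x + d *\<^sub>C x"
    and scaleC_scaleC: "c *\<^sub>C d *\<^sub>C x = (c * d) *\<^sub>C x"
    and scaleR_scaleC: "r *\<^sub>R x = complex_of_real r *\<^sub>C x"
    and norm_scaleC: "norm (c *\<^sub>C x) = cmod c * norm x"

instantiation complex :: complex_banach
begin

definition scaleC_complex_def: "c *\<^sub>C (z :: complex) = c * z"

instance
  by standard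
    (simp_all add: scaleC_complex_def algebra_simps norm_mult scaleR_conv_of_real)

end

instantiation prod :: (complex_banach, complex_banach) complex_banach
begin

definition scaleC_prod_def: "c *\<^sub>C z = (c *\<^sub>C fst z, c *\<^sub>C snd z)"

instance
proof
  fix c d :: complex and r :: real and x y :: "'a \<times> 'b"
  show "c *\<^sub>C (x + y) = c *\<^sub>C x + c *\<^sub>C y"
    by (simp add: scaleC_prod_def scaleC_add_right)
  show "(c + d) *\<^sub>C x = c *\<^sub>C x + d *\<^sub>C x"
    by (simp add: scaleC_prod_def scaleC_add_left)
  show "c *\<^sub>C d *\<^sub>C x = (c * d) *\<^sub>C x"
    by (simp add: scaleC_prod_def scaleC_scaleC)
  show "r *\<^sub>R x = complex_of_real r *\<^sub>C x"
    by (simp add: scaleC_prod_def scaleR_prod_def scaleR_scaleC)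
  show "norm (c *\<^sub>C x) = cmod c * norm x"
    by (simp add: scaleC_prod_def norm_prod_def norm_scaleC power_mult_distrib
        flip: distrib_left) (simp add: real_sqrt_mult)
qed

end

text \<open>
  A Banach space \<open>Y\<close> that depends on other data (here: a fractional domain) cannot be a
  type. Throughout, such a \<open>Y\<close> is a closed complex-linear subspace of a complex Banach
  space type, with the inherited norm, and operators on \<open>Y\<close> are total functions of which
  only the values on \<open>Y\<close> matter.
\<close>

definition bounded_clinear_on ::
  "'y::complex_banach set \<Rightarrow> ('y \<Rightarrow> 'x::complex_banach) \<Rightarrow> bool" where
  "bounded_clinear_on Y f \<longleftrightarrow>
     (\<forall>x\<in>Y. \<forall>y\<in>Y. f (x + y) = f x + f y) \<and>
     (\<forall>c. \<forall>x\<in>Y. f (c *\<^sub>C x) = c *\<^sub>C f x) \<and>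
     (\<exists>C. \<forall>x\<in>Y. norm (f x) \<le> C * norm x)"

definition onorm_on ::
  "'y::complex_banach set \<Rightarrow> ('y \<Rightarrow> 'x::complex_banach) \<Rightarrow> real" where
  "onorm_on Y f = (SUP y\<in>Y. norm (f y) / norm y)"


section \<open>Semigroups and unbounded operators\<close>

definition C0_semigroup :: "(real \<Rightarrow> 'x::complex_banach \<Rightarrow> 'x) \<Rightarrow> bool" where
  "C0_semigroup T \<longleftrightarrow>
     (\<forall>t\<ge>0. bounded_clinear_on UNIV (T t)) \<and>
     (\<forall>x. T 0 x = x) \<and>
     (\<forall>s\<ge>0. \<forall>t\<ge>0. \<forall>x. T (s + t) x = T s (T t x)) \<and>
     (\<forall>x. continuous_on {0..} (\<lambda>t. T t x))"

text \<open>An unbounded operator is given by its domain \<open>D\<close> and a function, relevant on \<open>D\<close> only.\<close>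

definition is_generator ::
  "(real \<Rightarrow> 'x::complex_banach \<Rightarrow> 'x) \<Rightarrow> 'x set \<Rightarrow> ('x \<Rightarrow> 'x) \<Rightarrow> bool" where
  "is_generator T D G \<longleftrightarrow>
     D = {x. \<exists>y. ((\<lambda>t. (1 / t) *\<^sub>R (T t x - x)) \<longlongrightarrow> y) (at_right 0)} \<and>
     (\<forall>x\<in>D. ((\<lambda>t. (1 / t) *\<^sub>R (T t x - x)) \<longlongrightarrow> G x) (at_right 0))"

definition growth_bound :: "(real \<Rightarrow> 'x::complex_banach \<Rightarrow> 'x) \<Rightarrow> ereal" where
  "growth_bound T = Inf (ereal ` {w. \<exists>M. \<forall>t\<ge>0. onorm (T t) \<le> M * exp (w * t)})"

definition resolvent_set :: "'x::complex_banach set \<Rightarrow> ('x \<Rightarrow> 'x) \<Rightarrow> complex set" where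
  "resolvent_set D A =
     {z. bij_betw (\<lambda>x. z *\<^sub>C x - A x) D UNIV \<and>
         bounded_clinear_on UNIV (inv_into D (\<lambda>x. z *\<^sub>C x - A x))}"

text \<open>The operator \<open>(z + A)\<^sup>-\<^sup>1\<close>, for \<open>- z\<close> in the resolvent set of \<open>A\<close>.\<close>

definition shift_inverse ::
  "'x::complex_banach set \<Rightarrow> ('x \<Rightarrow> 'x) \<Rightarrow> complex \<Rightarrow> 'x \<Rightarrow> 'x" where
  "shift_inverse D A z = inv_into D (\<lambda>x. z *\<^sub>C x + A x)"


section \<open>Strong measurability, Bochner integral and Lebesgue-Bochner spaces\<close>

text \<open>
  The library's Bochner integral requires a second countable target. The definitions below
  follow it, replacing Borel measurability by strong measurability, so that they apply to
  arbitrary Banach spaces.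
\<close>

definition strongly_measurable :: "(real \<Rightarrow> 'x::complex_banach) \<Rightarrow> bool" where
  "strongly_measurable f \<longleftrightarrow>
     (\<exists>s. (\<forall>n. simple_function lebesgue (s n)) \<and>
          (AE t in lebesgue. (\<lambda>n. s n t) \<longlonglongrightarrow> f t))"

definition has_Bochner :: "(real \<Rightarrow> 'x::complex_banach) \<Rightarrow> 'x \<Rightarrow> bool" where
  "has_Bochner f z \<longleftrightarrow>
     strongly_measurable f \<and>
     (\<exists>s. (\<forall>n. Bochner_Integration.simple_bochner_integrable lebesgue (s n)) \<and>
          (\<lambda>n. \<integral>\<^sup>+t. ennreal (norm (f t - s n t)) \<partial>lebesgue) \<longlonglongrightarrow> 0 \<and>
          (\<lambda>n. Bochner_Integration.simple_bochner_integral lebesgue (s n)) \<longlonglongrightarrow> z)"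

definition Bochner :: "(real \<Rightarrow> 'x::complex_banach) \<Rightarrow> 'x" where
  "Bochner f = (THE z. has_Bochner f z)"

definition Lp_norm :: "ennreal \<Rightarrow> (real \<Rightarrow> 'x::complex_banach) \<Rightarrow> ennreal" where
  "Lp_norm p f =
     (if p = \<infinity> then Inf {c. AE t in lebesgue. ennreal (norm (f t)) \<le> c}
      else (let r = enn2real p;
                I = (\<integral>\<^sup>+t. ennreal (norm (f t) powr r) \<partial>lebesgue)
            in if I = \<infinity> then \<infinity> else ennreal (enn2real I powr (1 / r))))"

text \<open>Representatives of the elements of \<open>L\<^sup>p(\<real>;Y)\<close>; classes modulo null sets are not formed.\<close>

definition Lp_fun :: "ennreal \<Rightarrow> 'y::complex_banach set \<Rightarrow> (real \<Rightarrow> 'y) set" where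
  "Lp_fun p Y = {f. strongly_measurable f \<and> (\<forall>t. f t \<in> Y) \<and> Lp_norm p f < \<infinity>}"


section \<open>Fourier transform and Fourier multipliers\<close>

definition schwartz :: "'y::complex_banach set \<Rightarrow> (real \<Rightarrow> 'y) set" where
  "schwartz Y =
     {f. (\<forall>t. f t \<in> Y) \<and>
         (\<exists>d :: nat \<Rightarrow> real \<Rightarrow> 'y. d 0 = f \<and>
            (\<forall>n t. (d n has_vector_derivative d (Suc n) t) (at t)) \<and>
            (\<forall>n k. \<exists>C. \<forall>t. \<bar>t\<bar> ^ k * norm (d n t) \<le> C))}"

definition fourier :: "(real \<Rightarrow> 'x::complex_banach) \<Rightarrow> real \<Rightarrow> 'x" where
  "fourier f \<xi> = Bochner (\<lambda>t. exp (- (\<i> * of_real \<xi> * of_real t)) *\<^sub>C f t)"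

definition inv_fourier :: "(real \<Rightarrow> 'x::complex_banach) \<Rightarrow> real \<Rightarrow> 'x" where
  "inv_fourier g t =
     (1 / (2 * pi)) *\<^sub>R Bochner (\<lambda>\<xi>. exp (\<i> * of_real \<xi> * of_real t) *\<^sub>C g \<xi>)"

text \<open>
  The tempered distribution \<open>T\<^sub>m f = \<F>\<^sup>-\<^sup>1(m \<cdot> \<F> f)\<close> as a functional on scalar test
  functions, using \<open>\<langle>\<F>\<^sup>-\<^sup>1 u, \<phi>\<rangle> = \<langle>u, \<F>\<^sup>-\<^sup>1 \<phi>\<rangle>\<close>.
\<close>

definition multiplier_distr ::
  "(real \<Rightarrow> 'y::complex_banach \<Rightarrow> 'x::complex_banach) \<Rightarrow>
     (real \<Rightarrow> 'y) \<Rightarrow> (real \<Rightarrow> complex) \<Rightarrow> 'x" where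
  "multiplier_distr m f \<phi> = Bochner (\<lambda>\<xi>. inv_fourier \<phi> \<xi> *\<^sub>C m \<xi> (fourier f \<xi>))"

definition represents_distr ::
  "(real \<Rightarrow> 'x::complex_banach) \<Rightarrow> ((real \<Rightarrow> complex) \<Rightarrow> 'x) \<Rightarrow> bool" where
  "represents_distr g u \<longleftrightarrow> (\<forall>\<phi>\<in>schwartz UNIV. Bochner (\<lambda>t. \<phi> t *\<^sub>C g t) = u \<phi>)"

definition strongly_measurable_on ::
  "'y::complex_banach set \<Rightarrow> (real \<Rightarrow> 'y \<Rightarrow> 'x::complex_banach) \<Rightarrow> bool" where
  "strongly_measurable_on Y m \<longleftrightarrow> (\<forall>y\<in>Y. strongly_measurable (\<lambda>\<xi>. m \<xi> y))"

definition moderate_growth ::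
  "'y::complex_banach set \<Rightarrow> (real \<Rightarrow> 'y \<Rightarrow> 'x::complex_banach) \<Rightarrow> bool" where
  "moderate_growth Y m \<longleftrightarrow>
     (\<exists>\<beta>>0. \<exists>h. integrable lebesgue h \<and>
        (\<forall>\<xi>. (1 + \<bar>\<xi>\<bar>) powr (- \<beta>) * onorm_on Y (m \<xi>) \<le> h \<xi>))"

text \<open>
  \<open>T\<^sub>m\<close> extends to an operator \<open>S : L\<^sup>p(\<real>;Y) \<rightarrow> L\<^sup>q(\<real>;X)\<close> of norm at most \<open>C\<close>.
  \<open>S\<close> acts on representatives; linearity and the bound make it independent of their choice.
\<close>

definition multiplier_bound_finite ::
  "ennreal \<Rightarrow> ennreal \<Rightarrow> 'y::complex_banach set \<Rightarrow>
     (real \<Rightarrow> 'y \<Rightarrow> 'x::complex_banach) \<Rightarrow> real \<Rightarrow> bool" where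
  "multiplier_bound_finite p q Y m C \<longleftrightarrow>
     strongly_measurable_on Y m \<and> moderate_growth Y m \<and>
     (\<exists>S :: (real \<Rightarrow> 'y) \<Rightarrow> (real \<Rightarrow> 'x).
        (\<forall>f\<in>Lp_fun p Y. S f \<in> Lp_fun q UNIV \<and> Lp_norm q (S f) \<le> ennreal C * Lp_norm p f) \<and>
        (\<forall>f\<in>Lp_fun p Y. \<forall>g\<in>Lp_fun p Y.
           AE t in lebesgue. S (\<lambda>s. f s + g s) t = S f t + S g t) \<and>
        (\<forall>c. \<forall>f\<in>Lp_fun p Y. AE t in lebesgue. S (\<lambda>s. c *\<^sub>C f s) t = c *\<^sub>C S f t) \<and>
        (\<forall>f\<in>schwartz Y. represents_distr (S f) (multiplier_distr m f)))"

text \<open>The separate definition for \<open>p = q = \<infinity>\<close>, in terms of a convolution kernel \<open>K\<close>.\<close>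

definition multiplier_bound_infty ::
  "'y::complex_banach set \<Rightarrow> (real \<Rightarrow> 'y \<Rightarrow> 'x::complex_banach) \<Rightarrow> real \<Rightarrow> bool" where
  "multiplier_bound_infty Y m C \<longleftrightarrow>
     (\<exists>K :: real \<Rightarrow> 'y \<Rightarrow> 'x.
        (\<forall>t. bounded_clinear_on Y (K t)) \<and> strongly_measurable_on Y K \<and>
        (\<forall>y\<in>Y. (\<lambda>t. K t y) \<in> Lp_fun 1 UNIV \<and> (\<forall>\<xi>. m \<xi> y = fourier (\<lambda>t. K t y) \<xi>)) \<and>
        (\<forall>f. simple_function lebesgue f \<and> (\<forall>t. f t \<in> Y) \<longrightarrow>
           Lp_norm \<infinity> (\<lambda>t. Bochner (\<lambda>s. K (t - s) (f s))) \<le> ennreal C * Lp_norm \<infinity> f))"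

definition multiplier_bound ::
  "ennreal \<Rightarrow> ennreal \<Rightarrow> 'y::complex_banach set \<Rightarrow>
     (real \<Rightarrow> 'y \<Rightarrow> 'x::complex_banach) \<Rightarrow> real \<Rightarrow> bool" where
  "multiplier_bound p q Y m C \<longleftrightarrow>
     0 \<le> C \<and> (\<forall>\<xi>. bounded_clinear_on Y (m \<xi>)) \<and>
     (if p = \<infinity> then q = \<infinity> \<and> multiplier_bound_infty Y m C
      else multiplier_bound_finite p q Y m C)"

definition fourier_multipliers ::
  "ennreal \<Rightarrow> ennreal \<Rightarrow> 'y::complex_banach set \<Rightarrow>
     (real \<Rightarrow> 'y \<Rightarrow> 'x::complex_banach) set" where
  "fourier_multipliers p q Y = {m. \<exists>C. multiplier_bound p q Y m C}"

definition multiplier_norm ::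
  "ennreal \<Rightarrow> ennreal \<Rightarrow> 'y::complex_banach set \<Rightarrow>
     (real \<Rightarrow> 'y \<Rightarrow> 'x::complex_banach) \<Rightarrow> real" where
  "multiplier_norm p q Y m = Inf {C. multiplier_bound p q Y m C}"


section \<open>Fractional powers and fractional domains\<close>

text \<open>
  For a sectorial operator \<open>B\<close> with \<open>0 \<in> \<rho>(B)\<close> and \<open>0 < \<gamma> < n\<close>, the Balakrishnan-Komatsu formula is
  \<open>B\<^sup>-\<^sup>\<gamma> x = \<Gamma>(n) / (\<Gamma>(\<gamma>) \<Gamma>(n - \<gamma>)) \<integral>\<^sub>0\<^sup>\<infinity> t\<^sup>n\<^sup>-\<^sup>\<gamma>\<^sup>-\<^sup>1 (t + B)\<^sup>-\<^sup>n x dt\<close>, whose value does not depend on \<open>n\<close>;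
  here \<open>n = \<lfloor>\<gamma>\<rfloor> + 1\<close>. For \<open>\<gamma> < 1\<close> the constant is \<open>sin(\<pi>\<gamma>) / \<pi>\<close>.
\<close>

definition neg_frac_power ::
  "'x::complex_banach set \<Rightarrow> ('x \<Rightarrow> 'x) \<Rightarrow> real \<Rightarrow> 'x \<Rightarrow> 'x" where
  "neg_frac_power D B \<gamma> x =
     (if \<gamma> = 0 then x
      else let n = nat \<lfloor>\<gamma>\<rfloor> + 1 in
        (Gamma (real n) / (Gamma \<gamma> * Gamma (real n - \<gamma>))) *\<^sub>R
        Bochner (\<lambda>t. (indicator {0<..} t * t powr (real n - \<gamma> - 1)) *\<^sub>R
                      (shift_inverse D B (of_real t) ^^ n) x))"

definition frac_domain ::
  "'x::complex_banach set \<Rightarrow> ('x \<Rightarrow> 'x) \<Rightarrow> real \<Rightarrow> 'x set" where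
  "frac_domain D B \<gamma> = range (neg_frac_power D B \<gamma>)"

definition frac_power ::
  "'x::complex_banach set \<Rightarrow> ('x \<Rightarrow> 'x) \<Rightarrow> real \<Rightarrow> 'x \<Rightarrow> 'x" where
  "frac_power D B \<gamma> = inv (neg_frac_power D B \<gamma>)"

text \<open>
  The space \<open>D(B\<^sup>\<gamma>)\<close> with its graph norm, realised as the graph of \<open>B\<^sup>\<gamma>\<close> with the norm
  of the product, \<open>\<parallel>(x, B\<^sup>\<gamma> x)\<parallel> = sqrt (\<parallel>x\<parallel>\<^sup>2 + \<parallel>B\<^sup>\<gamma> x\<parallel>\<^sup>2)\<close>, which is equivalent to
  \<open>\<parallel>x\<parallel> + \<parallel>B\<^sup>\<gamma> x\<parallel>\<close>. The embedding into the ambient space is \<^const>\<open>fst\<close>, so the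
  restriction to \<open>D(B\<^sup>\<gamma>)\<close> of an operator \<open>R\<close> is \<open>R \<circ> fst\<close>.
\<close>

definition frac_space ::
  "'x::complex_banach set \<Rightarrow> ('x \<Rightarrow> 'x) \<Rightarrow> real \<Rightarrow> ('x \<times> 'x) set" where
  "frac_space D B \<gamma> = (\<lambda>x. (x, frac_power D B \<gamma> x)) ` frac_domain D B \<gamma>"

end

theory Submission
  imports Defs "HOL-Probability.Probability" "HOL-Complex_Analysis.Complex_Analysis" "HOL-Real_Asymp.Real_Asymp"
begin

text \<open>
  Polynomial growth of the semigroup on a fractional domain is compared with Fourier multiplier
  bounds for the resolvent on vertical lines. All integrals of vector-valued functions are reduced
  to scalar ones by bounded functionals, which separate points by the Hahn-Banach theorem. The
  fractional domain enters through the operator \<open>J = (\<omega> + A)\<^bsup>-\<gamma>\<^esup>\<close>: it is a Gamma-weighted integral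
  of the semigroup, so it is bounded, injective and commutes with the semigroup, and \<open>X\<^sub>\<gamma>\<close> is
  the set of all \<open>(J z, z)\<close> (\<open>neg_frac_power_facts\<close>, \<open>frac_space_eq\<close>).

  From growth to multipliers one can take \<open>p = 1\<close> and \<open>q = \<infinity>\<close>. The operator with symbol
  \<open>(a + i\<xi> + A)\<^sup>-\<^sup>1\<close> is convolution with \<open>e\<^bsup>-au\<^esup> T(u)\<close>, whose norm from \<open>X\<^sub>\<gamma>\<close> to \<open>X\<close> is bounded by
  the supremum of \<open>e\<^bsup>-au\<^esup> C (u\<^sup>\<alpha> + 1)\<close>, and that is a multiple of \<open>a\<^bsup>-\<alpha>\<^esup> + 1\<close>
  (\<open>resolvent_multiplier_bound\<close>).

  For the converse the exponents are removed first: functions that are bounded both in \<open>L\<^sup>1\<close> and in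
  \<open>L\<^sup>\<infinity>\<close> are bounded in every \<open>L\<^sup>p\<close>, so each multiplier bound, whatever \<open>p \<le> q\<close> are, controls a
  finite sum of pairings of such inputs with such test functions (\<open>multiplier_test_bound\<close>). The
  second step identifies the pairings. For \<open>Re z\<close> large the resolvent is the Laplace transform of
  the semigroup, but on the line \<open>Re z = a\<close> this integral is not known to converge. With smooth test
  functions of compact support the pairing is an integral of the resolvent against an entire
  function, and the contour can be moved to the right. The bound needed for this between the two
  lines is again a consequence of the multiplier hypothesis, applied to frequency windows
  (\<open>contour_shift\<close>, \<open>window_bound\<close>, \<open>functional_paired\<close>).

  The last step recovers \<open>T(t)x\<close> from pairings with \<open>a = 1/t\<close>. A single pairing averages the orbit
  over a long time. Unit intervals at time \<open>0\<close> and at time \<open>t\<close> are therefore cut into \<open>n\<close> cells, and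
  every pair of cells is synchronised by inserting \<open>T(k/n)\<close> before and \<open>T(j/n)\<close> after the pairing.
  The inputs have disjoint supports, and so have the test functions; hence the sum over all pairs is
  controlled by one multiplier bound, and as \<open>n\<close> grows it tends to a multiple of \<open>T(t)x\<close> that is
  bounded from below (\<open>orbit_bound\<close>).
\<close>

abbreviation lborel2 :: "(real \<times> real) measure" where "lborel2 \<equiv> lborel \<Otimes>\<^sub>M lborel"

lemmas integrable_dom = Bochner_Integration.integrable_bound
lemmas integral_eqI = Bochner_Integration.integral_cong

section \<open>Bounded functionals separate points\<close>

definition sublinear :: "('v::real_vector \<Rightarrow> real) \<Rightarrow> bool" where
 "sublinear p \<longleftrightarrow> (\<forall>x y. p (x + y) \<le> p x + p y) \<and> (\<forall>t\<ge>0. \<forall>x. p (t *\<^sub>R x) = t * p x)"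

lemma sublinear_zero: "sublinear p \<Longrightarrow> p 0 = 0"
 unfolding sublinear_def by (metis mult_zero_left order_refl scaleR_zero_left)

lemma sublinear_minus: "sublinear p \<Longrightarrow> - p (- x) \<le> p x"
proof -
 assume p: "sublinear p"
 then have "p (x + - x) \<le> p x + p (- x)" unfolding sublinear_def by blast
 with sublinear_zero[OF p] show ?thesis by simp
qed

text \<open>
 The functional along \<open>y\<close> is sublinear, lies below \<open>p\<close> and is at most
 \<open>- p y\<close> at \<open>- y\<close>. So a minimal sublinear functional, as provided by
 Zorn's lemma, is linear.
\<close>
definition sublinear_along :: "('v::real_vector \<Rightarrow> real) \<Rightarrow> 'v \<Rightarrow> 'v \<Rightarrow> real" where
 "sublinear_along p y x = (INF t\<in>{0..}. p (x + t *\<^sub>R y) - t * p y)"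

lemma sublinear_along_bdd:
 assumes p: "sublinear p"
 shows "bdd_below ((\<lambda>t. p (x + t *\<^sub>R y) - t * p y) ` {0..})"
proof (rule bdd_belowI2)
 fix t :: real assume "t \<in> {0..}"
 then have "t * p y = p (t *\<^sub>R y)"
  using p by (simp add: sublinear_def)
 also have "\<dots> \<le> p (x + t *\<^sub>R y) + p (- x)"
 proof -
  have "p ((x + t *\<^sub>R y) + - x) \<le> p (x + t *\<^sub>R y) + p (- x)"
   using p unfolding sublinear_def by blast
  then show ?thesis by simp
 qed
 finally show "- p (- x) \<le> p (x + t *\<^sub>R y) - t * p y" by simp
qed

lemma sublinear_along_le:
 assumes p: "sublinear p" and "0 \<le> t"
 shows "sublinear_along p y x \<le> p (x + t *\<^sub>R y) - t * p y"
 unfolding sublinear_along_def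
 by (rule cINF_lower[OF sublinear_along_bdd[OF p]]) (use assms in auto)

lemma sublinear_along_greatest:
 assumes "\<And>t. 0 \<le> t \<Longrightarrow> c \<le> p (x + t *\<^sub>R y) - t * p y"
 shows "c \<le> sublinear_along p y x"
 unfolding sublinear_along_def by (rule cINF_greatest) (use assms in auto)

lemma sublinear_along_sublinear:
 assumes p: "sublinear p"
 shows "sublinear (sublinear_along p y)"
proof -
 have add: "sublinear_along p y (u + v) \<le> sublinear_along p y u + sublinear_along p y v" for u v
 proof -
  have *: "sublinear_along p y (u + v) \<le> (p (u + s *\<^sub>R y) - s * p y) + (p (v + t *\<^sub>R y) - t * p y)"
   if "0 \<le> s" "0 \<le> t" for s t
  proof -
   have "sublinear_along p y (u + v) \<le> p ((u + v) + (s + t) *\<^sub>R y) - (s + t) * p y"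
    using sublinear_along_le[OF p] that by simp
   also have "p ((u + v) + (s + t) *\<^sub>R y) = p ((u + s *\<^sub>R y) + (v + t *\<^sub>R y))"
    by (simp add: algebra_simps)
   also have "\<dots> \<le> p (u + s *\<^sub>R y) + p (v + t *\<^sub>R y)"
    using p by (auto simp: sublinear_def)
   finally show ?thesis by (simp add: algebra_simps)
  qed
  have "sublinear_along p y (u + v) - (p (u + s *\<^sub>R y) - s * p y) \<le> sublinear_along p y v" if "0 \<le> s" for s
   by (rule sublinear_along_greatest) (use *[OF that] in \<open>smt (verit)\<close>)
  then have "sublinear_along p y (u + v) - sublinear_along p y v \<le> sublinear_along p y u"
   by (intro sublinear_along_greatest) (smt (verit))
  then show ?thesis by simp
 qed
 have scale_le: "sublinear_along p y (c *\<^sub>R x) \<le> c * sublinear_along p y x" if "0 < c" for c x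
 proof -
  have "inverse c * sublinear_along p y (c *\<^sub>R x) \<le> sublinear_along p y x"
  proof (rule sublinear_along_greatest)
   fix t :: real assume t: "0 \<le> t"
   have "sublinear_along p y (c *\<^sub>R x) \<le> p (c *\<^sub>R x + (c * t) *\<^sub>R y) - (c * t) * p y"
    using sublinear_along_le[OF p, of "c * t"] t that by simp
   also have "c *\<^sub>R x + (c * t) *\<^sub>R y = c *\<^sub>R (x + t *\<^sub>R y)" by (simp add: algebra_simps)
   also have "p \<dots> = c * p (x + t *\<^sub>R y)" using p that by (simp add: sublinear_def)
   finally show "inverse c * sublinear_along p y (c *\<^sub>R x) \<le> p (x + t *\<^sub>R y) - t * p y"
    using that by (simp add: field_simps)
  qed
  then show ?thesis using that by (simp add: field_simps)
 qed
 have scale: "sublinear_along p y (c *\<^sub>R x) = c * sublinear_along p y x" if "0 \<le> c" for c x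
 proof (cases "c = 0")
  case True
  have "sublinear_along p y 0 = 0"
  proof (rule antisym)
   show "sublinear_along p y 0 \<le> 0"
    using sublinear_along_le[OF p, of 0 y 0] sublinear_zero[OF p] by simp
   show "0 \<le> sublinear_along p y 0"
    by (rule sublinear_along_greatest) (use p in \<open>simp add: sublinear_def\<close>)
  qed
  with True show ?thesis by simp
 next
  case False
  with that have c: "0 < c" by simp
  have "sublinear_along p y (inverse c *\<^sub>R (c *\<^sub>R x)) \<le> inverse c * sublinear_along p y (c *\<^sub>R x)"
   by (rule scale_le) (use c in simp)
  then have "c * sublinear_along p y x \<le> sublinear_along p y (c *\<^sub>R x)"
   using c by (simp add: field_simps)
  with scale_le[OF c] show ?thesis by (simp add: antisym)
 qed
 show ?thesis unfolding sublinear_def using add scale by blast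
qed

lemma minimal_sublinear_additive:
 assumes q: "sublinear q" and min: "\<And>r. sublinear r \<Longrightarrow> r \<le> q \<Longrightarrow> r = q"
 shows "q (x + y) = q x + q y"
proof (rule antisym)
 show "q (x + y) \<le> q x + q y" using q by (auto simp: sublinear_def)
 have "sublinear_along q y = q"
 proof (rule min[OF sublinear_along_sublinear[OF q]], rule le_funI)
  show "sublinear_along q y u \<le> q u" for u using sublinear_along_le[OF q, of 0 y u] by simp
 qed
 then have "q x = sublinear_along q y x" by simp
 also have "\<dots> \<le> q (x + 1 *\<^sub>R y) - 1 * q y" by (rule sublinear_along_le[OF q]) simp
 finally show "q x + q y \<le> q (x + y)" by simp
qed

lemma minimal_sublinear_below:
 fixes p :: "'v::real_vector \<Rightarrow> real"
 assumes p: "sublinear p"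
 shows "\<exists>q. sublinear q \<and> q \<le> p \<and> (\<forall>r. sublinear r \<and> r \<le> q \<longrightarrow> r = q)"
proof -
 let ?A = "{q. sublinear q \<and> q \<le> p}"
 let ?P = "\<lambda>a b::'v \<Rightarrow> real. b \<le> a"
 have "\<exists>m\<in>?A. \<forall>a\<in>?A. ?P m a \<longrightarrow> a = m"
 proof (rule predicate_Zorn)
  show "partial_order_on ?A (relation_of ?P ?A)"
   unfolding partial_order_on_def preorder_on_def refl_on_def trans_def antisym_def relation_of_def
   by auto
 next
  fix C assume C: "C \<in> Chains (relation_of ?P ?A)"
  then have CA: "C \<subseteq> ?A" and tot: "\<And>a b. a \<in> C \<Longrightarrow> b \<in> C \<Longrightarrow> a \<le> b \<or> b \<le> a"
   unfolding Chains_def relation_of_def by blast+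
  show "\<exists>u\<in>?A. \<forall>a\<in>C. u \<le> a"
  proof (cases "C = {}")
   case True then show ?thesis using p by auto
  next
   case False
   define u where "u x = (INF a\<in>C. a x)" for x
   have bdd: "bdd_below ((\<lambda>a. a x) ` C)" for x
   proof (rule bdd_belowI2)
    fix a assume "a \<in> C"
    then have "sublinear a" "a \<le> p" using CA by auto
    then show "- p (- x) \<le> a x" using sublinear_minus[of a x] by (auto simp: le_fun_def) (smt (verit))
   qed
   have ule: "u x \<le> a x" if "a \<in> C" for a x
    unfolding u_def by (rule cINF_lower[OF bdd that])
   have ugr: "c \<le> u x" if "\<And>a. a \<in> C \<Longrightarrow> c \<le> a x" for c x
    unfolding u_def by (rule cINF_greatest) (use False that in auto)
   have add: "u (x + y) \<le> u x + u y" for x y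
   proof -
    have *: "u (x + y) \<le> a x + b y" if ab: "a \<in> C" "b \<in> C" for a b
    proof -
     obtain c where "c \<in> C" "c \<le> a" "c \<le> b" using tot[OF ab] ab by blast
     moreover have "c (x + y) \<le> c x + c y" using CA \<open>c \<in> C\<close> by (auto simp: sublinear_def)
     ultimately show ?thesis using ule[of c "x + y"] by (auto simp: le_fun_def) (smt (verit))
    qed
    have "u (x + y) - a x \<le> u y" if "a \<in> C" for a by (rule ugr) (use *[OF that] in \<open>smt (verit)\<close>)
    then have "u (x + y) - u y \<le> u x" by (intro ugr) (smt (verit))
    then show ?thesis by simp
   qed
   have scale: "u (t *\<^sub>R x) = t * u x" if t: "0 \<le> t" for t x
   proof (cases "t = 0")
    case True
    have "u 0 = (INF a\<in>C. 0)" unfolding u_def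
     by (rule INF_cong) (use CA sublinear_zero in auto)
    with False True show ?thesis by simp
   next
    case nz: False
    have hom: "a (t *\<^sub>R x) = t * a x" if "a \<in> C" for a using CA that t by (auto simp: sublinear_def)
    show ?thesis
    proof (rule antisym)
     have "inverse t * u (t *\<^sub>R x) \<le> u x"
     proof (rule ugr)
      fix a assume "a \<in> C"
      then show "inverse t * u (t *\<^sub>R x) \<le> a x"
       using ule[of a "t *\<^sub>R x"] hom t nz by (simp add: field_simps)
     qed
     then show "u (t *\<^sub>R x) \<le> t * u x" using t nz by (simp add: field_simps)
     show "t * u x \<le> u (t *\<^sub>R x)"
     proof (rule ugr)
      fix a assume a: "a \<in> C"
      show "t * u x \<le> a (t *\<^sub>R x)" unfolding hom[OF a] by (rule mult_left_mono[OF ule[OF a] t])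
     qed
    qed
   qed
   obtain a0 where a0: "a0 \<in> C" using False by blast
   have "u \<le> p" 
   proof (rule le_funI)
    fix x
    have "a0 \<le> p" using CA a0 by blast
    then show "u x \<le> p x" using ule[OF a0, of x] by (meson le_funD order_trans)
   qed
   then have "u \<in> ?A" using add scale by (auto simp: sublinear_def)
   moreover have "\<forall>a\<in>C. u \<le> a" using ule by (auto simp: le_fun_def)
   ultimately show ?thesis by blast
  qed
 qed
 then obtain m where "sublinear m" "m \<le> p" "\<And>a. sublinear a \<Longrightarrow> a \<le> p \<Longrightarrow> a \<le> m \<Longrightarrow> a = m" by auto
 then show ?thesis by (meson order_trans)
qed

lemma norming_real_functional:
 fixes x0 :: "'v::real_normed_vector"
 shows "\<exists>f. (\<forall>x y. f (x + y) = f x + f y) \<and> (\<forall>t x. f (t *\<^sub>R x) = t * f x) \<and>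
       (\<forall>x. f x \<le> norm x) \<and> f x0 = norm x0"
proof -
 have n: "sublinear (norm :: 'v \<Rightarrow> real)" by (auto simp: sublinear_def norm_triangle_ineq)
 let ?p = "sublinear_along norm x0"
 obtain q where q: "sublinear q" "q \<le> ?p" and min: "\<And>r. sublinear r \<Longrightarrow> r \<le> q \<Longrightarrow> r = q"
  using minimal_sublinear_below[OF sublinear_along_sublinear[OF n]] by blast
 have add: "q (x + y) = q x + q y" for x y by (rule minimal_sublinear_additive[OF q(1) min])
 have neg: "q (- x) = - q x" for x using add[of x "- x"] sublinear_zero[OF q(1)] by simp
 have scale: "q (t *\<^sub>R x) = t * q x" for t x
 proof (cases "0 \<le> t")
  case True then show ?thesis using q by (simp add: sublinear_def)
 next
  case False
  then have "q ((- t) *\<^sub>R x) = (- t) * q x" using q(1) unfolding sublinear_def by (meson less_eq_real_def neg_0_le_iff_le not_less)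
  moreover have "(- t) *\<^sub>R x = - (t *\<^sub>R x)" by simp
  ultimately show ?thesis using neg[of "t *\<^sub>R x"] by (metis minus_equation_iff minus_mult_left)
 qed
 have le: "q x \<le> norm x" for x
  using q(2) sublinear_along_le[OF n, of 0 x0 x] by (auto simp: le_fun_def) (smt (verit))
 have "q (- x0) \<le> ?p (- x0)" using q(2) by (simp add: le_fun_def)
 also have "\<dots> \<le> - norm x0" using sublinear_along_le[OF n, of 1 x0 "- x0"] by simp
 finally have "norm x0 \<le> q x0" using neg by simp
 with le have "q x0 = norm x0" by (simp add: antisym)
 with add scale le show ?thesis by blast
qed

lemma bcl_add: "bounded_clinear_on UNIV F \<Longrightarrow> F (x + y) = F x + F y"
 and bcl_scaleC: "bounded_clinear_on UNIV F \<Longrightarrow> F (c *\<^sub>C x) = c *\<^sub>C F x"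
 by (auto simp: bounded_clinear_on_def)

lemma bcl_bounded_linear: "bounded_clinear_on UNIV F \<Longrightarrow> bounded_linear F"
proof -
 assume F: "bounded_clinear_on UNIV F"
 then obtain C where "\<And>x. norm (F x) \<le> C * norm x" by (auto simp: bounded_clinear_on_def)
 with F show "bounded_linear F"
  by (intro bounded_linear_intro[where K=C])
    (auto simp: bounded_clinear_on_def scaleR_scaleC mult.commute)
qed

lemma bcl_bound:
 assumes "bounded_clinear_on UNIV F"
 obtains K where "0 \<le> K" "\<forall>x. norm (F x) \<le> K * norm x"
 using bounded_linear.nonneg_bounded[OF bcl_bounded_linear[OF assms]] by (auto simp: mult.commute)

lemma bcl_compose:
 assumes F: "bounded_clinear_on UNIV F" and G: "bounded_clinear_on UNIV G"
 shows "bounded_clinear_on UNIV (\<lambda>x. F (G x))"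
proof -
 obtain K L where "0 \<le> K" "\<And>x. norm (F x) \<le> K * norm x" "\<And>x. norm (G x) \<le> L * norm x"
  using bcl_bound[OF F] bcl_bound[OF G] by metis
 then have "norm (F (G x)) \<le> (K * L) * norm x" for x
  by (metis mult.assoc mult_left_mono order_trans)
 then show ?thesis using F G unfolding bounded_clinear_on_def by auto
qed

text \<open>
 A real functional \<open>u\<close> becomes complex linear as \<open>u x - \<i> u (\<i> x)\<close>;
 rotating a value to the positive axis shows that the bound by the norm survives.
\<close>
lemma norming_functional:
 fixes x0 :: "'x::complex_banach"
 obtains l where "bounded_clinear_on UNIV l" "\<forall>x. cmod (l x) \<le> norm x"
  "l x0 = of_real (norm x0)"
proof -
 obtain f where add: "\<And>x y. f (x + y) = f x + f y" and sc: "\<And>t x. f (t *\<^sub>R x) = t * f x"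
  and le: "\<And>x. f x \<le> norm x" and x0: "f x0 = norm x0"
  using norming_real_functional[of x0] by metis
 define l where "l x = Complex (f x) (- f (\<i> *\<^sub>C x))" for x
 have neg: "f (- x) = - f x" for x using sc[of "-1" x] by simp
 have cx: "c *\<^sub>C x = Re c *\<^sub>R x + Im c *\<^sub>R (\<i> *\<^sub>C x)" for c and x :: 'x
  unfolding scaleR_scaleC scaleC_scaleC scaleC_add_left[symmetric]
  by (metis complex_eq mult.commute)
 have ii: "\<i> *\<^sub>C \<i> *\<^sub>C x = - x" for x :: 'x
  using cx[of "-1" x] by (simp add: scaleC_scaleC)
 have ladd: "l (x + y) = l x + l y" for x y
  by (simp add: l_def add scaleC_add_right complex_eq_iff)
 have lsc: "l (c *\<^sub>C x) = c * l x" for c x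
 proof -
  have "f (c *\<^sub>C x) = Re c * f x + Im c * f (\<i> *\<^sub>C x)"
   by (subst cx) (simp add: add sc)
  moreover have "f (\<i> *\<^sub>C c *\<^sub>C x) = Re c * f (\<i> *\<^sub>C x) - Im c * f x"
  proof -
   have "\<i> *\<^sub>C c *\<^sub>C x = Re c *\<^sub>R (\<i> *\<^sub>C x) + Im c *\<^sub>R (\<i> *\<^sub>C \<i> *\<^sub>C x)"
    using cx[of c "\<i> *\<^sub>C x"] by (simp add: scaleC_scaleC mult.commute)
   then show ?thesis by (simp only: ii add sc) (simp add: neg)
  qed
  ultimately show ?thesis by (simp add: l_def complex_eq_iff algebra_simps)
 qed
 have bd: "cmod (l x) \<le> norm x" for x
 proof (cases "l x = 0")
  case False
  define c where "c = cnj (l x) / cmod (l x)"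
  have c: "cmod c = 1" using False by (simp add: c_def norm_divide)
  have "c * l x = of_real (cmod (l x))"
   using False by (simp add: c_def complex_norm_square[symmetric] power2_eq_square mult.commute)
  then have "cmod (l x) = Re (l (c *\<^sub>C x))" by (simp add: lsc)
  also have "\<dots> = f (c *\<^sub>C x)" by (simp add: l_def)
  also have "\<dots> \<le> norm x" using le[of "c *\<^sub>C x"] c by (simp add: norm_scaleC)
  finally show ?thesis .
 qed simp
 have "Re (l x0) = norm x0" by (simp add: l_def x0)
 moreover have "Im (l x0) = 0"
 proof -
  have "(norm x0)\<^sup>2 + (Im (l x0))\<^sup>2 \<le> (norm x0)\<^sup>2"
   using power_mono[OF bd[of x0], of 2] \<open>Re (l x0) = norm x0\<close> by (simp add: cmod_power2)
  then show ?thesis by simp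
 qed
 ultimately have "l x0 = of_real (norm x0)" by (simp add: complex_eq_iff)
 moreover have "bounded_clinear_on UNIV l"
  unfolding bounded_clinear_on_def using ladd lsc bd
  by (auto simp: scaleC_complex_def intro: exI[of _ 1])
 ultimately show ?thesis using that bd by blast
qed

lemma functional_ext:
 fixes x y :: "'x::complex_banach"
 assumes "\<And>l::'x \<Rightarrow> complex. bounded_clinear_on UNIV l \<Longrightarrow> l x = l y"
 shows "x = y"
proof -
 obtain l :: "'x \<Rightarrow> complex" where l: "bounded_clinear_on UNIV l" "l (x - y) = of_real (norm (x - y))"
  using norming_functional[of "x - y"] by auto
 have "l (x - y) = l x - l y" using bounded_linear.linear[OF bcl_bounded_linear[OF l(1)]] by (simp add: linear_diff)
 then show ?thesis using assms[OF l(1)] l(2) by simp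
qed

section \<open>Strong measurability and the Bochner integral\<close>

text \<open>
 Stated for topological targets, so that scalar weights and time parameters are covered along with
 vectors.
\<close>
definition smeas :: "(real \<Rightarrow> 'a::topological_space) \<Rightarrow> bool" where
 "smeas f \<longleftrightarrow> (\<exists>s. (\<forall>n. simple_function lebesgue (s n)) \<and>
   (AE t in lebesgue. (\<lambda>n. s n t) \<longlonglongrightarrow> f t))"

lemma strongly_measurable_smeas: "strongly_measurable f \<longleftrightarrow> smeas f"
 by (simp add: strongly_measurable_def smeas_def)

lemma smeas_compose2:
 assumes f: "smeas f" and g: "smeas g"
  and c: "AE t in lebesgue. isCont (\<lambda>z. h (fst z) (snd z)) (f t, g t)"
 shows "smeas (\<lambda>t. h (f t) (g t))"
proof -
 obtain s where s: "\<And>n. simple_function lebesgue (s n)" "AE t in lebesgue. (\<lambda>n. s n t) \<longlonglongrightarrow> f t"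
  using f by (auto simp: smeas_def)
 obtain r where r: "\<And>n. simple_function lebesgue (r n)" "AE t in lebesgue. (\<lambda>n. r n t) \<longlonglongrightarrow> g t"
  using g by (auto simp: smeas_def)
 have "simple_function lebesgue (\<lambda>t. h (s n t) (r n t))" for n
  by (rule simple_function_compose2[OF s(1) r(1)])
 moreover have "AE t in lebesgue. (\<lambda>n. h (s n t) (r n t)) \<longlonglongrightarrow> h (f t) (g t)"
  using s(2) r(2) c
 proof eventually_elim
  case (elim t)
  have "(\<lambda>n. (s n t, r n t)) \<longlonglongrightarrow> (f t, g t)" using elim by (intro tendsto_Pair)
  from isCont_tendsto_compose[OF elim(3) this] show ?case by simp
 qed
 ultimately show ?thesis unfolding smeas_def
  by (intro exI[of _ "\<lambda>n t. h (s n t) (r n t)"] conjI allI)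
qed

lemma smeas_compose:
 assumes f: "smeas f" and c: "AE t in lebesgue. isCont h (f t)"
 shows "smeas (\<lambda>t. h (f t))"
proof -
 obtain s where s: "\<And>n. simple_function lebesgue (s n)" "AE t in lebesgue. (\<lambda>n. s n t) \<longlonglongrightarrow> f t"
  using f by (auto simp: smeas_def)
 have "simple_function lebesgue (\<lambda>t. h (s n t))" for n
  by (rule simple_function_compose1[where g=h and f="s n", OF s(1)])
 moreover have "AE t in lebesgue. (\<lambda>n. h (s n t)) \<longlonglongrightarrow> h (f t)"
  using s(2) c by eventually_elim (rule isCont_tendsto_compose)
 ultimately show ?thesis unfolding smeas_def
  by (intro exI[of _ "\<lambda>n t. h (s n t)"] conjI allI)
qed

lemma smeas_borel:
 fixes f :: "real \<Rightarrow> 'a::{metric_space, second_countable_topology}"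
 assumes "f \<in> borel_measurable lebesgue"
 shows "smeas f"
 using borel_measurable_implies_sequence_metric[OF assms, of undefined]
 by (auto simp: smeas_def)

lemma smeas_isCont: "(AE t in lebesgue. isCont f t) \<Longrightarrow> smeas f"
 using smeas_compose[OF smeas_borel[of "\<lambda>t. t"], of f] by (simp add: measurable_completion)

lemma smeas_cong_AE:
 assumes "smeas f" "AE t in lebesgue. f t = g t"
 shows "smeas g"
proof -
 obtain s where s: "\<And>n. simple_function lebesgue (s n)" "AE t in lebesgue. (\<lambda>n. s n t) \<longlonglongrightarrow> f t"
  using assms(1) by (auto simp: smeas_def)
 have "AE t in lebesgue. (\<lambda>n. s n t) \<longlonglongrightarrow> g t" using s(2) assms(2) by eventually_elim simp
 with s(1) show ?thesis unfolding smeas_def by (intro exI[of _ s]) simp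
qed

lemma measurable_lebesgue_AE:
 fixes g h :: "real \<Rightarrow> 'a::topological_space"
 assumes g: "g \<in> borel_measurable lebesgue" and ae: "AE t in lebesgue. g t = h t"
 shows "h \<in> borel_measurable lebesgue"
proof (rule borel_measurableI)
 fix S :: "'a set" assume "open S"
 obtain M where M: "M \<in> null_sets lebesgue" "{t \<in> space lebesgue. \<not> g t = h t} \<subseteq> M"
  using ae unfolding eventually_ae_filter by blast
 then have N: "{t. g t \<noteq> h t} \<in> null_sets lebesgue"
  by (intro null_sets_completion_subset[OF _ M(1)]) auto
 have eq: "h -` S \<inter> space lebesgue = (g -` S \<inter> space lebesgue - {t. g t \<noteq> h t}) \<union> ({t. g t \<noteq> h t} \<inter> h -` S)"
  by auto
 have "{t. g t \<noteq> h t} \<inter> h -` S \<in> null_sets lebesgue"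
  by (rule null_sets_completion_subset[OF _ N]) auto
 then show "h -` S \<inter> space lebesgue \<in> sets lebesgue"
  unfolding eq by (intro sets.Un sets.Diff null_setsD2[OF N] null_setsD2 measurable_sets[OF g borel_open[OF \<open>open S\<close>]])
qed

text \<open>
 Modified on a null set, a strongly measurable function is an everywhere limit of simple functions;
 this makes it Borel measurable although the target need not be separable.
\<close>
lemma smeas_modification:
 fixes f :: "real \<Rightarrow> 'a::real_normed_vector"
 assumes "smeas f"
 shows "\<exists>s g. (\<forall>n. simple_function lebesgue (s n)) \<and> (\<forall>t. (\<lambda>n. s n t) \<longlonglongrightarrow> g t) \<and>
  (AE t in lebesgue. f t = g t)"
proof -
 obtain s where s: "\<And>n. simple_function lebesgue (s n)" "AE t in lebesgue. (\<lambda>n. s n t) \<longlonglongrightarrow> f t"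
  using assms by (auto simp: smeas_def)
 then obtain N where N: "N \<in> null_sets lebesgue" "{t. \<not> (\<lambda>n. s n t) \<longlonglongrightarrow> f t} \<subseteq> N"
  by (auto simp: eventually_ae_filter)
 define s' where "s' n t = indicator (- N) t *\<^sub>R s n t" for n t
 define g where "g t = indicator (- N) t *\<^sub>R f t" for t
 have "simple_function lebesgue (s' n)" for n
 proof -
  have "simple_function lebesgue (indicator (- N) :: real \<Rightarrow> real)"
   using N by (intro simple_function_indicator) (auto simp: Compl_in_sets_lebesgue)
  from simple_function_compose2[OF this s(1)[of n], of "\<lambda>a b. a *\<^sub>R b"]
  show ?thesis by (simp add: s'_def[abs_def])
 qed
 moreover have "(\<lambda>n. s' n t) \<longlonglongrightarrow> g t" for t
  using N(2) by (cases "t \<in> N") (auto simp: s'_def g_def)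
 moreover have "AE t in lebesgue. f t = g t"
  using AE_not_in[OF N(1)] by eventually_elim (simp add: g_def)
 ultimately show ?thesis by (intro exI[of _ s'] exI[of _ g] conjI allI)
qed

lemma smeas_measurable:
 fixes f :: "real \<Rightarrow> 'a::real_normed_vector"
 assumes "smeas f"
 shows "f \<in> borel_measurable lebesgue"
proof -
 obtain s g where s: "\<forall>n. simple_function lebesgue (s n)" "\<forall>t. (\<lambda>n. s n t) \<longlonglongrightarrow> g t"
  and fg: "AE t in lebesgue. f t = g t" using smeas_modification[OF assms] by (elim exE conjE)
 note s = s[rule_format]
 have "g \<in> borel_measurable lebesgue"
  by (rule borel_measurable_LIMSEQ_metric[OF borel_measurable_simple_function[OF s(1)]]) (use s(2) in auto)
 then show ?thesis by (rule measurable_lebesgue_AE) (use fg in \<open>auto elim: eventually_mono\<close>)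
qed

lemma smeas_simple: "simple_function lebesgue f \<Longrightarrow> smeas f"
 unfolding smeas_def by (intro exI[of _ "\<lambda>_. f"]) simp

lemma smeas_const: "smeas (\<lambda>t. c)"
 by (auto simp: smeas_def intro!: exI[of _ "\<lambda>n t. c"])

lemma smeas_add: "smeas f \<Longrightarrow> smeas g \<Longrightarrow> smeas (\<lambda>t. f t + g t :: 'a::real_normed_vector)"
 by (erule (1) smeas_compose2) (auto intro!: continuous_intros)

lemma isCont_scaleC: "isCont (\<lambda>z. fst z *\<^sub>C (snd z :: 'a::complex_banach)) w"
proof (cases w)
 case (Pair c x)
 have "((\<lambda>z. fst z *\<^sub>C snd z - c *\<^sub>C x) \<longlongrightarrow> 0) (at (c, x))"
 proof (rule Lim_null_comparison)
  have *: "fst z *\<^sub>C snd z - c *\<^sub>C x = fst z *\<^sub>C (snd z - x) + (fst z - c) *\<^sub>C x" for z :: "complex \<times> 'a"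
  proof -
   have "fst z *\<^sub>C (snd z - x) + fst z *\<^sub>C x = fst z *\<^sub>C snd z"
    by (simp flip: scaleC_add_right)
   moreover have "(fst z - c) *\<^sub>C x + c *\<^sub>C x = fst z *\<^sub>C x"
    by (simp flip: scaleC_add_left)
   ultimately have "fst z *\<^sub>C snd z = (fst z *\<^sub>C (snd z - x) + (fst z - c) *\<^sub>C x) + c *\<^sub>C x"
    by (metis add.assoc)
   then show ?thesis by (metis add_diff_cancel_right')
  qed
  have "norm (fst z *\<^sub>C snd z - c *\<^sub>C x) \<le> cmod (fst z) * norm (snd z - x) + cmod (fst z - c) * norm x"
   for z :: "complex \<times> 'a"
   unfolding * using norm_triangle_ineq[of "fst z *\<^sub>C (snd z - x)" "(fst z - c) *\<^sub>C x"]
   by (simp add: norm_scaleC)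
  then show "\<forall>\<^sub>F z in at (c, x). norm (fst z *\<^sub>C snd z - c *\<^sub>C x)
    \<le> cmod (fst z) * norm (snd z - x) + cmod (fst z - c) * norm x" by simp
  have "((\<lambda>z. cmod (fst z) * norm (snd z - x) + cmod (fst z - c) * norm x) \<longlongrightarrow>
    cmod c * norm (x - x) + cmod (c - c) * norm x) (at (c, x))"
   by (intro tendsto_intros tendsto_fst[OF tendsto_ident_at, of "(c, x)", simplified]
     tendsto_snd[OF tendsto_ident_at, of "(c, x)", simplified])
  then show "((\<lambda>z. cmod (fst z) * norm (snd z - x) + cmod (fst z - c) * norm x) \<longlongrightarrow> 0) (at (c, x))"
   by simp
 qed
 then show ?thesis unfolding Pair isCont_def
  by (subst LIM_zero_iff[symmetric]) simp
qed

lemma tendsto_scaleC: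
 assumes "(f \<longlongrightarrow> a) F" "(g \<longlongrightarrow> (b :: 'a::complex_banach)) F"
 shows "((\<lambda>t. f t *\<^sub>C g t) \<longlongrightarrow> a *\<^sub>C b) F"
 using isCont_tendsto_compose[OF isCont_scaleC tendsto_Pair[OF assms]] by simp

lemma smeas_scaleC: "smeas f \<Longrightarrow> smeas g \<Longrightarrow> smeas (\<lambda>t. f t *\<^sub>C (g t :: 'a::complex_banach))"
 by (erule (1) smeas_compose2) (simp add: isCont_scaleC)

lemma smeas_scaleR: "smeas f \<Longrightarrow> smeas g \<Longrightarrow> smeas (\<lambda>t. f t *\<^sub>R (g t :: 'a::real_normed_vector))"
 by (erule (1) smeas_compose2) (auto intro!: continuous_intros)

lemma smeas_linear: "bounded_linear F \<Longrightarrow> smeas f \<Longrightarrow> smeas (\<lambda>t. F (f t))"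
 by (rule smeas_compose) (simp_all add: linear_continuous_at)

lemma smeas_sum:
 fixes f :: "'i \<Rightarrow> real \<Rightarrow> 'a::real_normed_vector"
 assumes "\<And>i. i \<in> I \<Longrightarrow> smeas (f i)"
 shows "smeas (\<lambda>t. \<Sum>i\<in>I. f i t)"
 using assms by (induction I rule: infinite_finite_induct) (auto intro: smeas_const smeas_add)

definition bint :: "(real \<Rightarrow> 'a::complex_banach) \<Rightarrow> bool" where
 "bint f \<longleftrightarrow> smeas f \<and> (\<integral>\<^sup>+t. ennreal (norm (f t)) \<partial>lebesgue) < \<infinity>"

lemma bint_smeas: "bint f \<Longrightarrow> smeas f" by (simp add: bint_def)

lemma norm_measurable: "f \<in> borel_measurable M \<Longrightarrow> (\<lambda>t. norm (f t :: 'a::real_normed_vector)) \<in> borel_measurable M"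
 by (rule borel_measurable_continuous_on) (auto intro!: continuous_intros)

lemma bintI:
 assumes "smeas f" "integrable lebesgue k" "AE t in lebesgue. norm (f t) \<le> k t"
 shows "bint f"
proof -
 have "integrable lebesgue (\<lambda>t. norm (f t))"
  by (rule integrable_dom[OF assms(2)])
    (use assms norm_measurable[OF smeas_measurable[OF assms(1)]] in auto)
 then show ?thesis using assms(1) by (simp add: bint_def integrable_iff_bounded)
qed

lemma bint_norm_integrable: "bint f \<Longrightarrow> integrable lebesgue (\<lambda>t. norm (f t))"
 unfolding bint_def integrable_iff_bounded using norm_measurable[OF smeas_measurable, of f] by simp

text \<open>
 The simple functions are cut off at twice the norm of the limit, so that the limit of their
 integrals exists by dominated convergence and completeness.
\<close>
lemma has_Bochner_exists:
 fixes f :: "real \<Rightarrow> 'a::complex_banach"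
 assumes f: "bint f"
 shows "\<exists>z. has_Bochner f z"
proof -
 obtain s g where s: "\<forall>n. simple_function lebesgue (s n)" "\<forall>t. (\<lambda>n. s n t) \<longlonglongrightarrow> g t"
  and fg: "AE t in lebesgue. f t = g t"
  using smeas_modification[OF bint_smeas[OF f]] by (elim exE conjE)
 note s = s[rule_format]
 have g[measurable]: "g \<in> borel_measurable lebesgue"
  by (rule borel_measurable_LIMSEQ_metric[OF borel_measurable_simple_function[OF s(1)]]) (use s(2) in auto)
 note [measurable] = norm_measurable[OF g] borel_measurable_simple_function[OF s(1)]
  norm_measurable[OF borel_measurable_simple_function[OF s(1)]]
 define r where "r n t = indicator {t. norm (s n t) \<le> 2 * norm (g t)} t *\<^sub>R s n t" for n t
 have r: "simple_function lebesgue (r n)" for n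
 proof -
  have "{t \<in> space lebesgue. norm (s n t) \<le> 2 * norm (g t)} \<in> sets lebesgue" by measurable
  then have "simple_function lebesgue (indicator {t. norm (s n t) \<le> 2 * norm (g t)} :: real \<Rightarrow> real)"
   by (intro simple_function_indicator) simp
  from simple_function_compose2[OF this s(1)[of n], of "\<lambda>a b. a *\<^sub>R b"]
  show ?thesis by (simp add: r_def[abs_def])
 qed
 have r_le: "norm (r n t) \<le> 2 * norm (g t)" for n t by (simp add: r_def indicator_def)
 have r_lim: "(\<lambda>n. r n t) \<longlonglongrightarrow> g t" for t
 proof (cases "g t = 0")
  case True
  then have "r n t = 0" for n using r_le[of n t] by simp
  with True show ?thesis by simp
 next
  case False
  then have "norm (g t) < 2 * norm (g t)" by simp
  from order_tendstoD(2)[OF tendsto_norm[OF s(2)] this]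
  have "\<forall>\<^sub>F n in sequentially. s n t = r n t" by eventually_elim (simp add: r_def)
  from Lim_transform_eventually[OF s(2) this] show ?thesis .
 qed
 have fin: "(\<integral>\<^sup>+t. ennreal (norm (g t)) \<partial>lebesgue) < \<infinity>"
 proof -
  have "(\<integral>\<^sup>+t. ennreal (norm (g t)) \<partial>lebesgue) = (\<integral>\<^sup>+t. ennreal (norm (f t)) \<partial>lebesgue)"
   by (rule nn_integral_cong_AE) (use fg in auto)
  then show ?thesis using f by (simp add: bint_def)
 qed
 then have fin2: "(\<integral>\<^sup>+t. ennreal (3 * norm (g t)) \<partial>lebesgue) < \<infinity>"
  by (simp add: ennreal_mult nn_integral_cmult ennreal_mult_less_top)
 have rb: "Bochner_Integration.simple_bochner_integrable lebesgue (r n)" for n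
 proof (rule simple_bochner_integrableI_bounded[OF r])
  have "(\<integral>\<^sup>+t. ennreal (norm (r n t)) \<partial>lebesgue) \<le> (\<integral>\<^sup>+t. ennreal (3 * norm (g t)) \<partial>lebesgue)"
   by (intro nn_integral_mono ennreal_leI) (use r_le in \<open>smt (verit) norm_ge_zero\<close>)
  then show "(\<integral>\<^sup>+t. ennreal (norm (r n t)) \<partial>lebesgue) < \<infinity>" using fin2 by (rule le_less_trans)
 qed
 have dm: "(\<lambda>t. g t - r n t) \<in> borel_measurable lebesgue" for n
 proof (rule borel_measurable_LIMSEQ_metric)
  show "(\<lambda>t. r m t - r n t) \<in> borel_measurable lebesgue" for m
   by (rule borel_measurable_simple_function[OF simple_function_compose2[OF r r]])
  show "(\<lambda>m. r m t - r n t) \<longlonglongrightarrow> g t - r n t" for t by (intro tendsto_intros r_lim)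
 qed
 have conv: "(\<lambda>n. \<integral>\<^sup>+t. ennreal (norm (g t - r n t)) \<partial>lebesgue) \<longlonglongrightarrow> 0"
 proof -
  have "(\<lambda>n. \<integral>\<^sup>+t. ennreal (norm (g t - r n t)) \<partial>lebesgue) \<longlonglongrightarrow> integral\<^sup>N (lebesgue :: real measure) (\<lambda>t. 0)"
  proof (rule nn_integral_dominated_convergence[where w="\<lambda>t. ennreal (3 * norm (g t))"])
   show "(\<lambda>t. ennreal (norm (g t - r n t))) \<in> borel_measurable lebesgue" for n
    using norm_measurable[OF dm] by simp
   show "AE t in lebesgue. ennreal (norm (g t - r n t)) \<le> ennreal (3 * norm (g t))" for n
    by (intro AE_I2 ennreal_leI) (use r_le[of n] norm_triangle_ineq4[of "g _" "r n _"] in \<open>smt (verit)\<close>)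
   show "AE t in lebesgue. (\<lambda>n. ennreal (norm (g t - r n t))) \<longlonglongrightarrow> 0"
   proof (rule AE_I2)
    fix t
    have "(\<lambda>n. norm (g t - r n t)) \<longlonglongrightarrow> norm (g t - g t)" by (intro tendsto_intros r_lim)
    from tendsto_ennrealI[OF this] show "(\<lambda>n. ennreal (norm (g t - r n t))) \<longlonglongrightarrow> 0" by simp
   qed
  qed (use fin2 in auto)
  then show ?thesis by simp
 qed
 let ?I = "\<lambda>n. Bochner_Integration.simple_bochner_integral lebesgue (r n)"
 have dist: "ennreal (norm (?I m - ?I n)) \<le> (\<integral>\<^sup>+t. ennreal (norm (g t - r m t)) \<partial>lebesgue)
   + (\<integral>\<^sup>+t. ennreal (norm (g t - r n t)) \<partial>lebesgue)" for m n
 proof -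
  have "norm (?I m - ?I n) = norm (Bochner_Integration.simple_bochner_integral lebesgue (\<lambda>t. r m t - r n t))"
   by (simp add: simple_bochner_integral_diff[OF rb rb])
  also have "\<dots> \<le> Bochner_Integration.simple_bochner_integral lebesgue (\<lambda>t. norm (r m t - r n t))"
   by (rule simple_bochner_integral_norm_bound) (rule simple_bochner_integrable_compose2[OF _ rb rb], simp)
  finally have "ennreal (norm (?I m - ?I n)) \<le> ennreal \<dots>" by (rule ennreal_leI)
  also have "\<dots> = (\<integral>\<^sup>+t. ennreal (norm (r m t - r n t)) \<partial>lebesgue)"
   by (rule simple_bochner_integral_eq_nn_integral)
     (rule simple_bochner_integrable_compose2[OF _ rb rb], auto)
  also have "\<dots> \<le> (\<integral>\<^sup>+t. ennreal (norm (g t - r m t)) + ennreal (norm (g t - r n t)) \<partial>lebesgue)"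
  proof (rule nn_integral_mono)
   fix t
   have "r m t - r n t = (g t - r n t) - (g t - r m t)" by simp
   then have "norm (r m t - r n t) \<le> norm (g t - r m t) + norm (g t - r n t)"
    using norm_triangle_ineq4[of "g t - r n t" "g t - r m t"] by simp
   then show "ennreal (norm (r m t - r n t)) \<le> ennreal (norm (g t - r m t)) + ennreal (norm (g t - r n t))"
    by (simp flip: ennreal_plus)
  qed
  also have "\<dots> = (\<integral>\<^sup>+t. ennreal (norm (g t - r m t)) \<partial>lebesgue) + (\<integral>\<^sup>+t. ennreal (norm (g t - r n t)) \<partial>lebesgue)"
   by (rule nn_integral_add) (use norm_measurable[OF dm] in simp_all)
  finally show ?thesis .
 qed
 have "Cauchy ?I"
 proof (rule metric_CauchyI)
  fix e :: real assume "0 < e"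
  then have "0 < ennreal (e / 2)" by simp
  from order_tendstoD(2)[OF conv this] obtain N where
   N: "\<And>n. N \<le> n \<Longrightarrow> (\<integral>\<^sup>+t. ennreal (norm (g t - r n t)) \<partial>lebesgue) < ennreal (e / 2)"
   by (auto simp: eventually_sequentially)
  have "dist (?I m) (?I n) < e" if "N \<le> m" "N \<le> n" for m n
  proof -
   have "ennreal (norm (?I m - ?I n)) < ennreal (e / 2) + ennreal (e / 2)"
    using dist[of m n] add_strict_mono[OF N[OF that(1)] N[OF that(2)]] by (rule le_less_trans)
   then show ?thesis using \<open>0 < e\<close>
    by (simp add: dist_norm ennreal_less_iff flip: ennreal_plus)
  qed
  then show "\<exists>N. \<forall>m\<ge>N. \<forall>n\<ge>N. dist (?I m) (?I n) < e" by blast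
 qed
 then have "convergent ?I" by (rule Cauchy_convergent)
 then obtain z where z: "?I \<longlonglongrightarrow> z" unfolding convergent_def by (elim exE)
 have "(\<lambda>n. \<integral>\<^sup>+t. ennreal (norm (f t - r n t)) \<partial>lebesgue) \<longlonglongrightarrow> 0"
 proof -
  have "(\<integral>\<^sup>+t. ennreal (norm (f t - r n t)) \<partial>lebesgue) = (\<integral>\<^sup>+t. ennreal (norm (g t - r n t)) \<partial>lebesgue)" for n
   by (rule nn_integral_cong_AE) (use fg in auto)
  with conv show ?thesis by simp
 qed
 with z rb bint_smeas[OF f] show ?thesis
  unfolding has_Bochner_def strongly_measurable_smeas
  by (intro exI[of _ z] conjI exI[of _ r] allI)
qed

text \<open>Through this identity every statement on vector-valued integrals reduces to scalar integrals.\<close>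
lemma has_Bochner_functional:
 fixes f :: "real \<Rightarrow> 'a::complex_banach" and l :: "'a \<Rightarrow> complex"
 assumes f: "has_Bochner f z" and l: "bounded_clinear_on UNIV l"
 shows "has_bochner_integral lebesgue (\<lambda>t. l (f t)) (l z)"
proof -
 have lin: "bounded_linear l" by (rule bcl_bounded_linear[OF l])
 obtain K where K: "0 \<le> K" "\<forall>x. norm (l x) \<le> K * norm x" by (rule bcl_bound[OF l])
 obtain s where s: "\<forall>n. Bochner_Integration.simple_bochner_integrable lebesgue (s n)"
   "(\<lambda>n. \<integral>\<^sup>+t. ennreal (norm (f t - s n t)) \<partial>lebesgue) \<longlonglongrightarrow> 0"
   "(\<lambda>n. Bochner_Integration.simple_bochner_integral lebesgue (s n)) \<longlonglongrightarrow> z"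
  and sm: "smeas f"
  using f by (auto simp: has_Bochner_def strongly_measurable_smeas)
 note s = s[rule_format]
 show ?thesis
 proof (rule has_bochner_integral.intros[where s="\<lambda>n t. l (s n t)"])
  show "(\<lambda>t. l (f t)) \<in> borel_measurable lebesgue"
   by (rule smeas_measurable[OF smeas_linear[OF lin sm]])
  show "Bochner_Integration.simple_bochner_integrable lebesgue (\<lambda>t. l (s n t))" for n
   using simple_bochner_integrable_compose2[OF _ s(1)[of n] s(1)[of n], of "\<lambda>x y. l x"]
    linear_0[OF bounded_linear.linear[OF lin]] by simp
  show "(\<lambda>n. Bochner_Integration.simple_bochner_integral lebesgue (\<lambda>t. l (s n t))) \<longlonglongrightarrow> l z"
   using bounded_linear.tendsto[OF lin s(3)]
   by (simp add: simple_bochner_integral_linear[OF bounded_linear.linear[OF lin] s(1)])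
  show "(\<lambda>n. \<integral>\<^sup>+t. ennreal (norm (l (f t) - l (s n t))) \<partial>lebesgue) \<longlonglongrightarrow> 0"
  proof (rule tendsto_sandwich[where f="\<lambda>_. 0"])
   show "\<forall>\<^sub>F n in sequentially. (\<integral>\<^sup>+t. ennreal (norm (l (f t) - l (s n t))) \<partial>lebesgue)
     \<le> ennreal K * (\<integral>\<^sup>+t. ennreal (norm (f t - s n t)) \<partial>lebesgue)"
   proof (rule always_eventually, rule allI)
    fix n
    have sn: "smeas (\<lambda>t. f t - s n t)"
    proof -
     have "simple_function lebesgue (s n)" using s(1)[of n] by (auto simp: simple_bochner_integrable.simps)
     from smeas_add[OF sm smeas_scaleR[OF smeas_const[of "-1"] smeas_simple[OF this]]]
     show ?thesis by simp
    qed
    have "(\<integral>\<^sup>+t. ennreal (norm (l (f t) - l (s n t))) \<partial>lebesgue)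
     \<le> (\<integral>\<^sup>+t. ennreal K * ennreal (norm (f t - s n t)) \<partial>lebesgue)"
    proof (rule nn_integral_mono)
     fix t
     have "norm (l (f t) - l (s n t)) = norm (l (f t - s n t))"
      by (simp add: linear_diff[OF bounded_linear.linear[OF lin]])
     also have "\<dots> \<le> K * norm (f t - s n t)" using K(2) by blast
     finally show "ennreal (norm (l (f t) - l (s n t))) \<le> ennreal K * ennreal (norm (f t - s n t))"
      by (simp add: ennreal_leI K(1) flip: ennreal_mult)
    qed
    also have "\<dots> = ennreal K * (\<integral>\<^sup>+t. ennreal (norm (f t - s n t)) \<partial>lebesgue)"
     by (rule nn_integral_cmult) (use norm_measurable[OF smeas_measurable[OF sn]] in simp)
    finally show "(\<integral>\<^sup>+t. ennreal (norm (l (f t) - l (s n t))) \<partial>lebesgue)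
     \<le> ennreal K * (\<integral>\<^sup>+t. ennreal (norm (f t - s n t)) \<partial>lebesgue)" .
   qed
   show "(\<lambda>n. ennreal K * (\<integral>\<^sup>+t. ennreal (norm (f t - s n t)) \<partial>lebesgue)) \<longlonglongrightarrow> 0"
    using ennreal_tendsto_cmult[OF _ s(2), of "ennreal K"] by simp
  qed auto
 qed
qed

lemma has_Bochner_Bochner:
 fixes f :: "real \<Rightarrow> 'a::complex_banach"
 assumes f: "bint f"
 shows "has_Bochner f (Bochner f)"
proof -
 obtain z where z: "has_Bochner f z" using has_Bochner_exists[OF f] by blast
 have "w = z" if "has_Bochner f w" for w
 proof (rule functional_ext)
  fix l :: "'a \<Rightarrow> complex" assume l: "bounded_clinear_on UNIV l"
  show "l w = l z"
   using has_Bochner_functional[OF that l] has_Bochner_functional[OF z l]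
   by (rule has_bochner_integral_eq)
 qed
 with z show ?thesis unfolding Bochner_def by (rule theI)
qed

lemma functional_Bochner:
 fixes f :: "real \<Rightarrow> 'a::complex_banach" and l :: "'a \<Rightarrow> complex"
 assumes f: "bint f" and l: "bounded_clinear_on UNIV l"
 shows "integrable lebesgue (\<lambda>t. l (f t))" "l (Bochner f) = (\<integral>t. l (f t) \<partial>lebesgue)"
 using has_Bochner_functional[OF has_Bochner_Bochner[OF f] l]
 by (auto simp: has_bochner_integral_iff)

lemma Bochner_eqI:
 fixes f :: "real \<Rightarrow> 'a::complex_banach"
 assumes "bint f"
  "\<And>l::'a \<Rightarrow> complex. bounded_clinear_on UNIV l \<Longrightarrow> (\<integral>t. l (f t) \<partial>lebesgue) = l z"
 shows "Bochner f = z"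
 by (rule functional_ext) (simp add: functional_Bochner assms)

lemma bcl_ident: "bounded_clinear_on UNIV (\<lambda>z::complex. z)"
 by (auto simp: bounded_clinear_on_def intro: exI[of _ 1])

lemma Bochner_complex:
 fixes f :: "real \<Rightarrow> complex"
 assumes "bint f"
 shows "integrable lebesgue f" "Bochner f = (\<integral>t. f t \<partial>lebesgue)"
 using functional_Bochner[OF assms bcl_ident] by auto

lemma bint_complex:
 fixes f :: "real \<Rightarrow> complex"
 assumes "integrable lebesgue f"
 shows "bint f"
 using assms smeas_borel[of f] by (auto simp: bint_def integrable_iff_bounded)

lemma Bochner_norm_le:
 fixes f :: "real \<Rightarrow> 'a::complex_banach"
 assumes f: "bint f"
 shows "norm (Bochner f) \<le> (\<integral>t. norm (f t) \<partial>lebesgue)"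
proof -
 obtain l :: "'a \<Rightarrow> complex" where l: "bounded_clinear_on UNIV l" "\<forall>x. cmod (l x) \<le> norm x"
  "l (Bochner f) = of_real (norm (Bochner f))" by (rule norming_functional)
 have "norm (Bochner f) = cmod (\<integral>t. l (f t) \<partial>lebesgue)"
  unfolding functional_Bochner(2)[OF f l(1), symmetric] l(3) by simp
 also have "\<dots> \<le> (\<integral>t. cmod (l (f t)) \<partial>lebesgue)" by (rule integral_norm_bound)
 also have "\<dots> \<le> (\<integral>t. norm (f t) \<partial>lebesgue)"
  by (intro integral_mono integrable_norm functional_Bochner f l bint_norm_integrable) (use l in auto)
 finally show ?thesis .
qed

lemma bint_bcl:
 assumes F: "bounded_clinear_on UNIV F" and f: "bint f"
 shows "bint (\<lambda>t. F (f t))"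
proof -
 obtain K where K: "0 \<le> K" "\<forall>x. norm (F x) \<le> K * norm x" by (rule bcl_bound[OF F])
 show ?thesis
  by (rule bintI[OF smeas_linear[OF bcl_bounded_linear[OF F] bint_smeas[OF f]],
    of "\<lambda>t. K * norm (f t)"]) (use bint_norm_integrable[OF f] K in auto)
qed

lemma Bochner_bcl:
 fixes F :: "'a::complex_banach \<Rightarrow> 'b::complex_banach"
 assumes F: "bounded_clinear_on UNIV F" and f: "bint f"
 shows "Bochner (\<lambda>t. F (f t)) = F (Bochner f)"
 by (rule Bochner_eqI[OF bint_bcl[OF F f]])
   (simp add: functional_Bochner(2)[OF f bcl_compose[OF _ F]])

lemma bint_add: "bint f \<Longrightarrow> bint g \<Longrightarrow> bint (\<lambda>t. f t + g t)"
 by (rule bintI[OF smeas_add, of _ _ "\<lambda>t. norm (f t) + norm (g t)"])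
   (auto intro: bint_smeas bint_norm_integrable norm_triangle_ineq)

lemma Bochner_add:
 fixes f g :: "real \<Rightarrow> 'a::complex_banach"
 assumes "bint f" "bint g"
 shows "Bochner (\<lambda>t. f t + g t) = Bochner f + Bochner g"
 by (rule Bochner_eqI[OF bint_add[OF assms]])
   (simp add: bcl_add functional_Bochner assms)

lemma bcl_scaleC_const: "bounded_clinear_on UNIV (\<lambda>x::'a::complex_banach. c *\<^sub>C x)"
 by (auto simp: bounded_clinear_on_def scaleC_add_right scaleC_scaleC norm_scaleC mult.commute
   intro!: exI[of _ "cmod c"])

lemma bint_sum:
 fixes f :: "'i \<Rightarrow> real \<Rightarrow> 'a::complex_banach"
 assumes "\<And>i. i \<in> I \<Longrightarrow> bint (f i)"
 shows "bint (\<lambda>t. \<Sum>i\<in>I. f i t)"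
 using assms
proof (induction I rule: infinite_finite_induct)
 case (insert i I)
 then have "bint (\<lambda>t. f i t + (\<Sum>i\<in>I. f i t))" by (intro bint_add) auto
 with insert show ?case by simp
qed (simp_all add: bint_def smeas_const)

lemma bcl_sum:
 fixes l :: "'a::complex_banach \<Rightarrow> 'b::complex_banach"
 assumes "bounded_clinear_on UNIV l"
 shows "l (\<Sum>i\<in>I. x i) = (\<Sum>i\<in>I. l (x i))"
 by (rule linear_sum[OF bounded_linear.linear[OF bcl_bounded_linear[OF assms]]])

lemma Bochner_sum:
 fixes f :: "'i \<Rightarrow> real \<Rightarrow> 'a::complex_banach"
 assumes "\<And>i. i \<in> I \<Longrightarrow> bint (f i)"
 shows "Bochner (\<lambda>t. \<Sum>i\<in>I. f i t) = (\<Sum>i\<in>I. Bochner (f i))"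
 by (rule Bochner_eqI[OF bint_sum[OF assms]])
   (simp_all add: bcl_sum functional_Bochner assms)

lemma scaleC_one [simp]: "1 *\<^sub>C x = (x :: 'a::complex_banach)"
 using scaleR_scaleC[of 1 x] by simp

lemma scaleC_zero_left [simp]: "0 *\<^sub>C x = (0 :: 'a::complex_banach)"
 using scaleR_scaleC[of 0 x] by simp

lemma scaleC_zero_right [simp]: "c *\<^sub>C (0 :: 'a::complex_banach) = 0"
 using norm_scaleC[of c "0::'a"] by simp

lemma scaleC_minus_left: "(- c) *\<^sub>C x = - (c *\<^sub>C (x :: 'a::complex_banach))"
 using scaleC_add_left[of "- c" c x] by (simp add: eq_neg_iff_add_eq_0)

lemma scaleC_minus_right: "c *\<^sub>C (- x) = - (c *\<^sub>C (x :: 'a::complex_banach))"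
 using scaleC_add_right[of c "- x" x] by (simp add: eq_neg_iff_add_eq_0)

lemma scaleC_diff_left: "(c - d) *\<^sub>C x = c *\<^sub>C x - d *\<^sub>C (x :: 'a::complex_banach)"
 using scaleC_add_left[of c "- d" x] by (simp add: scaleC_minus_left)

lemma scaleC_diff_right: "c *\<^sub>C (x - y) = c *\<^sub>C x - c *\<^sub>C (y :: 'a::complex_banach)"
 using scaleC_add_right[of c x "- y"] by (simp add: scaleC_minus_right)

lemma bcl_diff: "bounded_clinear_on UNIV F \<Longrightarrow> F (x - y) = F x - F y"
 by (rule linear_diff[OF bounded_linear.linear[OF bcl_bounded_linear]])

lemma bcl_scaleR: "bounded_clinear_on UNIV F \<Longrightarrow> F (r *\<^sub>R x) = r *\<^sub>R F x"
 by (simp add: scaleR_scaleC bcl_scaleC)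

lemma bcl_mult: "bounded_clinear_on UNIV l \<Longrightarrow> l (c *\<^sub>C x) = c * (l x :: complex)"
 by (simp add: bcl_scaleC scaleC_complex_def)

lemma bcl_zero: "bounded_clinear_on UNIV F \<Longrightarrow> F 0 = 0"
 by (rule linear_0[OF bounded_linear.linear[OF bcl_bounded_linear]])

lemma bcl_tendsto: "bounded_clinear_on UNIV F \<Longrightarrow> (f \<longlongrightarrow> a) G \<Longrightarrow> ((\<lambda>t. F (f t)) \<longlongrightarrow> F a) G"
 by (rule bounded_linear.tendsto[OF bcl_bounded_linear])

lemma bint_scaleC: "bint f \<Longrightarrow> bint (\<lambda>t. c *\<^sub>C f t)"
 by (rule bint_bcl[OF bcl_scaleC_const])

lemma Bochner_scaleC: "bint f \<Longrightarrow> Bochner (\<lambda>t. c *\<^sub>C f t) = c *\<^sub>C Bochner f"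
 by (rule Bochner_bcl[OF bcl_scaleC_const])

lemma bint_diff: "bint f \<Longrightarrow> bint g \<Longrightarrow> bint (\<lambda>t. f t - g t)"
 using bint_add[of f "\<lambda>t. (- 1) *\<^sub>C g t"] bint_scaleC[of g "- 1"] by (simp add: scaleC_minus_left)

lemma Bochner_diff:
 assumes "bint f" "bint g"
 shows "Bochner (\<lambda>t. f t - g t) = Bochner f - Bochner g"
 using Bochner_add[OF assms(1) bint_scaleC[OF assms(2), of "- 1"]] Bochner_scaleC[OF assms(2), of "-1"]
 by (simp add: scaleC_minus_left)

lemma Bochner_dominated_convergence:
 fixes f :: "nat \<Rightarrow> real \<Rightarrow> 'a::complex_banach"
 assumes f: "\<And>n. smeas (f n)" and g: "smeas g" and w: "integrable lebesgue w"
  and le: "\<And>n. AE t in lebesgue. norm (f n t) \<le> w t"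
  and lim: "AE t in lebesgue. (\<lambda>n. f n t) \<longlonglongrightarrow> g t"
 shows "(\<lambda>n. Bochner (f n)) \<longlonglongrightarrow> Bochner g"
proof -
 have leall: "AE t in lebesgue. \<forall>n. norm (f n t) \<le> w t" using le by (simp add: AE_all_countable)
 have gle: "AE t in lebesgue. norm (g t) \<le> w t"
  using leall lim
 proof eventually_elim
  case (elim t)
  show ?case by (rule LIMSEQ_le_const2[OF tendsto_norm[OF elim(2)]]) (use elim in auto)
 qed
 have bf: "bint (f n)" for n by (rule bintI[OF f w le])
 have bg: "bint g" by (rule bintI[OF g w gle])
 have "(\<lambda>n. \<integral>t. norm (f n t - g t) \<partial>lebesgue) \<longlonglongrightarrow> integral\<^sup>L lebesgue (\<lambda>t::real. 0::real)"
 proof (rule integral_dominated_convergence[where w="\<lambda>t. 2 * w t"])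
  show "(\<lambda>t. norm (f n t - g t)) \<in> borel_measurable lebesgue" for n
   by (rule borel_measurable_integrable[OF bint_norm_integrable[OF bint_diff[OF bf bg]]])
  show "AE t in lebesgue. (\<lambda>n. norm (f n t - g t)) \<longlonglongrightarrow> 0"
   using lim by eventually_elim (simp add: tendsto_norm_zero LIM_zero)
  show "AE t in lebesgue. norm (norm (f n t - g t)) \<le> 2 * w t" for n
   using le[of n] gle
  proof eventually_elim
   case (elim t)
   then show ?case using norm_triangle_ineq4[of "f n t" "g t"] by simp
  qed
 qed (use w in auto)
 then have *: "(\<lambda>n. \<integral>t. norm (f n t - g t) \<partial>lebesgue) \<longlonglongrightarrow> 0" by simp
 have "(\<lambda>n. Bochner (f n) - Bochner g) \<longlonglongrightarrow> 0"
 proof (rule Lim_null_comparison[OF always_eventually *], rule allI)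
  fix n
  show "norm (Bochner (f n) - Bochner g) \<le> (\<integral>t. norm (f n t - g t) \<partial>lebesgue)"
   using Bochner_norm_le[OF bint_diff[OF bf bg]] by (simp add: Bochner_diff[OF bf bg])
 qed
 then show ?thesis by (simp add: LIM_zero_iff)
qed

lemma lebesgue_lborel:
 fixes f :: "real \<Rightarrow> 'a::{banach, second_countable_topology}"
 assumes "f \<in> borel_measurable borel"
 shows "integral\<^sup>L lebesgue f = integral\<^sup>L lborel f" "integrable lebesgue f \<longleftrightarrow> integrable lborel f"
 using assms by (simp_all add: integral_completion integrable_completion)

lemma smeas_borel':
 fixes f :: "real \<Rightarrow> 'a::{metric_space, second_countable_topology}"
 shows "f \<in> borel_measurable borel \<Longrightarrow> smeas f"
 by (rule smeas_borel, rule measurable_completion) simp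

lemma smeas_indicator: "S \<in> sets borel \<Longrightarrow> smeas (indicator S :: real \<Rightarrow> real)"
 by (rule smeas_borel') simp

lemma gamma_kernel_integral:
 fixes \<gamma> c :: real
 assumes "0 < \<gamma>" "0 < c"
 shows "has_bochner_integral lborel (\<lambda>t. indicator {0..} t * (t powr (\<gamma> - 1) * exp (- c * t))) (Gamma \<gamma> * c powr (- \<gamma>))"
proof (rule has_bochner_integral_nn_integral)
 have "ennreal (Gamma \<gamma>) = (\<integral>\<^sup>+t. ennreal (indicator {0..} t * t powr (\<gamma> - 1) / exp t) \<partial>lborel)"
  by (rule Gamma_conv_nn_integral_real[OF assms(1)])
 also have "\<dots> = ennreal \<bar>c\<bar> * (\<integral>\<^sup>+t. ennreal (indicator {0..} (0 + c * t) * (0 + c * t) powr (\<gamma> - 1) / exp (0 + c * t)) \<partial>lborel)"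
  using assms by (intro nn_integral_real_affine) auto
 also have "\<dots> = (\<integral>\<^sup>+t. ennreal c * ennreal (indicator {0..} (0 + c * t) * (0 + c * t) powr (\<gamma> - 1) / exp (0 + c * t)) \<partial>lborel)"
  using assms by (subst nn_integral_cmult) auto
 also have "\<dots> = (\<integral>\<^sup>+t. ennreal (c powr \<gamma>) * ennreal (indicator {0..} t * (t powr (\<gamma> - 1) * exp (- c * t))) \<partial>lborel)"
 proof (rule nn_integral_cong)
  fix t :: real
  have "c * (indicator {0..} (0 + c * t) * (0 + c * t) powr (\<gamma> - 1) / exp (0 + c * t))
    = c powr \<gamma> * (indicator {0..} t * (t powr (\<gamma> - 1) * exp (- c * t)))"
  proof (cases "0 \<le> t")
   case True
   have "c * c powr (\<gamma> - 1) = c powr \<gamma>" using assms by (simp add: powr_mult_base)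
   moreover have "0 \<le> c * t" using True assms by simp
   ultimately show ?thesis using True assms
    by (simp add: powr_mult exp_minus field_simps)
  next
   case False
   then have "\<not> 0 \<le> c * t" using assms by (simp add: zero_le_mult_iff)
   with False show ?thesis by simp
  qed
  then show "ennreal c * ennreal (indicator {0..} (0 + c * t) * (0 + c * t) powr (\<gamma> - 1) / exp (0 + c * t))
   = ennreal (c powr \<gamma>) * ennreal (indicator {0..} t * (t powr (\<gamma> - 1) * exp (- c * t)))"
   using assms by (simp flip: ennreal_mult')
 qed
 also have "\<dots> = ennreal (c powr \<gamma>) * (\<integral>\<^sup>+t. ennreal (indicator {0..} t * (t powr (\<gamma> - 1) * exp (- c * t))) \<partial>lborel)"
  by (rule nn_integral_cmult) auto
 finally have *: "ennreal (Gamma \<gamma>) = ennreal (c powr \<gamma>) * (\<integral>\<^sup>+t. ennreal (indicator {0..} t * (t powr (\<gamma> - 1) * exp (- c * t))) \<partial>lborel)" .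
 have "ennreal (Gamma \<gamma> * c powr (- \<gamma>)) = ennreal (c powr (- \<gamma>)) * ennreal (Gamma \<gamma>)"
  using assms by (simp add: mult.commute flip: ennreal_mult')
 also have "\<dots> = (ennreal (c powr (- \<gamma>)) * ennreal (c powr \<gamma>)) * (\<integral>\<^sup>+t. ennreal (indicator {0..} t * (t powr (\<gamma> - 1) * exp (- c * t))) \<partial>lborel)"
  unfolding * by (simp add: mult.assoc)
 also have "ennreal (c powr (- \<gamma>)) * ennreal (c powr \<gamma>) = 1"
  using assms by (simp flip: ennreal_mult powr_add)
 finally show "(\<integral>\<^sup>+t. ennreal (indicator {0..} t * (t powr (\<gamma> - 1) * exp (- c * t))) \<partial>lborel) = ennreal (Gamma \<gamma> * c powr (- \<gamma>))"
  by simp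
qed (use assms in \<open>auto intro!: Gamma_real_nonneg mult_nonneg_nonneg simp: less_imp_le\<close>)

lemma exp_kernel_integrable:
 fixes c :: real
 assumes "0 < c"
 shows "integrable lborel (\<lambda>t::real. indicator {0..} t * exp (- c * t))"
proof -
 have "integrable lborel (\<lambda>t::real. indicator {0..} t * (t powr (1 - 1) * exp (- c * t)))"
  using gamma_kernel_integral[of 1 c] assms by (auto simp: has_bochner_integral_iff)
 then show ?thesis
  by (rule integrable_cong_AE_imp)
    (auto intro!: AE_I'[of "{0}"] simp: indicator_def)
qed

section \<open>Laplace transforms of orbits and resolvents\<close>

locale C0_generator =
 fixes T :: "real \<Rightarrow> 'x::complex_banach \<Rightarrow> 'x" and D :: "'x set" and A :: "'x \<Rightarrow> 'x"
  and M w :: real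
 assumes semigroup: "C0_semigroup T" and generator: "is_generator T D (\<lambda>x. - A x)"
  and growth: "\<And>t x. 0 \<le> t \<Longrightarrow> norm (T t x) \<le> M * exp (w * t) * norm x"
  and M_nonneg: "0 \<le> M"
begin

abbreviation R :: "complex \<Rightarrow> 'x \<Rightarrow> 'x" where "R \<equiv> shift_inverse D A"

lemma T_bcl: "0 \<le> t \<Longrightarrow> bounded_clinear_on UNIV (T t)"
 and T_zero: "T 0 x = x"
 and T_add: "0 \<le> s \<Longrightarrow> 0 \<le> t \<Longrightarrow> T (s + t) x = T s (T t x)"
 and T_continuous_on: "continuous_on {0..} (\<lambda>t. T t x)"
 using semigroup unfolding C0_semigroup_def by blast+

text \<open>Extended by zero to negative times, so that integrals run over the whole line.\<close>
definition Tp :: "real \<Rightarrow> 'x \<Rightarrow> 'x" where "Tp t x = indicator {0..} t *\<^sub>R T t x"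

lemma Tp_nonneg: "0 \<le> t \<Longrightarrow> Tp t x = T t x" by (simp add: Tp_def)
lemma Tp_neg: "t < 0 \<Longrightarrow> Tp t x = 0" by (simp add: Tp_def)

lemma Tp_bcl: "bounded_clinear_on UNIV (Tp t)"
proof (cases "0 \<le> t")
 case True
 then have "Tp t = T t" by (auto simp: Tp_def)
 then show ?thesis using T_bcl[OF True] by simp
next
 case False
 then have "Tp t = (\<lambda>x. 0)" by (auto simp: Tp_def)
 then show ?thesis by (auto simp: bounded_clinear_on_def intro: exI[of _ 0])
qed

lemma Tp_norm_le: "norm (Tp t x) \<le> indicator {0..} t * (M * exp (w * t) * norm x)"
 using growth[of t x] by (auto simp: Tp_def indicator_def)

lemma T_tendsto:
 assumes s: "(s \<longlongrightarrow> t) F" and y: "(y \<longlongrightarrow> x) F" and nn: "\<forall>\<^sub>F i in F. 0 \<le> s i" and t: "0 \<le> t"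
 shows "((\<lambda>i. T (s i) (y i)) \<longlongrightarrow> T t x) F"
proof -
 have "((\<lambda>i. T (s i) (y i) - T (s i) x) \<longlongrightarrow> 0) F"
 proof (rule Lim_null_comparison)
  show "\<forall>\<^sub>F i in F. norm (T (s i) (y i) - T (s i) x) \<le> M * exp (w * s i) * norm (y i - x)"
   using nn
  proof eventually_elim
   case (elim i)
   then show ?case using growth[OF elim, of "y i - x"] by (simp add: bcl_diff[OF T_bcl[OF elim]])
  qed
  have "((\<lambda>i. M * exp (w * s i) * norm (y i - x)) \<longlongrightarrow> M * exp (w * t) * norm (x - x)) F"
   by (intro tendsto_intros s y)
  then show "((\<lambda>i. M * exp (w * s i) * norm (y i - x)) \<longlongrightarrow> 0) F" by simp
 qed
 moreover have "((\<lambda>i. T (s i) x) \<longlongrightarrow> T t x) F"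
  by (rule continuous_on_tendsto_compose[OF T_continuous_on s]) (use nn t in auto)
 ultimately have "((\<lambda>i. (T (s i) (y i) - T (s i) x) + T (s i) x) \<longlongrightarrow> 0 + T t x) F"
  by (rule tendsto_add)
 then show ?thesis by simp
qed

lemma Tp_isCont: "t \<noteq> 0 \<Longrightarrow> isCont (\<lambda>z. Tp (fst z) (snd z)) (t, x)"
proof (cases "0 < t")
 case True
 have ev: "\<forall>\<^sub>F z in at (t, x). 0 < fst z"
  using order_tendstoD(1)[OF tendsto_fst[OF tendsto_ident_at], of 0 "(t, x)" UNIV] True by simp
 have "((\<lambda>z. T (fst z) (snd z)) \<longlongrightarrow> T t x) (at (t, x))"
  using tendsto_fst[OF tendsto_ident_at, of "(t, x)" UNIV] tendsto_snd[OF tendsto_ident_at, of "(t, x)" UNIV] True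
  by (intro T_tendsto eventually_mono[OF ev]) auto
 moreover have "\<forall>\<^sub>F z in at (t, x). T (fst z) (snd z) = Tp (fst z) (snd z)"
  using ev by eventually_elim (simp add: Tp_nonneg)
 ultimately have "((\<lambda>z. Tp (fst z) (snd z)) \<longlongrightarrow> T t x) (at (t, x))"
  by (rule Lim_transform_eventually)
 then show ?thesis using True by (simp add: isCont_def Tp_nonneg)
next
 case False
 assume "t \<noteq> 0"
 with False have "t < 0" by simp
 have ev: "\<forall>\<^sub>F z in at (t, x). fst z < 0"
  using order_tendstoD(2)[OF tendsto_fst[OF tendsto_ident_at, of "(t, x)" UNIV], of 0] \<open>t < 0\<close> by simp
 have "\<forall>\<^sub>F z in at (t, x). 0 = Tp (fst z) (snd z)"
  using ev by eventually_elim (simp add: Tp_neg)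
 then have "((\<lambda>z. Tp (fst z) (snd z)) \<longlongrightarrow> 0) (at (t, x))"
  by (rule Lim_transform_eventually[OF tendsto_const])
 then show ?thesis using \<open>t < 0\<close> by (simp add: isCont_def Tp_neg)
qed

lemma smeas_Tp:
 assumes "smeas u" "smeas f" "AE t in lebesgue. u t \<noteq> 0"
 shows "smeas (\<lambda>t. Tp (u t) (f t))"
 by (rule smeas_compose2[OF assms(1,2)]) (use assms(3) Tp_isCont in \<open>auto elim: eventually_mono\<close>)

lemma AE_neq: "AE t in lebesgue. t \<noteq> (c :: real)"
 by (rule AE_I'[of "{c}"]) auto

lemma smeas_id: "smeas (\<lambda>t::real. t)"
 by (rule smeas_isCont) simp

lemma smeas_orbit: "smeas (\<lambda>t. Tp t x)"
 by (rule smeas_Tp[OF smeas_id smeas_const AE_neq])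

lemma Tp_borel:
 fixes l :: "'x \<Rightarrow> complex"
 assumes l: "bounded_clinear_on UNIV l"
 shows "(\<lambda>t. l (Tp t x)) \<in> borel_measurable borel"
proof -
 have "continuous_on {0..} (\<lambda>t. l (T t x))"
  by (rule bounded_linear.continuous_on[OF bcl_bounded_linear[OF l] T_continuous_on])
 then have "(\<lambda>t. indicator {0..} t *\<^sub>R l (T t x)) \<in> borel_measurable borel"
  by (intro borel_measurable_continuous_on_indicator) auto
 then show ?thesis by (simp add: Tp_def bcl_scaleR[OF l])
qed

definition lap :: "complex \<Rightarrow> 'x \<Rightarrow> 'x" where
 "lap z x = Bochner (\<lambda>t. exp (- z * of_real t) *\<^sub>C Tp t x)"

lemma T_Tp: "0 \<le> h \<Longrightarrow> T h (Tp t x) = indicator {0..} t *\<^sub>R Tp (t + h) x"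
 by (auto simp: Tp_def indicator_def bcl_zero[OF T_bcl] T_add add.commute[of t])

lemma smeas_lap: "smeas (\<lambda>t. exp (- z * of_real t) *\<^sub>C Tp t x)"
 by (intro smeas_scaleC smeas_orbit smeas_isCont) auto

lemma lap_T:
 assumes b: "bint (\<lambda>t. exp (- z * of_real t) *\<^sub>C Tp t x)" and h: "0 \<le> h"
 shows "T h (lap z x) = exp (z * of_real h) *\<^sub>C
  (lap z x - Bochner (\<lambda>t. indicator {0..<h} t *\<^sub>R (exp (- z * of_real t) *\<^sub>C Tp t x)))"
proof (rule functional_ext)
 fix l :: "'x \<Rightarrow> complex" assume l: "bounded_clinear_on UNIV l"
 let ?F = "\<lambda>t. exp (- z * of_real t) *\<^sub>C Tp t x"
 let ?f = "\<lambda>t. exp (- z * of_real t) * l (Tp t x)"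
 have lF: "l (?F t) = ?f t" for t by (simp add: bcl_mult[OF l])
 have m: "?f \<in> borel_measurable borel" using Tp_borel[OF l] by measurable
 have i: "integrable lborel ?f"
  using functional_Bochner(1)[OF b l] lebesgue_lborel(2)[OF m] unfolding lF by blast
 have bi: "bint (\<lambda>t. indicator {0..<h} t *\<^sub>R ?F t)"
 proof (rule bintI[OF _ bint_norm_integrable[OF b]])
  have "smeas (indicator {0..<h} :: real \<Rightarrow> real)" by (rule smeas_indicator) simp
  then show "smeas (\<lambda>t. indicator {0..<h} t *\<^sub>R ?F t)" by (rule smeas_scaleR[OF _ smeas_lap])
 qed (auto simp: indicator_def)
 have "(\<lambda>t. ?f (h + 1 * t)) \<in> borel_measurable borel"
  by (rule measurable_compose[OF _ m]) simp
 then have m': "(\<lambda>t. indicator {h..} (h + 1 * t) *\<^sub>R ?f (h + 1 * t)) \<in> borel_measurable borel"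
  by (intro borel_measurable_scaleR) (auto intro!: measurable_compose[OF _ borel_measurable_indicator])
 have mi: "(\<lambda>t. indicator {0..<h} t *\<^sub>R ?f t) \<in> borel_measurable borel"
  by (intro borel_measurable_scaleR m) auto
 have i2: "integrable lborel (\<lambda>t. indicator {0..<h} t *\<^sub>R ?f t)"
  using i by (rule integrable_mult_indicator[rotated]) simp
 have lT: "bounded_clinear_on UNIV (\<lambda>y. l (T h y))" by (rule bcl_compose[OF l T_bcl[OF h]])
 have "l (T h (lap z x)) = (\<integral>t. l (T h (?F t)) \<partial>lebesgue)"
  unfolding lap_def by (rule functional_Bochner(2)[OF b lT])
 also have "\<dots> = (\<integral>t. exp (z * of_real h) * (indicator {h..} (h + 1 * t) *\<^sub>R ?f (h + 1 * t)) \<partial>lebesgue)"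
 proof (rule integral_eqI[OF refl])
  fix t
  have "exp (- z * of_real t) = exp (z * of_real h) * exp (- z * of_real (h + t))"
   by (simp add: exp_add[symmetric] algebra_simps)
  moreover have "(indicator {0..} t :: real) = indicator {h..} (h + 1 * t)" by (simp add: indicator_def)
  ultimately show "l (T h (?F t)) = exp (z * of_real h) * (indicator {h..} (h + 1 * t) *\<^sub>R ?f (h + 1 * t))"
   unfolding bcl_scaleC[OF T_bcl[OF h]] bcl_mult[OF l] T_Tp[OF h] bcl_scaleR[OF l]
   by (simp add: add.commute[of t h])
 qed
 also have "\<dots> = exp (z * of_real h) * (LBINT t. indicator {h..} (h + 1 * t) *\<^sub>R ?f (h + 1 * t))"
  by (simp only: integral_mult_right_zero lebesgue_lborel(1)[OF m'])
 also have "(LBINT t. indicator {h..} (h + 1 * t) *\<^sub>R ?f (h + 1 * t)) = (LBINT t. indicator {h..} t *\<^sub>R ?f t)"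
  using lborel_integral_real_affine[of 1 "\<lambda>t. indicator {h..} t *\<^sub>R ?f t" h] by (simp only: abs_one scaleR_one not_False_eq_True one_neq_zero)
 also have "\<dots> = (LBINT t. ?f t - indicator {0..<h} t *\<^sub>R ?f t)"
  by (rule integral_eqI[OF refl])
    (use h in \<open>auto simp: indicator_def Tp_neg bcl_zero[OF l]\<close>)
 also have "\<dots> = (LBINT t. ?f t) - (LBINT t. indicator {0..<h} t *\<^sub>R ?f t)"
  by (rule Bochner_Integration.integral_diff[OF i i2])
 also have "(LBINT t. ?f t) = l (lap z x)"
  by (simp only: lap_def functional_Bochner(2)[OF b l] lF lebesgue_lborel(1)[OF m])
 also have "(LBINT t. indicator {0..<h} t *\<^sub>R ?f t) = l (Bochner (\<lambda>t. indicator {0..<h} t *\<^sub>R ?F t))"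
  by (simp only: functional_Bochner(2)[OF bi l] bcl_scaleR[OF l] lF lebesgue_lborel(1)[OF mi])
 finally show "l (T h (lap z x)) = l (exp (z * of_real h) *\<^sub>C (lap z x - Bochner (\<lambda>t. indicator {0..<h} t *\<^sub>R ?F t)))"
  by (simp add: bcl_mult[OF l] bcl_diff[OF l])
qed

lemma initial_average:
 assumes b: "bint (\<lambda>t. exp (- z * of_real t) *\<^sub>C Tp t x)"
 shows "((\<lambda>h. (1 / h) *\<^sub>R Bochner (\<lambda>t. indicator {0..<h} t *\<^sub>R (exp (- z * of_real t) *\<^sub>C Tp t x))) \<longlongrightarrow> x) (at_right 0)"
proof (rule tendstoI)
 fix e :: real assume e: "0 < e"
 let ?F = "\<lambda>t. exp (- z * of_real t) *\<^sub>C Tp t x"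
 have "((\<lambda>t. exp (- z * of_real t) *\<^sub>C T t x) \<longlongrightarrow> exp (- z * of_real 0) *\<^sub>C T 0 x) (at 0 within {0..})"
  by (intro tendsto_scaleC tendsto_intros continuous_on_tendsto_compose[OF T_continuous_on])
    (auto simp: eventually_at_filter)
 from tendstoD[OF this, of "e / 2"] e obtain d where d: "0 < d"
  "\<And>t. 0 \<le> t \<Longrightarrow> t \<noteq> 0 \<Longrightarrow> t < d \<Longrightarrow> dist (exp (- z * of_real t) *\<^sub>C T t x) x < e / 2"
  by (auto simp: eventually_at T_zero dist_real_def)
 have near: "norm (?F t - x) \<le> e / 2" if "0 \<le> t" "t < d" for t
  using d(2)[of t] that e by (cases "t = 0") (auto simp: T_zero Tp_nonneg dist_norm)
 have "dist ((1 / h) *\<^sub>R Bochner (\<lambda>t. indicator {0..<h} t *\<^sub>R ?F t)) x < e" if h: "0 < h" "h < d" for h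
 proof -
  have si: "smeas (indicator {0..<h} :: real \<Rightarrow> real)" by (rule smeas_indicator) simp
  have ii: "integrable lebesgue (\<lambda>t. indicator {0..<h} t * c)" for c :: real
  proof -
   have "integrable lborel (indicator {0..<h} :: real \<Rightarrow> real)"
    by (rule integrable_real_indicator) (use h in auto)
   then have "integrable lborel (\<lambda>t. indicator {0..<h} t * c)" by (rule integrable_mult_left)
   then show ?thesis by (subst lebesgue_lborel(2)) auto
  qed
  have b1: "bint (\<lambda>t. indicator {0..<h} t *\<^sub>R ?F t)"
   by (rule bintI[OF smeas_scaleR[OF si smeas_lap] bint_norm_integrable[OF b]]) (auto simp: indicator_def)
  have b2: "bint (\<lambda>t. indicator {0..<h} t *\<^sub>R x)"
   by (rule bintI[OF smeas_scaleR[OF si smeas_const] ii[of "norm x"]]) auto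
  have Bx: "Bochner (\<lambda>t. indicator {0..<h} t *\<^sub>R x) = h *\<^sub>R x"
  proof (rule Bochner_eqI[OF b2])
   fix l :: "'x \<Rightarrow> complex" assume l: "bounded_clinear_on UNIV l"
   have "(\<integral>t. indicator {0..<h} t *\<^sub>R l x \<partial>lebesgue) = h *\<^sub>R l x"
    using h by (subst lebesgue_lborel(1)) auto
   then show "(\<integral>t. l (indicator {0..<h} t *\<^sub>R x) \<partial>lebesgue) = l (h *\<^sub>R x)"
    by (simp add: bcl_scaleR[OF l])
  qed
  have "norm (Bochner (\<lambda>t. indicator {0..<h} t *\<^sub>R ?F t) - h *\<^sub>R x) =
    norm (Bochner (\<lambda>t. indicator {0..<h} t *\<^sub>R ?F t - indicator {0..<h} t *\<^sub>R x))"
   by (simp only: Bochner_diff[OF b1 b2] Bx)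
  also have "\<dots> \<le> (\<integral>t. norm (indicator {0..<h} t *\<^sub>R ?F t - indicator {0..<h} t *\<^sub>R x) \<partial>lebesgue)"
   by (rule Bochner_norm_le[OF bint_diff[OF b1 b2]])
  also have "\<dots> \<le> (\<integral>t. indicator {0..<h} t * (e / 2) \<partial>lebesgue)"
   by (intro integral_mono bint_norm_integrable bint_diff b1 b2 ii)
     (use near h in \<open>auto simp: indicator_def\<close>)
  also have "\<dots> = h * (e / 2)" using h by (subst lebesgue_lborel(1)) auto
  finally have *: "norm (Bochner (\<lambda>t. indicator {0..<h} t *\<^sub>R ?F t) - h *\<^sub>R x) \<le> h * (e / 2)" .
  have "(1 / h) *\<^sub>R Bochner (\<lambda>t. indicator {0..<h} t *\<^sub>R ?F t) - x =
    (1 / h) *\<^sub>R (Bochner (\<lambda>t. indicator {0..<h} t *\<^sub>R ?F t) - h *\<^sub>R x)"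
   using h by (simp add: scaleR_diff_right)
  then have "norm ((1 / h) *\<^sub>R Bochner (\<lambda>t. indicator {0..<h} t *\<^sub>R ?F t) - x) =
    (1 / h) * norm (Bochner (\<lambda>t. indicator {0..<h} t *\<^sub>R ?F t) - h *\<^sub>R x)"
   using h by simp
  also have "\<dots> \<le> (1 / h) * (h * (e / 2))" by (rule mult_left_mono[OF *]) (use h in simp)
  also have "\<dots> < e" using h e by simp
  finally show ?thesis by (simp add: dist_norm)
 qed
 then show "\<forall>\<^sub>F h in at_right 0. dist ((1 / h) *\<^sub>R Bochner (\<lambda>t. indicator {0..<h} t *\<^sub>R ?F t)) x < e"
  using d(1) by (auto simp: eventually_at_right_field)
qed

lemma lap_difference_quotient:
 assumes b: "bint (\<lambda>t. exp (- z * of_real t) *\<^sub>C Tp t x)"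
 shows "((\<lambda>h. (1 / h) *\<^sub>R (T h (lap z x) - lap z x)) \<longlongrightarrow> z *\<^sub>C lap z x - x) (at_right 0)"
proof -
 let ?Z = "\<lambda>h. (1 / h) *\<^sub>R Bochner (\<lambda>t. indicator {0..<h} t *\<^sub>R (exp (- z * of_real t) *\<^sub>C Tp t x))"
 let ?q = "\<lambda>h. (exp (z * of_real h) - 1) / of_real h"
 have e: "((\<lambda>h. exp (z * of_real h)) \<longlongrightarrow> exp (z * of_real 0)) (at_right (0::real))"
  by (intro tendsto_intros)
 have "((\<lambda>u. exp (z * u)) has_field_derivative z) (at 0)"
  by (auto intro!: derivative_eq_intros)
 then have "((\<lambda>u. (exp (z * u) - 1) / u) \<longlongrightarrow> z) (at 0)" using DERIV_D by fastforce
 moreover have "filterlim (complex_of_real) (at 0) (at_right 0)"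
  by (auto simp: filterlim_at eventually_at_filter intro!: tendsto_eq_intros)
 ultimately have q: "(?q \<longlongrightarrow> z) (at_right (0::real))" by (rule filterlim_compose)
 have "((\<lambda>h. ?q h *\<^sub>C lap z x - exp (z * of_real h) *\<^sub>C ?Z h) \<longlongrightarrow> z *\<^sub>C lap z x - exp (z * of_real 0) *\<^sub>C x) (at_right 0)"
  by (intro tendsto_diff tendsto_scaleC q e initial_average[OF b] tendsto_const)
 moreover have "\<forall>\<^sub>F h in at_right (0::real). ?q h *\<^sub>C lap z x - exp (z * of_real h) *\<^sub>C ?Z h = (1 / h) *\<^sub>R (T h (lap z x) - lap z x)"
  unfolding eventually_at_right_field
 proof (intro exI[of _ 1] conjI allI impI)
  fix h :: real assume h: "0 < h" "h < 1"
  let ?B = "Bochner (\<lambda>t. indicator {0..<h} t *\<^sub>R (exp (- z * of_real t) *\<^sub>C Tp t x))"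
  have "(1 / h) *\<^sub>R (T h (lap z x) - lap z x) = of_real (1 / h) *\<^sub>C (exp (z * of_real h) *\<^sub>C lap z x - exp (z * of_real h) *\<^sub>C ?B - 1 *\<^sub>C lap z x)"
   using lap_T[OF b, of h] h by (simp add: scaleR_scaleC scaleC_diff_right)
  also have "\<dots> = of_real (1 / h) *\<^sub>C ((exp (z * of_real h) - 1) *\<^sub>C lap z x) - of_real (1 / h) *\<^sub>C (exp (z * of_real h) *\<^sub>C ?B)"
   by (simp add: scaleC_diff_right scaleC_diff_left)
  also have "\<dots> = ?q h *\<^sub>C lap z x - exp (z * of_real h) *\<^sub>C ?Z h"
   by (simp add: scaleR_scaleC scaleC_scaleC mult.commute)
  finally show "?q h *\<^sub>C lap z x - exp (z * of_real h) *\<^sub>C ?Z h = (1 / h) *\<^sub>R (T h (lap z x) - lap z x)" by simp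
 qed simp
 ultimately show ?thesis by (simp add: Lim_transform_eventually)
qed

lemma in_domainI:
 assumes "((\<lambda>t. (1 / t) *\<^sub>R (T t x - x)) \<longlongrightarrow> y) (at_right 0)"
 shows "x \<in> D" "A x = - y"
proof -
 show D: "x \<in> D" using generator assms unfolding is_generator_def by blast
 then have "((\<lambda>t. (1 / t) *\<^sub>R (T t x - x)) \<longlongrightarrow> - A x) (at_right 0)"
  using generator unfolding is_generator_def by blast
 from tendsto_unique[OF _ this assms] show "A x = - y" by (simp add: eq_neg_iff_add_eq_0 minus_equation_iff)
qed

lemma domainD: "x \<in> D \<Longrightarrow> ((\<lambda>t. (1 / t) *\<^sub>R (T t x - x)) \<longlongrightarrow> - A x) (at_right 0)"
 using generator unfolding is_generator_def by blast

text \<open>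
 Convergence of the integral for this one \<open>x\<close> suffices, also to the left of the abscissa where
 it converges for all \<open>x\<close>.
\<close>
lemma lap_solves:
 assumes "bint (\<lambda>t. exp (- z * of_real t) *\<^sub>C Tp t x)"
 shows "lap z x \<in> D" "z *\<^sub>C lap z x + A (lap z x) = x"
 using in_domainI[OF lap_difference_quotient[OF assms]] by auto

text \<open>
 The condition that \<open>- z\<close> is in the resolvent set of \<open>A\<close>, phrased for
 \<open>z + A\<close>.
\<close>
definition regular :: "complex \<Rightarrow> bool" where
 "regular z \<longleftrightarrow> bij_betw (\<lambda>x. z *\<^sub>C x + A x) D UNIV \<and> bounded_clinear_on UNIV (R z)"

lemma regular_bcl: "regular z \<Longrightarrow> bounded_clinear_on UNIV (R z)"
 by (simp add: regular_def)

lemma regular_R: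
 assumes "regular z"
 shows "R z x \<in> D" "z *\<^sub>C R z x + A (R z x) = x"
proof -
 have b: "bij_betw (\<lambda>x. z *\<^sub>C x + A x) D UNIV" using assms by (simp add: regular_def)
 show "R z x \<in> D" unfolding shift_inverse_def
  by (rule inv_into_into) (use b in \<open>simp add: bij_betw_def\<close>)
 show "z *\<^sub>C R z x + A (R z x) = x" unfolding shift_inverse_def
  using bij_betw_inv_into_right[OF b, of x] by simp
qed

lemma regular_unique:
 assumes "regular z" "y \<in> D" "z *\<^sub>C y + A y = x"
 shows "R z x = y"
 using bij_betw_inv_into_left[of "\<lambda>x. z *\<^sub>C x + A x" D UNIV y] assms
 by (simp add: regular_def shift_inverse_def)

lemma regularI:
 assumes F: "bounded_clinear_on UNIV F" and D: "\<And>x. F x \<in> D"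
  and r: "\<And>x. z *\<^sub>C F x + A (F x) = x" and l: "\<And>y. y \<in> D \<Longrightarrow> F (z *\<^sub>C y + A y) = y"
 shows "regular z" "R z = F"
proof -
 have b: "bij_betw (\<lambda>x. z *\<^sub>C x + A x) D UNIV"
  by (rule bij_betwI[where g=F]) (use D r l in auto)
 show RF: "R z = F"
 proof
  fix x
  have "inv_into D (\<lambda>x. z *\<^sub>C x + A x) (z *\<^sub>C F x + A (F x)) = F x"
   using bij_betw_inv_into_left[OF b D] by simp
  then show "R z x = F x" by (simp add: shift_inverse_def r)
 qed
 show "regular z" using b F RF by (simp add: regular_def)
qed

lemma regular_resolvent_set:
 assumes "- z \<in> resolvent_set D A"
 shows "regular z"
proof -
 define g where "g x = (- z) *\<^sub>C x - A x" for x
 have b: "bij_betw g D UNIV" and c: "bounded_clinear_on UNIV (inv_into D g)"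
  using assms by (auto simp: resolvent_set_def g_def[abs_def])
 have n: "bounded_clinear_on UNIV (\<lambda>x::'x. - x)"
  using bcl_scaleC_const[of "- 1"] by (simp add: scaleC_minus_left)
 have gz: "z *\<^sub>C x + A x = - g x" for x by (simp add: g_def scaleC_minus_left)
 show ?thesis
 proof (rule regularI(1)[OF bcl_compose[OF c n]])
  show "inv_into D g (- x) \<in> D" for x
   by (rule inv_into_into) (use b in \<open>simp add: bij_betw_def\<close>)
  show "z *\<^sub>C inv_into D g (- x) + A (inv_into D g (- x)) = x" for x
   unfolding gz using bij_betw_inv_into_right[OF b, of "- x"] by simp
  show "inv_into D g (- (z *\<^sub>C y + A y)) = y" if "y \<in> D" for y
   unfolding gz using bij_betw_inv_into_left[OF b that] by simp
 qed
qed

lemma lap_bint: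
 assumes z: "w < Re z"
 shows "bint (\<lambda>t. exp (- z * of_real t) *\<^sub>C Tp t x)"
proof (rule bintI[OF smeas_lap])
 have "integrable lborel (\<lambda>t::real. (indicator {0..} t * exp (- (Re z - w) * t)) * (M * norm x))"
  by (rule integrable_mult_left[OF exp_kernel_integrable]) (use z in simp)
 then show "integrable lebesgue (\<lambda>t::real. (indicator {0..} t * exp (- (Re z - w) * t)) * (M * norm x))"
  by (subst lebesgue_lborel(2)) auto
 show "AE t in lebesgue. norm (exp (- z * of_real t) *\<^sub>C Tp t x) \<le> (indicator {0..} t * exp (- (Re z - w) * t)) * (M * norm x)"
 proof (rule AE_I2)
  fix t :: real
  have "norm (exp (- z * of_real t) *\<^sub>C Tp t x) = exp (- Re z * t) * norm (Tp t x)"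
   by (simp add: norm_scaleC)
  also have "\<dots> \<le> exp (- Re z * t) * (indicator {0..} t * (M * exp (w * t) * norm x))"
   by (rule mult_left_mono[OF Tp_norm_le]) simp
  also have "\<dots> = (indicator {0..} t * (exp (- Re z * t) * exp (w * t))) * (M * norm x)" by simp
  also have "exp (- Re z * t) * exp (w * t) = exp (- (Re z - w) * t)"
   by (simp add: exp_add[symmetric] algebra_simps)
  finally show "norm (exp (- z * of_real t) *\<^sub>C Tp t x) \<le> (indicator {0..} t * exp (- (Re z - w) * t)) * (M * norm x)" .
 qed
qed

lemma lap_norm_le:
 assumes z: "w < Re z"
 shows "norm (lap z x) \<le> (LBINT t. indicator {0..} t * exp (- (Re z - w) * t)) * M * norm x"
proof -
 let ?k = "\<lambda>t::real. indicator {0..} t * exp (- (Re z - w) * t)"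
 have i: "integrable lborel (\<lambda>t::real. ?k t * (M * norm x))"
  by (rule integrable_mult_left[OF exp_kernel_integrable]) (use z in simp)
 have m: "(\<lambda>t::real. ?k t * (M * norm x)) \<in> borel_measurable borel" by measurable
 have "norm (lap z x) \<le> (\<integral>t. norm (exp (- z * of_real t) *\<^sub>C Tp t x) \<partial>lebesgue)"
  unfolding lap_def by (rule Bochner_norm_le[OF lap_bint[OF z]])
 also have "\<dots> \<le> (\<integral>t. ?k t * (M * norm x) \<partial>lebesgue)"
 proof (rule integral_mono[OF bint_norm_integrable[OF lap_bint[OF z]]])
  show "integrable lebesgue (\<lambda>t::real. ?k t * (M * norm x))" using i lebesgue_lborel(2)[OF m] by blast
  fix t :: real
  have "norm (exp (- z * of_real t) *\<^sub>C Tp t x) = exp (- Re z * t) * norm (Tp t x)"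
   by (simp add: norm_scaleC)
  also have "\<dots> \<le> exp (- Re z * t) * (indicator {0..} t * (M * exp (w * t) * norm x))"
   by (rule mult_left_mono[OF Tp_norm_le]) simp
  also have "\<dots> = (indicator {0..} t * (exp (- Re z * t) * exp (w * t))) * (M * norm x)" by simp
  also have "exp (- Re z * t) * exp (w * t) = exp (- (Re z - w) * t)"
   by (simp add: exp_add[symmetric] algebra_simps)
  finally show "norm (exp (- z * of_real t) *\<^sub>C Tp t x) \<le> ?k t * (M * norm x)" .
 qed
 also have "\<dots> = (LBINT t. ?k t) * (M * norm x)"
  unfolding lebesgue_lborel(1)[OF m] by (rule integral_mult_left_zero)
 finally show ?thesis by (simp add: mult.assoc)
qed

lemma lap_bcl:
 assumes z: "w < Re z"
 shows "bounded_clinear_on UNIV (lap z)"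
 unfolding bounded_clinear_on_def
proof (intro conjI ballI allI)
 fix x y c
 show "lap z (x + y) = lap z x + lap z y"
  unfolding lap_def bcl_add[OF Tp_bcl] scaleC_add_right by (rule Bochner_add[OF lap_bint[OF z] lap_bint[OF z]])
 have "lap z (c *\<^sub>C x) = Bochner (\<lambda>t. c *\<^sub>C (exp (- z * of_real t) *\<^sub>C Tp t x))"
  unfolding lap_def bcl_scaleC[OF Tp_bcl] by (simp only: scaleC_scaleC mult.commute)
 also have "\<dots> = c *\<^sub>C lap z x" unfolding lap_def by (rule Bochner_scaleC[OF lap_bint[OF z]])
 finally show "lap z (c *\<^sub>C x) = c *\<^sub>C lap z x" .
 show "\<exists>C. \<forall>x\<in>UNIV. norm (lap z x) \<le> C * norm x" using lap_norm_le[OF z] by blast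
qed

lemma T_Tp_commute: "0 \<le> h \<Longrightarrow> T h (Tp t x) = Tp t (T h x)"
 by (auto simp: Tp_def indicator_def bcl_zero[OF T_bcl] T_add[symmetric] add.commute)

lemma T_lap:
 assumes z: "w < Re z" and h: "0 \<le> h"
 shows "T h (lap z x) = lap z (T h x)"
 unfolding lap_def Bochner_bcl[OF T_bcl[OF h] lap_bint[OF z], symmetric] bcl_scaleC[OF T_bcl[OF h]]
  T_Tp_commute[OF h] ..

text \<open>
 The difference quotients of the orbit of \<open>lap z y\<close> converge for every \<open>y\<close>; for \<open>y\<close> in the domain
 they are also the images under \<open>lap z\<close> of those of the orbit of \<open>y\<close>. Comparing the limits gives
 the left inverse.
\<close>
lemma lap_left_inverse:
 assumes z: "w < Re z" and y: "y \<in> D"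
 shows "lap z (z *\<^sub>C y + A y) = y"
proof -
 have "((\<lambda>h. lap z ((1 / h) *\<^sub>R (T h y - y))) \<longlongrightarrow> lap z (- A y)) (at_right 0)"
  by (rule bcl_tendsto[OF lap_bcl[OF z] domainD[OF y]])
 moreover have "\<forall>\<^sub>F h in at_right (0::real). lap z ((1 / h) *\<^sub>R (T h y - y)) = (1 / h) *\<^sub>R (T h (lap z y) - lap z y)"
  unfolding eventually_at_right_field
  by (intro exI[of _ 1]) (simp add: bcl_scaleR[OF lap_bcl[OF z]] bcl_diff[OF lap_bcl[OF z]] T_lap[OF z])
 ultimately have "((\<lambda>h. (1 / h) *\<^sub>R (T h (lap z y) - lap z y)) \<longlongrightarrow> lap z (- A y)) (at_right 0)"
  by (rule Lim_transform_eventually)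
 from tendsto_unique[OF _ this lap_difference_quotient[OF lap_bint[OF z]]]
 have eq: "lap z (- A y) = z *\<^sub>C lap z y - y" by simp
 have "lap z (z *\<^sub>C y + A y) = lap z (z *\<^sub>C y - (- A y))" by simp
 also have "\<dots> = z *\<^sub>C lap z y - lap z (- A y)"
  by (simp only: bcl_diff[OF lap_bcl[OF z]] bcl_scaleC[OF lap_bcl[OF z]])
 also have "\<dots> = y" by (simp add: eq)
 finally show ?thesis .
qed

lemma regular_lap:
 assumes "w < Re z"
 shows "regular z" "R z = lap z"
 using regularI[OF lap_bcl[OF assms] lap_solves(1)[OF lap_bint[OF assms]] lap_solves(2)[OF lap_bint[OF assms]]
   lap_left_inverse[OF assms]] by auto

lemma R_eq_lap:
 assumes "regular z" "bint (\<lambda>t. exp (- z * of_real t) *\<^sub>C Tp t x)"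
 shows "R z x = lap z x"
 using lap_solves[OF assms(2)] by (intro regular_unique[OF assms(1)])

lemma T_domain:
 assumes y: "y \<in> D" and t: "0 \<le> t"
 shows "T t y \<in> D" "A (T t y) = T t (A y)"
proof -
 have "((\<lambda>h. T t ((1 / h) *\<^sub>R (T h y - y))) \<longlongrightarrow> T t (- A y)) (at_right 0)"
  by (rule bcl_tendsto[OF T_bcl[OF t] domainD[OF y]])
 moreover have "\<forall>\<^sub>F h in at_right (0::real). T t ((1 / h) *\<^sub>R (T h y - y)) = (1 / h) *\<^sub>R (T h (T t y) - T t y)"
  unfolding eventually_at_right_field
  by (intro exI[of _ 1]) (simp add: bcl_scaleR[OF T_bcl[OF t]] bcl_diff[OF T_bcl[OF t]] T_add[symmetric] t add.commute)
 ultimately have "((\<lambda>h. (1 / h) *\<^sub>R (T h (T t y) - T t y)) \<longlongrightarrow> T t (- A y)) (at_right 0)"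
  by (rule Lim_transform_eventually)
 from in_domainI[OF this] show "T t y \<in> D" "A (T t y) = T t (A y)"
  using bcl_diff[OF T_bcl[OF t], of 0 "A y"] bcl_zero[OF T_bcl[OF t]] by auto
qed

lemma resolvent_identity:
 assumes z: "regular z" and u: "regular u"
 shows "R z x = R u x + (u - z) *\<^sub>C R u (R z x)"
proof -
 have "u *\<^sub>C R z x + A (R z x) = (z *\<^sub>C R z x + A (R z x)) + (u - z) *\<^sub>C R z x"
  by (simp add: scaleC_diff_left)
 also have "\<dots> = x + (u - z) *\<^sub>C R z x" by (simp add: regular_R(2)[OF z])
 finally have "R u (x + (u - z) *\<^sub>C R z x) = R z x"
  by (intro regular_unique[OF u] regular_R(1)[OF z])
 then show ?thesis by (simp add: bcl_add[OF regular_bcl[OF u]] bcl_scaleC[OF regular_bcl[OF u]])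
qed

text \<open>
 In the resolvent identity the term with the factor \<open>u - z\<close> is absorbed when
 \<open>z\<close> is close to \<open>u\<close>.
\<close>
lemma R_locally_bounded:
 assumes u: "regular u"
 shows "\<exists>d>0. \<exists>K\<ge>0. \<forall>z x. regular z \<longrightarrow> cmod (z - u) < d \<longrightarrow> norm (R z x) \<le> K * norm x"
proof -
 obtain C where C: "0 \<le> C" "\<forall>x. norm (R u x) \<le> C * norm x" by (rule bcl_bound[OF regular_bcl[OF u]])
 define d where "d = 1 / (2 * C + 1)"
 have d: "0 < d" "d * C \<le> 1 / 2" using C(1) by (auto simp: d_def field_simps)
 have "norm (R z x) \<le> (2 * C) * norm x" if z: "regular z" and zd: "cmod (z - u) < d" for z x
 proof -
  have "norm (R z x) \<le> norm (R u x) + norm ((u - z) *\<^sub>C R u (R z x))"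
   by (subst resolvent_identity[OF z u]) (rule norm_triangle_ineq)
  also have "\<dots> \<le> C * norm x + d * (C * norm (R z x))"
   unfolding norm_scaleC using C zd
   by (intro add_mono mult_mono) (auto simp: norm_minus_commute less_imp_le[OF d(1)])
  also have "\<dots> \<le> C * norm x + (1 / 2) * norm (R z x)"
   using mult_right_mono[OF d(2), of "norm (R z x)"] by (simp add: mult.assoc)
  finally show ?thesis by simp
 qed
 then show ?thesis using d(1) C(1) by (intro exI[of _ d] exI[of _ "2 * C"] conjI) auto
qed

lemma R_tendsto:
 assumes u: "regular u" and f: "(f \<longlongrightarrow> u) F" and g: "(g \<longlongrightarrow> x) F" and r: "\<forall>\<^sub>F i in F. regular (f i)"
 shows "((\<lambda>i. R (f i) (g i)) \<longlongrightarrow> R u x) F"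
proof -
 obtain d K where d: "0 < d" "0 \<le> K" and
  K: "\<And>z x. regular z \<Longrightarrow> cmod (z - u) < d \<Longrightarrow> norm (R z x) \<le> K * norm x"
  using R_locally_bounded[OF u] by metis
 have ev: "\<forall>\<^sub>F i in F. regular (f i) \<and> cmod (f i - u) < d"
  using r tendstoD[OF f d(1)] by eventually_elim (simp add: dist_norm)
 have "((\<lambda>i. (u - f i) *\<^sub>C R u (R (f i) (g i))) \<longlongrightarrow> 0) F"
 proof -
  obtain C where C: "0 \<le> C" "\<forall>x. norm (R u x) \<le> C * norm x" by (rule bcl_bound[OF regular_bcl[OF u]])
  show ?thesis
  proof (rule Lim_null_comparison)
   show "\<forall>\<^sub>F i in F. norm ((u - f i) *\<^sub>C R u (R (f i) (g i))) \<le> cmod (u - f i) * (C * (K * norm (g i)))"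
    using ev
   proof eventually_elim
    case (elim i)
    have "norm (R u (R (f i) (g i))) \<le> C * norm (R (f i) (g i))" using C by blast
    also have "\<dots> \<le> C * (K * norm (g i))" by (rule mult_left_mono[OF K C(1)]) (use elim in auto)
    finally show ?case by (simp add: norm_scaleC mult_left_mono)
   qed
   have "((\<lambda>i. cmod (u - f i) * (C * (K * norm (g i)))) \<longlongrightarrow> cmod (u - u) * (C * (K * norm x))) F"
    by (intro tendsto_intros f g)
   then show "((\<lambda>i. cmod (u - f i) * (C * (K * norm (g i)))) \<longlongrightarrow> 0) F" by simp
  qed
 qed
 from tendsto_add[OF bcl_tendsto[OF regular_bcl[OF u] g] this]
 have "((\<lambda>i. R u (g i) + (u - f i) *\<^sub>C R u (R (f i) (g i))) \<longlongrightarrow> R u x) F" by simp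
 moreover have "\<forall>\<^sub>F i in F. R u (g i) + (u - f i) *\<^sub>C R u (R (f i) (g i)) = R (f i) (g i)"
  using ev by eventually_elim (metis resolvent_identity u)
 ultimately show ?thesis by (rule Lim_transform_eventually)
qed

lemma R_holomorphic:
 fixes l :: "'x \<Rightarrow> complex"
 assumes U: "open U" "\<And>z. z \<in> U \<Longrightarrow> regular z" and l: "bounded_clinear_on UNIV l"
 shows "(\<lambda>z. l (R z x)) holomorphic_on U"
proof (rule holomorphic_onI)
 fix u assume u: "u \<in> U"
 note ru = U(2)[OF u]
 have ev: "\<forall>\<^sub>F z in at u. z \<in> U" using U(1) u by (rule eventually_at_in_open')
 have "((\<lambda>z. R z x) \<longlongrightarrow> R u x) (at u)"
  by (rule R_tendsto[OF ru tendsto_ident_at tendsto_const]) (use ev U(2) in \<open>auto elim: eventually_mono\<close>)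
 then have "((\<lambda>z. - l (R u (R z x))) \<longlongrightarrow> - l (R u (R u x))) (at u)"
  by (intro tendsto_minus bcl_tendsto[OF l] bcl_tendsto[OF regular_bcl[OF ru]])
 moreover have "\<forall>\<^sub>F z in at u. - l (R u (R z x)) = (l (R z x) - l (R u x)) / (z - u)"
  using ev eventually_neq_at_within[of u u UNIV]
 proof eventually_elim
  case (elim z)
  have "l (R z x) = l (R u x) + (u - z) * l (R u (R z x))"
   by (subst resolvent_identity[OF U(2)[OF elim(1)] ru]) (simp add: bcl_add[OF l] bcl_mult[OF l])
  then have "l (R z x) - l (R u x) = - l (R u (R z x)) * (z - u)" by (simp add: algebra_simps)
  with elim(2) show ?case by simp
 qed
 ultimately have "((\<lambda>z. (l (R z x) - l (R u x)) / (z - u)) \<longlongrightarrow> - l (R u (R u x))) (at u)"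
  by (rule Lim_transform_eventually)
 then have "((\<lambda>z. l (R z x)) has_field_derivative - l (R u (R u x))) (at u)"
  by (simp add: has_field_derivative_iff)
 then show "(\<lambda>z. l (R z x)) field_differentiable at u within U"
  unfolding field_differentiable_def by (blast intro: has_field_derivative_at_within)
qed

end

section \<open>Fractional powers as integrals of the semigroup\<close>

text \<open>
 The kernel of \<open>(\<kappa> + A)\<^bsup>-\<gamma>\<^esup>\<close>: the Gamma density of shape
 \<open>\<gamma>\<close> and rate \<open>\<kappa>\<close> without its factor
 \<open>\<kappa>\<^sup>\<gamma>\<close>.
\<close>
definition gk :: "real \<Rightarrow> real \<Rightarrow> real \<Rightarrow> real" where
 "gk \<gamma> \<kappa> t = indicator {0..} t * (t powr (\<gamma> - 1) * exp (- \<kappa> * t)) / Gamma \<gamma>"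

lemma gk_borel [measurable]: "gk \<gamma> \<kappa> \<in> borel_measurable borel"
 unfolding gk_def[abs_def] by measurable

lemma gk_nonneg: "0 < \<gamma> \<Longrightarrow> 0 \<le> gk \<gamma> \<kappa> t"
 by (simp add: gk_def Gamma_real_nonneg)

lemma gk_neg: "t < 0 \<Longrightarrow> gk \<gamma> \<kappa> t = 0" by (simp add: gk_def)

lemma gk_integral:
 assumes "0 < \<gamma>" "0 < c"
 shows "integrable lborel (gk \<gamma> c)" "(LBINT t. gk \<gamma> c t) = c powr (- \<gamma>)"
proof -
 have *: "has_bochner_integral lborel (\<lambda>t. indicator {0..} t * (t powr (\<gamma> - 1) * exp (- c * t)) / Gamma \<gamma>)
   (Gamma \<gamma> * c powr (- \<gamma>) / Gamma \<gamma>)"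
  by (intro has_bochner_integral_divide_zero gamma_kernel_integral assms)
 then show "integrable lborel (gk \<gamma> c)" unfolding gk_def[abs_def] by (auto simp: has_bochner_integral_iff)
 show "(LBINT t. gk \<gamma> c t) = c powr (- \<gamma>)"
  using * Gamma_real_pos[OF assms(1)] unfolding gk_def[abs_def] by (auto simp: has_bochner_integral_iff)
qed

lemma gk_shift: "gk \<gamma> \<kappa> t * exp (w * t) = gk \<gamma> (\<kappa> - w) t"
proof -
 have "exp (- \<kappa> * t) * exp (w * t) = exp (- (\<kappa> - w) * t)"
  by (simp add: exp_add[symmetric] algebra_simps)
 then show ?thesis unfolding gk_def by (simp add: mult.assoc)
qed

text \<open>The convolution semigroup of Gamma densities, by the Beta integral.\<close>
lemma gk_convolution:
 assumes g: "0 < \<gamma>" "0 < \<mu>" and v: "0 < v"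
 shows "(LBINT t. gk \<gamma> \<kappa> t * gk \<mu> \<kappa> (v - t)) = gk (\<gamma> + \<mu>) \<kappa> v"
proof -
 let ?b = "\<lambda>t. indicator {0..1} t *\<^sub>R (t powr (\<gamma> - 1) * (1 - t) powr (\<mu> - 1))"
 have ib: "integrable lborel ?b"
  using integrable_Beta[OF g] by (simp add: set_integrable_def)
 have Ib: "(LBINT t. ?b t) = Beta \<gamma> \<mu>"
 proof -
  have "(LBINT t. ?b t) = (LINT t:{0..1}|lborel. t powr (\<gamma> - 1) * (1 - t) powr (\<mu> - 1))"
   by (simp add: set_lebesgue_integral_def)
  also have "\<dots> = integral {0..1} (\<lambda>t. t powr (\<gamma> - 1) * (1 - t) powr (\<mu> - 1))"
   by (rule set_borel_integral_eq_integral(2)[OF integrable_Beta[OF g]])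
  also have "\<dots> = Beta \<gamma> \<mu>" by (rule integral_unique[OF has_integral_Beta_real[OF g]])
  finally show ?thesis .
 qed
 have "(LBINT t. gk \<gamma> \<kappa> t * gk \<mu> \<kappa> (v - t)) = \<bar>v\<bar> *\<^sub>R (LBINT t. gk \<gamma> \<kappa> (0 + v * t) * gk \<mu> \<kappa> (v - (0 + v * t)))"
  by (rule lborel_integral_real_affine) (use v in simp)
 also have "(\<lambda>t. gk \<gamma> \<kappa> (0 + v * t) * gk \<mu> \<kappa> (v - (0 + v * t))) =
   (\<lambda>t. (v powr (\<gamma> + \<mu> - 2) * exp (- \<kappa> * v) / (Gamma \<gamma> * Gamma \<mu>)) * ?b t)"
 proof
  fix t :: real
  show "gk \<gamma> \<kappa> (0 + v * t) * gk \<mu> \<kappa> (v - (0 + v * t)) = (v powr (\<gamma> + \<mu> - 2) * exp (- \<kappa> * v) / (Gamma \<gamma> * Gamma \<mu>)) * ?b t"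
  proof (cases "t \<in> {0..1}")
   case True
   have e: "exp (- \<kappa> * (v * t)) * exp (- \<kappa> * (v - v * t)) = exp (- \<kappa> * v)"
    by (simp add: exp_add[symmetric] algebra_simps)
   have p: "v powr (\<gamma> - 1) * v powr (\<mu> - 1) = v powr (\<gamma> + \<mu> - 2)"
    by (simp add: powr_add[symmetric])
   have vt: "v - v * t = v * (1 - t)" by (simp add: algebra_simps)
   have "gk \<gamma> \<kappa> (0 + v * t) * gk \<mu> \<kappa> (v - (0 + v * t)) =
    ((v * t) powr (\<gamma> - 1) * (v * (1 - t)) powr (\<mu> - 1)) * (exp (- \<kappa> * (v * t)) * exp (- \<kappa> * (v - v * t))) / (Gamma \<gamma> * Gamma \<mu>)"
    using True v by (simp add: gk_def vt)
   also have "\<dots> = (v powr (\<gamma> - 1) * v powr (\<mu> - 1)) * (t powr (\<gamma> - 1) * (1 - t) powr (\<mu> - 1)) * exp (- \<kappa> * v) / (Gamma \<gamma> * Gamma \<mu>)"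
    unfolding e using True v by (simp add: powr_mult)
   finally show ?thesis using True unfolding p by simp
  next
   case False
   then have "\<not> (0 \<le> v * t \<and> 0 \<le> v - v * t)"
    using v by (auto simp: zero_le_mult_iff mult_le_cancel_left1)
   with False show ?thesis by (auto simp: gk_def)
  qed
 qed
 also have "(LBINT t. (v powr (\<gamma> + \<mu> - 2) * exp (- \<kappa> * v) / (Gamma \<gamma> * Gamma \<mu>)) * ?b t) =
   (v powr (\<gamma> + \<mu> - 2) * exp (- \<kappa> * v) / (Gamma \<gamma> * Gamma \<mu>)) * Beta \<gamma> \<mu>"
  by (simp only: integral_mult_right_zero Ib)
 also have "\<bar>v\<bar> *\<^sub>R \<dots> = gk (\<gamma> + \<mu>) \<kappa> v"
 proof -
  have "v * v powr (\<gamma> + \<mu> - 2) = v powr (\<gamma> + \<mu> - 1)" using v by (simp add: powr_mult_base)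
  then show ?thesis using v Gamma_real_pos[OF g(1)] Gamma_real_pos[OF g(2)]
   by (simp add: gk_def Beta_def)
 qed
 finally show ?thesis .
qed

lemma integral_scaleR_complex: "(\<integral>t. f t *\<^sub>R (y::complex) \<partial>N) = (\<integral>t. f t \<partial>N) *\<^sub>R y"
 unfolding scaleR_conv_of_real by simp

lemma pair_integrableI:
 fixes f :: "real \<times> real \<Rightarrow> 'a::{banach, second_countable_topology}"
 assumes "f \<in> borel_measurable (borel \<Otimes>\<^sub>M borel)"
  and "\<And>x. integrable lborel (\<lambda>y. f (x, y))"
  and "integrable lborel (\<lambda>x. \<integral>y. norm (f (x, y)) \<partial>lborel)"
 shows "integrable (lborel2) f"
proof (rule lborel_pair.Fubini_integrable)
 have "sets (lborel2 :: (real \<times> real) measure) = sets (borel \<Otimes>\<^sub>M borel)"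
  by (intro sets_pair_measure_cong) auto
 then show "f \<in> borel_measurable (lborel2)"
  using assms(1) by (simp cong: measurable_cong_sets)
qed (use assms in auto)

lemma pair_swap_integral:
 fixes f :: "real \<Rightarrow> real \<Rightarrow> 'a::{banach, second_countable_topology}"
 assumes "integrable (lborel2) (\<lambda>(x, y). f x y)"
 shows "(LBINT y. (LBINT x. f x y)) = (LBINT x. (LBINT y. f x y))"
 using lborel_pair.Fubini_integral[OF assms] .

lemma product_integrable:
 fixes f g :: "real \<Rightarrow> 'a::{real_normed_field, banach, second_countable_topology}"
 assumes f: "integrable lborel f" and g: "integrable lborel g"
 shows "integrable (lborel2) (\<lambda>(x, y). f x * g y)"
proof (rule pair_integrableI)
 have [measurable]: "f \<in> borel_measurable borel" "g \<in> borel_measurable borel"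
  using borel_measurable_integrable[OF f] borel_measurable_integrable[OF g] by auto
 show "(\<lambda>(x, y). f x * g y) \<in> borel_measurable (borel \<Otimes>\<^sub>M borel)" by measurable
qed (use f g in \<open>auto simp: norm_mult\<close>)

lemma convolution_integrable:
 fixes f g :: "real \<Rightarrow> 'a::{real_normed_field, banach, second_countable_topology}"
 assumes f: "integrable lborel f" and g: "integrable lborel g"
 shows "integrable (lborel2) (\<lambda>(x, y). f x * g (y - x))"
proof (rule pair_integrableI)
 have [measurable]: "f \<in> borel_measurable borel" "g \<in> borel_measurable borel"
  using borel_measurable_integrable[OF f] borel_measurable_integrable[OF g] by auto
 show "(\<lambda>(x, y). f x * g (y - x)) \<in> borel_measurable (borel \<Otimes>\<^sub>M borel)" by measurable
 show "integrable lborel (\<lambda>y. case (x, y) of (x, y) \<Rightarrow> f x * g (y - x))" for x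
  using lborel_integrable_real_affine[OF g, of 1 "- x"] by (simp add: add.commute)
 have "(LBINT y. norm (g (y - x))) = (LBINT y. norm (g y))" for x
  using lborel_integral_real_affine[of 1 "\<lambda>y. norm (g y)" "- x"] by (simp add: add.commute)
 then have "(LBINT y. norm (f x * g (y - x))) = norm (f x) * (LBINT y. norm (g y))" for x
  by (simp add: norm_mult)
 then show "integrable lborel (\<lambda>x. \<integral>y. norm (case (x, y) of (x, y) \<Rightarrow> f x * g (y - x)) \<partial>lborel)"
  using f by simp
qed

context C0_generator
begin

definition fint :: "real \<Rightarrow> real \<Rightarrow> 'x \<Rightarrow> 'x" where
 "fint \<kappa> \<gamma> x = Bochner (\<lambda>t. gk \<gamma> \<kappa> t *\<^sub>R Tp t x)"

lemma fint_norm_integrand: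
 assumes "0 < \<gamma>"
 shows "norm (gk \<gamma> \<kappa> t *\<^sub>R Tp t x) \<le> gk \<gamma> (\<kappa> - w) t * (M * norm x)"
proof -
 have "norm (gk \<gamma> \<kappa> t *\<^sub>R Tp t x) = gk \<gamma> \<kappa> t * norm (Tp t x)"
  using gk_nonneg[OF assms] by simp
 also have "\<dots> \<le> gk \<gamma> \<kappa> t * (indicator {0..} t * (M * exp (w * t) * norm x))"
  by (rule mult_left_mono[OF Tp_norm_le gk_nonneg[OF assms]])
 also have "\<dots> = (gk \<gamma> \<kappa> t * exp (w * t)) * (M * norm x)"
  by (cases "0 \<le> t") (auto simp: gk_neg)
 finally show ?thesis by (simp add: gk_shift)
qed

lemma fint_bint:
 assumes "0 < \<gamma>" "w < \<kappa>"
 shows "bint (\<lambda>t. gk \<gamma> \<kappa> t *\<^sub>R Tp t x)"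
proof (rule bintI[OF smeas_scaleR[OF smeas_borel'[OF gk_borel] smeas_orbit]])
 have "integrable lborel (\<lambda>t. gk \<gamma> (\<kappa> - w) t * (M * norm x))"
  by (rule integrable_mult_left[OF gk_integral(1)]) (use assms in auto)
 then show "integrable lebesgue (\<lambda>t. gk \<gamma> (\<kappa> - w) t * (M * norm x))"
  by (subst lebesgue_lborel(2)) auto
 show "AE t in lebesgue. norm (gk \<gamma> \<kappa> t *\<^sub>R Tp t x) \<le> gk \<gamma> (\<kappa> - w) t * (M * norm x)"
  by (rule AE_I2) (rule fint_norm_integrand[OF assms(1)])
qed

lemma fint_norm_le:
 assumes "0 < \<gamma>" "w < \<kappa>"
 shows "norm (fint \<kappa> \<gamma> x) \<le> (\<kappa> - w) powr (- \<gamma>) * (M * norm x)"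
proof -
 have i: "integrable lborel (\<lambda>t. gk \<gamma> (\<kappa> - w) t * (M * norm x))"
  by (rule integrable_mult_left[OF gk_integral(1)]) (use assms in auto)
 have m: "(\<lambda>t. gk \<gamma> (\<kappa> - w) t * (M * norm x)) \<in> borel_measurable borel" by measurable
 have "norm (fint \<kappa> \<gamma> x) \<le> (\<integral>t. norm (gk \<gamma> \<kappa> t *\<^sub>R Tp t x) \<partial>lebesgue)"
  unfolding fint_def by (rule Bochner_norm_le[OF fint_bint[OF assms]])
 also have "\<dots> \<le> (\<integral>t. gk \<gamma> (\<kappa> - w) t * (M * norm x) \<partial>lebesgue)"
  using i lebesgue_lborel(2)[OF m]
  by (intro integral_mono[OF bint_norm_integrable[OF fint_bint[OF assms]]] fint_norm_integrand[OF assms(1)]) blast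
 also have "\<dots> = (LBINT t. gk \<gamma> (\<kappa> - w) t) * (M * norm x)"
  unfolding lebesgue_lborel(1)[OF m] by (rule integral_mult_left_zero)
 also have "(LBINT t. gk \<gamma> (\<kappa> - w) t) = (\<kappa> - w) powr (- \<gamma>)"
  by (rule gk_integral(2)) (use assms in auto)
 finally show ?thesis .
qed

lemma fint_bcl:
 assumes "0 < \<gamma>" "w < \<kappa>"
 shows "bounded_clinear_on UNIV (fint \<kappa> \<gamma>)"
 unfolding bounded_clinear_on_def
proof (intro conjI ballI allI)
 fix x y c
 show "fint \<kappa> \<gamma> (x + y) = fint \<kappa> \<gamma> x + fint \<kappa> \<gamma> y"
  unfolding fint_def bcl_add[OF Tp_bcl] scaleR_add_right by (rule Bochner_add[OF fint_bint fint_bint]) fact+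
 have "fint \<kappa> \<gamma> (c *\<^sub>C x) = Bochner (\<lambda>t. c *\<^sub>C (gk \<gamma> \<kappa> t *\<^sub>R Tp t x))"
  unfolding fint_def bcl_scaleC[OF Tp_bcl] by (simp only: scaleR_scaleC scaleC_scaleC mult.commute)
 also have "\<dots> = c *\<^sub>C fint \<kappa> \<gamma> x" unfolding fint_def by (rule Bochner_scaleC[OF fint_bint[OF assms]])
 finally show "fint \<kappa> \<gamma> (c *\<^sub>C x) = c *\<^sub>C fint \<kappa> \<gamma> x" .
 show "\<exists>C. \<forall>x\<in>UNIV. norm (fint \<kappa> \<gamma> x) \<le> C * norm x"
  using fint_norm_le[OF assms] by (intro exI[of _ "(\<kappa> - w) powr (- \<gamma>) * M"]) (simp add: mult.assoc)
qed

lemma T_fint: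
 assumes "0 < \<gamma>" "w < \<kappa>" "0 \<le> h"
 shows "T h (fint \<kappa> \<gamma> x) = fint \<kappa> \<gamma> (T h x)"
 unfolding fint_def Bochner_bcl[OF T_bcl[OF assms(3)] fint_bint[OF assms(1,2)], symmetric]
  bcl_scaleR[OF T_bcl[OF assms(3)]] T_Tp_commute[OF assms(3)] ..

lemma functional_fint:
 fixes l :: "'x \<Rightarrow> complex"
 assumes "0 < \<gamma>" "w < \<kappa>" and l: "bounded_clinear_on UNIV l"
 shows "l (fint \<kappa> \<gamma> x) = (LBINT t. gk \<gamma> \<kappa> t *\<^sub>R l (Tp t x))"
proof -
 have "(\<lambda>t. gk \<gamma> \<kappa> t *\<^sub>R l (Tp t x)) \<in> borel_measurable borel"
  by (intro borel_measurable_scaleR gk_borel Tp_borel[OF l])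
 then show ?thesis
  unfolding fint_def functional_Bochner(2)[OF fint_bint[OF assms(1,2)] l] bcl_scaleR[OF l]
  by (rule lebesgue_lborel(1))
qed

lemma Tp_Tp: "0 \<le> s \<Longrightarrow> 0 \<le> t \<Longrightarrow> Tp t (Tp s x) = Tp (t + s) x"
 by (simp add: Tp_nonneg T_add)

lemma fint_fint:
 assumes g: "0 < \<gamma>" "0 < \<mu>" and lam: "w < \<kappa>"
 shows "fint \<kappa> \<gamma> (fint \<kappa> \<mu> x) = fint \<kappa> (\<gamma> + \<mu>) x"
proof (rule functional_ext)
 fix l :: "'x \<Rightarrow> complex" assume l: "bounded_clinear_on UNIV l"
 obtain K where K: "0 \<le> K" "\<forall>x. norm (l x) \<le> K * norm x" by (rule bcl_bound[OF l])
 note [measurable] = Tp_borel[OF l]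
 define P where "P = (\<lambda>(t, v). (gk \<gamma> \<kappa> t * gk \<mu> \<kappa> (v - t)) *\<^sub>R l (Tp v x))"
 have P: "integrable (lborel2) P"
 proof (rule integrable_dom)
  have "integrable (lborel2) (\<lambda>(t, v). gk \<gamma> (\<kappa> - w) t * gk \<mu> (\<kappa> - w) (v - t))"
   by (intro convolution_integrable gk_integral) (use g lam in auto)
  then show "integrable (lborel2) (\<lambda>z. (case z of (t, v) \<Rightarrow> gk \<gamma> (\<kappa> - w) t * gk \<mu> (\<kappa> - w) (v - t)) * (K * (M * norm x)))"
   by (rule integrable_mult_left)
  show "P \<in> borel_measurable (lborel2)" unfolding P_def by measurable
  show "AE z in lborel2. norm (P z) \<le> norm ((case z of (t, v) \<Rightarrow> gk \<gamma> (\<kappa> - w) t * gk \<mu> (\<kappa> - w) (v - t)) * (K * (M * norm x)))"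
  proof (rule AE_I2)
   fix z :: "real \<times> real"
   obtain t v where z: "z = (t, v)" by fastforce
   have nn: "0 \<le> gk \<gamma> \<kappa> t * gk \<mu> \<kappa> (v - t)" by (intro mult_nonneg_nonneg gk_nonneg g)
   have "norm (P z) = (gk \<gamma> \<kappa> t * gk \<mu> \<kappa> (v - t)) * cmod (l (Tp v x))"
    using nn by (simp add: P_def z)
   also have "\<dots> \<le> (gk \<gamma> \<kappa> t * gk \<mu> \<kappa> (v - t)) * (K * (M * exp (w * v) * norm x))"
   proof (rule mult_left_mono[OF _ nn])
    have "cmod (l (Tp v x)) \<le> K * norm (Tp v x)" using K by blast
    also have "norm (Tp v x) \<le> M * exp (w * v) * norm x"
     using Tp_norm_le[of v x] M_nonneg by (cases "0 \<le> v") auto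
    finally show "cmod (l (Tp v x)) \<le> K * (M * exp (w * v) * norm x)" using K(1) by (simp add: mult_left_mono)
   qed
   also have "exp (w * v) = exp (w * t) * exp (w * (v - t))" by (simp add: exp_add[symmetric] algebra_simps)
   also have "(gk \<gamma> \<kappa> t * gk \<mu> \<kappa> (v - t)) * (K * (M * (exp (w * t) * exp (w * (v - t))) * norm x)) =
     ((gk \<gamma> \<kappa> t * exp (w * t)) * (gk \<mu> \<kappa> (v - t) * exp (w * (v - t)))) * (K * (M * norm x))" by simp
   finally show "norm (P z) \<le> norm ((case z of (t, v) \<Rightarrow> gk \<gamma> (\<kappa> - w) t * gk \<mu> (\<kappa> - w) (v - t)) * (K * (M * norm x)))"
    unfolding gk_shift z by simp
  qed
 qed
 have inner: "(LBINT v. P (t, v)) = gk \<gamma> \<kappa> t *\<^sub>R l (Tp t (fint \<kappa> \<mu> x))" for t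
 proof (cases "0 \<le> t")
  case True
  have lt: "bounded_clinear_on UNIV (\<lambda>x. l (Tp t x))" by (rule bcl_compose[OF l Tp_bcl])
  have "l (Tp t (fint \<kappa> \<mu> x)) = (LBINT s. gk \<mu> \<kappa> s *\<^sub>R l (Tp t (Tp s x)))"
   by (rule functional_fint[OF g(2) lam lt])
  also have "\<dots> = (LBINT s. gk \<mu> \<kappa> s *\<^sub>R l (Tp (t + s) x))"
   by (intro integral_eqI refl) (metis Tp_Tp True gk_neg not_le scaleR_zero_left)
  also have "\<dots> = (LBINT v. gk \<mu> \<kappa> (v - t) *\<^sub>R l (Tp v x))"
   using lborel_integral_real_affine[of 1 "\<lambda>v. gk \<mu> \<kappa> (v - t) *\<^sub>R l (Tp v x)" t] by simp
  finally show ?thesis by (simp add: P_def scaleR_scaleR[symmetric] del: scaleR_scaleR)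
 next
  case False then show ?thesis by (simp add: P_def gk_neg)
 qed
 have "l (fint \<kappa> \<gamma> (fint \<kappa> \<mu> x)) = (LBINT t. (LBINT v. P (t, v)))"
  unfolding functional_fint[OF g(1) lam l] inner ..
 also have "\<dots> = (LBINT v. (LBINT t. P (t, v)))"
  using pair_swap_integral[of "\<lambda>t v. P (t, v)"] P by simp
 also have "\<dots> = (LBINT v. gk (\<gamma> + \<mu>) \<kappa> v *\<^sub>R l (Tp v x))"
 proof (rule integral_cong_AE)
  show "(\<lambda>v. \<integral>t. P (t, v) \<partial>lborel) \<in> borel_measurable lborel"
   by (rule borel_measurable_integrable[OF lborel_pair.integrable_snd]) (use P in simp)
  have "AE v in lborel. v \<noteq> (0::real)" by (rule AE_lborel_singleton)
  then show "AE v in lborel. (LBINT t. P (t, v)) = gk (\<gamma> + \<mu>) \<kappa> v *\<^sub>R l (Tp v x)"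
  proof eventually_elim
   case (elim v)
   show ?case
   proof (cases "0 < v")
    case True
    then show ?thesis unfolding P_def prod.case integral_scaleR_complex by (simp only: gk_convolution[OF g True])
   next
    case False
    with elim have "v < 0" by simp
    then show ?thesis by (simp add: P_def Tp_neg bcl_zero[OF l])
   qed
  qed
 qed measurable
 also have "\<dots> = l (fint \<kappa> (\<gamma> + \<mu>) x)"
  using functional_fint[OF _ lam l, of "\<gamma> + \<mu>"] g by simp
 finally show "l (fint \<kappa> \<gamma> (fint \<kappa> \<mu> x)) = l (fint \<kappa> (\<gamma> + \<mu>) x)" .
qed

lemma fint_one:
 assumes "w < \<kappa>"
 shows "fint \<kappa> 1 x = R (of_real \<kappa>) x"
proof -
 have z: "w < Re (of_real \<kappa>)" using assms by simp
 have "fint \<kappa> 1 x = lap (of_real \<kappa>) x" unfolding fint_def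
 proof (rule Bochner_eqI[OF fint_bint])
  fix l :: "'x \<Rightarrow> complex" assume l: "bounded_clinear_on UNIV l"
  have "(\<integral>t. l (gk 1 \<kappa> t *\<^sub>R Tp t x) \<partial>lebesgue) = (\<integral>t. l (exp (- of_real \<kappa> * of_real t) *\<^sub>C Tp t x) \<partial>lebesgue)"
  proof (rule integral_cong_AE)
   show "(\<lambda>t. l (gk 1 \<kappa> t *\<^sub>R Tp t x)) \<in> borel_measurable lebesgue"
    by (rule borel_measurable_integrable[OF functional_Bochner(1)[OF fint_bint l]]) (use assms in auto)
   show "(\<lambda>t. l (exp (- of_real \<kappa> * of_real t) *\<^sub>C Tp t x)) \<in> borel_measurable lebesgue"
    by (rule borel_measurable_integrable[OF functional_Bochner(1)[OF lap_bint[OF z] l]])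
   show "AE t in lebesgue. l (gk 1 \<kappa> t *\<^sub>R Tp t x) = l (exp (- of_real \<kappa> * of_real t) *\<^sub>C Tp t x)"
    using AE_neq[of 0]
   proof eventually_elim
    case (elim t)
    have "exp (- of_real \<kappa> * of_real t) = complex_of_real (exp (- \<kappa> * t))" by (simp add: exp_of_real[symmetric])
    then show ?case using elim
     by (cases "0 < t") (auto simp: gk_def scaleR_scaleC Tp_neg)
   qed
  qed
  also have "\<dots> = l (lap (of_real \<kappa>) x)" unfolding lap_def functional_Bochner(2)[OF lap_bint[OF z] l] ..
  finally show "(\<integral>t. l (gk 1 \<kappa> t *\<^sub>R Tp t x) \<partial>lebesgue) = l (lap (of_real \<kappa>) x)" .
 qed (use assms in auto)
 then show ?thesis using regular_lap(2)[OF z] by simp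
qed

lemma fint_Suc:
 assumes "w < \<kappa>"
 shows "fint \<kappa> (real (Suc n)) x = (R (of_real \<kappa>) ^^ Suc n) x"
proof (induction n)
 case 0 show ?case using fint_one[OF assms] by simp
next
 case (Suc n)
 have "fint \<kappa> (real (Suc (Suc n))) x = fint \<kappa> 1 (fint \<kappa> (real (Suc n)) x)"
  using fint_fint[OF _ _ assms, of 1 "real (Suc n)"] by (simp add: add.commute)
 with Suc show ?case by (simp add: fint_one[OF assms])
qed

lemma R_inj: "regular z \<Longrightarrow> R z x = R z y \<Longrightarrow> x = y"
 by (metis regular_R(2))

text \<open>
 Composition with a further power completes the exponent to an integer, where injectivity is that of
 the resolvent.
\<close>
lemma fint_inj:
 assumes "0 < \<gamma>" "w < \<kappa>" and eq: "fint \<kappa> \<gamma> x = fint \<kappa> \<gamma> y"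
 shows "x = y"
proof -
 define n where "n = nat \<lfloor>\<gamma>\<rfloor>"
 have n: "\<gamma> < real (Suc n)" unfolding n_def using assms(1) by linarith
 have e: "(R (of_real \<kappa>) ^^ Suc n) v = fint \<kappa> (real (Suc n) - \<gamma>) (fint \<kappa> \<gamma> v)" for v
  unfolding fint_Suc[OF assms(2), symmetric] using fint_fint[OF _ assms(1,2), of "real (Suc n) - \<gamma>" v] n by simp
 have *: "(R (of_real \<kappa>) ^^ Suc n) x = (R (of_real \<kappa>) ^^ Suc n) y"
  by (simp only: e eq)
 have "regular (of_real \<kappa>)" by (rule regular_lap(1)) (use assms in simp)
 then have "inj (R (of_real \<kappa>))" using R_inj by (meson injI)
 then have "inj (R (of_real \<kappa>) ^^ Suc n)" by (rule inj_fn)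
 then show ?thesis using * by (rule injD)
qed

lemma R_power_tendsto:
 assumes "regular u" "(f \<longlongrightarrow> u) F" "\<forall>\<^sub>F i in F. regular (f i)"
 shows "((\<lambda>i. (R (f i) ^^ n) x) \<longlongrightarrow> (R u ^^ n) x) F"
 by (induction n) (auto intro: R_tendsto assms)

lemma shift_inverse_shift:
 "shift_inverse D (\<lambda>x. \<omega> *\<^sub>R x + A x) (of_real t) = R (of_real (t + \<omega>))"
 unfolding shift_inverse_def by (simp add: scaleR_scaleC scaleC_add_left add.assoc)

text \<open>
 In the Balakrishnan-Komatsu integral each resolvent power is a Laplace transform of the
 semigroup; interchanging the integrals leaves a Gamma integral.
\<close>
lemma neg_frac_power_eq_fint:
 assumes g: "0 < \<gamma>" and om: "w < \<omega>"
 shows "neg_frac_power D (\<lambda>x. \<omega> *\<^sub>R x + A x) \<gamma> x = fint \<omega> \<gamma> x"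
proof -
 define n where "n = nat \<lfloor>\<gamma>\<rfloor>"
 define \<mu> where "\<mu> = real (Suc n) - \<gamma>"
 have n: "\<gamma> < real (Suc n)" unfolding n_def using g by linarith
 then have mu: "0 < \<mu>" by (simp add: \<mu>_def)
 let ?k = "\<lambda>t. indicator {0<..} t * t powr (\<mu> - 1) :: real"
 let ?F = "\<lambda>t. ?k t *\<^sub>R (R (of_real (t + \<omega>)) ^^ Suc n) x"
 have kb: "?k \<in> borel_measurable borel" by measurable
 have kn: "0 \<le> ?k t" for t by simp
 have reg: "regular (of_real (t + \<omega>))" if "0 < t" for t
  by (rule regular_lap(1)) (use that om in simp)
 have inner: "has_bochner_integral lborel (\<lambda>t. ?k t * gk (real (Suc n)) (t + c) s)
   (Gamma \<mu> * Gamma \<gamma> / Gamma (real (Suc n)) * gk \<gamma> c s)" if s: "s \<noteq> 0" for s c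
 proof (cases "0 < s")
  case True
  have e1: "has_bochner_integral lborel (\<lambda>t. (indicator {0..} t * (t powr (\<mu> - 1) * exp (- s * t))) * gk (real (Suc n)) c s)
    ((Gamma \<mu> * s powr (- \<mu>)) * gk (real (Suc n)) c s)"
   by (rule has_bochner_integral_mult_left[OF gamma_kernel_integral[OF mu True]])
  have e2: "(indicator {0..} t * (t powr (\<mu> - 1) * exp (- s * t))) * gk (real (Suc n)) c s = ?k t * gk (real (Suc n)) (t + c) s" for t
  proof -
   have "exp (- s * t) * exp (- c * s) = exp (- (t + c) * s)" by (simp add: exp_add[symmetric] algebra_simps)
   then show ?thesis by (auto simp: gk_def indicator_def not_le intro: antisym)
  qed
  have e3: "(Gamma \<mu> * s powr (- \<mu>)) * gk (real (Suc n)) c s = Gamma \<mu> * Gamma \<gamma> / Gamma (real (Suc n)) * gk \<gamma> c s"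
  proof -
   have "s powr (- \<mu>) * s powr (real (Suc n) - 1) = s powr (\<gamma> - 1)"
    by (simp add: powr_add[symmetric] \<mu>_def)
   then show ?thesis using True Gamma_real_pos[OF g] by (simp add: gk_def)
  qed
  show ?thesis using e1 unfolding e2 e3 .
 next
  case False
  with s have "s < 0" by simp
  then show ?thesis by (simp add: gk_neg has_bochner_integral_zero)
 qed
 have dom: "integrable (lborel2) (\<lambda>(s, t). ?k t * gk (real (Suc n)) (t + (\<omega> - w)) s)"
 proof (rule lborel_pair.Fubini_integrable)
  show "(\<lambda>(s, t). ?k t * gk (real (Suc n)) (t + (\<omega> - w)) s) \<in> borel_measurable (lborel2)"
   unfolding gk_def by measurable
  have ne: "AE s in lborel. s \<noteq> (0::real)" by (rule AE_lborel_singleton)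
  show "AE s in lborel. integrable lborel (\<lambda>t. case (s, t) of (s, t) \<Rightarrow> ?k t * gk (real (Suc n)) (t + (\<omega> - w)) s)"
   using ne by eventually_elim (use inner in \<open>auto simp: has_bochner_integral_iff\<close>)
  have "integrable lborel (\<lambda>s. Gamma \<mu> * Gamma \<gamma> / Gamma (real (Suc n)) * gk \<gamma> (\<omega> - w) s)"
   by (intro integrable_mult_right gk_integral) (use g om in auto)
  then show "integrable lborel (\<lambda>s. \<integral>t. norm (case (s, t) of (s, t) \<Rightarrow> ?k t * gk (real (Suc n)) (t + (\<omega> - w)) s) \<partial>lborel)"
  proof (rule integrable_cong_AE_imp)
   show "(\<lambda>s. \<integral>t. norm (case (s, t) of (s, t) \<Rightarrow> ?k t * gk (real (Suc n)) (t + (\<omega> - w)) s) \<partial>lborel) \<in> borel_measurable lborel"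
    unfolding gk_def by measurable
   show "AE s in lborel. Gamma \<mu> * Gamma \<gamma> / Gamma (real (Suc n)) * gk \<gamma> (\<omega> - w) s =
     (LBINT t. norm (case (s, t) of (s, t) \<Rightarrow> ?k t * gk (real (Suc n)) (t + (\<omega> - w)) s))"
    using ne
   proof eventually_elim
    case (elim s)
    have "norm (?k t * gk (real (Suc n)) (t + (\<omega> - w)) s) = ?k t * gk (real (Suc n)) (t + (\<omega> - w)) s" for t
     using gk_nonneg[of "real (Suc n)"] by simp
    then show ?case using inner[OF elim, of "\<omega> - w"] by (simp add: has_bochner_integral_iff)
   qed
  qed
 qed
 have Fb: "bint ?F"
 proof (rule bintI)
  have sc: "isCont (\<lambda>t. (R (of_real (t + \<omega>)) ^^ Suc n) x) t" if "0 < t" for t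
   unfolding isCont_def
  proof (rule R_power_tendsto[OF reg[OF that]])
   show "((\<lambda>t. complex_of_real (t + \<omega>)) \<longlongrightarrow> of_real (t + \<omega>)) (at t)" by (intro tendsto_intros)
   show "\<forall>\<^sub>F t in at t. regular (of_real (t + \<omega>))"
    using order_tendstoD(1)[OF tendsto_ident_at that] by eventually_elim (rule reg)
  qed
  have "isCont ?F t" if "t \<noteq> 0" for t
  proof (cases "0 < t")
   case True
   have "isCont (\<lambda>t. t powr (\<mu> - 1) *\<^sub>R (R (of_real (t + \<omega>)) ^^ Suc n) x) t"
    using True by (intro continuous_intros sc) auto
   moreover have "\<forall>\<^sub>F t in nhds t. ?F t = t powr (\<mu> - 1) *\<^sub>R (R (of_real (t + \<omega>)) ^^ Suc n) x"
    using eventually_nhds_in_open[of "{0<..}" t] True by (auto elim!: eventually_mono)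
   ultimately show ?thesis by (subst isCont_cong) auto
  next
   case False
   then have "\<forall>\<^sub>F t in nhds t. ?F t = 0"
    using eventually_nhds_in_open[of "{..<0}" t] that by (auto elim!: eventually_mono)
   then have "isCont ?F t = isCont (\<lambda>_. 0 :: 'x) t" by (rule isCont_cong)
   then show ?thesis by (simp only: continuous_const)
  qed
  then show "smeas ?F" by (intro smeas_isCont) (use AE_neq[of 0] in \<open>auto elim: eventually_mono\<close>)
  have i: "integrable lborel (\<lambda>t. (LBINT s. ?k t * gk (real (Suc n)) (t + (\<omega> - w)) s) * (M * norm x))"
   by (rule integrable_mult_left) (use lborel_pair.integrable_snd[OF dom] in simp)
  then show "integrable lebesgue (\<lambda>t. (LBINT s. ?k t * gk (real (Suc n)) (t + (\<omega> - w)) s) * (M * norm x))"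
   by (subst lebesgue_lborel(2)) (use borel_measurable_integrable[OF i] in auto)
  show "AE t in lebesgue. norm (?F t) \<le> (LBINT s. ?k t * gk (real (Suc n)) (t + (\<omega> - w)) s) * (M * norm x)"
  proof (rule AE_I2)
   fix t :: real
   show "norm (?F t) \<le> (LBINT s. ?k t * gk (real (Suc n)) (t + (\<omega> - w)) s) * (M * norm x)"
   proof (cases "0 < t")
    case True
    have "(LBINT s. gk (real (Suc n)) (t + (\<omega> - w)) s) = (t + (\<omega> - w)) powr (- real (Suc n))"
     by (rule gk_integral(2)) (use True om in auto)
    moreover have "norm (fint (t + \<omega>) (real (Suc n)) x) \<le> (t + \<omega> - w) powr (- real (Suc n)) * (M * norm x)"
     by (rule fint_norm_le) (use True om in auto)
    moreover have "fint (t + \<omega>) (real (Suc n)) x = (R (of_real (t + \<omega>)) ^^ Suc n) x"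
     by (rule fint_Suc) (use True om in auto)
    ultimately have "norm ((R (of_real (t + \<omega>)) ^^ Suc n) x) \<le> (LBINT s. gk (real (Suc n)) (t + (\<omega> - w)) s) * (M * norm x)"
     by (simp add: add_diff_eq)
    from mult_left_mono[OF this kn[of t]] show ?thesis by (simp add: mult.assoc del: funpow.simps)
   qed simp
  qed
 qed
 have "Bochner ?F = (Gamma \<mu> * Gamma \<gamma> / Gamma (real (Suc n))) *\<^sub>R fint \<omega> \<gamma> x"
 proof (rule Bochner_eqI[OF Fb])
  fix l :: "'x \<Rightarrow> complex" assume l: "bounded_clinear_on UNIV l"
  obtain K where K: "0 \<le> K" "\<forall>x. norm (l x) \<le> K * norm x" by (rule bcl_bound[OF l])
  note [measurable] = Tp_borel[OF l]
  define P where "P = (\<lambda>(s, t). (?k t * gk (real (Suc n)) (t + \<omega>) s) *\<^sub>R l (Tp s x))"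
  have P: "integrable (lborel2) P"
  proof (rule integrable_dom[OF integrable_mult_left[OF dom, of "K * (M * norm x)"]])
   show "P \<in> borel_measurable (lborel2)" unfolding P_def gk_def by measurable
   show "AE z in lborel2. norm (P z) \<le> norm ((case z of (s, t) \<Rightarrow> ?k t * gk (real (Suc n)) (t + (\<omega> - w)) s) * (K * (M * norm x)))"
   proof (rule AE_I2)
    fix z :: "real \<times> real"
    obtain s t where z: "z = (s, t)" by fastforce
    have nn: "0 \<le> ?k t * gk (real (Suc n)) (t + \<omega>) s" by (intro mult_nonneg_nonneg kn gk_nonneg) simp
    have "norm (P z) = (?k t * gk (real (Suc n)) (t + \<omega>) s) * cmod (l (Tp s x))"
     using nn by (simp add: P_def z)
    also have "\<dots> \<le> (?k t * gk (real (Suc n)) (t + \<omega>) s) * (K * (M * exp (w * s) * norm x))"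
    proof (rule mult_left_mono[OF _ nn])
     have "cmod (l (Tp s x)) \<le> K * norm (Tp s x)" using K by blast
     also have "norm (Tp s x) \<le> M * exp (w * s) * norm x"
      using Tp_norm_le[of s x] M_nonneg by (cases "0 \<le> s") auto
     finally show "cmod (l (Tp s x)) \<le> K * (M * exp (w * s) * norm x)" using K(1) by (simp add: mult_left_mono)
    qed
    also have "\<dots> = ?k t * (gk (real (Suc n)) (t + \<omega>) s * exp (w * s)) * (K * (M * norm x))" by simp
    also have "gk (real (Suc n)) (t + \<omega>) s * exp (w * s) = gk (real (Suc n)) (t + (\<omega> - w)) s"
     unfolding gk_shift by (simp add: add_diff_eq)
    finally show "norm (P z) \<le> norm ((case z of (s, t) \<Rightarrow> ?k t * gk (real (Suc n)) (t + (\<omega> - w)) s) * (K * (M * norm x)))"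
     unfolding z by simp
   qed
  qed
  have lF: "l (?F t) = (LBINT s. P (s, t))" for t
  proof (cases "0 < t")
   case True
   have "(R (of_real (t + \<omega>)) ^^ Suc n) x = fint (t + \<omega>) (real (Suc n)) x"
    by (rule fint_Suc[symmetric]) (use True om in auto)
   moreover have "l (fint (t + \<omega>) (real (Suc n)) x) = (LBINT s. gk (real (Suc n)) (t + \<omega>) s *\<^sub>R l (Tp s x))"
    by (rule functional_fint[OF _ _ l]) (use True om in auto)
   ultimately have "l (?F t) = ?k t *\<^sub>R (LBINT s. gk (real (Suc n)) (t + \<omega>) s *\<^sub>R l (Tp s x))"
    by (simp only: bcl_scaleR[OF l])
   also have "\<dots> = (LBINT s. ?k t *\<^sub>R (gk (real (Suc n)) (t + \<omega>) s *\<^sub>R l (Tp s x)))" by (simp only: integral_scaleR_right)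
   finally show ?thesis by (simp only: P_def scaleR_scaleR prod.case)
  next
   case False then show ?thesis by (simp add: P_def bcl_zero[OF l])
  qed
  have mP: "(\<lambda>t. \<integral>s. P (s, t) \<partial>lborel) \<in> borel_measurable borel"
   using borel_measurable_integrable[OF lborel_pair.integrable_snd, of "\<lambda>s t. P (s, t)"] P by simp
  have "(\<integral>t. l (?F t) \<partial>lebesgue) = (LBINT t. (LBINT s. P (s, t)))"
   unfolding lF by (rule lebesgue_lborel(1)[OF mP])
  also have "\<dots> = (LBINT s. (LBINT t. P (s, t)))"
   using pair_swap_integral[of "\<lambda>s t. P (s, t)"] P by simp
  also have "\<dots> = (LBINT s. (Gamma \<mu> * Gamma \<gamma> / Gamma (real (Suc n))) *\<^sub>R (gk \<gamma> \<omega> s *\<^sub>R l (Tp s x)))"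
  proof (rule integral_cong_AE)
   show "(\<lambda>s. \<integral>t. P (s, t) \<partial>lborel) \<in> borel_measurable lborel"
    by (rule borel_measurable_integrable[OF lborel_pair.integrable_fst]) (use P in simp)
   have "AE s in lborel. s \<noteq> (0::real)" by (rule AE_lborel_singleton)
   then show "AE s in lborel. (LBINT t. P (s, t)) = (Gamma \<mu> * Gamma \<gamma> / Gamma (real (Suc n))) *\<^sub>R (gk \<gamma> \<omega> s *\<^sub>R l (Tp s x))"
   proof eventually_elim
    case (elim s)
    have "(LBINT t. P (s, t)) = (LBINT t. ?k t * gk (real (Suc n)) (t + \<omega>) s) *\<^sub>R l (Tp s x)"
     unfolding P_def prod.case by (rule integral_scaleR_complex)
    then show ?case using inner[OF elim, of \<omega>] by (simp add: has_bochner_integral_iff)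
   qed
  qed measurable
  also have "\<dots> = (Gamma \<mu> * Gamma \<gamma> / Gamma (real (Suc n))) *\<^sub>R l (fint \<omega> \<gamma> x)"
   unfolding functional_fint[OF g om l] by (rule integral_scaleR_right)
  finally show "(\<integral>t. l (?F t) \<partial>lebesgue) = l ((Gamma \<mu> * Gamma \<gamma> / Gamma (real (Suc n))) *\<^sub>R fint \<omega> \<gamma> x)"
   by (simp only: bcl_scaleR[OF l])
 qed
 moreover have "neg_frac_power D (\<lambda>x. \<omega> *\<^sub>R x + A x) \<gamma> x = (Gamma (real (Suc n)) / (Gamma \<gamma> * Gamma \<mu>)) *\<^sub>R Bochner ?F"
  using g unfolding neg_frac_power_def shift_inverse_shift Let_def n_def[symmetric] \<mu>_def by simp
 moreover have "Gamma (real (Suc n)) \<noteq> 0" "Gamma \<gamma> \<noteq> 0" "Gamma \<mu> \<noteq> 0"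
  by (rule less_imp_neq[THEN not_sym], rule Gamma_real_pos, use g mu in simp)+
 ultimately show ?thesis by (simp del: of_nat_Suc)
qed

lemma neg_frac_power_facts:
 assumes g: "0 \<le> \<gamma>" and om: "w < \<omega>"
 defines "J \<equiv> neg_frac_power D (\<lambda>x. \<omega> *\<^sub>R x + A x) \<gamma>"
 shows "bounded_clinear_on UNIV J" "inj J" "0 \<le> t \<Longrightarrow> T t (J x) = J (T t x)"
proof -
 have "bounded_clinear_on UNIV J \<and> inj J \<and> (0 \<le> t \<longrightarrow> T t (J x) = J (T t x))"
 proof (cases "\<gamma> = 0")
  case True
  then have J: "J = (\<lambda>x. x)" by (auto simp: J_def neg_frac_power_def)
  show ?thesis unfolding J using bcl_scaleC_const[of 1] by auto
 next
  case False
  with g have g': "0 < \<gamma>" by simp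
  have J: "J = fint \<omega> \<gamma>" unfolding J_def using neg_frac_power_eq_fint[OF g' om] by blast
  show ?thesis unfolding J
  proof (intro conjI impI)
   show "bounded_clinear_on UNIV (fint \<omega> \<gamma>)" by (rule fint_bcl[OF g' om])
   show "inj (fint \<omega> \<gamma>)" by (rule injI) (rule fint_inj[OF g' om])
   show "T t (fint \<omega> \<gamma> x) = fint \<omega> \<gamma> (T t x)" if "0 \<le> t" by (rule T_fint[OF g' om that])
  qed
 qed
 then show "bounded_clinear_on UNIV J" "inj J" "0 \<le> t \<Longrightarrow> T t (J x) = J (T t x)" by auto
qed

lemma frac_space_eq:
 assumes "0 \<le> \<gamma>" "w < \<omega>"
 shows "frac_space D (\<lambda>x. \<omega> *\<^sub>R x + A x) \<gamma> =
  range (\<lambda>z. (neg_frac_power D (\<lambda>x. \<omega> *\<^sub>R x + A x) \<gamma> z, z))"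
 unfolding frac_space_def frac_domain_def frac_power_def
 using inv_f_f[OF neg_frac_power_facts(2)[OF assms]] by (auto simp: image_image)

end

section \<open>Smooth functions of compact support and their transforms\<close>

text \<open>
 All derivatives are carried along as data, as in the definition of the Schwartz space.
\<close>
definition deriv_chain :: "(nat \<Rightarrow> real \<Rightarrow> 'a::real_normed_vector) \<Rightarrow> bool" where
 "deriv_chain d \<longleftrightarrow> (\<forall>n t. (d n has_vector_derivative d (Suc n) t) (at t))"

lemma deriv_chain_isCont: "deriv_chain d \<Longrightarrow> isCont (d n) t"
 unfolding deriv_chain_def using has_vector_derivative_continuous by blast

lemma deriv_chain_borel:
 fixes d :: "nat \<Rightarrow> real \<Rightarrow> complex"
 shows "deriv_chain d \<Longrightarrow> d n \<in> borel_measurable borel"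
 by (intro borel_measurable_continuous_onI) (auto simp: continuous_on_eq_continuous_at deriv_chain_isCont)

lemma deriv_chain_shift: "deriv_chain d \<Longrightarrow> deriv_chain (\<lambda>n. d (n + k))"
 by (simp add: deriv_chain_def)

text \<open>Leibniz' rule for all derivatives at once.\<close>
lemma deriv_chain_mult:
 fixes f g :: "nat \<Rightarrow> real \<Rightarrow> complex"
 assumes f: "deriv_chain f" and g: "deriv_chain g"
 shows "deriv_chain (\<lambda>n t. \<Sum>i\<le>n. of_nat (n choose i) * f i t * g (n - i) t)"
 unfolding deriv_chain_def
proof (intro allI)
 fix n t
 have d: "((\<lambda>t. of_nat (n choose i) * f i t * g (n - i) t) has_vector_derivative
   of_nat (n choose i) * (f (Suc i) t * g (n - i) t) + of_nat (n choose i) * (f i t * g (Suc (n - i)) t)) (at t)" for i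
 proof -
  have "(f i has_vector_derivative f (Suc i) t) (at t)" "(g (n - i) has_vector_derivative g (Suc (n - i)) t) (at t)"
   using f g by (auto simp: deriv_chain_def)
  from has_vector_derivative_mult_right[OF has_vector_derivative_mult[OF this], of "of_nat (n choose i)"]
  show ?thesis by (simp add: algebra_simps)
 qed
 have "((\<lambda>t. \<Sum>i\<le>n. of_nat (n choose i) * f i t * g (n - i) t) has_vector_derivative
   (\<Sum>i\<le>n. of_nat (n choose i) * (f (Suc i) t * g (n - i) t) + of_nat (n choose i) * (f i t * g (Suc (n - i)) t))) (at t)"
  by (rule has_vector_derivative_sum) (rule d)
 also have "(\<Sum>i\<le>n. of_nat (n choose i) * (f (Suc i) t * g (n - i) t) + of_nat (n choose i) * (f i t * g (Suc (n - i)) t))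
   = (\<Sum>i\<le>Suc n. of_nat (Suc n choose i) * f i t * g (Suc n - i) t)" (is "?L = ?R")
 proof -
  have s1: "(\<Sum>i\<le>n. of_nat (n choose i) * (f i t * g (Suc (n - i)) t)) =
    f 0 t * g (Suc n) t + (\<Sum>i<n. of_nat (n choose Suc i) * (f (Suc i) t * g (n - i) t))"
  proof (cases n)
   case (Suc m)
   have "(\<Sum>i\<le>Suc m. of_nat (Suc m choose i) * (f i t * g (Suc (Suc m - i)) t)) = f 0 t * g (Suc (Suc m)) t +
    (\<Sum>i\<le>m. of_nat (Suc m choose Suc i) * (f (Suc i) t * g (Suc (Suc m - Suc i)) t))"
    by (subst sum.atMost_Suc_shift) simp
   also have "(\<Sum>i\<le>m. of_nat (Suc m choose Suc i) * (f (Suc i) t * g (Suc (Suc m - Suc i)) t))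
     = (\<Sum>i<Suc m. of_nat (Suc m choose Suc i) * (f (Suc i) t * g (Suc m - i) t))"
    unfolding lessThan_Suc_atMost by (rule sum.cong) (auto simp: Suc_diff_le)
   finally show ?thesis unfolding Suc .
  qed simp
  have s2: "(\<Sum>i<n. of_nat (n choose Suc i) * (f (Suc i) t * g (n - i) t)) = (\<Sum>i\<le>n. of_nat (n choose Suc i) * (f (Suc i) t * g (n - i) t))"
   unfolding lessThan_Suc_atMost[symmetric] by simp
  have "?R = f 0 t * g (Suc n) t + (\<Sum>i\<le>n. of_nat (Suc n choose Suc i) * f (Suc i) t * g (n - i) t)"
   by (subst sum.atMost_Suc_shift) simp
  also have "\<dots> = f 0 t * g (Suc n) t + ((\<Sum>i\<le>n. of_nat (n choose i) * (f (Suc i) t * g (n - i) t)) + (\<Sum>i\<le>n. of_nat (n choose Suc i) * (f (Suc i) t * g (n - i) t)))"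
   by (simp add: sum.distrib[symmetric] algebra_simps)
  finally show ?thesis unfolding sum.distrib s1 s2 by (simp add: algebra_simps)
 qed
 finally show "((\<lambda>t. \<Sum>i\<le>n. of_nat (n choose i) * f i t * g (n - i) t) has_vector_derivative ?R) (at t)" .
qed

text \<open>Besides the function itself all its derivatives are recorded.\<close>
definition ccinf :: "(nat \<Rightarrow> real \<Rightarrow> complex) \<Rightarrow> bool" where
 "ccinf d \<longleftrightarrow> deriv_chain d \<and> (\<exists>r. \<forall>n t. r < \<bar>t\<bar> \<longrightarrow> d n t = 0)"

lemma ccinf_chain: "ccinf d \<Longrightarrow> deriv_chain d" by (simp add: ccinf_def)

lemma ccinf_isCont: "ccinf d \<Longrightarrow> isCont (d n) t"
 by (rule deriv_chain_isCont[OF ccinf_chain])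

lemma ccinf_support:
 assumes "ccinf d" obtains r where "0 < r" "\<forall>n t. r < \<bar>t\<bar> \<longrightarrow> d n t = 0"
proof -
 obtain r where r: "\<forall>n t. r < \<bar>t\<bar> \<longrightarrow> d n t = 0" using assms by (auto simp: ccinf_def)
 show ?thesis by (rule that[of "\<bar>r\<bar> + 1"]) (use r in auto)
qed

lemma ccinf_mult:
 assumes f: "ccinf f" and g: "deriv_chain g"
 shows "ccinf (\<lambda>n t. \<Sum>i\<le>n. of_nat (n choose i) * f i t * g (n - i) t)"
 unfolding ccinf_def
proof
 show "deriv_chain (\<lambda>n t. \<Sum>i\<le>n. of_nat (n choose i) * f i t * g (n - i) t)"
  by (rule deriv_chain_mult[OF ccinf_chain[OF f] g])
 obtain r where "\<forall>n t. r < \<bar>t\<bar> \<longrightarrow> f n t = 0" using f by (auto simp: ccinf_def)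
 then show "\<exists>r. \<forall>n t. r < \<bar>t\<bar> \<longrightarrow> (\<Sum>i\<le>n. of_nat (n choose i) * f i t * g (n - i) t) = 0"
  by (intro exI[of _ r]) auto
qed

lemma ccinf_mult_exists: "ccinf f \<Longrightarrow> deriv_chain g \<Longrightarrow> \<exists>h. ccinf h \<and> h 0 = (\<lambda>t. f 0 t * g 0 t)"
 by (rule exI[of _ "\<lambda>n t. \<Sum>i\<le>n. of_nat (n choose i) * f i t * g (n - i) t"]) (simp add: ccinf_mult)

lemma ccinf_affine:
 assumes f: "ccinf f" and b: "b \<noteq> 0"
 shows "ccinf (\<lambda>n t. of_real (b ^ n) * f n (a + b * t))"
 unfolding ccinf_def deriv_chain_def
proof (intro conjI allI)
 fix n t
 have "((\<lambda>t. a + b * t) has_vector_derivative b) (at t)" by (auto intro!: derivative_eq_intros)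
 moreover have "(f n has_vector_derivative f (Suc n) (a + b * t)) (at (a + b * t))"
  using f by (auto simp: ccinf_def deriv_chain_def)
 ultimately have "(f n \<circ> (\<lambda>t. a + b * t) has_vector_derivative b *\<^sub>R f (Suc n) (a + b * t)) (at t)"
  by (rule vector_diff_chain_at)
 from has_vector_derivative_mult_right[OF this, of "of_real (b ^ n)"]
 show "((\<lambda>t. of_real (b ^ n) * f n (a + b * t)) has_vector_derivative of_real (b ^ Suc n) * f (Suc n) (a + b * t)) (at t)"
  by (simp add: o_def scaleR_conv_of_real algebra_simps)
next
 obtain r where r: "0 < r" "\<forall>n t. r < \<bar>t\<bar> \<longrightarrow> f n t = 0" by (rule ccinf_support[OF f])
 have "f n (a + b * t) = 0" if "(r + \<bar>a\<bar>) / \<bar>b\<bar> < \<bar>t\<bar>" for n t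
 proof -
  have "r + \<bar>a\<bar> < \<bar>b * t\<bar>" using that b by (simp add: abs_mult field_simps)
  then have "r < \<bar>a + b * t\<bar>" by linarith
  with r show ?thesis by blast
 qed
 then show "\<exists>r. \<forall>n t. r < \<bar>t\<bar> \<longrightarrow> of_real (b ^ n) * f n (a + b * t) = 0" by auto
qed

lemma ccinf_bounded:
 assumes "ccinf d" shows "\<exists>C. \<forall>t. cmod (d n t) \<le> C"
proof -
 obtain r where r: "0 < r" "\<forall>n t. r < \<bar>t\<bar> \<longrightarrow> d n t = 0" by (rule ccinf_support[OF assms])
 have "bounded (d n ` {-r..r})"
  by (intro compact_imp_bounded compact_continuous_image)
    (auto intro!: continuous_at_imp_continuous_on ccinf_isCont assms)
 then obtain C where C: "\<forall>t\<in>{-r..r}. cmod (d n t) \<le> C" by (auto simp: bounded_iff)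
 have "cmod (d n t) \<le> max C 0" for t
 proof (cases "\<bar>t\<bar> \<le> r")
  case True
  then have "t \<in> {-r..r}" by auto
  then have "cmod (d n t) \<le> C" using C by blast
  then show ?thesis by simp
 next
  case False then show ?thesis using r by simp
 qed
 then show ?thesis by blast
qed

lemma ccinf_weighted_integrable:
 fixes k :: "real \<Rightarrow> complex"
 assumes d: "ccinf d" and k: "continuous_on UNIV k"
 shows "integrable lborel (\<lambda>t. k t * d n t)"
proof -
 obtain r where r: "0 < r" "\<forall>n t. r < \<bar>t\<bar> \<longrightarrow> d n t = 0" by (rule ccinf_support[OF d])
 have "set_integrable lborel {-r..r} (\<lambda>t. k t * d n t)"
 proof (rule borel_integrable_atLeastAtMost')
  have "continuous_on {-r..r} (d n)"
   by (intro continuous_at_imp_continuous_on ballI ccinf_isCont[OF d])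
  then show "continuous_on {-r..r} (\<lambda>t. k t * d n t)"
   using continuous_on_mult[OF continuous_on_subset[OF k subset_UNIV]] by blast
 qed
 then have "integrable lborel (\<lambda>t. indicator {-r..r} t *\<^sub>R (k t * d n t))" by (simp add: set_integrable_def)
 moreover have "indicator {-r..r} t *\<^sub>R (k t * d n t) = k t * d n t" for t
  using r(2)[rule_format, of t n] by (auto simp: indicator_def abs_le_iff not_le)
 ultimately show ?thesis by simp
qed

lemma ccinf_integrable: "ccinf d \<Longrightarrow> integrable lborel (d n)"
 using ccinf_weighted_integrable[of d "\<lambda>_. 1" n] by simp

text \<open>Integration by parts against an exponential, on the whole line.\<close>
lemma exp_parts:
 fixes f f' :: "real \<Rightarrow> complex"
 assumes d: "\<And>t. (f has_vector_derivative f' t) (at t)" and c: "\<And>t. isCont f' t"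
  and i: "integrable lborel (\<lambda>t. exp (z * of_real t) * f t)" "integrable lborel (\<lambda>t. exp (z * of_real t) * f' t)"
  and lim: "((\<lambda>t. exp (z * of_real t) * f t) \<longlongrightarrow> 0) at_top" "((\<lambda>t. exp (z * of_real t) * f t) \<longlongrightarrow> 0) at_bot"
 shows "(LBINT t. exp (z * of_real t) * f' t) = - z * (LBINT t. exp (z * of_real t) * f t)"
proof -
 let ?F = "\<lambda>t. exp (z * of_real t) * f t"
 let ?f = "\<lambda>t. z * (exp (z * of_real t) * f t) + exp (z * of_real t) * f' t"
 have dF: "(?F has_vector_derivative ?f t) (at t)" for t
 proof -
  have "((\<lambda>t. exp (z * of_real t)) has_vector_derivative z * exp (z * of_real t)) (at t)"
   by (rule has_vector_derivative_real_field) (auto intro!: derivative_eq_intros)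
  from has_vector_derivative_mult[OF this d[of t]] show ?thesis by (simp add: algebra_simps)
 qed
 have cf: "isCont f t" for t using has_vector_derivative_continuous[OF d[of t]] .
 have "(LBINT t=-\<infinity>..\<infinity>. ?f t) = 0 - 0"
 proof (rule interval_integral_FTC_integrable[where F="?F"])
  show "isCont ?f t" for t by (intro continuous_intros cf c)
  show "set_integrable lborel (einterval (-\<infinity>) \<infinity>) ?f"
   using i by (simp add: set_integrable_def einterval_def)
  show "((?F \<circ> real_of_ereal) \<longlongrightarrow> 0) (at_left \<infinity>)"
   using lim(1) by (simp add: ereal_tendsto_simps1)
  show "((?F \<circ> real_of_ereal) \<longlongrightarrow> 0) (at_right (-\<infinity>))"
   using lim(2) by (simp add: ereal_tendsto_simps1)
 qed (use dF in auto)
 then have "(LBINT t. ?f t) = 0"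
  by (simp add: interval_lebesgue_integral_def set_lebesgue_integral_def einterval_def)
 moreover have "(LBINT t. ?f t) = z * (LBINT t. ?F t) + (LBINT t. exp (z * of_real t) * f' t)"
  using i by (subst Bochner_Integration.integral_add) auto
 ultimately show ?thesis by (simp add: eq_neg_iff_add_eq_0 add.commute)
qed

text \<open>
 Two-sided Laplace transform; on the imaginary axis it is the Fourier transform or its inverse,
 according to the sign.
\<close>
definition ltr :: "(real \<Rightarrow> complex) \<Rightarrow> complex \<Rightarrow> complex" where
 "ltr f z = (LBINT t. exp (z * of_real t) * f t)"

lemma ccinf_ltr_integrable: "ccinf d \<Longrightarrow> integrable lborel (\<lambda>t. exp (z * of_real t) * d n t)"
 by (rule ccinf_weighted_integrable) (auto intro!: continuous_intros)

lemma ccinf_ltr_deriv: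
 assumes d: "ccinf d"
 shows "ltr (d (Suc n)) z = - z * ltr (d n) z"
 unfolding ltr_def
proof (rule exp_parts)
 obtain r where r: "0 < r" "\<forall>n t. r < \<bar>t\<bar> \<longrightarrow> d n t = 0" by (rule ccinf_support[OF d])
 have "\<forall>\<^sub>F t in at_top. 0 = exp (z * of_real t) * d n t"
  using eventually_gt_at_top[of r] by eventually_elim (use r in auto)
 then show "((\<lambda>t. exp (z * of_real t) * d n t) \<longlongrightarrow> 0) at_top"
  by (rule Lim_transform_eventually[OF tendsto_const])
 have "\<forall>\<^sub>F t in at_bot. 0 = exp (z * of_real t) * d n t"
  using eventually_gt_at_bot[of "- r"] eventually_le_at_bot[of "- r - 1"]
  by eventually_elim (use r in auto)
 then show "((\<lambda>t. exp (z * of_real t) * d n t) \<longlongrightarrow> 0) at_bot"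
  by (rule Lim_transform_eventually[OF tendsto_const])
qed (use ccinf_isCont[OF d] ccinf_ltr_integrable[OF d] ccinf_chain[OF d] in \<open>auto simp: deriv_chain_def\<close>)

lemma ccinf_ltr_power:
 assumes d: "ccinf d"
 shows "z ^ k * ltr (d n) z = (- 1) ^ k * ltr (d (n + k)) z"
 by (induction k) (auto simp: ccinf_ltr_deriv[OF d] algebra_simps)

lemma ltr_bound_strip:
 assumes d: "ccinf d"
 shows "\<exists>C\<ge>0. \<forall>z. \<bar>Re z\<bar> \<le> b \<longrightarrow> cmod (ltr (d n) z) \<le> C"
proof -
 obtain r where r: "0 < r" "\<forall>n t. r < \<bar>t\<bar> \<longrightarrow> d n t = 0" by (rule ccinf_support[OF d])
 let ?C = "exp (\<bar>b\<bar> * r) * (LBINT t. cmod (d n t))"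
 have "cmod (ltr (d n) z) \<le> ?C" if z: "\<bar>Re z\<bar> \<le> b" for z
 proof -
  have "cmod (ltr (d n) z) \<le> (LBINT t. cmod (exp (z * of_real t) * d n t))"
   unfolding ltr_def by (rule integral_norm_bound)
  also have "\<dots> \<le> (LBINT t. exp (\<bar>b\<bar> * r) * cmod (d n t))"
  proof (rule integral_mono)
   show "integrable lborel (\<lambda>t. cmod (exp (z * of_real t) * d n t))"
    by (rule integrable_norm[OF ccinf_ltr_integrable[OF d]])
   show "integrable lborel (\<lambda>t. exp (\<bar>b\<bar> * r) * cmod (d n t))"
    by (intro integrable_mult_right integrable_norm ccinf_integrable d)
   fix t
   show "cmod (exp (z * of_real t) * d n t) \<le> exp (\<bar>b\<bar> * r) * cmod (d n t)"
   proof (cases "\<bar>t\<bar> \<le> r")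
    case True
    have "Re z * t \<le> \<bar>Re z\<bar> * \<bar>t\<bar>" by (metis abs_ge_self abs_mult)
    also have "\<dots> \<le> \<bar>b\<bar> * r" using z True by (intro mult_mono) auto
    finally show ?thesis by (simp add: norm_mult mult_right_mono)
   next
    case False then show ?thesis using r by simp
   qed
  qed
  finally show ?thesis by simp
 qed
 then show ?thesis by (intro exI[of _ ?C]) auto
qed

text \<open>
 Each derivative of the function gains a factor \<open>z\<close>, uniformly for bounded real part.
\<close>
lemma ltr_decay_strip:
 assumes d: "ccinf d"
 shows "\<exists>C\<ge>0. \<forall>z. \<bar>Re z\<bar> \<le> b \<longrightarrow> cmod (ltr (d n) z) * (1 + \<bar>Im z\<bar>) ^ k \<le> C"
proof -
 obtain C0 where C0: "0 \<le> C0" "\<forall>z. \<bar>Re z\<bar> \<le> b \<longrightarrow> cmod (ltr (d n) z) \<le> C0"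
  using ltr_bound_strip[OF d] by blast
 obtain C1 where C1: "0 \<le> C1" "\<forall>z. \<bar>Re z\<bar> \<le> b \<longrightarrow> cmod (ltr (d (n + k)) z) \<le> C1"
  using ltr_bound_strip[OF d] by blast
 have "cmod (ltr (d n) z) * (1 + \<bar>Im z\<bar>) ^ k \<le> 2 ^ k * (C0 + C1)" if z: "\<bar>Re z\<bar> \<le> b" for z
 proof (cases "\<bar>Im z\<bar> \<le> 1")
  case True
  have "(1 + \<bar>Im z\<bar>) ^ k \<le> 2 ^ k" by (rule power_mono) (use True in auto)
  then have "cmod (ltr (d n) z) * (1 + \<bar>Im z\<bar>) ^ k \<le> C0 * 2 ^ k"
   using C0 z by (intro mult_mono) auto
  also have "\<dots> \<le> 2 ^ k * (C0 + C1)" using C1(1) by (simp add: algebra_simps)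
  finally show ?thesis .
 next
  case False
  have "(1 + \<bar>Im z\<bar>) ^ k \<le> (2 * cmod z) ^ k"
   by (rule power_mono) (use False abs_Im_le_cmod[of z] in auto)
  then have "cmod (ltr (d n) z) * (1 + \<bar>Im z\<bar>) ^ k \<le> cmod (ltr (d n) z) * (2 * cmod z) ^ k"
   by (intro mult_left_mono) auto
  also have "\<dots> = 2 ^ k * cmod (z ^ k * ltr (d n) z)" by (simp add: norm_mult norm_power power_mult_distrib)
  also have "\<dots> = 2 ^ k * cmod (ltr (d (n + k)) z)"
   unfolding ccinf_ltr_power[OF d] by (simp add: norm_mult norm_power)
  also have "\<dots> \<le> 2 ^ k * (C0 + C1)" using C1 C0 z by (intro mult_left_mono) (auto intro: add_increasing)
  finally show ?thesis .
 qed
 then show ?thesis using C0 C1 by (intro exI[of _ "2 ^ k * (C0 + C1)"]) auto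
qed

lemma ltr_has_derivative:
 assumes d: "ccinf d"
 shows "(ltr (d n) has_field_derivative ltr (\<lambda>t. of_real t * d n t) z) (at z)"
proof -
 obtain r where r: "0 < r" "\<forall>n t. r < \<bar>t\<bar> \<longrightarrow> d n t = 0" by (rule ccinf_support[OF d])
 note r0 = less_imp_le[OF r(1)]
 define K where "K = (r\<^sup>2 * exp r) * exp (cmod z * r) * (LBINT t. cmod (d n t))"
 have i0: "integrable lborel (\<lambda>t. exp (u * of_real t) * d n t)" for u by (rule ccinf_ltr_integrable[OF d])
 have i1: "integrable lborel (\<lambda>t. exp (z * of_real t) * (of_real t * d n t))"
 proof -
  have "continuous_on UNIV (\<lambda>t. exp (z * of_real t) * of_real t)" by (intro continuous_intros)
  from ccinf_weighted_integrable[OF d this, of n] show ?thesis by (simp only: mult.assoc)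
 qed
 have est: "cmod (ltr (d n) (z + h) - ltr (d n) z - h * ltr (\<lambda>t. of_real t * d n t) z) \<le> K * (cmod h)\<^sup>2"
  if h: "cmod h \<le> 1" for h
 proof -
  have eq: "ltr (d n) (z + h) - ltr (d n) z - h * ltr (\<lambda>t. of_real t * d n t) z =
   (LBINT t. exp ((z + h) * of_real t) * d n t - exp (z * of_real t) * d n t - h * (exp (z * of_real t) * (of_real t * d n t)))"
   unfolding ltr_def
   by (simp only: Bochner_Integration.integral_diff[OF i0 i0] integral_mult_right_zero
     Bochner_Integration.integral_diff[OF Bochner_Integration.integrable_diff[OF i0 i0] integrable_mult_right[OF i1]])
  have "cmod (ltr (d n) (z + h) - ltr (d n) z - h * ltr (\<lambda>t. of_real t * d n t) z) \<le> (LBINT t. cmod (exp ((z + h) * of_real t) * d n t - exp (z * of_real t) * d n t - h * (exp (z * of_real t) * (of_real t * d n t))))"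
   unfolding eq by (rule integral_norm_bound)
  also have "\<dots> \<le> (LBINT t. ((r\<^sup>2 * exp r) * exp (cmod z * r) * (cmod h)\<^sup>2) * cmod (d n t))"
  proof (rule integral_mono)
   show "integrable lborel (\<lambda>t. cmod (exp ((z + h) * of_real t) * d n t - exp (z * of_real t) * d n t - h * (exp (z * of_real t) * (of_real t * d n t))))"
    by (intro integrable_norm Bochner_Integration.integrable_diff integrable_mult_right i0 i1)
   show "integrable lborel (\<lambda>t. ((r\<^sup>2 * exp r) * exp (cmod z * r) * (cmod h)\<^sup>2) * cmod (d n t))"
    by (intro integrable_mult_right integrable_norm ccinf_integrable d)
   fix t
   show "cmod (exp ((z + h) * of_real t) * d n t - exp (z * of_real t) * d n t - h * (exp (z * of_real t) * (of_real t * d n t)))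
    \<le> ((r\<^sup>2 * exp r) * exp (cmod z * r) * (cmod h)\<^sup>2) * cmod (d n t)"
   proof (cases "\<bar>t\<bar> \<le> r")
    case True
    let ?u = "h * of_real t"
    have u: "cmod ?u \<le> cmod h * r" using True by (simp add: norm_mult mult_left_mono)
    have "cmod (exp ?u - (\<Sum>k\<le>1. ?u ^ k / fact k)) \<le> exp \<bar>Re ?u\<bar> * (cmod ?u ^ Suc 1) / fact 1"
     by (rule Taylor_exp)
    then have "cmod (exp ?u - 1 - ?u) \<le> exp \<bar>Re ?u\<bar> * (cmod ?u)\<^sup>2"
     by (simp add: power2_eq_square algebra_simps)
    also have "\<dots> \<le> exp r * (cmod h * r)\<^sup>2"
    proof (intro mult_mono power_mono)
     have "\<bar>Re ?u\<bar> \<le> cmod ?u" by (rule abs_Re_le_cmod)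
     also have "\<dots> \<le> 1 * r" using u h r(1) by (meson mult_right_mono order_trans less_imp_le)
     finally show "exp \<bar>Re ?u\<bar> \<le> exp r" by simp
    qed (use u in auto)
    finally have e1: "cmod (exp ?u - 1 - ?u) \<le> (r\<^sup>2 * exp r) * (cmod h)\<^sup>2"
     by (simp add: power_mult_distrib mult_ac)
    have "Re z * t \<le> \<bar>Re z\<bar> * \<bar>t\<bar>" by (metis abs_ge_self abs_mult)
    also have "\<dots> \<le> cmod z * r" using True by (intro mult_mono abs_Re_le_cmod) auto
    finally have e2: "cmod (exp (z * of_real t)) \<le> exp (cmod z * r)" by simp
    have eq2: "exp ((z + h) * of_real t) * d n t - exp (z * of_real t) * d n t - h * (exp (z * of_real t) * (of_real t * d n t))
     = exp (z * of_real t) * (exp ?u - 1 - ?u) * d n t"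
     by (simp add: exp_add distrib_right algebra_simps)
    have "cmod (exp ((z + h) * of_real t) * d n t - exp (z * of_real t) * d n t - h * (exp (z * of_real t) * (of_real t * d n t)))
     = cmod (exp (z * of_real t)) * cmod (exp ?u - 1 - ?u) * cmod (d n t)" unfolding eq2 by (simp only: norm_mult)
    also have "\<dots> \<le> exp (cmod z * r) * ((r\<^sup>2 * exp r) * (cmod h)\<^sup>2) * cmod (d n t)"
     by (intro mult_right_mono mult_mono e1 e2) auto
    finally show ?thesis by (simp add: mult_ac)
   next
    case False then show ?thesis using r by simp
   qed
  qed
  finally show ?thesis by (simp add: K_def mult_ac)
 qed
 have K: "0 \<le> K" by (simp add: K_def)
 show ?thesis
  unfolding has_field_derivative_def has_derivative_at
 proof (intro conjI bounded_linear_mult_right)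
  show "(\<lambda>h. cmod (ltr (d n) (z + h) - ltr (d n) z - ltr (\<lambda>t. of_real t * d n t) z * h) / cmod h) \<midarrow>0\<rightarrow> 0"
  proof (rule Lim_null_comparison)
   have "\<forall>\<^sub>F h in at (0::complex). cmod h \<le> 1"
    using eventually_at_ball[of 1 "0::complex" UNIV] by (auto elim!: eventually_mono simp: dist_norm)
   then show "\<forall>\<^sub>F h in at (0::complex). norm (cmod (ltr (d n) (z + h) - ltr (d n) z - ltr (\<lambda>t. of_real t * d n t) z * h) / cmod h) \<le> K * cmod h"
   proof eventually_elim
    case (elim h)
    show ?case
    proof (cases "h = 0")
     case False
     then show ?thesis using est[OF elim] by (simp add: divide_le_eq power2_eq_square mult.assoc mult.commute[of h])
    qed simp
   qed
   show "((\<lambda>h. K * cmod h) \<longlongrightarrow> 0) (at 0)"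
    using tendsto_mult[OF tendsto_const[of K] tendsto_norm[OF tendsto_ident_at[of "0::complex" UNIV]]] by simp
  qed
 qed
qed

lemma ltr_holomorphic: "ccinf d \<Longrightarrow> ltr (d n) holomorphic_on S"
 by (rule holomorphic_onI)
   (meson ltr_has_derivative field_differentiable_at_within field_differentiable_def)

lemma ccinf_times_id:
 assumes d: "ccinf d"
 shows "ccinf (\<lambda>n t. of_real t * d n t + of_nat n * d (n - 1) t)"
 unfolding ccinf_def deriv_chain_def
proof (intro conjI allI)
 fix n t
 have dd: "(d n has_vector_derivative d (Suc n) t) (at t)" for n t
  using d by (auto simp: ccinf_def deriv_chain_def)
 have "((\<lambda>t. of_real t * d n t) has_vector_derivative of_real t * d (Suc n) t + 1 * d n t) (at t)"
  by (rule has_vector_derivative_mult[OF _ dd]) (auto intro!: derivative_eq_intros has_vector_derivative_real_field)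
 moreover have "((\<lambda>t. of_nat n * d (n - 1) t) has_vector_derivative of_nat n * d n t) (at t)"
  using has_vector_derivative_mult_right[OF dd[of "n - 1" t], of "of_nat n"] by (cases n) auto
 ultimately have "((\<lambda>t. of_real t * d n t + of_nat n * d (n - 1) t) has_vector_derivative
   (of_real t * d (Suc n) t + 1 * d n t) + of_nat n * d n t) (at t)"
  by (rule has_vector_derivative_add)
 then show "((\<lambda>t. of_real t * d n t + of_nat n * d (n - 1) t) has_vector_derivative
   of_real t * d (Suc n) t + of_nat (Suc n) * d (Suc n - 1) t) (at t)"
  by (simp add: algebra_simps)
next
 show "\<exists>r. \<forall>n t. r < \<bar>t\<bar> \<longrightarrow> of_real t * d n t + of_nat n * d (n - 1) t = 0"
 proof -
  obtain r where "\<forall>n t. r < \<bar>t\<bar> \<longrightarrow> d n t = 0" using d by (auto simp: ccinf_def)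
  then show ?thesis by (intro exI[of _ r]) simp
 qed
qed

lemma ccinf_times_power:
 assumes d: "ccinf d"
 shows "\<exists>e. ccinf e \<and> e 0 = (\<lambda>t. of_real t ^ k * d 0 t)"
proof (induction k)
 case 0 show ?case using d by auto
next
 case (Suc k)
 then obtain e where "ccinf e" "e 0 = (\<lambda>t. of_real t ^ k * d 0 t)" by blast
 then show ?case using ccinf_times_id[of e]
  by (intro exI[of _ "\<lambda>n t. of_real t * e n t + of_nat n * e (n - 1) t"]) (auto simp: mult.assoc)
qed

lemma ccinf_schwartz:
 assumes d: "ccinf d" shows "d 0 \<in> schwartz UNIV"
 unfolding schwartz_def
proof (intro CollectI conjI exI[of _ d] allI)
 show "(d n has_vector_derivative d (Suc n) t) (at t)" for n t using d by (auto simp: ccinf_def deriv_chain_def)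
 fix n k
 obtain r where r: "0 < r" "\<forall>n t. r < \<bar>t\<bar> \<longrightarrow> d n t = 0" by (rule ccinf_support[OF d])
 obtain C where C: "\<forall>t. cmod (d n t) \<le> C" using ccinf_bounded[OF d] by blast
 have "\<bar>t\<bar> ^ k * norm (d n t) \<le> r ^ k * C" for t
 proof (cases "\<bar>t\<bar> \<le> r")
  case True then show ?thesis using C r by (intro mult_mono power_mono) auto
 next
  case False
  have "0 \<le> C" using C[rule_format, of 0] norm_ge_zero order_trans by blast
  with False show ?thesis using r by simp
 qed
 then show "\<exists>C. \<forall>t. \<bar>t\<bar> ^ k * norm (d n t) \<le> C" by blast
qed auto

text \<open>The Fourier transform of a smooth function of compact support is a Schwartz function.\<close>
lemma ltr_schwartz:
 assumes d: "ccinf d" and c: "c = \<i> \<or> c = - \<i>"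
 shows "(\<lambda>t. K * ltr (d 0) (c * of_real t)) \<in> schwartz UNIV"
proof -
 define e where "e n = (\<lambda>t. K * c ^ n * ltr (\<lambda>s. of_real s ^ n * d 0 s) (c * of_real t))" for n
 show ?thesis
  unfolding schwartz_def
 proof (intro CollectI conjI exI[of _ e] allI)
  show "e 0 = (\<lambda>t. K * ltr (d 0) (c * of_real t))" by (simp add: e_def)
  fix n :: nat
  obtain f where f: "ccinf f" "f 0 = (\<lambda>t. of_real t ^ n * d 0 t)" using ccinf_times_power[OF d] by blast
  show "(e n has_vector_derivative e (Suc n) t) (at t)" for t
  proof -
   have "(ltr (f 0) has_field_derivative ltr (\<lambda>t. of_real t * f 0 t) (c * of_real t)) (at (c * of_real t))"
    by (rule ltr_has_derivative[OF f(1)])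
   moreover have "((\<lambda>u. c * u) has_field_derivative c) (at (of_real t))" by (auto intro!: derivative_eq_intros)
   ultimately have "((\<lambda>u. ltr (f 0) (c * u)) has_field_derivative ltr (\<lambda>t. of_real t * f 0 t) (c * of_real t) * c) (at (of_real t))"
    by (rule DERIV_chain2)
   from has_vector_derivative_mult_right[OF has_vector_derivative_real_field[OF this], of "K * c ^ n"]
   show ?thesis by (simp add: e_def f(2) mult_ac)
  qed
  fix k
  obtain C where C: "\<forall>z. \<bar>Re z\<bar> \<le> 0 \<longrightarrow> cmod (ltr (f 0) z) * (1 + \<bar>Im z\<bar>) ^ k \<le> C"
   using ltr_decay_strip[OF f(1)] by blast
  have c1: "cmod c = 1" "Re (c * of_real t) = 0" "\<bar>Im (c * of_real t)\<bar> = \<bar>t\<bar>" for t using c by auto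
  have "\<bar>t\<bar> ^ k * norm (e n t) \<le> cmod K * C" for t
  proof -
   have "\<bar>t\<bar> ^ k * norm (e n t) = cmod K * (cmod (ltr (f 0) (c * of_real t)) * \<bar>t\<bar> ^ k)"
    by (simp add: e_def f(2) norm_mult norm_power c1)
   also have "\<dots> \<le> cmod K * (cmod (ltr (f 0) (c * of_real t)) * (1 + \<bar>t\<bar>) ^ k)"
    by (intro mult_left_mono power_mono) auto
   also have "\<dots> \<le> cmod K * C" using C[rule_format, of "c * of_real t"] c1 by (intro mult_left_mono) auto
   finally show ?thesis .
  qed
  then show "\<exists>C. \<forall>t. \<bar>t\<bar> ^ k * norm (e n t) \<le> C" by blast
 qed auto
qed

lemma integrable_inverse_square: "integrable lborel (\<lambda>t::real. inverse (1 + t\<^sup>2))"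
 using integrable_inverse_1_plus_square by (simp add: set_integrable_def einterval_def)

text \<open>
 Quadratic decay of all derivatives is the part of the Schwartz condition that Fourier inversion
 uses.
\<close>
definition rapid :: "(nat \<Rightarrow> real \<Rightarrow> complex) \<Rightarrow> bool" where
 "rapid d \<longleftrightarrow> deriv_chain d \<and> (\<forall>n. \<exists>C. \<forall>t. (1 + t\<^sup>2) * cmod (d n t) \<le> C)"

lemma schwartz_rapid:
 assumes "\<phi> \<in> schwartz (UNIV :: complex set)"
 shows "\<exists>d. rapid d \<and> d 0 = \<phi>"
proof -
 obtain d where d: "d 0 = \<phi>" "\<forall>n t. (d n has_vector_derivative d (Suc n) t) (at t)"
  and b: "\<forall>n k. \<exists>C. \<forall>t. \<bar>t\<bar> ^ k * norm (d n t) \<le> C"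
  using assms unfolding schwartz_def by blast
 have "\<exists>C. \<forall>t. (1 + t\<^sup>2) * cmod (d n t) \<le> C" for n
 proof -
  obtain C0 C2 where "\<forall>t. \<bar>t\<bar> ^ 0 * norm (d n t) \<le> C0" "\<forall>t. \<bar>t\<bar> ^ 2 * norm (d n t) \<le> C2"
   using b by metis
  then have "(1 + t\<^sup>2) * cmod (d n t) \<le> C0 + C2" for t
   using add_mono[of "norm (d n t)" C0 "\<bar>t\<bar> ^ 2 * norm (d n t)" C2] by (simp add: distrib_right)
  then show ?thesis by blast
 qed
 with d show ?thesis by (auto simp: rapid_def deriv_chain_def)
qed

lemma rapid_bound:
 assumes "rapid d"
 obtains C where "0 \<le> C" "\<forall>t. cmod (d n t) \<le> C * inverse (1 + t\<^sup>2)"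
proof -
 obtain C where C: "\<forall>t. (1 + t\<^sup>2) * cmod (d n t) \<le> C" using assms by (auto simp: rapid_def)
 have p: "0 < 1 + t\<^sup>2" for t :: real by (rule add_pos_nonneg) auto
 have "0 \<le> (1 + 0\<^sup>2) * cmod (d n 0)" by simp
 also have "\<dots> \<le> C" using C by blast
 finally have "0 \<le> C" .
 moreover have "\<forall>t. cmod (d n t) \<le> C * inverse (1 + t\<^sup>2)"
  using C p by (simp add: field_simps)
 ultimately show ?thesis using that by blast
qed

lemma rapid_integrable:
 assumes d: "rapid d" and k: "k \<in> borel_measurable borel" "\<And>t. cmod (k t) \<le> 1"
 shows "integrable lborel (\<lambda>t. k t * d n t)"
proof -
 obtain C where C: "0 \<le> C" "\<forall>t. cmod (d n t) \<le> C * inverse (1 + t\<^sup>2)" by (rule rapid_bound[OF d])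
 have m: "d n \<in> borel_measurable borel" using d by (intro deriv_chain_borel) (simp add: rapid_def)
 show ?thesis
 proof (rule integrable_dom[OF integrable_mult_right[OF integrable_inverse_square, of C]])
  show "(\<lambda>t. k t * d n t) \<in> borel_measurable lborel" using m k(1) by simp
  have "norm (k t * d n t) \<le> norm (C * inverse (1 + t\<^sup>2))" for t
  proof -
   have "norm (k t * d n t) \<le> 1 * cmod (d n t)" unfolding norm_mult by (rule mult_right_mono[OF k(2)]) simp
   also have "\<dots> \<le> C * inverse (1 + t\<^sup>2)" using C(2) by simp
   also have "\<dots> \<le> norm (C * inverse (1 + t\<^sup>2))" by simp
   finally show ?thesis .
  qed
  then show "AE t in lborel. norm (k t * d n t) \<le> norm (C * inverse (1 + t\<^sup>2))" by simp
 qed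
qed

lemma rapid_integrable0: "rapid d \<Longrightarrow> integrable lborel (d n)"
 using rapid_integrable[of d "\<lambda>_. 1" n] by simp

lemma rapid_exp_integrable: "rapid d \<Longrightarrow> Re z = 0 \<Longrightarrow> integrable lborel (\<lambda>t. exp (z * of_real t) * d n t)"
 by (rule rapid_integrable) auto

lemma rapid_ltr_deriv:
 assumes d: "rapid d" and z: "Re z = 0"
 shows "ltr (d (Suc n)) z = - z * ltr (d n) z"
 unfolding ltr_def
proof (rule exp_parts)
 obtain C where C: "0 \<le> C" "\<forall>t. cmod (d n t) \<le> C * inverse (1 + t\<^sup>2)" by (rule rapid_bound[OF d])
 have le: "norm (exp (z * of_real t) * d n t) \<le> C * inverse (1 + t\<^sup>2)" for t
  using C z by (simp add: norm_mult)
 have l1: "((\<lambda>t::real. C * inverse (1 + t\<^sup>2)) \<longlongrightarrow> 0) at_top" by real_asymp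
 have l2: "((\<lambda>t::real. C * inverse (1 + t\<^sup>2)) \<longlongrightarrow> 0) at_bot" by real_asymp
 show "((\<lambda>t. exp (z * of_real t) * d n t) \<longlongrightarrow> 0) at_top"
  by (rule Lim_null_comparison[OF _ l1]) (use le in simp)
 show "((\<lambda>t. exp (z * of_real t) * d n t) \<longlongrightarrow> 0) at_bot"
  by (rule Lim_null_comparison[OF _ l2]) (use le in simp)
qed (use d rapid_exp_integrable[OF d z] deriv_chain_isCont[of d] in \<open>auto simp: rapid_def deriv_chain_def\<close>)

lemma rapid_ltr_decay:
 assumes d: "rapid d"
 shows "\<exists>C\<ge>0. \<forall>z. Re z = 0 \<longrightarrow> cmod (ltr (d 0) z) \<le> C * inverse (1 + (Im z)\<^sup>2)"
proof -
 let ?I = "\<lambda>n. \<integral>t. cmod (d n t) \<partial>lborel"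
 have b: "cmod (ltr (d n) z) \<le> ?I n" if z: "Re z = 0" for n z
 proof -
  have "cmod (ltr (d n) z) \<le> (LBINT t. cmod (exp (z * of_real t) * d n t))"
   unfolding ltr_def by (rule integral_norm_bound)
  then show ?thesis using z by (simp add: norm_mult)
 qed
 have nn: "0 \<le> ?I n" for n by simp
 have "cmod (ltr (d 0) z) \<le> (?I 0 + ?I 2) * inverse (1 + (Im z)\<^sup>2)" if z: "Re z = 0" for z
 proof -
  have "ltr (d 2) z = z\<^sup>2 * ltr (d 0) z"
   using rapid_ltr_deriv[OF d z, of 0] rapid_ltr_deriv[OF d z, of 1]
   by (simp add: power2_eq_square numeral_2_eq_2)
  moreover have "cmod z = \<bar>Im z\<bar>" using z by (simp add: cmod_def)
  ultimately have "(Im z)\<^sup>2 * cmod (ltr (d 0) z) = cmod (ltr (d 2) z)" by (simp add: norm_mult norm_power)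
  then have "(1 + (Im z)\<^sup>2) * cmod (ltr (d 0) z) \<le> ?I 0 + ?I 2"
   using b[OF z, of 0] b[OF z, of 2] by (simp add: distrib_right)
  moreover have "0 < 1 + (Im z)\<^sup>2" by (rule add_pos_nonneg) auto
  ultimately show ?thesis by (simp add: field_simps)
 qed
 then show ?thesis using nn by (intro exI[of _ "?I 0 + ?I 2"]) auto
qed

lemma fourier_lborel:
 assumes "integrable lborel f"
 shows "fourier f \<xi> = ltr f (- \<i> * of_real \<xi>)" "inv_fourier f \<xi> = (1 / (2 * pi)) *\<^sub>R ltr f (\<i> * of_real \<xi>)"
proof -
 have m[measurable]: "f \<in> borel_measurable borel" using borel_measurable_integrable[OF assms] by simp
 have i: "integrable lborel (\<lambda>t. exp (z * of_real t) * f t)" if "Re z = 0" for z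
  by (rule integrable_dom[OF assms]) (use that in \<open>auto simp: norm_mult\<close>)
 have b: "Bochner (\<lambda>t. exp (z * of_real t) * f t) = ltr f z" if "Re z = 0" for z
 proof -
  have m: "(\<lambda>t. exp (z * of_real t) * f t) \<in> borel_measurable borel" by measurable
  have "integrable lebesgue (\<lambda>t. exp (z * of_real t) * f t)"
   using lebesgue_lborel(2)[OF m] i[OF that] by blast
  then show ?thesis
   unfolding ltr_def lebesgue_lborel(1)[OF m, symmetric] by (intro Bochner_complex(2) bint_complex)
 qed
 show "fourier f \<xi> = ltr f (- \<i> * of_real \<xi>)"
  using b[of "- \<i> * of_real \<xi>"] unfolding fourier_def scaleC_complex_def by simp
 show "inv_fourier f \<xi> = (1 / (2 * pi)) *\<^sub>R ltr f (\<i> * of_real \<xi>)"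
 proof -
  have "(\<lambda>s. exp (\<i> * of_real s * of_real \<xi>) * f s) = (\<lambda>t. exp (\<i> * of_real \<xi> * of_real t) * f t)"
   by (simp only: mult_ac)
  then show ?thesis
   using b[of "\<i> * of_real \<xi>"] unfolding inv_fourier_def scaleC_complex_def by simp
 qed
qed

lemma gaussian_transform:
 "(LBINT x. std_normal_density x *\<^sub>R exp (\<i> * of_real (t * x))) = complex_of_real (exp (- (t\<^sup>2) / 2))"
proof -
 have "char std_normal_distribution t = (LBINT x. std_normal_density x *\<^sub>R exp (\<i> * of_real (t * x)))"
  unfolding char_def by (subst integral_density) (auto simp: normal_density_nonneg)
 then show ?thesis using char_std_normal_distribution by simp
qed

text \<open>
 Gaussian regularisation: with the factor \<open>exp (- (e * \<xi>)\<^sup>2 / 2)\<close> inserted, the integrals may be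
 interchanged, and the inner one is the average of \<open>\<phi>\<close> against a normal density of variance \<open>e\<^sup>2\<close>
 centred at \<open>t\<close>.
\<close>
lemma fourier_inversion:
 fixes \<phi> :: "real \<Rightarrow> complex"
 assumes c: "\<And>t. isCont \<phi> t" and b: "\<And>t. cmod (\<phi> t) \<le> C" and i: "integrable lborel \<phi>"
  and ig: "integrable lborel (\<lambda>\<xi>. ltr \<phi> (\<i> * of_real \<xi>))"
 shows "(LBINT \<xi>. ltr \<phi> (\<i> * of_real \<xi>) * exp (- \<i> * of_real \<xi> * of_real t)) = of_real (2 * pi) * \<phi> t"
proof -
 define e where "e n = inverse (real (Suc n))" for n
 have e: "0 < e n" for n by (simp add: e_def)
 have e0: "e \<longlonglongrightarrow> 0" unfolding e_def by (rule LIMSEQ_inverse_real_of_nat)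
 note [measurable] = borel_measurable_integrable[OF i, simplified] borel_measurable_integrable[OF ig, simplified]
 let ?g = "\<lambda>\<xi>. ltr \<phi> (\<i> * of_real \<xi>)"
 let ?G = "\<lambda>n \<xi>. complex_of_real (exp (- ((e n * \<xi>)\<^sup>2) / 2))"
 have lhs: "(\<lambda>n. \<integral>\<xi>. (?g \<xi> * exp (- \<i> * of_real \<xi> * of_real t)) * ?G n \<xi> \<partial>lborel) \<longlonglongrightarrow>
   (LBINT \<xi>. ?g \<xi> * exp (- \<i> * of_real \<xi> * of_real t))"
 proof (rule integral_dominated_convergence[where w="\<lambda>\<xi>. cmod (?g \<xi>)"])
  show "AE \<xi> in lborel. (\<lambda>n. (?g \<xi> * exp (- \<i> * of_real \<xi> * of_real t)) * ?G n \<xi>) \<longlonglongrightarrow> ?g \<xi> * exp (- \<i> * of_real \<xi> * of_real t)"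
  proof (rule AE_I2)
   fix \<xi> :: real
   have "(\<lambda>n. (?g \<xi> * exp (- \<i> * of_real \<xi> * of_real t)) * ?G n \<xi>) \<longlonglongrightarrow>
     (?g \<xi> * exp (- \<i> * of_real \<xi> * of_real t)) * complex_of_real (exp (- ((0 * \<xi>)\<^sup>2) / 2))"
    by (intro tendsto_intros e0) auto
   then show "(\<lambda>n. (?g \<xi> * exp (- \<i> * of_real \<xi> * of_real t)) * ?G n \<xi>) \<longlonglongrightarrow> ?g \<xi> * exp (- \<i> * of_real \<xi> * of_real t)"
    by simp
  qed
  show "AE \<xi> in lborel. norm ((?g \<xi> * exp (- \<i> * of_real \<xi> * of_real t)) * ?G n \<xi>) \<le> cmod (?g \<xi>)" for n
   by (rule AE_I2) (simp add: norm_mult mult_left_le)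
 qed (use ig in auto)
 have rhs: "(\<lambda>n. \<integral>v. std_normal_density v *\<^sub>R \<phi> (t + e n * v) \<partial>lborel) \<longlonglongrightarrow> (LBINT v. std_normal_density v *\<^sub>R \<phi> t)"
 proof (rule integral_dominated_convergence[where w="\<lambda>v. std_normal_density v * C"])
  show "AE v in lborel. (\<lambda>n. std_normal_density v *\<^sub>R \<phi> (t + e n * v)) \<longlonglongrightarrow> std_normal_density v *\<^sub>R \<phi> t"
  proof (rule AE_I2)
   fix v :: real
   have "(\<lambda>n. t + e n * v) \<longlonglongrightarrow> t + 0 * v" by (intro tendsto_intros e0)
   then have "(\<lambda>n. t + e n * v) \<longlonglongrightarrow> t" by simp
   from isCont_tendsto_compose[OF c this]
   show "(\<lambda>n. std_normal_density v *\<^sub>R \<phi> (t + e n * v)) \<longlonglongrightarrow> std_normal_density v *\<^sub>R \<phi> t"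
    by (intro tendsto_intros)
  qed
  show "AE v in lborel. norm (std_normal_density v *\<^sub>R \<phi> (t + e n * v)) \<le> std_normal_density v * C" for n
   by (rule AE_I2) (simp add: b mult_left_mono)
 qed auto
 have eq: "(LBINT \<xi>. (?g \<xi> * exp (- \<i> * of_real \<xi> * of_real t)) * ?G n \<xi>) =
   of_real (2 * pi) * (LBINT v. std_normal_density v *\<^sub>R \<phi> (t + e n * v))" for n
 proof -
  define P where "P = (\<lambda>(\<xi>, s). ?G n \<xi> * \<phi> s * exp (\<i> * of_real (\<xi> * (s - t))))"
  have iG: "integrable lborel (?G n)"
  proof -
   have "integrable lborel (\<lambda>\<xi>. std_normal_density (0 + e n * \<xi>))"
    by (rule lborel_integrable_real_affine) (use e[of n] in auto)
   then have "integrable lborel (\<lambda>\<xi>. complex_of_real (sqrt (2 * pi) * std_normal_density (0 + e n * \<xi>)))"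
    by (intro integrable_of_real integrable_mult_right)
   then show ?thesis by (simp add: std_normal_density_def)
  qed
  have P: "integrable (lborel2) P"
  proof (rule integrable_dom[OF product_integrable[OF iG i]])
   show "P \<in> borel_measurable (lborel2)" unfolding P_def by measurable
   show "AE z in lborel2. norm (P z) \<le> norm (case z of (x, y) \<Rightarrow> ?G n x * \<phi> y)"
    by (rule AE_I2) (auto simp: P_def norm_mult)
  qed
  have in1: "(LBINT s. P (\<xi>, s)) = (?g \<xi> * exp (- \<i> * of_real \<xi> * of_real t)) * ?G n \<xi>" for \<xi>
  proof -
   have eqP: "P (\<xi>, s) = (?G n \<xi> * exp (- \<i> * of_real \<xi> * of_real t)) * (exp (\<i> * of_real \<xi> * of_real s) * \<phi> s)" for s
   proof -
    have "exp (\<i> * of_real (\<xi> * (s - t))) = exp (- \<i> * of_real \<xi> * of_real t) * exp (\<i> * of_real \<xi> * of_real s)"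
     by (simp add: exp_add[symmetric] algebra_simps)
    then show ?thesis by (simp add: P_def mult_ac)
   qed
   show ?thesis unfolding eqP integral_mult_right_zero ltr_def by (simp only: mult_ac)
  qed
  have in2: "(LBINT \<xi>. P (\<xi>, s)) = of_real (2 * pi / e n) * (of_real (std_normal_density ((s - t) / e n)) * \<phi> s)" for s
  proof -
   have "(LBINT \<xi>. ?G n \<xi> * exp (\<i> * of_real (\<xi> * (s - t)))) =
     \<bar>1 / e n\<bar> *\<^sub>R (LBINT x. ?G n (0 + 1 / e n * x) * exp (\<i> * of_real ((0 + 1 / e n * x) * (s - t))))"
    by (rule lborel_integral_real_affine) (use e[of n] in auto)
   also have "(\<lambda>x. ?G n (0 + 1 / e n * x) * exp (\<i> * of_real ((0 + 1 / e n * x) * (s - t)))) =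
     (\<lambda>x. of_real (sqrt (2 * pi)) * (std_normal_density x *\<^sub>R exp (\<i> * of_real ((s - t) / e n * x))))"
    using e[of n] by (auto simp: std_normal_density_def scaleR_conv_of_real mult_ac)
   also have "(LBINT x. of_real (sqrt (2 * pi)) * (std_normal_density x *\<^sub>R exp (\<i> * of_real ((s - t) / e n * x))))
     = of_real (sqrt (2 * pi)) * complex_of_real (exp (- (((s - t) / e n)\<^sup>2) / 2))"
    by (simp only: integral_mult_right_zero gaussian_transform)
   also have "exp (- (((s - t) / e n)\<^sup>2) / 2) = sqrt (2 * pi) * std_normal_density ((s - t) / e n)"
    by (simp add: std_normal_density_def)
   also have "\<bar>1 / e n\<bar> *\<^sub>R (complex_of_real (sqrt (2 * pi)) * complex_of_real (sqrt (2 * pi) * std_normal_density ((s - t) / e n)))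
     = of_real (2 * pi / e n) * of_real (std_normal_density ((s - t) / e n))"
   proof -
    have "sqrt (2 * pi) * (sqrt (2 * pi) * y) = 2 * pi * y" for y
     by (simp add: mult.assoc[symmetric] del: real_sqrt_mult)
    then show ?thesis using e[of n]
     by (simp add: scaleR_conv_of_real flip: of_real_mult del: real_sqrt_mult)
   qed
   finally have *: "(LBINT \<xi>. ?G n \<xi> * exp (\<i> * of_real (\<xi> * (s - t)))) = of_real (2 * pi / e n) * of_real (std_normal_density ((s - t) / e n))" .
   have "(LBINT \<xi>. P (\<xi>, s)) = (LBINT \<xi>. (?G n \<xi> * exp (\<i> * of_real (\<xi> * (s - t)))) * \<phi> s)"
    unfolding P_def by (simp only: prod.case mult_ac)
   then show ?thesis unfolding integral_mult_left_zero * by (simp only: mult.assoc)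
  qed
  have "(LBINT \<xi>. (?g \<xi> * exp (- \<i> * of_real \<xi> * of_real t)) * ?G n \<xi>) = (LBINT \<xi>. (LBINT s. P (\<xi>, s)))"
   unfolding in1 ..
  also have "\<dots> = (LBINT s. (LBINT \<xi>. P (\<xi>, s)))"
   using pair_swap_integral[of "\<lambda>\<xi> s. P (\<xi>, s)"] P by simp
  also have "\<dots> = of_real (2 * pi / e n) * (LBINT s. of_real (std_normal_density ((s - t) / e n)) * \<phi> s)"
   unfolding in2 by (rule integral_mult_right_zero)
  also have "(LBINT s. of_real (std_normal_density ((s - t) / e n)) * \<phi> s) =
    \<bar>e n\<bar> *\<^sub>R (LBINT v. of_real (std_normal_density ((t + e n * v - t) / e n)) * \<phi> (t + e n * v))"
   by (rule lborel_integral_real_affine) (use e[of n] in auto)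
  also have "of_real (2 * pi / e n) * \<dots> = of_real (2 * pi) * (LBINT v. std_normal_density v *\<^sub>R \<phi> (t + e n * v))"
   using e[of n] by (simp add: scaleR_conv_of_real)
  finally show ?thesis .
 qed
 have "(\<lambda>n. of_real (2 * pi) * (LBINT v. std_normal_density v *\<^sub>R \<phi> (t + e n * v))) \<longlonglongrightarrow>
   of_real (2 * pi) * (LBINT v. std_normal_density v *\<^sub>R \<phi> t)"
  by (intro tendsto_intros rhs)
 moreover have "(LBINT v. std_normal_density v *\<^sub>R \<phi> t) = \<phi> t"
  unfolding integral_scaleR_complex by simp
 ultimately show ?thesis using lhs unfolding eq by (simp add: LIMSEQ_unique)
qed

lemma ccinf_rapid: "ccinf d \<Longrightarrow> rapid d"
proof -
 assume d: "ccinf d"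
 have "\<exists>C. \<forall>t. (1 + t\<^sup>2) * cmod (d n t) \<le> C" for n
 proof -
  obtain r where r: "0 < r" "\<forall>n t. r < \<bar>t\<bar> \<longrightarrow> d n t = 0" by (rule ccinf_support[OF d])
  obtain C where C: "\<forall>t. cmod (d n t) \<le> C" using ccinf_bounded[OF d] by blast
  have C0: "0 \<le> C" using C[rule_format, of 0] norm_ge_zero order_trans by blast
  have "(1 + t\<^sup>2) * cmod (d n t) \<le> (1 + r\<^sup>2) * C" for t
  proof (cases "\<bar>t\<bar> \<le> r")
   case True
   then have "t\<^sup>2 \<le> r\<^sup>2" by (metis abs_ge_zero power2_abs power_mono)
   then show ?thesis using C by (intro mult_mono) auto
  qed (use r C0 in auto)
  then show ?thesis by blast
 qed
 with d show "rapid d" by (simp add: rapid_def ccinf_def)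
qed

lemma rapid_inversion:
 assumes d: "rapid d"
 shows "integrable lborel (inv_fourier (d 0))"
  "d 0 t = (LBINT \<xi>. inv_fourier (d 0) \<xi> * exp (- \<i> * of_real \<xi> * of_real t))"
proof -
 have ch: "deriv_chain d" using d by (simp add: rapid_def)
 note c = deriv_chain_isCont[OF ch]
 note i = rapid_integrable0[OF d, of 0]
 obtain C where C: "0 \<le> C" "\<forall>t. cmod (d 0 t) \<le> C * inverse (1 + t\<^sup>2)" by (rule rapid_bound[OF d])
 have b: "cmod (d 0 t) \<le> C" for t
 proof -
  have "C * inverse (1 + t\<^sup>2) \<le> C * 1" by (rule mult_left_mono[OF _ C(1)]) (simp add: inverse_le_1_iff)
  then show ?thesis using C(2)[rule_format, of t] by simp
 qed
 have m: "(\<lambda>\<xi>. ltr (d 0) (\<i> * of_real \<xi>)) \<in> borel_measurable borel"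
  unfolding ltr_def using deriv_chain_borel[OF ch, of 0] by measurable
 obtain K where K: "0 \<le> K" "\<forall>z. Re z = 0 \<longrightarrow> cmod (ltr (d 0) z) \<le> K * inverse (1 + (Im z)\<^sup>2)"
  using rapid_ltr_decay[OF d] by blast
 have ig: "integrable lborel (\<lambda>\<xi>. ltr (d 0) (\<i> * of_real \<xi>))"
 proof (rule integrable_dom[OF integrable_mult_right[OF integrable_inverse_square, of K]])
  show "AE \<xi> in lborel. norm (ltr (d 0) (\<i> * of_real \<xi>)) \<le> norm (K * inverse (1 + \<xi>\<^sup>2))"
  proof (rule AE_I2)
   fix \<xi> :: real
   have "norm (ltr (d 0) (\<i> * of_real \<xi>)) \<le> K * inverse (1 + \<xi>\<^sup>2)"
    using K(2)[rule_format, of "\<i> * of_real \<xi>"] by simp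
   also have "\<dots> \<le> norm (K * inverse (1 + \<xi>\<^sup>2))" by simp
   finally show "norm (ltr (d 0) (\<i> * of_real \<xi>)) \<le> norm (K * inverse (1 + \<xi>\<^sup>2))" .
  qed
 qed (use m in simp)
 show "integrable lborel (inv_fourier (d 0))"
  using ig by (simp add: fourier_lborel(2)[OF i, abs_def])
 have "(LBINT \<xi>. inv_fourier (d 0) \<xi> * exp (- \<i> * of_real \<xi> * of_real t)) =
   (LBINT \<xi>. of_real (1 / (2 * pi)) * (ltr (d 0) (\<i> * of_real \<xi>) * exp (- \<i> * of_real \<xi> * of_real t)))"
  unfolding fourier_lborel(2)[OF i] scaleR_conv_of_real by (simp only: mult.assoc)
 also have "\<dots> = d 0 t"
  unfolding integral_mult_right_zero fourier_inversion[OF c b i ig] by simp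
 finally show "d 0 t = (LBINT \<xi>. inv_fourier (d 0) \<xi> * exp (- \<i> * of_real \<xi> * of_real t))" by simp
qed

text \<open>
 The form in which Fourier inversion is used: a multiplier that is itself a Fourier transform
 acts by convolution. It covers both representations of the multiplier by the semigroup and
 the kernels in the case of bounded functions.
\<close>
lemma inversion_convolution:
 fixes h :: "real \<times> real \<Rightarrow> complex"
 assumes g: "integrable lborel g"
  and \<phi>: "\<And>t. \<phi> t = (LBINT \<xi>. g \<xi> * exp (- \<i> * of_real \<xi> * of_real t))"
  and h: "integrable (lborel2) h"
 shows "(LBINT \<xi>. g \<xi> * (\<integral>z. exp (- \<i> * of_real \<xi> * of_real (fst z + snd z)) * h z \<partial>lborel2)) =
  (\<integral>z. \<phi> (fst z + snd z) * h z \<partial>lborel2)"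
proof -
 interpret pair_sigma_finite lborel "lborel2 :: (real \<times> real) measure"
  by (intro pair_sigma_finite.intro lborel.sigma_finite_measure_axioms lborel_pair.P.sigma_finite_measure_axioms)
 have mg[measurable]: "g \<in> borel_measurable borel" using borel_measurable_integrable[OF g] by simp
 have mh[measurable]: "h \<in> borel_measurable (borel \<Otimes>\<^sub>M borel)"
  using borel_measurable_integrable[OF h] by (simp cong: measurable_cong_sets sets_pair_measure_cong)
 define P where "P = (\<lambda>(\<xi>, z). g \<xi> * (exp (- \<i> * of_real \<xi> * of_real (fst z + snd z)) * h z))"
 have sp: "sets (lborel \<Otimes>\<^sub>M (lborel2) :: (real \<times> real \<times> real) measure) = sets (borel \<Otimes>\<^sub>M (borel \<Otimes>\<^sub>M borel))"
  by (intro sets_pair_measure_cong) auto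
 have P: "integrable (lborel \<Otimes>\<^sub>M (lborel2)) P"
 proof (rule Fubini_integrable)
  have "P \<in> borel_measurable (borel \<Otimes>\<^sub>M (borel \<Otimes>\<^sub>M borel))" unfolding P_def by measurable
  then show "P \<in> borel_measurable (lborel \<Otimes>\<^sub>M (lborel2))"
   using sp by (simp cong: measurable_cong_sets)
  have "norm (P (\<xi>, z)) = norm (g \<xi>) * norm (h z)" for \<xi> z by (simp add: P_def norm_mult)
  then show "integrable lborel (\<lambda>\<xi>. \<integral>z. norm (P (\<xi>, z)) \<partial>lborel2)" using g by simp
  have "integrable (lborel2) (\<lambda>z. exp (- \<i> * of_real \<xi> * of_real (fst z + snd z)) * h z)" for \<xi>
  proof (rule integrable_dom[OF h])
   have "(\<lambda>z. exp (- \<i> * of_real \<xi> * of_real (fst z + snd z)) * h z) \<in> borel_measurable (borel \<Otimes>\<^sub>M borel)" by measurable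
   then show "(\<lambda>z. exp (- \<i> * of_real \<xi> * of_real (fst z + snd z)) * h z) \<in> borel_measurable (lborel2)"
    by (simp cong: measurable_cong_sets sets_pair_measure_cong)
  qed (simp add: norm_mult)
  then show "AE \<xi> in lborel. integrable (lborel2) (\<lambda>z. P (\<xi>, z))" by (simp add: P_def)
 qed
 have "(LBINT \<xi>. (\<integral>z. P (\<xi>, z) \<partial>lborel2)) = (\<integral>z. (LBINT \<xi>. P (\<xi>, z)) \<partial>lborel2)"
  using Fubini_integral[of "\<lambda>\<xi> z. P (\<xi>, z)"] P by simp
 moreover have "(LBINT \<xi>. P (\<xi>, z)) = \<phi> (fst z + snd z) * h z" for z
 proof -
  have "(LBINT \<xi>. P (\<xi>, z)) = (LBINT \<xi>. (g \<xi> * exp (- \<i> * of_real \<xi> * of_real (fst z + snd z))) * h z)"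
   unfolding P_def by (simp only: prod.case mult.assoc)
  then show ?thesis unfolding integral_mult_left_zero \<phi> .
 qed
 moreover have "(\<integral>z. P (\<xi>, z) \<partial>lborel2) = g \<xi> * (\<integral>z. exp (- \<i> * of_real \<xi> * of_real (fst z + snd z)) * h z \<partial>lborel2)" for \<xi>
  unfolding P_def prod.case by (rule integral_mult_right_zero)
 ultimately show ?thesis by simp
qed

text \<open>The polynomials with \<open>(d/dt)\<^sup>n exp (- 1 / t) = p\<^sub>n (1 / t) * exp (- 1 / t)\<close>.\<close>
primrec flat_poly :: "nat \<Rightarrow> real poly" where
 "flat_poly 0 = 1"
| "flat_poly (Suc n) = [:0, 0, 1:] * (flat_poly n - pderiv (flat_poly n))"

definition flat :: "nat \<Rightarrow> real \<Rightarrow> real" where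
 "flat n t = (if 0 < t then poly (flat_poly n) (1 / t) * exp (- (1 / t)) else 0)"

lemma poly_times_exp_tendsto_zero:
 "((\<lambda>y::real. poly p y * exp (- y)) \<longlongrightarrow> 0) at_top"
proof -
 have "((\<lambda>y::real. \<Sum>i\<le>degree p. coeff p i * (y ^ i / exp y)) \<longlongrightarrow> (\<Sum>i\<le>degree p. coeff p i * 0)) at_top"
  by (intro tendsto_sum tendsto_mult tendsto_const tendsto_power_div_exp_0)
 then show ?thesis
  by (simp add: poly_altdef sum_distrib_right exp_minus divide_inverse mult.assoc)
qed

lemma flat_derivative: "(flat n has_real_derivative flat (Suc n) t) (at t)"
proof -
 consider "0 < t" | "t < 0" | "t = 0" by linarith
 then show ?thesis
 proof cases
  case 1
  have "((\<lambda>t. poly (flat_poly n) (1 / t) * exp (- (1 / t))) has_real_derivative flat (Suc n) t) (at t)"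
  proof (rule DERIV_cong)
   have d: "((\<lambda>t. 1 / t) has_real_derivative - (1 / t\<^sup>2)) (at t)"
    using 1 by (auto intro!: derivative_eq_intros simp: power2_eq_square)
   have "((\<lambda>t. poly (flat_poly n) (1 / t)) has_real_derivative poly (pderiv (flat_poly n)) (1 / t) * - (1 / t\<^sup>2)) (at t)"
    by (rule DERIV_chain2[OF poly_DERIV d])
   moreover have "((\<lambda>t. exp (- (1 / t))) has_real_derivative exp (- (1 / t)) * (- (- (1 / t\<^sup>2)))) (at t)"
    by (rule DERIV_chain2[OF DERIV_exp DERIV_minus[OF d]])
   ultimately show "((\<lambda>t. poly (flat_poly n) (1 / t) * exp (- (1 / t))) has_real_derivative
    (poly (pderiv (flat_poly n)) (1 / t) * - (1 / t\<^sup>2)) * exp (- (1 / t)) + (exp (- (1 / t)) * (- (- (1 / t\<^sup>2)))) * poly (flat_poly n) (1 / t)) (at t)"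
    by (rule DERIV_mult)
   show "(poly (pderiv (flat_poly n)) (1 / t) * - (1 / t\<^sup>2)) * exp (- (1 / t)) + (exp (- (1 / t)) * (- (- (1 / t\<^sup>2)))) * poly (flat_poly n) (1 / t) = flat (Suc n) t"
    using 1 by (simp add: flat_def algebra_simps power2_eq_square)
  qed
  moreover have "\<forall>\<^sub>F t in nhds t. flat n t = poly (flat_poly n) (1 / t) * exp (- (1 / t))"
   using eventually_nhds_in_open[of "{0<..}" t] 1 by (auto elim!: eventually_mono simp: flat_def)
  ultimately show ?thesis by (subst DERIV_cong_ev[OF refl _ refl]) auto
 next
  case 2
  then have "\<forall>\<^sub>F t in nhds t. flat n t = 0"
   using eventually_nhds_in_open[of "{..<0}" t] by (auto elim!: eventually_mono simp: flat_def)
  then have "(flat n has_real_derivative 0) (at t)" by (subst DERIV_cong_ev[OF refl _ refl]) auto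
  with 2 show ?thesis by (simp add: flat_def)
 next
  case 3
  have l: "((\<lambda>h. flat n h / h) \<longlongrightarrow> 0) (at_left 0)"
  proof (rule Lim_transform_eventually[OF tendsto_const])
   show "\<forall>\<^sub>F h in at_left 0. 0 = flat n h / h" by (auto simp: eventually_at_filter flat_def)
  qed
  have "((\<lambda>h. poly (pCons 0 (flat_poly n)) (inverse h) * exp (- inverse h)) \<longlongrightarrow> 0) (at_right 0)"
   by (rule filterlim_compose[OF poly_times_exp_tendsto_zero filterlim_inverse_at_top_right])
  then have r: "((\<lambda>h. flat n h / h) \<longlongrightarrow> 0) (at_right 0)"
  proof (rule Lim_transform_eventually)
   show "\<forall>\<^sub>F h in at_right 0. poly (pCons 0 (flat_poly n)) (inverse h) * exp (- inverse h) = flat n h / h"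
    unfolding eventually_at_right_field
    by (intro exI[of _ 1]) (simp add: flat_def inverse_eq_divide)
  qed
  have "((\<lambda>h. flat n h / h) \<longlongrightarrow> 0) (at 0)" using l r by (simp add: filterlim_split_at)
  with 3 show ?thesis by (simp add: has_field_derivative_iff flat_def)
 qed
qed

lemma smooth_bump:
 obtains d and \<beta> :: "real \<Rightarrow> real" where "ccinf d" "d 0 = (\<lambda>t. of_real (\<beta> t))"
  "\<forall>t. 0 \<le> \<beta> t \<and> \<beta> t \<le> 1" "\<forall>t. t \<notin> {0<..<1} \<longrightarrow> \<beta> t = 0" "\<forall>t\<in>{0<..<1}. 0 < \<beta> t"
  "\<forall>n t. 1 < \<bar>t\<bar> \<longrightarrow> d n t = 0"
proof -
 define f where "f n t = complex_of_real (flat n t)" for n t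
 define g where "g n t = complex_of_real ((-1) ^ n * flat n (1 - t))" for n t
 define d where "d n t = (\<Sum>i\<le>n. of_nat (n choose i) * f i t * g (n - i) t)" for n t
 have cf: "deriv_chain f" unfolding deriv_chain_def f_def
  by (intro allI has_vector_derivative_of_real flat_derivative)
 have cg: "deriv_chain g" unfolding deriv_chain_def g_def
 proof (intro allI has_vector_derivative_of_real)
  fix n t
  have "((\<lambda>t. 1 - t) has_real_derivative - 1) (at t)" by (auto intro!: derivative_eq_intros)
  from DERIV_cmult[OF DERIV_chain2[OF flat_derivative this], of "(-1) ^ n" n]
  show "((\<lambda>t. (-1) ^ n * flat n (1 - t)) has_real_derivative (-1) ^ Suc n * flat (Suc n) (1 - t)) (at t)" by simp
 qed
 have z: "\<forall>n t. 1 < \<bar>t\<bar> \<longrightarrow> d n t = 0"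
 proof (intro allI impI)
  fix n t assume "1 < \<bar>t::real\<bar>"
  then have "f i t = 0 \<or> g j t = 0" for i j by (auto simp: f_def g_def flat_def)
  then show "d n t = 0" unfolding d_def by (intro sum.neutral) (metis mult_eq_0_iff)
 qed
 have cd: "ccinf d"
  unfolding ccinf_def using z deriv_chain_mult[OF cf cg] by (auto simp: d_def[abs_def])
 define \<beta> where "\<beta> t = flat 0 t * flat 0 (1 - t)" for t
 have f01: "0 \<le> flat 0 t" "flat 0 t \<le> 1" for t by (auto simp: flat_def)
 show ?thesis
 proof (rule that[OF cd _ _ _ _ z])
  show "d 0 = (\<lambda>t. of_real (\<beta> t))" by (simp add: d_def f_def g_def \<beta>_def fun_eq_iff)
  show "\<forall>t. 0 \<le> \<beta> t \<and> \<beta> t \<le> 1" using f01 by (auto simp: \<beta>_def intro: mult_le_one)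
  show "\<forall>t. t \<notin> {0<..<1} \<longrightarrow> \<beta> t = 0" by (auto simp: \<beta>_def flat_def)
  show "\<forall>t\<in>{0<..<1}. 0 < \<beta> t" by (auto simp: \<beta>_def flat_def)
 qed
qed

text \<open>
 Every smooth window of compact support is at once a Fourier transform and an inverse Fourier
 transform of Schwartz functions; translating the window only modulates these.
\<close>
lemma fourier_windows:
 assumes d: "ccinf d"
 shows "\<exists>\<phi> \<eta> b. 0 \<le> b \<and> (\<forall>S::real.
   \<phi> S \<in> schwartz UNIV \<and> \<eta> S \<in> schwartz UNIV \<and>
   (\<forall>\<xi>. inv_fourier (\<phi> S) \<xi> = d 0 (\<xi> - S)) \<and> (\<forall>\<xi>. fourier (\<eta> S) \<xi> = d 0 (\<xi> - S)) \<and>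
   (\<forall>t. cmod (\<phi> S t) \<le> b * inverse (1 + t\<^sup>2)) \<and> (\<forall>t. cmod (\<eta> S t) \<le> b * inverse (1 + t\<^sup>2)))"
proof -
 define dS where "dS S = (\<lambda>n t. of_real (1 ^ n) * d n (- S + 1 * t))" for S :: real
 have cS: "ccinf (dS S)" for S unfolding dS_def by (rule ccinf_affine[OF d]) simp
 have dS0: "dS S 0 \<xi> = d 0 (\<xi> - S)" for S \<xi> by (simp add: dS_def add.commute)
 define \<phi> where "\<phi> S = (\<lambda>t. 1 * ltr (dS S 0) (- \<i> * of_real t))" for S
 define \<eta> where "\<eta> S = (\<lambda>t. of_real (1 / (2 * pi)) * ltr (dS S 0) (\<i> * of_real t))" for S
 have sch: "\<phi> S \<in> schwartz UNIV" "\<eta> S \<in> schwartz UNIV" for S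
  unfolding \<phi>_def \<eta>_def by (intro ltr_schwartz cS; simp)+
 have shift: "ltr (dS S 0) z = exp (z * of_real S) * ltr (d 0) z" for S z
 proof -
  have "ltr (d 0) z = \<bar>1\<bar> *\<^sub>R (LBINT t. exp (z * of_real (- S + 1 * t)) * d 0 (- S + 1 * t))"
   unfolding ltr_def by (rule lborel_integral_real_affine) simp
  then have "exp (z * of_real S) * ltr (d 0) z = (LBINT t. exp (z * of_real S) * (exp (z * of_real (- S + 1 * t)) * d 0 (- S + 1 * t)))"
   by simp
  also have "\<dots> = (LBINT t. exp (z * of_real t) * dS S 0 t)"
  proof (rule integral_eqI[OF refl])
   fix t
   have "exp (z * of_real S) * exp (z * of_real (- S + 1 * t)) = exp (z * of_real t)"
    by (simp add: exp_add[symmetric] algebra_simps)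
   then show "exp (z * of_real S) * (exp (z * of_real (- S + 1 * t)) * d 0 (- S + 1 * t)) = exp (z * of_real t) * dS S 0 t"
    by (simp add: dS_def mult.assoc[symmetric])
  qed
  finally show ?thesis by (simp add: ltr_def)
 qed
 obtain C where C: "0 \<le> C" "\<forall>z. Re z = 0 \<longrightarrow> cmod (ltr (d 0) z) \<le> C * inverse (1 + (Im z)\<^sup>2)"
  using rapid_ltr_decay[OF ccinf_rapid[OF d]] by blast
 have b1: "cmod (\<phi> S t) \<le> C * inverse (1 + t\<^sup>2)" for S t
 proof -
  have "cmod (\<phi> S t) = cmod (ltr (d 0) (- \<i> * of_real t))" by (simp add: \<phi>_def shift norm_mult)
  then show ?thesis using C(2)[rule_format, of "- \<i> * of_real t"] by simp
 qed
 have b2: "cmod (\<eta> S t) \<le> C * inverse (1 + t\<^sup>2)" for S t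
 proof -
  have "cmod (\<eta> S t) = 1 / (2 * pi) * cmod (ltr (d 0) (\<i> * of_real t))"
   by (simp add: \<eta>_def shift norm_mult norm_divide)
  also have "\<dots> \<le> 1 * cmod (ltr (d 0) (\<i> * of_real t))"
   using pi_gt3 by (intro mult_right_mono) auto
  finally show ?thesis using C(2)[rule_format, of "\<i> * of_real t"] by simp
 qed
 have intS: "integrable lborel (\<phi> S)" "integrable lborel (\<eta> S)" for S
 proof -
  obtain e where "rapid e" "e 0 = \<phi> S" using schwartz_rapid[OF sch(1)] by blast
  then show "integrable lborel (\<phi> S)" using rapid_integrable0[of e 0] by simp
  obtain e where "rapid e" "e 0 = \<eta> S" using schwartz_rapid[OF sch(2)] by blast
  then show "integrable lborel (\<eta> S)" using rapid_integrable0[of e 0] by simp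
 qed
 have inv: "dS S 0 x = (LBINT t. \<eta> S t * exp (- \<i> * of_real t * of_real x))" for S x
  using rapid_inversion(2)[OF ccinf_rapid[OF cS], of S x]
  unfolding fourier_lborel(2)[OF ccinf_integrable[OF cS]] \<eta>_def scaleR_conv_of_real .
 have f: "fourier (\<eta> S) \<xi> = dS S 0 \<xi>" for S \<xi>
  unfolding fourier_lborel(1)[OF intS(2)] inv ltr_def
  by (rule integral_eqI[OF refl]) (simp add: mult_ac)
 have i: "inv_fourier (\<phi> S) \<xi> = dS S 0 \<xi>" for S \<xi>
 proof -
  have p: "\<phi> S (0 + (- 1) * t) = of_real (2 * pi) * \<eta> S t" for t by (simp add: \<phi>_def \<eta>_def)
  have "ltr (\<phi> S) (\<i> * of_real \<xi>) = \<bar>- 1\<bar> *\<^sub>R (LBINT t. exp (\<i> * of_real \<xi> * of_real (0 + (- 1) * t)) * \<phi> S (0 + (- 1) * t))"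
   unfolding ltr_def by (rule lborel_integral_real_affine) simp
  also have "\<dots> = (LBINT t. of_real (2 * pi) * (\<eta> S t * exp (- \<i> * of_real t * of_real \<xi>)))"
   unfolding p by (simp add: mult_ac)
  also have "\<dots> = of_real (2 * pi) * dS S 0 \<xi>" unfolding inv by (rule integral_mult_right_zero)
  finally show ?thesis unfolding fourier_lborel(2)[OF intS(1)] by (simp add: scaleR_conv_of_real)
 qed
 show ?thesis
  by (rule exI[of _ \<phi>], rule exI[of _ \<eta>], rule exI[of _ C]) (use C(1) sch f i b1 b2 in \<open>auto simp: dS0\<close>)
qed

section \<open>Shifting the contour\<close>

lemma continuous_vertical:
 assumes r: "continuous_on {z. 0 < Re z} r" and s: "0 < s"
 shows "continuous_on UNIV (\<lambda>\<xi>. r (Complex s \<xi>))"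
proof -
 have "continuous_on UNIV (\<lambda>\<xi>. Complex s \<xi>)"
  unfolding Complex_eq by (intro continuous_intros)
 then show ?thesis by (rule continuous_on_compose2[OF r]) (use s in auto)
qed

text \<open>
 By Cauchy's theorem two truncated line integrals differ by the integrals over horizontal segments,
 where the integrand is \<open>O(1 / \<bar>Im z\<bar>)\<close>.
\<close>
lemma vertical_lines_agree:
 fixes f :: "complex \<Rightarrow> complex"
 assumes f: "f holomorphic_on {z. 0 < Re z}" and ab: "0 < a" "a \<le> b"
  and i: "integrable lborel (\<lambda>\<xi>. f (Complex a \<xi>))" "integrable lborel (\<lambda>\<xi>. f (Complex b \<xi>))"
  and dec: "\<And>z. a \<le> Re z \<Longrightarrow> Re z \<le> b \<Longrightarrow> cmod (f z) * (1 + \<bar>Im z\<bar>) \<le> C"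
 shows "(LBINT \<xi>. f (Complex a \<xi>)) = (LBINT \<xi>. f (Complex b \<xi>))"
proof -
 have U: "open {z::complex. 0 < Re z}" "convex {z::complex. 0 < Re z}"
  by (auto simp: open_halfspace_Re_gt convex_halfspace_Re_gt)
 obtain F where F: "\<And>z. z \<in> {z. 0 < Re z} \<Longrightarrow> (F has_field_derivative f z) (at z)"
  using holomorphic_convex_primitive'[OF U(2,1) f] at_within_open[OF _ U(1)] by metis
 have V: "(LBINT \<xi>. indicator {- real n..real n} \<xi> *\<^sub>R (\<i> * f (Complex s \<xi>))) = F (Complex s (real n)) - F (Complex s (- real n))"
  if s: "0 < s" for s n
 proof (rule integral_FTC_Icc)
  show "continuous_on {- real n..real n} (\<lambda>\<xi>. \<i> * f (Complex s \<xi>))"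
   by (intro continuous_intros continuous_on_subset[OF continuous_vertical[OF holomorphic_on_imp_continuous_on[OF f] s]]) auto
  fix \<xi>
  have "((\<lambda>u. of_real s + \<i> * u) has_field_derivative \<i>) (at (of_real \<xi>))" by (auto intro!: derivative_eq_intros)
  from DERIV_chain2[OF _ this]
  have "((\<lambda>u. F (of_real s + \<i> * u)) has_field_derivative f (of_real s + \<i> * of_real \<xi>) * \<i>) (at (of_real \<xi>))"
   using F[of "of_real s + \<i> * of_real \<xi>"] s by simp
  from has_vector_derivative_real_field[OF this]
  have "((\<lambda>\<xi>. F (Complex s \<xi>)) has_vector_derivative \<i> * f (Complex s \<xi>)) (at \<xi>)"
   by (simp add: Complex_eq mult.commute)
  then show "((\<lambda>\<xi>. F (Complex s \<xi>)) has_vector_derivative \<i> * f (Complex s \<xi>)) (at \<xi> within {- real n..real n})"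
   by (rule has_vector_derivative_at_within)
 qed simp
 have lim: "(\<lambda>n. \<integral>\<xi>. indicator {- real n..real n} \<xi> *\<^sub>R (\<i> * f (Complex s \<xi>)) \<partial>lborel) \<longlonglongrightarrow> \<i> * (LBINT \<xi>. f (Complex s \<xi>))"
  if ints: "integrable lborel (\<lambda>\<xi>. f (Complex s \<xi>))" for s
 proof -
  have "(\<lambda>n. \<integral>\<xi>. indicator {- real n..real n} \<xi> *\<^sub>R (\<i> * f (Complex s \<xi>)) \<partial>lborel) \<longlonglongrightarrow> (LBINT \<xi>. \<i> * f (Complex s \<xi>))"
  proof (rule integral_dominated_convergence[where w="\<lambda>\<xi>. cmod (f (Complex s \<xi>))"])
   show "AE \<xi> in lborel. (\<lambda>n. indicator {- real n..real n} \<xi> *\<^sub>R (\<i> * f (Complex s \<xi>))) \<longlonglongrightarrow> \<i> * f (Complex s \<xi>)"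
   proof (rule AE_I2, rule tendsto_eventually)
    fix \<xi> :: real
    obtain N where "\<bar>\<xi>\<bar> \<le> real N" using real_arch_simple by blast
    then show "\<forall>\<^sub>F n in sequentially. indicator {- real n..real n} \<xi> *\<^sub>R (\<i> * f (Complex s \<xi>)) = \<i> * f (Complex s \<xi>)"
     unfolding eventually_sequentially by (intro exI[of _ N]) (auto simp: indicator_def)
   qed
   show "(\<lambda>\<xi>. indicator {- real n..real n} \<xi> *\<^sub>R (\<i> * f (Complex s \<xi>))) \<in> borel_measurable lborel" for n
    using borel_measurable_integrable[OF ints] by measurable
   show "AE \<xi> in lborel. norm (indicator {- real n..real n} \<xi> *\<^sub>R (\<i> * f (Complex s \<xi>))) \<le> cmod (f (Complex s \<xi>))" for n
    by (rule AE_I2) (auto simp: indicator_def norm_mult)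
  qed (use ints borel_measurable_integrable[OF ints] in auto)
  then show ?thesis by simp
 qed
 have hor: "cmod (F (Complex b x) - F (Complex a x)) \<le> C / (1 + \<bar>x\<bar>) * (b - a)" for x
 proof -
  have "cmod (F (Complex b x) - F (Complex a x)) \<le> C / (1 + \<bar>x\<bar>) * cmod (Complex b x - Complex a x)"
  proof (rule field_differentiable_bound[where S="closed_segment (Complex a x) (Complex b x)"])
   fix z assume "z \<in> closed_segment (Complex a x) (Complex b x)"
   then obtain u where u: "0 \<le> u" "u \<le> 1" "z = (1 - u) *\<^sub>R Complex a x + u *\<^sub>R Complex b x"
    by (auto simp: in_segment)
   have Im: "Im z = x" unfolding u(3) by (simp add: left_diff_distrib)
   have Re: "Re z = (1 - u) * a + u * b" unfolding u(3) by simp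
   have "a \<le> Re z" unfolding Re using convex_bound_le[of "- a" "- a" "- b" "1 - u" u] u ab by (simp add: algebra_simps)
   moreover have "Re z \<le> b" unfolding Re using convex_bound_le[of a b b "1 - u" u] u ab by simp
   ultimately have "0 < Re z" "cmod (f z) * (1 + \<bar>x\<bar>) \<le> C" using dec[of z] Im ab by auto
   then show "cmod (f z) \<le> C / (1 + \<bar>x\<bar>)" "(F has_field_derivative f z) (at z within closed_segment (Complex a x) (Complex b x))"
    using F[of z] by (auto simp: field_simps has_field_derivative_at_within)
  qed auto
  moreover have "cmod (Complex b x - Complex a x) = b - a"
   using ab by (simp add: cmod_def)
  ultimately show ?thesis by simp
 qed
 have h0: "(\<lambda>n. F (Complex b (c * real n)) - F (Complex a (c * real n))) \<longlonglongrightarrow> 0" if "\<bar>c\<bar> = 1" for c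
 proof (rule Lim_null_comparison)
  show "\<forall>\<^sub>F n in sequentially. norm (F (Complex b (c * real n)) - F (Complex a (c * real n))) \<le> C / (1 + real n) * (b - a)"
   using hor[of "c * real _"] that by (simp add: abs_mult)
  have "(\<lambda>n. C / (1 + real n)) \<longlonglongrightarrow> 0" by real_asymp
  from tendsto_mult_right[OF this, of "b - a"] show "(\<lambda>n. C / (1 + real n) * (b - a)) \<longlonglongrightarrow> 0" by simp
 qed
 have "(\<lambda>n. (F (Complex b (real n)) - F (Complex b (- real n))) - (F (Complex a (real n)) - F (Complex a (- real n)))) \<longlonglongrightarrow>
   \<i> * (LBINT \<xi>. f (Complex b \<xi>)) - \<i> * (LBINT \<xi>. f (Complex a \<xi>))"
  using tendsto_diff[OF lim[OF i(2)] lim[OF i(1)]] V[of a] V[of b] ab by simp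
 moreover have "(\<lambda>n. (F (Complex b (1 * real n)) - F (Complex a (1 * real n))) - (F (Complex b ((-1) * real n)) - F (Complex a ((-1) * real n)))) \<longlonglongrightarrow> 0 - 0"
  by (intro tendsto_diff h0) auto
 then have "(\<lambda>n. (F (Complex b (real n)) - F (Complex b (- real n))) - (F (Complex a (real n)) - F (Complex a (- real n)))) \<longlonglongrightarrow> 0"
  by (simp add: algebra_simps)
 ultimately have "\<i> * (LBINT \<xi>. f (Complex b \<xi>)) - \<i> * (LBINT \<xi>. f (Complex a \<xi>)) = 0"
  by (rule LIMSEQ_unique)
 then show ?thesis by simp
qed

lemma one_plus_abs_shift:
 fixes u x :: real
 assumes "\<bar>u\<bar> \<le> 1" shows "1 + \<bar>x\<bar> \<le> 2 * (1 + \<bar>x - u\<bar>)"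
proof -
 have "\<bar>x\<bar> = \<bar>(x - u) + u\<bar>" by simp
 also have "\<dots> \<le> \<bar>x - u\<bar> + \<bar>u\<bar>" by (rule abs_triangle_ineq)
 also have "\<dots> \<le> 2 * \<bar>x - u\<bar> + 1" by (rule add_mono[OF _ assms]) simp
 finally show ?thesis by simp
qed

lemma inverse_power2_le: "inverse ((1 + \<bar>x\<bar>)\<^sup>2) \<le> inverse (1 + (x::real)\<^sup>2)"
proof -
 have "0 < 1 + x\<^sup>2" by (rule add_pos_nonneg) auto
 moreover have "1 + x\<^sup>2 \<le> (1 + \<bar>x\<bar>)\<^sup>2" by (simp add: power2_sum)
 ultimately show ?thesis by (rule le_imp_inverse_le[rotated])
qed

text \<open>
 No bound on \<open>r\<close> between the two lines is assumed that would allow the contour to be closed at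
 infinity, only bounds on smooth averages of \<open>r\<close> along vertical lines. These averages are
 themselves holomorphic, so the contour can be shifted for them; then the averages are
 transferred to the entire factor, and the window is contracted to a point.
\<close>
lemma contour_shift:
 fixes r E :: "complex \<Rightarrow> complex"
 assumes hr: "r holomorphic_on {z. 0 < Re z}" and hE: "E holomorphic_on UNIV" and ab: "0 < a" "a \<le> b"
  and dec: "\<And>k. \<exists>C. \<forall>z. a \<le> Re z \<longrightarrow> Re z \<le> b \<longrightarrow> cmod (E z) * (1 + \<bar>Im z\<bar>) ^ k \<le> C"
  and mg: "\<And>s. s \<in> {a, b} \<Longrightarrow> \<exists>k h. integrable lborel h \<and> (\<forall>\<xi>. cmod (r (Complex s \<xi>)) \<le> (1 + \<bar>\<xi>\<bar>) ^ k * h \<xi>)"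
  and win: "\<And>d. ccinf d \<Longrightarrow> \<exists>K. \<forall>s\<in>{a..b}. \<forall>S. cmod (LBINT \<xi>. d 0 (\<xi> - S) * d 0 (\<xi> - S) * r (Complex s \<xi>)) \<le> K"
 shows "(LBINT \<xi>. E (Complex a \<xi>) * r (Complex a \<xi>)) = (LBINT \<xi>. E (Complex b \<xi>) * r (Complex b \<xi>))"
proof -
 let ?U = "{z::complex. 0 < Re z}"
 have U: "open ?U" "convex ?U" by (auto simp: open_halfspace_Re_gt convex_halfspace_Re_gt)
 have cr: "continuous_on ?U r" by (rule holomorphic_on_imp_continuous_on[OF hr])
 have cE: "continuous_on UNIV E" by (rule holomorphic_on_imp_continuous_on[OF hE])
 have rm: "(\<lambda>\<xi>. r (Complex s \<xi>)) \<in> borel_measurable borel" if "0 < s" for s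
  by (rule borel_measurable_continuous_onI[OF continuous_vertical[OF cr that]])
 have Em: "(\<lambda>\<xi>. E (Complex s \<xi>)) \<in> borel_measurable borel" for s
 proof (rule borel_measurable_continuous_onI)
  have "continuous_on UNIV (\<lambda>\<xi>. Complex s \<xi>)" unfolding Complex_eq by (intro continuous_intros)
  then show "continuous_on UNIV (\<lambda>\<xi>. E (Complex s \<xi>))" by (rule continuous_on_compose2[OF cE]) auto
 qed
 have s0: "0 < s" if "s \<in> {a, b}" for s using that ab by auto
 have sab: "a \<le> s \<and> s \<le> b" if "s \<in> {a, b}" for s using that ab by auto
 define G where "G s u = (LBINT \<xi>. E (Complex s (\<xi> - u)) * r (Complex s \<xi>))" for s u
 have dom: "\<exists>H. integrable lborel H \<and> (\<forall>u \<xi>. \<bar>u\<bar> \<le> 1 \<longrightarrow> cmod (E (Complex s (\<xi> - u)) * r (Complex s \<xi>)) \<le> H \<xi>)"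
  if s: "s \<in> {a, b}" for s
 proof -
  obtain k h where h: "integrable lborel h" "\<forall>\<xi>. cmod (r (Complex s \<xi>)) \<le> (1 + \<bar>\<xi>\<bar>) ^ k * h \<xi>"
   using mg[OF s] by (elim exE conjE)
  obtain C where C: "\<forall>z. a \<le> Re z \<longrightarrow> Re z \<le> b \<longrightarrow> cmod (E z) * (1 + \<bar>Im z\<bar>) ^ k \<le> C" using dec by metis
  have "cmod (E (Complex s (\<xi> - u)) * r (Complex s \<xi>)) \<le> 2 ^ k * C * h \<xi>" if u: "\<bar>u\<bar> \<le> 1" for u \<xi>
  proof -
   have "0 \<le> (1 + \<bar>\<xi>\<bar>) ^ k * h \<xi>" by (rule order_trans[OF norm_ge_zero h(2)[rule_format]])
   then have h0: "0 \<le> h \<xi>" by (simp add: zero_le_mult_iff) (smt (verit) zero_less_power)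
   have "cmod (E (Complex s (\<xi> - u)) * r (Complex s \<xi>)) \<le> cmod (E (Complex s (\<xi> - u))) * ((1 + \<bar>\<xi>\<bar>) ^ k * h \<xi>)"
    unfolding norm_mult by (rule mult_left_mono) (use h in auto)
   also have "\<dots> \<le> cmod (E (Complex s (\<xi> - u))) * ((2 * (1 + \<bar>\<xi> - u\<bar>)) ^ k * h \<xi>)"
    by (intro mult_left_mono mult_right_mono power_mono one_plus_abs_shift u h0) auto
   also have "\<dots> = 2 ^ k * (cmod (E (Complex s (\<xi> - u))) * (1 + \<bar>\<xi> - u\<bar>) ^ k) * h \<xi>"
    unfolding power_mult_distrib by simp
   also have "\<dots> \<le> 2 ^ k * C * h \<xi>"
    using C[rule_format, of "Complex s (\<xi> - u)"] sab[OF s] by (intro mult_right_mono mult_left_mono h0) auto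
   finally show ?thesis .
  qed
  then show ?thesis using h(1) by (intro exI[of _ "\<lambda>\<xi>. 2 ^ k * C * h \<xi>"]) auto
 qed
 have Ginner: "integrable lborel (\<lambda>\<xi>. E (Complex s (\<xi> - u)) * r (Complex s \<xi>))" if s: "s \<in> {a, b}" and u: "\<bar>u\<bar> \<le> 1" for s u
 proof -
  obtain H where H: "integrable lborel H" "\<forall>u \<xi>. \<bar>u\<bar> \<le> 1 \<longrightarrow> cmod (E (Complex s (\<xi> - u)) * r (Complex s \<xi>)) \<le> H \<xi>"
   using dom[OF s] by (elim exE conjE)
  show ?thesis
  proof (rule integrable_dom[OF H(1)])
   have "(\<lambda>\<xi>. E (Complex s (\<xi> - u))) \<in> borel_measurable borel" by (rule measurable_compose[OF _ Em]) simp
   then show "(\<lambda>\<xi>. E (Complex s (\<xi> - u)) * r (Complex s \<xi>)) \<in> borel_measurable lborel" using rm[OF s0[OF s]] by simp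
   have "cmod (E (Complex s (\<xi> - u)) * r (Complex s \<xi>)) \<le> norm (H \<xi>)" for \<xi>
    using H(2)[rule_format, OF u, of \<xi>] by simp
   then show "AE \<xi> in lborel. norm (E (Complex s (\<xi> - u)) * r (Complex s \<xi>)) \<le> norm (H \<xi>)" by simp
  qed
 qed
 have Gbound: "\<exists>B. \<forall>u. \<bar>u\<bar> \<le> 1 \<longrightarrow> (LBINT \<xi>. cmod (E (Complex s (\<xi> - u)) * r (Complex s \<xi>))) \<le> B" if s: "s \<in> {a, b}" for s
 proof -
  obtain H where H: "integrable lborel H" "\<forall>u \<xi>. \<bar>u\<bar> \<le> 1 \<longrightarrow> cmod (E (Complex s (\<xi> - u)) * r (Complex s \<xi>)) \<le> H \<xi>"
   using dom[OF s] by (elim exE conjE)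
  show ?thesis
   by (rule exI[of _ "LBINT \<xi>. H \<xi>"]) (intro allI impI integral_mono integrable_norm Ginner s H(1), use H(2) in auto)
 qed
 have Gcont: "(\<lambda>n. G s (u n)) \<longlonglongrightarrow> G s 0" if s: "s \<in> {a, b}" and u: "u \<longlonglongrightarrow> 0" "\<And>n. \<bar>u n\<bar> \<le> 1" for s u
 proof -
  obtain H where H: "integrable lborel H" "\<forall>u \<xi>. \<bar>u\<bar> \<le> 1 \<longrightarrow> cmod (E (Complex s (\<xi> - u)) * r (Complex s \<xi>)) \<le> H \<xi>"
   using dom[OF s] by (elim exE conjE)
  show ?thesis unfolding G_def
  proof (rule integral_dominated_convergence[OF _ _ H(1)])
   show "(\<lambda>\<xi>. E (Complex s (\<xi> - u n)) * r (Complex s \<xi>)) \<in> borel_measurable lborel" for n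
    by (rule borel_measurable_integrable[OF Ginner[OF s u(2)]])
   show "(\<lambda>\<xi>. E (Complex s (\<xi> - 0)) * r (Complex s \<xi>)) \<in> borel_measurable lborel"
    by (rule borel_measurable_integrable[OF Ginner[OF s]]) simp
   show "AE \<xi> in lborel. (\<lambda>n. E (Complex s (\<xi> - u n)) * r (Complex s \<xi>)) \<longlonglongrightarrow> E (Complex s (\<xi> - 0)) * r (Complex s \<xi>)"
   proof (rule AE_I2)
    fix \<xi> :: real
    have "(\<lambda>n. Complex s (\<xi> - u n)) \<longlonglongrightarrow> Complex s (\<xi> - 0)" unfolding Complex_eq by (intro tendsto_intros u)
    moreover have "isCont E (Complex s (\<xi> - 0))" using cE by (simp add: continuous_on_eq_continuous_at)
    ultimately have "(\<lambda>n. E (Complex s (\<xi> - u n))) \<longlonglongrightarrow> E (Complex s (\<xi> - 0))" by (rule isCont_tendsto_compose[rotated])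
    then show "(\<lambda>n. E (Complex s (\<xi> - u n)) * r (Complex s \<xi>)) \<longlonglongrightarrow> E (Complex s (\<xi> - 0)) * r (Complex s \<xi>)"
     by (rule tendsto_mult_right)
   qed
   show "AE \<xi> in lborel. norm (E (Complex s (\<xi> - u n)) * r (Complex s \<xi>)) \<le> H \<xi>" for n
    using H(2) u(2) by simp
  qed
 qed
 have avg: "(LBINT u. d 0 u * d 0 u * G a u) = (LBINT u. d 0 u * d 0 u * G b u)"
  if d: "ccinf d" and supp: "\<And>t. t \<notin> {0..1} \<Longrightarrow> d 0 t = 0" for d
 proof -
  define q where "q u = d 0 u * d 0 u" for u
  have q0: "q u = 0" if "u \<notin> {0..1}" for u using supp[OF that] by (simp add: q_def)
  have cq: "continuous_on S q" for S unfolding q_def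
   by (intro continuous_on_mult continuous_at_imp_continuous_on ballI ccinf_isCont[OF d])
  have qi: "integrable lborel q" unfolding q_def
   by (rule ccinf_weighted_integrable[OF d]) (intro continuous_at_imp_continuous_on ballI ccinf_isCont[OF d])
  note [measurable] = borel_measurable_integrable[OF qi, simplified]
  define rd where "rd z = integral (cbox 0 1) (\<lambda>t::real. q t * r (z + \<i> * of_real t))" for z
  have hd: "rd holomorphic_on ?U"
   unfolding rd_def
  proof (rule leibniz_rule_holomorphic[where fx="\<lambda>z t. q t * deriv r (z + \<i> * of_real t)"])
   fix z t assume z: "z \<in> ?U"
   have "(r has_field_derivative deriv r (z + \<i> * of_real t)) (at (z + \<i> * of_real t))"
    by (rule holomorphic_derivI[OF hr U(1)]) (use z in simp)
   moreover have "((\<lambda>z. z + \<i> * of_real t) has_field_derivative 1) (at z)" by (auto intro!: derivative_eq_intros)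
   ultimately have "((\<lambda>z. r (z + \<i> * of_real t)) has_field_derivative deriv r (z + \<i> * of_real t) * 1) (at z)"
    by (rule DERIV_chain2)
   from DERIV_cmult[OF this, of "q t"]
   show "((\<lambda>z. q t * r (z + \<i> * of_real t)) has_field_derivative q t * deriv r (z + \<i> * of_real t)) (at z within ?U)"
    by (simp add: has_field_derivative_at_within)
  next
   fix z assume z: "z \<in> ?U"
   have "continuous_on (cbox 0 1) (\<lambda>t. r (z + \<i> * of_real t))"
    by (rule continuous_on_compose2[OF cr]) (use z in \<open>auto intro!: continuous_intros\<close>)
   then show "(\<lambda>t. q t * r (z + \<i> * of_real t)) integrable_on cbox 0 1"
    by (intro integrable_continuous continuous_on_mult cq)
  next
   have "continuous_on ?U (deriv r)"
    by (rule holomorphic_on_imp_continuous_on[OF holomorphic_deriv[OF hr U(1)]])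
   then have "continuous_on (?U \<times> cbox 0 1) (\<lambda>p. deriv r (fst p + \<i> * of_real (snd p)))"
    by (rule continuous_on_compose2) (auto intro!: continuous_intros)
   moreover have "continuous_on (?U \<times> cbox 0 1) (\<lambda>p. q (snd p))"
    by (rule continuous_on_compose2[OF cq[of UNIV]]) (auto intro!: continuous_intros)
   ultimately show "continuous_on (?U \<times> cbox 0 1) (\<lambda>(z, t). q t * deriv r (z + \<i> * of_real t))"
    unfolding split_beta by (rule continuous_on_mult[rotated])
  qed (rule U(2))
  have rdl: "rd (Complex s x) = (LBINT t. q t * r (Complex s (x + t)))" if s: "0 < s" for s x
  proof -
   have cc: "continuous_on {0..1} (\<lambda>t. q t * r (Complex s (x + t)))"
   proof (intro continuous_on_mult cq)
    show "continuous_on {0..1} (\<lambda>t. r (Complex s (x + t)))"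
     by (rule continuous_on_compose2[OF continuous_vertical[OF cr s]]) (auto intro!: continuous_intros)
   qed
   have "(LBINT t. q t * r (Complex s (x + t))) = (LBINT t. indicator {0..1} t *\<^sub>R (q t * r (Complex s (x + t))))"
    by (rule integral_eqI[OF refl]) (use q0 in \<open>auto simp: indicator_def\<close>)
   also have "\<dots> = integral {0..1} (\<lambda>t. q t * r (Complex s (x + t)))"
    using set_borel_integral_eq_integral(2)[OF borel_integrable_atLeastAtMost'[OF cc]]
    by (simp add: set_lebesgue_integral_def)
   also have "\<dots> = rd (Complex s x)" unfolding rd_def
    by (simp add: Complex_eq algebra_simps)
   finally show ?thesis by simp
  qed
  obtain K where K: "\<forall>s\<in>{a..b}. \<forall>S. cmod (LBINT \<xi>. d 0 (\<xi> - S) * d 0 (\<xi> - S) * r (Complex s \<xi>)) \<le> K"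
   using win[OF d] by blast
  have rdb: "cmod (rd z) \<le> K" if z: "a \<le> Re z" "Re z \<le> b" for z
  proof -
   have "rd z = (LBINT t. q t * r (Complex (Re z) (Im z + t)))"
    using rdl[of "Re z" "Im z"] z ab by simp
   also have "\<dots> = (LBINT \<xi>. q (\<xi> - Im z) * r (Complex (Re z) \<xi>))"
    using lborel_integral_real_affine[of 1 "\<lambda>\<xi>. q (\<xi> - Im z) * r (Complex (Re z) \<xi>)" "Im z"] by simp
   finally show ?thesis using K z by (simp add: q_def)
  qed
  have K0: "0 \<le> K" by (rule order_trans[OF norm_ge_zero rdb[of "Complex a 0"]]) (use ab in auto)
  have line: "(LBINT x. E (Complex s x) * rd (Complex s x)) = (LBINT u. q u * G s u)" if s: "s \<in> {a, b}" for s
  proof -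
   note [measurable] = rm[OF s0[OF s]] Em[of s]
   define Q where "Q = (\<lambda>(u, x). q u * (E (Complex s x) * r (Complex s (x + u))))"
   have sh: "E (Complex s x) * r (Complex s (x + u)) = E (Complex s ((u + 1 * x) - u)) * r (Complex s (u + 1 * x))" for u x
    by (simp add: add.commute)
   have i1: "integrable lborel (\<lambda>x. E (Complex s x) * r (Complex s (x + u)))" if "\<bar>u\<bar> \<le> 1" for u
    unfolding sh using lborel_integrable_real_affine[OF Ginner[OF s that], of 1 u] by simp
   have i2: "(LBINT x. E (Complex s x) * r (Complex s (x + u))) = G s u" for u
    unfolding sh G_def
    using lborel_integral_real_affine[of 1 "\<lambda>\<xi>. E (Complex s (\<xi> - u)) * r (Complex s \<xi>)" u] by simp
   have i3: "(LBINT x. cmod (E (Complex s x) * r (Complex s (x + u)))) = (LBINT \<xi>. cmod (E (Complex s (\<xi> - u)) * r (Complex s \<xi>)))" for u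
    unfolding sh
    using lborel_integral_real_affine[of 1 "\<lambda>\<xi>. cmod (E (Complex s (\<xi> - u)) * r (Complex s \<xi>))" u] by simp
   obtain B where B: "\<forall>u. \<bar>u\<bar> \<le> 1 \<longrightarrow> (LBINT \<xi>. cmod (E (Complex s (\<xi> - u)) * r (Complex s \<xi>))) \<le> B"
    using Gbound[OF s] by (elim exE)
   have Qm: "Q \<in> borel_measurable (borel \<Otimes>\<^sub>M borel)" unfolding Q_def by measurable
   have Q: "integrable (lborel2) Q"
   proof (rule pair_integrableI[OF Qm])
    fix u show "integrable lborel (\<lambda>x. Q (u, x))"
     unfolding Q_def prod.case by (cases "\<bar>u\<bar> \<le> 1") (use i1 q0 in \<open>auto simp: abs_le_iff\<close>)
   next
    show "integrable lborel (\<lambda>u. \<integral>x. norm (Q (u, x)) \<partial>lborel)"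
    proof (rule integrable_dom[OF integrable_mult_left[OF integrable_norm[OF qi], of B]])
     show "(\<lambda>u. \<integral>x. norm (Q (u, x)) \<partial>lborel) \<in> borel_measurable lborel" using Qm by measurable
     have "norm (LBINT x. norm (Q (u, x))) \<le> norm (norm (q u) * B)" for u
     proof (cases "\<bar>u\<bar> \<le> 1")
      case True
      have "(LBINT x. norm (Q (u, x))) = norm (q u) * (LBINT x. cmod (E (Complex s x) * r (Complex s (x + u))))"
       by (simp add: Q_def norm_mult)
      also have "\<dots> \<le> norm (q u) * B" unfolding i3 by (rule mult_left_mono) (use B True in auto)
      also have "\<dots> \<le> norm (norm (q u) * B)" by simp
      finally have "(LBINT x. norm (Q (u, x))) \<le> norm (norm (q u) * B)" .
      moreover have "0 \<le> (LBINT x. norm (Q (u, x)))" by simp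
      ultimately show ?thesis by simp
     next
      case False
      then have "u \<notin> {0..1}" by auto
      then have "q u = 0" by (rule q0)
      then show ?thesis by (simp add: Q_def)
     qed
     then show "AE u in lborel. norm (LBINT x. norm (Q (u, x))) \<le> norm (norm (q u) * B)" by simp
    qed
   qed
   have "(LBINT x. E (Complex s x) * rd (Complex s x)) = (LBINT x. (LBINT u. Q (u, x)))"
   proof (rule integral_eqI[OF refl])
    fix x
    have "E (Complex s x) * rd (Complex s x) = (LBINT u. E (Complex s x) * (q u * r (Complex s (x + u))))"
     unfolding rdl[OF s0[OF s]] by simp
    then show "E (Complex s x) * rd (Complex s x) = (LBINT u. Q (u, x))" by (simp add: Q_def mult_ac)
   qed
   also have "\<dots> = (LBINT u. (LBINT x. Q (u, x)))"
    using pair_swap_integral[of "\<lambda>u x. Q (u, x)"] Q by simp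
   also have "\<dots> = (LBINT u. q u * G s u)"
    unfolding Q_def prod.case integral_mult_right_zero i2 ..
   finally show ?thesis .
  qed
  have "(LBINT x. E (Complex a x) * rd (Complex a x)) = (LBINT x. E (Complex b x) * rd (Complex b x))"
  proof -
   obtain C1 where C1: "\<forall>z. a \<le> Re z \<longrightarrow> Re z \<le> b \<longrightarrow> cmod (E z) * (1 + \<bar>Im z\<bar>) ^ 1 \<le> C1" using dec by metis
   have C10: "0 \<le> C1" by (rule order_trans[OF _ C1[rule_format, of "Complex a 0"]]) (use ab in auto)
   obtain C2 where C2: "\<forall>z. a \<le> Re z \<longrightarrow> Re z \<le> b \<longrightarrow> cmod (E z) * (1 + \<bar>Im z\<bar>) ^ 2 \<le> C2" using dec by metis
   have hf: "(\<lambda>z. E z * rd z) holomorphic_on ?U"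
    by (intro holomorphic_on_mult hd holomorphic_on_subset[OF hE]) auto
   have int: "integrable lborel (\<lambda>\<xi>. E (Complex s \<xi>) * rd (Complex s \<xi>))" if s: "s \<in> {a, b}" for s
   proof (rule integrable_dom[OF integrable_mult_right[OF integrable_inverse_square, of "C2 * K"]])
    show "(\<lambda>\<xi>. E (Complex s \<xi>) * rd (Complex s \<xi>)) \<in> borel_measurable lborel"
     using borel_measurable_continuous_onI[OF continuous_vertical[OF holomorphic_on_imp_continuous_on[OF hf] s0[OF s]]] by simp
    have "norm (E (Complex s \<xi>) * rd (Complex s \<xi>)) \<le> norm ((C2 * K) * inverse (1 + \<xi>\<^sup>2))" for \<xi>
    proof -
     have p: "0 < (1 + \<bar>\<xi>\<bar>)\<^sup>2" by (rule zero_less_power) simp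
     have c: "cmod (E (Complex s \<xi>)) * (1 + \<bar>\<xi>\<bar>)\<^sup>2 \<le> C2" using C2[rule_format, of "Complex s \<xi>"] sab[OF s] by simp
     have C20: "0 \<le> C2" by (rule order_trans[OF _ c]) simp
     have "cmod (E (Complex s \<xi>)) \<le> C2 * inverse ((1 + \<bar>\<xi>\<bar>)\<^sup>2)" using c p by (simp add: field_simps)
     also have "\<dots> \<le> C2 * inverse (1 + \<xi>\<^sup>2)" by (rule mult_left_mono[OF inverse_power2_le C20])
     finally have "norm (E (Complex s \<xi>) * rd (Complex s \<xi>)) \<le> (C2 * inverse (1 + \<xi>\<^sup>2)) * K"
      unfolding norm_mult using rdb[of "Complex s \<xi>"] sab[OF s] C20 by (intro mult_mono) auto
     also have "\<dots> = (C2 * K) * inverse (1 + \<xi>\<^sup>2)" by simp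
     also have "\<dots> \<le> norm \<dots>" by simp
     finally show ?thesis .
    qed
    then show "AE \<xi> in lborel. norm (E (Complex s \<xi>) * rd (Complex s \<xi>)) \<le> norm ((C2 * K) * inverse (1 + \<xi>\<^sup>2))" by simp
   qed
   have "cmod (E z * rd z) * (1 + \<bar>Im z\<bar>) \<le> C1 * K" if z: "a \<le> Re z" "Re z \<le> b" for z
   proof -
    have "cmod (E z) * (1 + \<bar>Im z\<bar>) \<le> C1" using C1 z by simp
    then have "(cmod (E z) * (1 + \<bar>Im z\<bar>)) * cmod (rd z) \<le> C1 * K"
     by (rule mult_mono[OF _ rdb[OF z]]) (use C10 in auto)
    then show ?thesis by (simp add: norm_mult mult_ac)
   qed
   from vertical_lines_agree[OF hf ab int int this] show ?thesis by simp
  qed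
  then show ?thesis using line[of a] line[of b] by (simp add: q_def)
 qed
 obtain d \<beta> where d: "ccinf d" "d 0 = (\<lambda>t. of_real (\<beta> t))" and \<beta>: "\<forall>t. 0 \<le> \<beta> t \<and> \<beta> t \<le> 1"
  "\<forall>t. t \<notin> {0<..<1} \<longrightarrow> \<beta> t = 0" "\<forall>t\<in>{0<..<1}. 0 < \<beta> t"
  by (rule smooth_bump)
 have d0: "d 0 v = 0" if "v \<notin> {0<..<1}" for v using \<beta>(2) that d(2) by simp
 define q where "q v = d 0 v * d 0 v" for v
 have qi: "integrable lborel q" unfolding q_def
  by (rule ccinf_weighted_integrable[OF d(1)]) (intro continuous_at_imp_continuous_on ballI ccinf_isCont[OF d(1)])
 note qm[measurable] = borel_measurable_integrable[OF qi, simplified]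
 have Gm: "G s \<in> borel_measurable borel" if s: "s \<in> {a, b}" for s
 proof -
  note [measurable] = rm[OF s0[OF s]] Em[of s]
  show ?thesis unfolding G_def by measurable
 qed
 have eqn: "(LBINT v. q v * G a (v / real (Suc n))) = (LBINT v. q v * G b (v / real (Suc n)))" for n
 proof -
  let ?m = "real (Suc n)"
  define e where "e = (\<lambda>k t. of_real (?m ^ k) * d k (0 + ?m * t))"
  have e: "ccinf e" unfolding e_def by (rule ccinf_affine[OF d(1)]) simp
  have e0: "e 0 t = d 0 (?m * t)" for t by (simp add: e_def)
  have supp: "e 0 t = 0" if "t \<notin> {0..1}" for t
  proof -
   have "\<not> (0 < ?m * t \<and> ?m * t < 1)"
   proof
    assume *: "0 < ?m * t \<and> ?m * t < 1"
    then have "0 < t" by (simp add: zero_less_mult_iff)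
    moreover have "t \<le> ?m * t" using \<open>0 < t\<close> by (simp add: mult_le_cancel_right1)
    with * have "t \<le> 1" by linarith
    ultimately show False using that by auto
   qed
   then show ?thesis unfolding e0 by (intro d0) auto
  qed
  have sc: "(LBINT u. e 0 u * e 0 u * G s u) = (1 / ?m) *\<^sub>R (LBINT v. q v * G s (v / ?m))" for s
   using lborel_integral_real_affine[of "1 / ?m" "\<lambda>u. e 0 u * e 0 u * G s u" 0] by (simp add: e0 q_def)
  show ?thesis using avg[OF e supp] unfolding sc by simp
 qed
 have lim: "(\<lambda>n. \<integral>v. q v * G s (v / real (Suc n)) \<partial>lborel) \<longlonglongrightarrow> (LBINT v. q v * G s 0)" if s: "s \<in> {a, b}" for s
 proof -
  note [measurable] = Gm[OF s]
  obtain B where B: "\<forall>u. \<bar>u\<bar> \<le> 1 \<longrightarrow> (LBINT \<xi>. cmod (E (Complex s (\<xi> - u)) * r (Complex s \<xi>))) \<le> B"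
   using Gbound[OF s] by (elim exE)
  have GB: "cmod (G s u) \<le> B" if "\<bar>u\<bar> \<le> 1" for u
   unfolding G_def by (rule order_trans[OF integral_norm_bound B[rule_format, OF that]])
  have small: "\<bar>v / real (Suc n)\<bar> \<le> 1" if "v \<in> {0<..<1}" for v n
  proof -
   have "\<bar>v\<bar> \<le> real (Suc n)" using that by auto
   then show ?thesis by (simp add: divide_le_eq del: of_nat_Suc)
  qed
  show ?thesis
  proof (rule integral_dominated_convergence[where w="\<lambda>v. cmod (q v) * B"])
   show "AE v in lborel. (\<lambda>n. q v * G s (v / real (Suc n))) \<longlonglongrightarrow> q v * G s 0"
   proof (rule AE_I2)
    fix v
    show "(\<lambda>n. q v * G s (v / real (Suc n))) \<longlonglongrightarrow> q v * G s 0"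
    proof (cases "v \<in> {0<..<1}")
     case True
     have "(\<lambda>n. v / real (Suc n)) \<longlonglongrightarrow> 0" by (rule LIMSEQ_Suc[OF lim_const_over_n])
     then show ?thesis by (intro tendsto_mult_left Gcont[OF s] small[OF True])
    next
     case False then show ?thesis using d0 by (simp add: q_def)
    qed
   qed
   show "AE v in lborel. norm (q v * G s (v / real (Suc n))) \<le> cmod (q v) * B" for n
   proof (rule AE_I2)
    fix v
    show "norm (q v * G s (v / real (Suc n))) \<le> cmod (q v) * B"
    proof (cases "v \<in> {0<..<1}")
     case True
     then show ?thesis unfolding norm_mult by (intro mult_left_mono GB small) auto
    next
     case False then show ?thesis using d0 by (simp add: q_def)
    qed
   qed
  qed (use qi in auto)
 qed
 have "(LBINT v. q v * G a 0) = (LBINT v. q v * G b 0)"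
  using LIMSEQ_unique[OF lim[of a, unfolded eqn] lim[of b]] by simp
 then have eq0: "(LBINT v. q v) * G a 0 = (LBINT v. q v) * G b 0" by simp
 have "(LBINT v. q v) \<noteq> 0"
 proof
  assume 0: "(LBINT v. q v) = 0"
  have qr: "q = (\<lambda>v. of_real ((\<beta> v)\<^sup>2))" by (simp add: q_def d(2) power2_eq_square fun_eq_iff)
  have bi: "integrable lborel (\<lambda>v. (\<beta> v)\<^sup>2)" using integrable_norm[OF qi] by (simp add: qr norm_power)
  have "(LBINT v. (\<beta> v)\<^sup>2) = 0" using 0 unfolding qr integral_complex_of_real by simp
  then have "AE v in lborel. (\<beta> v)\<^sup>2 = 0"
   using integral_nonneg_eq_0_iff_AE[OF bi] by simp
  then have "AE v in lborel. v \<notin> {0<..<1::real}"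
  proof (rule eventually_mono)
   fix v :: real assume "(\<beta> v)\<^sup>2 = 0" then show "v \<notin> {0<..<1}" using \<beta>(3) by force
  qed
  then have "{0<..<1::real} \<in> null_sets lborel" by (simp add: AE_iff_null_sets)
  then show False by (simp add: null_sets_def)
 qed
 with eq0 have "G a 0 = G b 0" by simp
 then show ?thesis by (simp add: G_def)
qed

lemma exp_chain: "deriv_chain (\<lambda>n t. c ^ n * exp (c * of_real t))" for c :: complex
proof -
 have "((\<lambda>t. c ^ n * exp (c * of_real t)) has_vector_derivative c ^ Suc n * exp (c * of_real t)) (at t)" for n and t :: real
 proof -
  have "((\<lambda>z. c ^ n * exp (c * z)) has_field_derivative c ^ Suc n * exp (c * of_real t)) (at (of_real t))"
   by (auto intro!: derivative_eq_intros)
  from has_vector_derivative_real_field[OF this] show ?thesis .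
 qed
 then show ?thesis by (simp add: deriv_chain_def)
qed

lemma ccinf_times_exp:
 assumes "ccinf d"
 obtains e where "ccinf e" "e 0 = (\<lambda>t. exp (c * of_real t) * d 0 t)"
 using ccinf_mult_exists[OF assms exp_chain[of c]] by (auto simp: mult.commute)

lemma product_integral:
 fixes f g :: "real \<Rightarrow> 'a::{real_normed_field, banach, second_countable_topology}"
 assumes f: "integrable lborel f" and g: "integrable lborel g"
 shows "(\<integral>z. f (fst z) * g (snd z) \<partial>lborel2) = (LBINT x. f x) * (LBINT y. g y)"
proof -
 have "(\<integral>z. f (fst z) * g (snd z) \<partial>lborel2) = (LBINT x. (LBINT y. f x * g y))"
  using lborel_pair.integral_fst'[OF product_integrable[OF f g]] unfolding split_beta fst_conv snd_conv by (rule sym)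
 then show ?thesis by (simp only: integral_mult_right_zero integral_mult_left_zero)
qed

text \<open>
 On a line far to the right \<open>r\<close> is a Laplace transform, and there the identity is Fourier
 inversion after Fubini. Both test functions have entire transforms, so the left-hand side is the
 integral over the line \<open>Re z = a\<close> of a product of \<open>r\<close> with an entire function, and the contour
 can be moved to that far line. Moving it multiplies the test functions by \<open>e\<^bsup>(b-a)t\<^esup>\<close> and
 \<open>e\<^bsup>-(b-a)t\<^esup>\<close>, which cancels against \<open>e\<^bsup>-(b-a)u\<^esup>\<close> from the kernel.
\<close>
lemma transform_identity:
 fixes r :: "complex \<Rightarrow> complex" and g :: "real \<Rightarrow> complex"
 assumes d: "ccinf d" and e: "ccinf e" and a: "0 < a" and hr: "r holomorphic_on {z. 0 < Re z}"
  and gm: "g \<in> borel_measurable borel" and gb: "\<And>u. cmod (g u) \<le> indicator {0..} u * (K * exp (w * u))"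
  and lap: "\<And>z. w < Re z \<Longrightarrow> 0 < Re z \<Longrightarrow> r z = (LBINT u. exp (- z * of_real u) * g u)"
  and mg: "\<And>s. 0 < s \<Longrightarrow> \<exists>k h. integrable lborel h \<and> (\<forall>\<xi>. cmod (r (Complex s \<xi>)) \<le> (1 + \<bar>\<xi>\<bar>) ^ k * h \<xi>)"
  and win: "\<And>d b. ccinf d \<Longrightarrow> \<exists>K. \<forall>s\<in>{a..b}. \<forall>S. cmod (LBINT \<xi>. d 0 (\<xi> - S) * d 0 (\<xi> - S) * r (Complex s \<xi>)) \<le> K"
 shows "(LBINT \<xi>. inv_fourier (d 0) \<xi> * (fourier (e 0) \<xi> * r (Complex a \<xi>))) =
  (\<integral>z. d 0 (fst z + snd z) * (e 0 (fst z) * (exp (- of_real (a * snd z)) * g (snd z))) \<partial>lborel2)"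
proof -
 define b where "b = max a w + 1"
 have b: "a \<le> b" "w < b" "0 < b" using a by (auto simp: b_def)
 define E where "E z = of_real (1 / (2 * pi)) * ltr (d 0) (z - of_real a) * ltr (e 0) (of_real a - z)" for z
 have hE: "E holomorphic_on UNIV"
 proof -
  have "(\<lambda>z. ltr (d 0) (z - of_real a)) holomorphic_on UNIV"
   using holomorphic_on_compose[of "\<lambda>z. z - of_real a" UNIV "ltr (d 0)"] ltr_holomorphic[OF d]
   by (simp add: o_def holomorphic_on_diff)
  moreover have "(\<lambda>z. ltr (e 0) (of_real a - z)) holomorphic_on UNIV"
   using holomorphic_on_compose[of "\<lambda>z. of_real a - z" UNIV "ltr (e 0)"] ltr_holomorphic[OF e]
   by (simp add: o_def holomorphic_on_diff)
  ultimately show ?thesis unfolding E_def by (intro holomorphic_on_mult) auto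
 qed
 have dec: "\<exists>C. \<forall>z. a \<le> Re z \<longrightarrow> Re z \<le> b \<longrightarrow> cmod (E z) * (1 + \<bar>Im z\<bar>) ^ k \<le> C" for k
 proof -
  obtain C1 where C1: "0 \<le> C1" "\<forall>z. \<bar>Re z\<bar> \<le> b - a \<longrightarrow> cmod (ltr (d 0) z) * (1 + \<bar>Im z\<bar>) ^ k \<le> C1"
   using ltr_decay_strip[OF d, of "b - a" 0 k] by (elim exE conjE)
  obtain C2 where C2: "0 \<le> C2" "\<forall>z. \<bar>Re z\<bar> \<le> b - a \<longrightarrow> cmod (ltr (e 0) z) \<le> C2"
   using ltr_bound_strip[OF e, of "b - a" 0] by (elim exE conjE)
  have "cmod (E z) * (1 + \<bar>Im z\<bar>) ^ k \<le> (1 / (2 * pi)) * (C1 * C2)" if z: "a \<le> Re z" "Re z \<le> b" for z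
  proof -
   have 1: "cmod (ltr (d 0) (z - of_real a)) * (1 + \<bar>Im z\<bar>) ^ k \<le> C1"
    using C1(2)[rule_format, of "z - of_real a"] z by simp
   have 2: "cmod (ltr (e 0) (of_real a - z)) \<le> C2" using C2(2)[rule_format, of "of_real a - z"] z by simp
   have "cmod (E z) * (1 + \<bar>Im z\<bar>) ^ k =
    (1 / (2 * pi)) * ((cmod (ltr (d 0) (z - of_real a)) * (1 + \<bar>Im z\<bar>) ^ k) * cmod (ltr (e 0) (of_real a - z)))"
    unfolding E_def norm_mult norm_of_real by simp
   moreover have "(cmod (ltr (d 0) (z - of_real a)) * (1 + \<bar>Im z\<bar>) ^ k) * cmod (ltr (e 0) (of_real a - z)) \<le> C1 * C2"
    by (rule mult_mono[OF 1 2 C1(1)]) simp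
   ultimately show ?thesis by (simp add: divide_right_mono)
  qed
  then show ?thesis by blast
 qed
 obtain p where p: "ccinf p" "p 0 = (\<lambda>t. exp (of_real (b - a) * of_real t) * d 0 t)" by (rule ccinf_times_exp[OF d])
 obtain q where q: "ccinf q" "q 0 = (\<lambda>t. exp (of_real (a - b) * of_real t) * e 0 t)" by (rule ccinf_times_exp[OF e])
 have inv: "inv_fourier f \<xi> = of_real (1 / (2 * pi)) * ltr f (\<i> * of_real \<xi>)" if "integrable lborel f" for f \<xi>
  using fourier_lborel(2)[OF that] by (simp only: scaleR_conv_of_real)
 have lines: "(LBINT \<xi>. E (Complex a \<xi>) * r (Complex a \<xi>)) = (LBINT \<xi>. E (Complex b \<xi>) * r (Complex b \<xi>))"
 proof (rule contour_shift[OF hr hE a b(1)])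
  show "\<exists>k h. integrable lborel h \<and> (\<forall>\<xi>. cmod (r (Complex s \<xi>)) \<le> (1 + \<bar>\<xi>\<bar>) ^ k * h \<xi>)" if "s \<in> {a, b}" for s
   by (rule mg) (use that a b in auto)
 qed (rule dec, rule win)
 have Ea: "E (Complex a \<xi>) = inv_fourier (d 0) \<xi> * fourier (e 0) \<xi>" for \<xi>
 proof -
  have z: "Complex a \<xi> - of_real a = \<i> * of_real \<xi>" "of_real a - Complex a \<xi> = - \<i> * of_real \<xi>"
   by (simp_all add: complex_eq_iff)
  show ?thesis unfolding E_def z inv[OF ccinf_integrable[OF d]] fourier_lborel(1)[OF ccinf_integrable[OF e]] ..
 qed
 have Eb: "E (Complex b \<xi>) = inv_fourier (p 0) \<xi> * ltr (q 0) (- \<i> * of_real \<xi>)" for \<xi>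
 proof -
  have z: "Complex b \<xi> - of_real a = \<i> * of_real \<xi> + of_real (b - a)" "of_real a - Complex b \<xi> = - \<i> * of_real \<xi> + of_real (a - b)"
   by (simp_all add: complex_eq_iff)
  have sh: "ltr f (z + c) = ltr (\<lambda>t. exp (c * of_real t) * f t) z" for f z c
   unfolding ltr_def distrib_right exp_add mult.assoc ..
  show ?thesis unfolding E_def z sh p(2)[symmetric] q(2)[symmetric] inv[OF ccinf_integrable[OF p(1)]] ..
 qed
 define h where "h z = q 0 (fst z) * (exp (- of_real (b * snd z)) * g (snd z))" for z :: "real \<times> real"
 have gi: "integrable lborel (\<lambda>u. exp (- of_real (b * u)) * g u)"
 proof (rule integrable_dom)
  show "integrable lborel (\<lambda>u. K * (indicator {0..} u * exp (- (b - w) * u)))"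
   by (intro integrable_mult_right exp_kernel_integrable) (use b in simp)
  show "(\<lambda>u. exp (- of_real (b * u)) * g u) \<in> borel_measurable lborel" using gm by measurable
  have "norm (exp (- of_real (b * u)) * g u) \<le> norm (K * (indicator {0..} u * exp (- (b - w) * u)))" for u
  proof -
   have "norm (exp (- of_real (b * u)) * g u) = exp (- (b * u)) * cmod (g u)" by (simp add: norm_mult)
   also have "\<dots> \<le> exp (- (b * u)) * (indicator {0..} u * (K * exp (w * u)))" by (intro mult_left_mono gb) simp
   also have "\<dots> = K * (indicator {0..} u * (exp (- (b * u)) * exp (w * u)))" by simp
   also have "exp (- (b * u)) * exp (w * u) = exp (- (b - w) * u)" unfolding exp_add[symmetric] by (simp add: algebra_simps)
   finally show ?thesis by simp
  qed
  then show "AE u in lborel. norm (exp (- of_real (b * u)) * g u) \<le> norm (K * (indicator {0..} u * exp (- (b - w) * u)))" by simp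
 qed
 have hi: "integrable (lborel2) h"
  using product_integrable[OF ccinf_integrable[OF q(1), of 0] gi] unfolding h_def split_beta .
 have rb: "ltr (q 0) (- \<i> * of_real \<xi>) * r (Complex b \<xi>) =
  (\<integral>z. exp (- \<i> * of_real \<xi> * of_real (fst z + snd z)) * h z \<partial>lborel2)" for \<xi>
 proof -
  have e1: "exp (- \<i> * of_real \<xi> * of_real (fst z + snd z)) * h z =
   (exp (- \<i> * of_real \<xi> * of_real (fst z)) * q 0 (fst z)) * (exp (- Complex b \<xi> * of_real (snd z)) * g (snd z))" for z :: "real \<times> real"
  proof -
   have "- Complex b \<xi> * of_real (snd z) = - \<i> * of_real \<xi> * of_real (snd z) + - of_real (b * snd z)"
    by (simp add: complex_eq_iff)
   then show ?thesis unfolding h_def of_real_add distrib_left exp_add by (simp only: mult_ac exp_add)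
  qed
  have i1: "integrable lborel (\<lambda>s. exp (- \<i> * of_real \<xi> * of_real s) * q 0 s)" by (rule ccinf_ltr_integrable[OF q(1)])
  have e2: "exp (- Complex b \<xi> * of_real u) * g u = exp (- \<i> * of_real \<xi> * of_real u) * (exp (- of_real (b * u)) * g u)" for u
  proof -
   have "- Complex b \<xi> * of_real u = - \<i> * of_real \<xi> * of_real u + - of_real (b * u)"
    by (simp add: complex_eq_iff)
   then show ?thesis by (simp only: mult_ac exp_add)
  qed
  have i2: "integrable lborel (\<lambda>u. exp (- Complex b \<xi> * of_real u) * g u)"
   unfolding e2 by (rule integrable_dom[OF gi]) (use gm in \<open>auto simp: norm_mult\<close>)
  show ?thesis unfolding e1 product_integral[OF i1 i2] using lap[of "Complex b \<xi>"] b by (simp add: ltr_def)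
 qed
 have "(LBINT \<xi>. inv_fourier (d 0) \<xi> * (fourier (e 0) \<xi> * r (Complex a \<xi>))) =
   (LBINT \<xi>. inv_fourier (p 0) \<xi> * (ltr (q 0) (- \<i> * of_real \<xi>) * r (Complex b \<xi>)))"
  using lines unfolding Ea Eb mult.assoc .
 also have "\<dots> = (\<integral>z. p 0 (fst z + snd z) * h z \<partial>lborel2)"
  unfolding rb by (rule inversion_convolution[OF rapid_inversion[OF ccinf_rapid[OF p(1)]] hi])
 also have "\<dots> = (\<integral>z. d 0 (fst z + snd z) * (e 0 (fst z) * (exp (- of_real (a * snd z)) * g (snd z))) \<partial>lborel2)"
 proof (rule integral_eqI[OF refl])
  fix z :: "real \<times> real"
  have "exp (complex_of_real (b - a) * of_real (fst z + snd z)) * (exp (of_real (a - b) * of_real (fst z)) * exp (- of_real (b * snd z)))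
   = exp (- of_real (a * snd z))"
   unfolding exp_add[symmetric] by (simp add: algebra_simps)
  moreover have "p 0 (fst z + snd z) * h z =
    (exp (complex_of_real (b - a) * of_real (fst z + snd z)) * (exp (of_real (a - b) * of_real (fst z)) * exp (- of_real (b * snd z)))) *
    (d 0 (fst z + snd z) * (e 0 (fst z) * g (snd z)))"
   unfolding p(2) h_def q(2) by (simp only: mult_ac)
  ultimately have "p 0 (fst z + snd z) * h z = (exp (- of_real (a * snd z))) * (d 0 (fst z + snd z) * (e 0 (fst z) * g (snd z)))"
   by simp
  then show "p 0 (fst z + snd z) * h z = d 0 (fst z + snd z) * (e 0 (fst z) * (exp (- of_real (a * snd z)) * g (snd z)))"
   by (simp only: mult_ac)
 qed
 finally show ?thesis .
qed

section \<open>Testing multipliers against bounded integrable functions\<close>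

lemma one_le_enn2real: "1 \<le> q \<Longrightarrow> q \<noteq> \<infinity> \<Longrightarrow> 1 \<le> enn2real q"
 using enn2real_mono[of 1 q] by (simp add: less_top)

text \<open>
 The factor 2 leaves room for the infimum in the definition of the norm not to be attained.
\<close>
lemma Lp_norm_infinityD:
 assumes "Lp_norm \<infinity> f \<le> ennreal L" "0 < L"
 shows "AE t in lebesgue. norm (f t) \<le> 2 * L"
proof -
 have "ennreal L < ennreal (2 * L)" using assms(2) by (simp add: ennreal_less_iff)
 then have "Inf {c. AE t in lebesgue. ennreal (norm (f t)) \<le> c} < ennreal (2 * L)"
  using assms(1) by (simp add: Lp_norm_def)
 then obtain c where c: "AE t in lebesgue. ennreal (norm (f t)) \<le> c" "c < ennreal (2 * L)"
  unfolding Inf_less_iff by blast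
 show ?thesis using c(1)
 proof (rule eventually_mono)
  fix t assume "ennreal (norm (f t)) \<le> c"
  then have "ennreal (norm (f t)) \<le> ennreal (2 * L)" using c(2) by simp
  then show "norm (f t) \<le> 2 * L" using assms(2) by simp
 qed
qed

lemma Lp_norm_finiteD:
 fixes g :: "real \<Rightarrow> 'x::complex_banach"
 assumes q: "1 \<le> q" "q \<noteq> \<infinity>" and g: "strongly_measurable g" and L: "Lp_norm q g \<le> ennreal L" "0 < L"
 defines "r \<equiv> enn2real q"
 shows "integrable lebesgue (\<lambda>t. norm (g t) powr r)" "(\<integral>t. norm (g t) powr r \<partial>lebesgue) \<le> L powr r"
proof -
 have r: "1 \<le> r" unfolding r_def by (rule one_le_enn2real[OF q])
 define I where "I = (\<integral>\<^sup>+t. ennreal (norm (g t) powr r) \<partial>lebesgue)"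
 have m: "(\<lambda>t. norm (g t) powr r) \<in> borel_measurable lebesgue"
  using norm_measurable[OF smeas_measurable[OF g[unfolded strongly_measurable_smeas]]] by measurable
 have N: "(if I = \<infinity> then \<infinity> else ennreal (enn2real I powr (1 / r))) \<le> ennreal L"
  using L(1) q(2) unfolding Lp_norm_def I_def r_def by (simp add: Let_def)
 then have fin: "I \<noteq> \<infinity>" by (auto simp: top_unique)
 with N have le: "enn2real I powr (1 / r) \<le> L" using L(2) by simp
 show "integrable lebesgue (\<lambda>t. norm (g t) powr r)"
  by (rule integrableI_nonneg[OF m]) (use fin in \<open>auto simp: I_def less_top\<close>)
 have "(\<integral>t. norm (g t) powr r \<partial>lebesgue) = enn2real I"
  unfolding I_def by (rule integral_eq_nn_integral[OF m]) simp
 also have "\<dots> = (enn2real I powr (1 / r)) powr r" using r by (simp add: powr_powr)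
 also have "\<dots> \<le> L powr r" by (rule powr_mono2) (use r le in auto)
 finally show "(\<integral>t. norm (g t) powr r \<partial>lebesgue) \<le> L powr r" .
qed

text \<open>
 Test functions whose sum is bounded in \<open>L\<^sup>1\<close> and in \<open>L\<^sup>\<infinity>\<close> by \<open>b\<close> are bounded by \<open>b\<close> in every
 \<open>L\<^sup>q'\<close>. The pointwise inequality \<open>\<parallel>g\<parallel> \<le> L + L\<^bsup>1-q\<^esup> \<parallel>g\<parallel>\<^sup>q\<close> replaces Hoelder's inequality, at the
 cost of the factor 2; this makes the bound uniform in \<open>q\<close>.
\<close>
lemma Lp_pairing_bound:
 fixes g :: "real \<Rightarrow> 'x::complex_banach" and \<phi> :: "'i \<Rightarrow> real \<Rightarrow> complex"
 assumes q: "1 \<le> q" and g: "strongly_measurable g" and L: "Lp_norm q g \<le> ennreal L" "0 < L"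
  and \<phi>: "\<And>j. j \<in> I \<Longrightarrow> integrable lborel (\<phi> j)" and b: "\<And>t. (\<Sum>j\<in>I. cmod (\<phi> j t)) \<le> b"
   "(LBINT t. (\<Sum>j\<in>I. cmod (\<phi> j t))) \<le> b"
 shows "(\<Sum>j\<in>I. norm (Bochner (\<lambda>t. \<phi> j t *\<^sub>C g t))) \<le> 2 * b * L"
proof -
 let ?\<Phi> = "\<lambda>t. \<Sum>j\<in>I. cmod (\<phi> j t)"
 have \<Phi>0: "0 \<le> ?\<Phi> t" for t by (simp add: sum_nonneg)
 have b0: "0 \<le> b" by (rule order_trans[OF \<Phi>0 b(1)])
 have \<Phi>i': "integrable lborel ?\<Phi>" by (intro Bochner_Integration.integrable_sum integrable_norm \<phi>)
 have \<phi>m: "\<phi> j \<in> borel_measurable borel" if "j \<in> I" for j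
  using borel_measurable_integrable[OF \<phi>[OF that]] by simp
 have \<Phi>m: "?\<Phi> \<in> borel_measurable borel" using borel_measurable_integrable[OF \<Phi>i'] by simp
 have \<Phi>i: "integrable lebesgue ?\<Phi>" using \<Phi>i' lebesgue_lborel(2)[OF \<Phi>m] by simp
 have \<Phi>b: "(\<integral>t. ?\<Phi> t \<partial>lebesgue) \<le> b" using b(2) lebesgue_lborel(1)[OF \<Phi>m] by simp
 have gs: "smeas g" using g by (simp add: strongly_measurable_smeas)
 have "\<exists>H. integrable lebesgue H \<and> (\<integral>t. H t \<partial>lebesgue) \<le> 2 * b * L \<and> (AE t in lebesgue. ?\<Phi> t * norm (g t) \<le> H t)"
 proof (cases "q = \<infinity>")
  case True
  then have ae: "AE t in lebesgue. norm (g t) \<le> 2 * L" using Lp_norm_infinityD L by blast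
  have "AE t in lebesgue. ?\<Phi> t * norm (g t) \<le> ?\<Phi> t * (2 * L)"
   using ae by (rule eventually_mono) (rule mult_left_mono[OF _ \<Phi>0])
  moreover have "(\<integral>t. ?\<Phi> t * (2 * L) \<partial>lebesgue) \<le> 2 * b * L"
   using mult_right_mono[OF \<Phi>b, of "2 * L"] L(2) by (simp add: mult_ac)
  ultimately show ?thesis using \<Phi>i by (intro exI[of _ "\<lambda>t. ?\<Phi> t * (2 * L)"]) auto
 next
  case False
  define r where "r = enn2real q"
  have r: "1 \<le> r" unfolding r_def by (rule one_le_enn2real[OF q False])
  note G = Lp_norm_finiteD[OF q False g L, folded r_def]
  let ?H = "\<lambda>t. L * ?\<Phi> t + (b * L powr (1 - r)) * norm (g t) powr r"
  have Hi: "integrable lebesgue ?H" by (intro Bochner_Integration.integrable_add integrable_mult_right \<Phi>i G)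
  have "(\<integral>t. ?H t \<partial>lebesgue) = L * (\<integral>t. ?\<Phi> t \<partial>lebesgue) + (b * L powr (1 - r)) * (\<integral>t. norm (g t) powr r \<partial>lebesgue)"
   using \<Phi>i G(1) by simp
  also have "\<dots> \<le> L * b + (b * L powr (1 - r)) * L powr r"
   by (intro add_mono mult_left_mono \<Phi>b G(2)) (use L b0 in auto)
  also have "\<dots> = 2 * b * L" using L(2) by (simp add: mult.assoc powr_add[symmetric])
  finally have int: "(\<integral>t. ?H t \<partial>lebesgue) \<le> 2 * b * L" .
  have key: "v \<le> L + L powr (1 - r) * v powr r" if "0 \<le> v" for v
  proof (cases "v \<le> L")
   case True then show ?thesis by (smt (verit) mult_nonneg_nonneg powr_ge_zero)
  next
   case False
   then have v: "1 \<le> v / L" "0 < v" using L(2) by auto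
   have "(v / L) powr 1 \<le> (v / L) powr r" by (rule powr_mono[OF r v(1)])
   then have "v \<le> L * (v / L) powr r" using L(2) v by (simp add: field_simps)
   also have "\<dots> = L powr (1 - r) * v powr r" using L(2) v by (simp add: powr_divide powr_diff)
   finally show ?thesis using L(2) by simp
  qed
  have "?\<Phi> t * norm (g t) \<le> ?H t" for t
  proof -
   have "?\<Phi> t * norm (g t) \<le> ?\<Phi> t * (L + L powr (1 - r) * norm (g t) powr r)" by (intro mult_left_mono key \<Phi>0) simp
   also have "\<dots> = L * ?\<Phi> t + ?\<Phi> t * (L powr (1 - r) * norm (g t) powr r)" by (simp add: distrib_left)
   also have "\<dots> \<le> L * ?\<Phi> t + b * (L powr (1 - r) * norm (g t) powr r)"
    by (intro add_left_mono mult_right_mono b(1)) auto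
   finally show ?thesis by (simp add: mult.assoc)
  qed
  then show ?thesis using Hi int by (intro exI[of _ ?H]) auto
 qed
 then obtain H where H: "integrable lebesgue H" "(\<integral>t. H t \<partial>lebesgue) \<le> 2 * b * L"
  "AE t in lebesgue. ?\<Phi> t * norm (g t) \<le> H t" by (elim exE conjE)
 show ?thesis
 proof (cases "finite I")
  case False then show ?thesis using b0 L(2) by simp
 next
  case fin: True
  have bi: "bint (\<lambda>t. \<phi> j t *\<^sub>C g t)" if j: "j \<in> I" for j
  proof (rule bintI[OF smeas_scaleC[OF smeas_borel'[OF \<phi>m[OF j]] gs] H(1)])
   show "AE t in lebesgue. norm (\<phi> j t *\<^sub>C g t) \<le> H t" using H(3)
   proof (rule eventually_mono)
    fix t assume h: "?\<Phi> t * norm (g t) \<le> H t"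
    have "cmod (\<phi> j t) \<le> ?\<Phi> t" by (rule member_le_sum[OF j _ fin]) simp
    then have "cmod (\<phi> j t) * norm (g t) \<le> ?\<Phi> t * norm (g t)" by (rule mult_right_mono) simp
    then show "norm (\<phi> j t *\<^sub>C g t) \<le> H t" using h by (simp add: norm_scaleC)
   qed
  qed
  have "(\<Sum>j\<in>I. norm (Bochner (\<lambda>t. \<phi> j t *\<^sub>C g t))) \<le> (\<Sum>j\<in>I. \<integral>t. norm (\<phi> j t *\<^sub>C g t) \<partial>lebesgue)"
   by (intro sum_mono Bochner_norm_le bi)
  also have "\<dots> = (\<integral>t. (\<Sum>j\<in>I. norm (\<phi> j t *\<^sub>C g t)) \<partial>lebesgue)"
   by (rule Bochner_Integration.integral_sum[symmetric]) (rule bint_norm_integrable[OF bi])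
  also have "\<dots> \<le> (\<integral>t. H t \<partial>lebesgue)"
  proof (rule integral_mono_AE[OF _ H(1)])
   show "integrable lebesgue (\<lambda>t. \<Sum>j\<in>I. norm (\<phi> j t *\<^sub>C g t))"
    by (rule Bochner_Integration.integrable_sum) (rule bint_norm_integrable[OF bi])
   show "AE t in lebesgue. (\<Sum>j\<in>I. norm (\<phi> j t *\<^sub>C g t)) \<le> H t"
    using H(3) by (simp add: norm_scaleC sum_distrib_right)
  qed
  finally show ?thesis using H(2) by simp
 qed
qed

lemma Lp_norm_le_of_bounds:
 fixes f :: "real \<Rightarrow> 'y::complex_banach"
 assumes p: "1 \<le> p" and f: "strongly_measurable f" and B: "0 < B" "\<And>t. norm (f t) \<le> B"
  and i: "integrable lebesgue (\<lambda>t. norm (f t))" "(\<integral>t. norm (f t) \<partial>lebesgue) \<le> B"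
 shows "Lp_norm p f \<le> ennreal B"
proof (cases "p = \<infinity>")
 case True
 then show ?thesis unfolding Lp_norm_def using B by (auto intro!: Inf_lower)
next
 case False
 define r where "r = enn2real p"
 have r: "1 \<le> r" unfolding r_def by (rule one_le_enn2real[OF p False])
 define I where "I = (\<integral>\<^sup>+t. ennreal (norm (f t) powr r) \<partial>lebesgue)"
 have pw: "norm (f t) powr r \<le> B powr (r - 1) * norm (f t)" for t
 proof (cases "f t = 0")
  case False
  have "norm (f t) powr r = norm (f t) powr (r - 1) * norm (f t) powr 1" unfolding powr_add[symmetric] by simp
  also have "\<dots> \<le> B powr (r - 1) * norm (f t) powr 1" by (intro mult_right_mono powr_mono2) (use r B in auto)
  finally show ?thesis by simp
 qed simp
 have "I \<le> (\<integral>\<^sup>+t. ennreal (B powr (r - 1) * norm (f t)) \<partial>lebesgue)"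
  unfolding I_def by (intro nn_integral_mono ennreal_leI pw)
 also have "\<dots> = ennreal (\<integral>t. B powr (r - 1) * norm (f t) \<partial>lebesgue)"
  by (rule nn_integral_eq_integral) (use i in auto)
 also have "\<dots> \<le> ennreal (B powr r)"
 proof (rule ennreal_leI)
  have "(\<integral>t. B powr (r - 1) * norm (f t) \<partial>lebesgue) \<le> B powr (r - 1) * B" using i(2) by (simp add: mult_left_mono)
  also have "\<dots> = B powr r" using B(1) powr_add[of B "r - 1" 1] by simp
  finally show "(\<integral>t. B powr (r - 1) * norm (f t) \<partial>lebesgue) \<le> B powr r" .
 qed
 finally have I: "I \<le> ennreal (B powr r)" .
 then have fin: "I \<noteq> \<infinity>" by (auto simp: top_unique)
 have "enn2real I \<le> B powr r" using enn2real_mono[OF I] by simp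
 then have "enn2real I powr (1 / r) \<le> (B powr r) powr (1 / r)" by (intro powr_mono2) (use r in auto)
 also have "\<dots> = B" using r B(1) by (simp add: powr_powr)
 finally have "enn2real I powr (1 / r) \<le> B" .
 then show ?thesis using fin False unfolding Lp_norm_def I_def r_def by (simp add: Let_def ennreal_leI)
qed

lemma schwartz_integrable:
 assumes "\<psi> \<in> schwartz (UNIV :: complex set)" shows "integrable lborel \<psi>"
 using schwartz_rapid[OF assms] rapid_integrable0 by auto

lemma sum_in_subspace:
 fixes Y :: "'y::complex_banach set"
 assumes Y: "0 \<in> Y" "\<And>u v. u \<in> Y \<Longrightarrow> v \<in> Y \<Longrightarrow> u + v \<in> Y" and y: "\<And>k. k \<in> J \<Longrightarrow> y k \<in> Y"
 shows "(\<Sum>k\<in>J. y k) \<in> Y"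
 using y by (induction J rule: infinite_finite_induct) (auto intro: Y)

lemma bounded_clinear_on_sum:
 assumes F: "bounded_clinear_on Y F" and Y: "0 \<in> Y" "\<And>u v. u \<in> Y \<Longrightarrow> v \<in> Y \<Longrightarrow> u + v \<in> Y" "\<And>c u. u \<in> Y \<Longrightarrow> c *\<^sub>C u \<in> Y"
  and y: "\<And>k. k \<in> J \<Longrightarrow> y k \<in> Y"
 shows "F (\<Sum>k\<in>J. c k *\<^sub>C y k) = (\<Sum>k\<in>J. c k *\<^sub>C F (y k))"
proof -
 have add: "F (u + v) = F u + F v" if "u \<in> Y" "v \<in> Y" for u v using F that by (simp add: bounded_clinear_on_def)
 have sc: "F (c *\<^sub>C u) = c *\<^sub>C F u" if "u \<in> Y" for c u using F that by (simp add: bounded_clinear_on_def)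
 have F0: "F 0 = 0" using sc[OF Y(1), of 0] by simp
 show ?thesis using y
 proof (induction J rule: infinite_finite_induct)
  case (insert k J)
  have "(\<Sum>k\<in>J. c k *\<^sub>C y k) \<in> Y" by (rule sum_in_subspace) (use Y insert in auto)
  then show ?case using insert by (simp add: add sc Y)
 qed (simp_all add: F0)
qed

lemma has_vector_derivative_scaleC:
 fixes y :: "'y::complex_banach"
 assumes "(f has_vector_derivative f') (at t)"
 shows "((\<lambda>t. f t *\<^sub>C y) has_vector_derivative f' *\<^sub>C y) (at t)"
proof -
 have "bounded_linear (\<lambda>c. c *\<^sub>C y)"
  by (rule bounded_linear_intro[of _ "norm y"]) (simp_all add: scaleC_add_left norm_scaleC scaleR_scaleC scaleC_scaleC scaleC_complex_def)
 from bounded_linear.has_vector_derivative[OF this assms] show ?thesis .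
qed

lemma schwartz_span:
 fixes Y :: "'y::complex_banach set"
 assumes Y: "0 \<in> Y" "\<And>u v. u \<in> Y \<Longrightarrow> v \<in> Y \<Longrightarrow> u + v \<in> Y" "\<And>c u. u \<in> Y \<Longrightarrow> c *\<^sub>C u \<in> Y"
  and \<psi>: "\<And>k. k \<in> J \<Longrightarrow> \<psi> k \<in> schwartz UNIV" and y: "\<And>k. k \<in> J \<Longrightarrow> y k \<in> Y"
 shows "(\<lambda>t. \<Sum>k\<in>J. \<psi> k t *\<^sub>C y k) \<in> schwartz Y"
proof -
 have "\<forall>k\<in>J. \<exists>d. d 0 = \<psi> k \<and> (\<forall>n t. (d n has_vector_derivative d (Suc n) t) (at t)) \<and>
  (\<forall>n i. \<exists>C. \<forall>t. \<bar>t\<bar> ^ i * norm (d n t) \<le> C)" using \<psi> by (simp add: schwartz_def)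
 then obtain d where d: "\<forall>k\<in>J. d k 0 = \<psi> k \<and> (\<forall>n t. (d k n has_vector_derivative d k (Suc n) t) (at t)) \<and>
  (\<forall>n i. \<exists>C. \<forall>t. \<bar>t\<bar> ^ i * norm (d k n t) \<le> C)" unfolding bchoice_iff by (elim exE)
 define D where "D n t = (\<Sum>k\<in>J. d k n t *\<^sub>C y k)" for n t
 have D0: "D 0 = (\<lambda>t. \<Sum>k\<in>J. \<psi> k t *\<^sub>C y k)" unfolding D_def using d by (intro ext sum.cong) auto
 have D1: "(D n has_vector_derivative D (Suc n) t) (at t)" for n t
  unfolding D_def by (intro has_vector_derivative_sum has_vector_derivative_scaleC) (use d in auto)
 have D2: "\<exists>C. \<forall>t. \<bar>t\<bar> ^ i * norm (D n t) \<le> C" for n i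
 proof -
  have "\<forall>k\<in>J. \<exists>C. \<forall>t. \<bar>t\<bar> ^ i * norm (d k n t) \<le> C" using d by blast
  then obtain C where C: "\<forall>k\<in>J. \<forall>t. \<bar>t\<bar> ^ i * norm (d k n t) \<le> C k" unfolding bchoice_iff by (elim exE)
  have "\<bar>t\<bar> ^ i * norm (D n t) \<le> (\<Sum>k\<in>J. C k * norm (y k))" for t
  proof -
   have "\<bar>t\<bar> ^ i * norm (D n t) \<le> \<bar>t\<bar> ^ i * (\<Sum>k\<in>J. norm (d k n t *\<^sub>C y k))"
    unfolding D_def by (intro mult_left_mono norm_sum) simp
   also have "\<dots> = (\<Sum>k\<in>J. (\<bar>t\<bar> ^ i * norm (d k n t)) * norm (y k))"
    unfolding sum_distrib_left by (simp add: norm_scaleC mult.assoc)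
   also have "\<dots> \<le> (\<Sum>k\<in>J. C k * norm (y k))" using C by (intro sum_mono mult_right_mono) auto
   finally show ?thesis .
  qed
  then show ?thesis by blast
 qed
 have "(\<Sum>k\<in>J. \<psi> k t *\<^sub>C y k) \<in> Y" for t by (intro sum_in_subspace Y y)
 then show ?thesis unfolding schwartz_def using D0 D1 D2 by blast
qed

lemma bcl_scaleC_vector: "bounded_clinear_on UNIV (\<lambda>c. c *\<^sub>C (y :: 'y::complex_banach))"
 unfolding bounded_clinear_on_def
 by (auto simp: scaleC_add_left scaleC_scaleC scaleC_complex_def norm_scaleC mult.commute intro!: exI[of _ "norm y"])

lemma bint_fourier:
 assumes "integrable lborel \<psi>"
 shows "bint (\<lambda>t. exp (- (\<i> * of_real \<xi> * of_real t)) * \<psi> t)"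
proof (rule bint_complex)
 have m: "\<psi> \<in> borel_measurable borel" using borel_measurable_integrable[OF assms] by simp
 have "integrable lborel (\<lambda>t. exp (- (\<i> * of_real \<xi> * of_real t)) * \<psi> t)"
  by (rule integrable_dom[OF assms]) (use m in \<open>auto simp: norm_mult\<close>)
 moreover have "(\<lambda>t. exp (- (\<i> * of_real \<xi> * of_real t)) * \<psi> t) \<in> borel_measurable borel" using m by measurable
 ultimately show "integrable lebesgue (\<lambda>t. exp (- (\<i> * of_real \<xi> * of_real t)) * \<psi> t)"
  using lebesgue_lborel(2) by blast
qed

lemma fourier_span:
 fixes y :: "'i \<Rightarrow> 'y::complex_banach"
 assumes \<psi>: "\<And>k. k \<in> J \<Longrightarrow> integrable lborel (\<psi> k)"
 shows "fourier (\<lambda>t. \<Sum>k\<in>J. \<psi> k t *\<^sub>C y k) \<xi> = (\<Sum>k\<in>J. fourier (\<psi> k) \<xi> *\<^sub>C y k)"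
proof -
 have sc: "c *\<^sub>C (\<Sum>k\<in>J. v k) = (\<Sum>k\<in>J. c *\<^sub>C v k)" for c and v :: "'i \<Rightarrow> 'y"
  by (rule bcl_sum[OF bcl_scaleC_const])
 have "fourier (\<lambda>t. \<Sum>k\<in>J. \<psi> k t *\<^sub>C y k) \<xi> =
   Bochner (\<lambda>t. \<Sum>k\<in>J. (exp (- (\<i> * of_real \<xi> * of_real t)) * \<psi> k t) *\<^sub>C y k)"
  unfolding fourier_def sc scaleC_scaleC ..
 also have "\<dots> = (\<Sum>k\<in>J. Bochner (\<lambda>t. (exp (- (\<i> * of_real \<xi> * of_real t)) * \<psi> k t) *\<^sub>C y k))"
  by (rule Bochner_sum) (rule bint_bcl[OF bcl_scaleC_vector bint_fourier[OF \<psi>]])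
 also have "\<dots> = (\<Sum>k\<in>J. fourier (\<psi> k) \<xi> *\<^sub>C y k)"
  unfolding fourier_def scaleC_complex_def
  by (intro sum.cong refl Bochner_bcl[OF bcl_scaleC_vector] bint_fourier \<psi>)
 finally show ?thesis .
qed

text \<open>
 Inputs bounded by \<open>B\<close> in \<open>L\<^sup>1\<close> and in
 \<open>L\<^sup>\<infinity>\<close> are bounded by \<open>B\<close> in \<open>L\<^sup>p\<close>; the
 output in \<open>L\<^sup>q\<close> is then paired with the test functions.
\<close>
lemma multiplier_test_bound_finite:
 fixes m :: "real \<Rightarrow> 'y::complex_banach \<Rightarrow> 'x::complex_banach"
 assumes mb: "multiplier_bound p q Y m C" and pq: "1 \<le> p" "p \<le> q" "p \<noteq> \<infinity>" and C: "0 < C"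
  and Y: "0 \<in> Y" "\<And>u v. u \<in> Y \<Longrightarrow> v \<in> Y \<Longrightarrow> u + v \<in> Y" "\<And>c u. u \<in> Y \<Longrightarrow> c *\<^sub>C u \<in> Y"
  and \<phi>: "\<And>j. j \<in> I \<Longrightarrow> \<phi> j \<in> schwartz UNIV" and \<psi>: "\<And>k. k \<in> J \<Longrightarrow> \<psi> k \<in> schwartz UNIV"
  and y: "\<And>k. k \<in> J \<Longrightarrow> y k \<in> Y"
  and b: "\<And>t. (\<Sum>j\<in>I. cmod (\<phi> j t)) \<le> b" "(LBINT t. (\<Sum>j\<in>I. cmod (\<phi> j t))) \<le> b"
  and B: "0 < B" "\<And>t. norm (\<Sum>k\<in>J. \<psi> k t *\<^sub>C y k) \<le> B" "(\<integral>t. norm (\<Sum>k\<in>J. \<psi> k t *\<^sub>C y k) \<partial>lebesgue) \<le> B"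
 shows "(\<Sum>j\<in>I. norm (Bochner (\<lambda>\<xi>. inv_fourier (\<phi> j) \<xi> *\<^sub>C (\<Sum>k\<in>J. fourier (\<psi> k) \<xi> *\<^sub>C m \<xi> (y k))))) \<le> 2 * b * (C * B)"
proof -
 define f where "f t = (\<Sum>k\<in>J. \<psi> k t *\<^sub>C y k)" for t
 have mb': "multiplier_bound_finite p q Y m C" and lin: "\<And>\<xi>. bounded_clinear_on Y (m \<xi>)"
  using mb pq(3) by (simp_all add: multiplier_bound_def)
 obtain S where S: "\<forall>f\<in>Lp_fun p Y. S f \<in> Lp_fun q UNIV \<and> Lp_norm q (S f) \<le> ennreal C * Lp_norm p f"
  "\<forall>f\<in>schwartz Y. represents_distr (S f) (multiplier_distr m f)"
  using mb' unfolding multiplier_bound_finite_def by (elim exE conjE)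
 have fs: "f \<in> schwartz Y" unfolding f_def by (intro schwartz_span Y \<psi> y)
 have fb: "bint f" unfolding f_def
 proof (rule bint_sum)
  fix k assume "k \<in> J"
  note i = schwartz_integrable[OF \<psi>[OF this]]
  have "integrable lebesgue (\<psi> k)" using i lebesgue_lborel(2)[of "\<psi> k"] borel_measurable_integrable[OF i] by simp
  then show "bint (\<lambda>t. \<psi> k t *\<^sub>C y k)" by (intro bint_bcl[OF bcl_scaleC_vector] bint_complex)
 qed
 have fm: "strongly_measurable f" using fb by (simp add: strongly_measurable_smeas bint_smeas)
 have fn: "Lp_norm p f \<le> ennreal B"
  by (rule Lp_norm_le_of_bounds[OF pq(1) fm B(1) _ bint_norm_integrable[OF fb]]) (use B in \<open>auto simp: f_def\<close>)
 then have fL: "f \<in> Lp_fun p Y" using fm fs unfolding Lp_fun_def schwartz_def by (auto simp: order_le_less_trans)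
 have gL: "S f \<in> Lp_fun q UNIV" "Lp_norm q (S f) \<le> ennreal C * Lp_norm p f" using S(1) fL by auto
 have "Lp_norm q (S f) \<le> ennreal C * ennreal B" by (rule order_trans[OF gL(2) mult_left_mono[OF fn]]) simp
 then have gn: "Lp_norm q (S f) \<le> ennreal (C * B)" using C B by (simp add: ennreal_mult)
 have gm: "strongly_measurable (S f)" using gL(1) by (simp add: Lp_fun_def)
 have "Bochner (\<lambda>\<xi>. inv_fourier (\<phi> j) \<xi> *\<^sub>C (\<Sum>k\<in>J. fourier (\<psi> k) \<xi> *\<^sub>C m \<xi> (y k))) = Bochner (\<lambda>t. \<phi> j t *\<^sub>C S f t)" if j: "j \<in> I" for j
 proof -
  have "m \<xi> (fourier f \<xi>) = (\<Sum>k\<in>J. fourier (\<psi> k) \<xi> *\<^sub>C m \<xi> (y k))" for \<xi>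
  proof -
   have "fourier f \<xi> = (\<Sum>k\<in>J. fourier (\<psi> k) \<xi> *\<^sub>C y k)"
    unfolding f_def by (rule fourier_span) (rule schwartz_integrable[OF \<psi>])
   then show ?thesis using bounded_clinear_on_sum[OF lin Y y] by simp
  qed
  then show ?thesis using S(2) fs \<phi>[OF j] by (simp add: represents_distr_def multiplier_distr_def)
 qed
 moreover have "(\<Sum>j\<in>I. norm (Bochner (\<lambda>t. \<phi> j t *\<^sub>C S f t))) \<le> 2 * b * (C * B)"
  by (rule Lp_pairing_bound[OF _ gm gn _ schwartz_integrable[OF \<phi>] b]) (use pq C B in auto)
 ultimately show ?thesis by simp
qed

lemma lebesgue_reflect:
 "(\<lambda>s. t - s) \<in> measurable lebesgue lebesgue" "distr lebesgue lebesgue (\<lambda>s. t - s) = (lebesgue :: real measure)"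
proof -
 have e: "(\<lambda>s. t + - 1 * s) = (\<lambda>s::real. t - s)" by auto
 show "(\<lambda>s. t - s) \<in> measurable lebesgue (lebesgue :: real measure)"
  using lebesgue_affine_measurable[where c="\<lambda>x::real. - 1" and t=t] unfolding e[symmetric] by simp
 show "distr lebesgue lebesgue (\<lambda>s. t - s) = (lebesgue :: real measure)"
  using lebesgue_real_affine[of "- 1" t] unfolding e by (simp add: density_1)
qed

lemma AE_reflect:
 assumes "AE s in lebesgue. P s" shows "AE s in lebesgue. P (t - s :: real)"
 using AE_distrD[OF lebesgue_reflect(1), of P t] assms unfolding lebesgue_reflect(2) by simp

lemma smeas_reflect:
 assumes "smeas f" shows "smeas (\<lambda>s. f (t - s))"
proof -
 obtain \<sigma> where s: "\<forall>n. simple_function lebesgue (\<sigma> n)" "AE s in lebesgue. (\<lambda>n. \<sigma> n s) \<longlonglongrightarrow> f s"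
  using assms unfolding smeas_def by (elim exE conjE)
 have "simple_function lebesgue (\<lambda>s. \<sigma> n (t - s))" for n
  by (rule simple_function_comp[OF lebesgue_reflect(1)]) (use s in blast)
 then show ?thesis unfolding smeas_def
  using AE_reflect[OF s(2), of t] by (intro exI[of _ "\<lambda>n s. \<sigma> n (t - s)"]) auto
qed

lemma integrable_reflect: "integrable lebesgue f \<Longrightarrow> integrable lebesgue (\<lambda>s. f (t - s :: real) :: real)"
 using integrable_distr_eq[OF lebesgue_reflect(1), of f t] unfolding lebesgue_reflect(2)
 using borel_measurable_integrable by blast

lemma borel_version:
 fixes f :: "real \<Rightarrow> complex"
 assumes "integrable lebesgue f"
 shows "\<exists>g. integrable lborel g \<and> (AE t in lebesgue. f t = g t)"
proof -
 have m: "f \<in> borel_measurable lebesgue" using assms by simp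
 have "(\<lambda>t. Re (f t)) \<in> borel_measurable (completion lborel)" "(\<lambda>t. Im (f t)) \<in> borel_measurable (completion lborel)"
  using m by measurable
 then obtain u v where u: "u \<in> borel_measurable lborel" "AE t in lborel. Re (f t) = u t"
  and v: "v \<in> borel_measurable lborel" "AE t in lborel. Im (f t) = v t"
  using completion_ex_borel_measurable_real by metis
 let ?g = "\<lambda>t. Complex (u t) (v t)"
 have gm: "?g \<in> borel_measurable borel" using u v unfolding Complex_eq by measurable
 have "AE t in lborel. f t = ?g t" using u(2) v(2) by eventually_elim (simp add: complex_eq_iff)
 then have ae: "AE t in lebesgue. f t = ?g t" by (rule AE_completion)
 have "integrable lebesgue ?g"
  by (rule Bochner_Integration.integrable_cong_AE_imp[OF assms]) (use gm ae in \<open>auto simp: eq_commute intro: measurable_completion\<close>)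
 then show ?thesis using ae lebesgue_lborel(2)[OF gm] by blast
qed

definition grid :: "nat \<Rightarrow> real \<Rightarrow> real" where
 "grid n s = of_int \<lfloor>s * real (Suc n)\<rfloor> / real (Suc n)"

lemma grid_close: "\<bar>grid n s - s\<bar> \<le> 1 / real (Suc n)"
proof -
 have "of_int \<lfloor>s * real (Suc n)\<rfloor> \<le> s * real (Suc n)" "s * real (Suc n) \<le> of_int \<lfloor>s * real (Suc n)\<rfloor> + 1" by linarith+
 then have "\<bar>of_int \<lfloor>s * real (Suc n)\<rfloor> - s * real (Suc n)\<bar> \<le> 1" by linarith
 then have "\<bar>of_int \<lfloor>s * real (Suc n)\<rfloor> - s * real (Suc n)\<bar> / real (Suc n) \<le> 1 / real (Suc n)"
  by (rule divide_right_mono) simp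
 also have "\<bar>of_int \<lfloor>s * real (Suc n)\<rfloor> - s * real (Suc n)\<bar> / real (Suc n) = \<bar>grid n s - s\<bar>"
 proof -
  have "grid n s - s = (of_int \<lfloor>s * real (Suc n)\<rfloor> - s * real (Suc n)) / real (Suc n)"
   by (simp add: grid_def diff_divide_distrib del: of_nat_Suc)
  then show ?thesis by (simp add: abs_divide del: of_nat_Suc)
 qed
 finally show ?thesis .
qed

text \<open>Step functions sampling \<open>f\<close> inherit every pointwise bound on \<open>f\<close>.\<close>
definition step_fun :: "nat \<Rightarrow> (real \<Rightarrow> 'a::zero) \<Rightarrow> real \<Rightarrow> 'a" where
 "step_fun n f s = (if \<bar>s\<bar> \<le> real n then f (grid n s) else 0)"

lemma simple_step_fun: "simple_function lebesgue (step_fun n f)"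
proof -
 define h where "h s = (if \<bar>s\<bar> \<le> real n then grid n s else real n + 2)" for s
 define F where "F v = (if v \<le> real n + 1 then f v else 0)" for v
 have "h ` UNIV \<subseteq> insert (real n + 2) ((\<lambda>k::int. of_int k / real (Suc n)) ` {- int (Suc n * Suc n)..int (Suc n * Suc n)})"
 proof
  fix v assume "v \<in> h ` UNIV"
  then obtain s where s: "v = h s" by auto
  show "v \<in> insert (real n + 2) ((\<lambda>k::int. of_int k / real (Suc n)) ` {- int (Suc n * Suc n)..int (Suc n * Suc n)})"
  proof (cases "\<bar>s\<bar> \<le> real n")
   case True
   have "\<bar>s * real (Suc n)\<bar> \<le> real n * real (Suc n)" unfolding abs_mult using True by (intro mult_mono) auto
   also have "\<dots> \<le> real (Suc n * Suc n) - 1" by (simp add: algebra_simps)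
   finally have "\<bar>s * real (Suc n)\<bar> \<le> real_of_int (int (Suc n * Suc n)) - 1" by simp
   then have "- int (Suc n * Suc n) \<le> \<lfloor>s * real (Suc n)\<rfloor>" "\<lfloor>s * real (Suc n)\<rfloor> \<le> int (Suc n * Suc n)"
    by linarith+
   then show ?thesis using s True by (auto simp: h_def grid_def)
  qed (use s in \<open>simp add: h_def\<close>)
 qed
 then have fin: "finite (h ` UNIV)" by (rule finite_subset) auto
 have "h \<in> borel_measurable borel" unfolding h_def grid_def by measurable
 then have "simple_function lebesgue h"
  by (intro simple_function_borel_measurable) (use fin in \<open>auto intro: measurable_completion\<close>)
 then have "simple_function lebesgue (\<lambda>s. F (h s))" by (rule simple_function_compose1)
 moreover have "F (h s) = step_fun n f s" for s
 proof (cases "\<bar>s\<bar> \<le> real n")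
  case True
  have "1 / real (Suc n) \<le> 1" by simp
  then have "\<bar>grid n s - s\<bar> \<le> 1" using grid_close[of n s] by linarith
  then have "grid n s \<le> real n + 1" using True by linarith
  then show ?thesis using True by (simp add: F_def h_def step_fun_def)
 qed (simp add: F_def h_def step_fun_def)
 ultimately show ?thesis by simp
qed

lemma step_fun_tendsto:
 fixes f :: "real \<Rightarrow> 'a::{zero, topological_space}"
 assumes "isCont f s"
 shows "(\<lambda>n. step_fun n f s) \<longlonglongrightarrow> f s"
proof -
 have "(\<lambda>n. grid n s) \<longlonglongrightarrow> s"
 proof (rule LIM_zero_cancel, rule tendsto_rabs_zero_cancel, rule tendsto_sandwich[OF _ _ tendsto_const])
  show "(\<lambda>n. 1 / real (Suc n)) \<longlonglongrightarrow> 0" by (rule LIMSEQ_Suc[OF lim_const_over_n])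
 qed (use grid_close in auto)
 then have "(\<lambda>n. f (grid n s)) \<longlonglongrightarrow> f s" by (rule isCont_tendsto_compose[OF assms])
 moreover have "\<forall>\<^sub>F n in sequentially. f (grid n s) = step_fun n f s"
  unfolding step_fun_def using eventually_ge_at_top[of "nat \<lceil>\<bar>s\<bar>\<rceil>"] by eventually_elim (simp add: nat_ceiling_le_eq)
 ultimately show ?thesis by (rule Lim_transform_eventually)
qed

lemma step_fun_decay:
 assumes \<psi>: "\<And>t. cmod (\<psi> t) \<le> C * inverse (1 + t\<^sup>2)" and C: "0 \<le> C"
 shows "cmod (step_fun n \<psi> s) \<le> (3 * C) * inverse (1 + s\<^sup>2)"
proof (cases "\<bar>s\<bar> \<le> real n")
 case True
 let ?v = "grid n s"
 have "1 / real (Suc n) \<le> 1" by simp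
 then have "\<bar>?v - s\<bar> \<le> 1" using grid_close[of n s] by linarith
 then have e: "(?v - s)\<^sup>2 \<le> 1" by (simp add: abs_square_le_1)
 have "s\<^sup>2 \<le> 2 * ?v\<^sup>2 + 2 * (?v - s)\<^sup>2"
  using zero_le_power2[of "s - 2 * ?v"] by (simp add: power2_eq_square algebra_simps)
 then have "1 + s\<^sup>2 \<le> 3 * (1 + ?v\<^sup>2)" using e zero_le_power2[of ?v] unfolding distrib_left by linarith
 moreover have p: "0 < 1 + s\<^sup>2" "0 < 1 + ?v\<^sup>2" by (auto intro: add_pos_nonneg)
 ultimately have "inverse (1 + ?v\<^sup>2) \<le> 3 * inverse (1 + s\<^sup>2)" by (simp add: field_simps)
 then have "C * inverse (1 + ?v\<^sup>2) \<le> C * (3 * inverse (1 + s\<^sup>2))" by (rule mult_left_mono[OF _ C])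
 then show ?thesis using \<psi>[of ?v] True by (simp add: step_fun_def)
next
 case False
 then show ?thesis using C by (simp add: step_fun_def)
qed

lemma fourier_borel:
 fixes \<psi> :: "real \<Rightarrow> complex"
 assumes "integrable lborel \<psi>"
 shows "(\<lambda>\<xi>. ltr \<psi> (c * of_real \<xi>)) \<in> borel_measurable borel"
proof -
 note [measurable] = borel_measurable_integrable[OF assms, simplified]
 show ?thesis unfolding ltr_def by measurable
qed

lemma fourier_bounded:
 assumes "integrable lborel \<psi>" "Re z = 0"
 shows "cmod (ltr \<psi> z) \<le> (LBINT t. cmod (\<psi> t))"
proof -
 have "cmod (ltr \<psi> z) \<le> (LBINT t. cmod (exp (z * of_real t) * \<psi> t))" unfolding ltr_def by (rule integral_norm_bound)
 then show ?thesis using assms(2) by (simp add: norm_mult)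
qed

text \<open>
 The decay of \<open>\<psi>\<close> is inherited by its step functions and dominates them. In the
 limit Fourier inversion turns the pairing in time into the pairing in frequency.
\<close>
lemma step_convolution:
 fixes \<phi> \<psi> \<kappa> :: "real \<Rightarrow> complex"
 assumes \<phi>: "\<phi> \<in> schwartz UNIV" and \<psi>: "\<psi> \<in> schwartz UNIV" and \<kappa>: "integrable lborel \<kappa>"
 shows "integrable lborel (\<lambda>t. \<phi> t * (LBINT s. step_fun n \<psi> s * \<kappa> (t - s)))"
  "(\<lambda>n. \<integral>t. \<phi> t * (LBINT s. step_fun n \<psi> s * \<kappa> (t - s)) \<partial>lborel) \<longlonglongrightarrow>
   (LBINT \<xi>. inv_fourier \<phi> \<xi> * (fourier \<psi> \<xi> * ltr \<kappa> (- \<i> * of_real \<xi>)))"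
proof -
 obtain d where d: "rapid d" "d 0 = \<phi>" using schwartz_rapid[OF \<phi>] by (elim exE conjE)
 obtain e where e: "rapid e" "e 0 = \<psi>" using schwartz_rapid[OF \<psi>] by (elim exE conjE)
 obtain C where C: "0 \<le> C" "\<forall>t. cmod (e 0 t) \<le> C * inverse (1 + t\<^sup>2)" by (rule rapid_bound[OF e(1)])
 obtain C' where C': "0 \<le> C'" "\<forall>t. cmod (d 0 t) \<le> C' * inverse (1 + t\<^sup>2)" by (rule rapid_bound[OF d(1)])
 have \<phi>b: "cmod (\<phi> t) \<le> C'" for t
 proof -
  have "inverse (1 + t\<^sup>2) \<le> 1" by (simp add: inverse_le_1_iff)
  from mult_left_mono[OF this C'(1)] show ?thesis using C'(2) d(2) by (metis mult.right_neutral order_trans)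
 qed
 note \<phi>i = schwartz_integrable[OF \<phi>] and \<psi>i = schwartz_integrable[OF \<psi>]
 note [measurable] = borel_measurable_integrable[OF \<kappa>, simplified] borel_measurable_integrable[OF \<phi>i, simplified]
  borel_measurable_integrable[OF \<psi>i, simplified]
 have \<sigma>m[measurable]: "step_fun n \<psi> \<in> borel_measurable borel" for n
  unfolding step_fun_def grid_def by measurable
 have \<sigma>b: "cmod (step_fun n \<psi> s) \<le> (3 * C) * inverse (1 + s\<^sup>2)" for n s
  by (rule step_fun_decay) (use C e in auto)
 have wi: "integrable lborel (\<lambda>s::real. (3 * C) * inverse (1 + s\<^sup>2))"
  by (intro integrable_mult_right integrable_inverse_square)
 have \<sigma>i: "integrable lborel (step_fun n \<psi>)" for n
 proof (rule integrable_dom[OF wi])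
  have "norm (step_fun n \<psi> s) \<le> norm ((3 * C) * inverse (1 + s\<^sup>2))" for s
   by (rule order_trans[OF \<sigma>b]) simp
  then show "AE s in lborel. norm (step_fun n \<psi> s) \<le> norm ((3 * C) * inverse (1 + s\<^sup>2))" by simp
 qed simp
 have conv: "integrable (lborel2) (\<lambda>(s, t). \<phi> t * (step_fun n \<psi> s * \<kappa> (t - s)))" for n
 proof (rule integrable_dom[OF integrable_mult_right[OF convolution_integrable[OF \<sigma>i[of n] \<kappa>], of "of_real C'"]])
  show "(\<lambda>(s, t). \<phi> t * (step_fun n \<psi> s * \<kappa> (t - s))) \<in> borel_measurable (lborel2)" by measurable
  have "norm (\<phi> t * (step_fun n \<psi> s * \<kappa> (t - s))) \<le> norm (of_real C' * (step_fun n \<psi> s * \<kappa> (t - s)))" for s t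
   unfolding norm_mult[of "\<phi> t"] norm_mult[of "of_real C'"] using \<phi>b[of t] C'(1) by (intro mult_right_mono) auto
  then show "AE z in lborel2. norm (case z of (s, t) \<Rightarrow> \<phi> t * (step_fun n \<psi> s * \<kappa> (t - s))) \<le>
    norm (of_real C' * (case z of (x, y) \<Rightarrow> step_fun n \<psi> x * \<kappa> (y - x)))" by (simp add: split_beta)
 qed
 show "integrable lborel (\<lambda>t. \<phi> t * (LBINT s. step_fun n \<psi> s * \<kappa> (t - s)))"
  using lborel_pair.integrable_snd[OF conv[of n]] by simp
 have each: "(LBINT t. \<phi> t * (LBINT s. step_fun n \<psi> s * \<kappa> (t - s))) =
   (\<integral>z. \<phi> (fst z + snd z) * (step_fun n \<psi> (fst z) * \<kappa> (snd z)) \<partial>lborel2)" for n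
 proof -
  have pi: "integrable (lborel2) (\<lambda>(s, u). \<phi> (s + u) * (step_fun n \<psi> s * \<kappa> u))"
  proof (rule integrable_dom[OF integrable_mult_right[OF product_integrable[OF \<sigma>i[of n] \<kappa>], of "of_real C'"]])
   show "(\<lambda>(s, u). \<phi> (s + u) * (step_fun n \<psi> s * \<kappa> u)) \<in> borel_measurable (lborel2)" by measurable
   have "norm (\<phi> (s + u) * (step_fun n \<psi> s * \<kappa> u)) \<le> norm (of_real C' * (step_fun n \<psi> s * \<kappa> u))" for s u
    unfolding norm_mult[of "\<phi> (s + u)"] norm_mult[of "of_real C'"] using \<phi>b[of "s + u"] C'(1) by (intro mult_right_mono) auto
   then show "AE z in lborel2. norm (case z of (s, u) \<Rightarrow> \<phi> (s + u) * (step_fun n \<psi> s * \<kappa> u)) \<le>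
     norm (of_real C' * (case z of (x, y) \<Rightarrow> step_fun n \<psi> x * \<kappa> y))" by (simp add: split_beta)
  qed
  have "(LBINT t. \<phi> t * (LBINT s. step_fun n \<psi> s * \<kappa> (t - s))) =
    (LBINT t. (LBINT s. \<phi> t * (step_fun n \<psi> s * \<kappa> (t - s))))" by simp
  also have "\<dots> = (LBINT s. (LBINT t. \<phi> t * (step_fun n \<psi> s * \<kappa> (t - s))))"
   by (rule pair_swap_integral[OF conv])
  also have "\<dots> = (LBINT s. (LBINT u. \<phi> (s + u) * (step_fun n \<psi> s * \<kappa> u)))"
  proof (rule integral_eqI[OF refl])
   fix s show "(LBINT t. \<phi> t * (step_fun n \<psi> s * \<kappa> (t - s))) = (LBINT u. \<phi> (s + u) * (step_fun n \<psi> s * \<kappa> u))"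
    using lborel_integral_real_affine[of 1 "\<lambda>t. \<phi> t * (step_fun n \<psi> s * \<kappa> (t - s))" s] by simp
  qed
  also have "\<dots> = (\<integral>z. \<phi> (fst z + snd z) * (step_fun n \<psi> (fst z) * \<kappa> (snd z)) \<partial>lborel2)"
   using lborel_pair.integral_fst'[OF pi] unfolding split_beta fst_conv snd_conv .
  finally show ?thesis .
 qed
 have "(\<lambda>n. \<integral>z. \<phi> (fst z + snd z) * (step_fun n \<psi> (fst z) * \<kappa> (snd z)) \<partial>lborel2) \<longlonglongrightarrow>
   (\<integral>z. \<phi> (fst z + snd z) * (\<psi> (fst z) * \<kappa> (snd z)) \<partial>lborel2)"
 proof (rule integral_dominated_convergence)
  show "integrable (lborel2) (\<lambda>z. C' * (case z of (x, y) \<Rightarrow> ((3 * C) * inverse (1 + x\<^sup>2)) * norm (\<kappa> y)))"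
   by (intro integrable_mult_right product_integrable wi integrable_norm \<kappa>)
  show "AE z in lborel2. norm (\<phi> (fst z + snd z) * (step_fun n \<psi> (fst z) * \<kappa> (snd z))) \<le>
    C' * (case z of (x, y) \<Rightarrow> ((3 * C) * inverse (1 + x\<^sup>2)) * norm (\<kappa> y))" for n
   unfolding norm_mult split_beta by (intro AE_I2 mult_mono \<phi>b \<sigma>b C'(1)) (use C in auto)
  show "AE z in lborel2. (\<lambda>n. \<phi> (fst z + snd z) * (step_fun n \<psi> (fst z) * \<kappa> (snd z))) \<longlonglongrightarrow>
    \<phi> (fst z + snd z) * (\<psi> (fst z) * \<kappa> (snd z))"
  proof (rule AE_I2)
   fix z :: "real \<times> real"
   have "isCont (e 0) (fst z)" by (rule deriv_chain_isCont) (use e(1) in \<open>simp add: rapid_def\<close>)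
   then have "isCont \<psi> (fst z)" using e(2) by simp
   then show "(\<lambda>n. \<phi> (fst z + snd z) * (step_fun n \<psi> (fst z) * \<kappa> (snd z))) \<longlonglongrightarrow> \<phi> (fst z + snd z) * (\<psi> (fst z) * \<kappa> (snd z))"
    by (intro tendsto_mult_left tendsto_mult_right step_fun_tendsto)
  qed
 qed measurable
 moreover have "(\<integral>z. \<phi> (fst z + snd z) * (\<psi> (fst z) * \<kappa> (snd z)) \<partial>lborel2) =
   (LBINT \<xi>. inv_fourier \<phi> \<xi> * (fourier \<psi> \<xi> * ltr \<kappa> (- \<i> * of_real \<xi>)))"
 proof -
  have hi: "integrable (lborel2) (\<lambda>z. \<psi> (fst z) * \<kappa> (snd z))"
   using product_integrable[OF \<psi>i \<kappa>] unfolding split_beta .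
  have "(\<integral>z. exp (- \<i> * of_real \<xi> * of_real (fst z + snd z)) * (\<psi> (fst z) * \<kappa> (snd z)) \<partial>lborel2) =
    fourier \<psi> \<xi> * ltr \<kappa> (- \<i> * of_real \<xi>)" for \<xi>
  proof -
   have e1: "exp (- \<i> * of_real \<xi> * of_real (fst z + snd z)) * (\<psi> (fst z) * \<kappa> (snd z)) =
     (exp (- \<i> * of_real \<xi> * of_real (fst z)) * \<psi> (fst z)) * (exp (- \<i> * of_real \<xi> * of_real (snd z)) * \<kappa> (snd z))" for z :: "real \<times> real"
    unfolding of_real_add distrib_left exp_add by (simp only: mult_ac)
   have i: "integrable lborel (\<lambda>t. exp (- \<i> * of_real \<xi> * of_real t) * f t)" if "integrable lborel f" for f :: "real \<Rightarrow> complex"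
    by (rule integrable_dom[OF that])
     (use borel_measurable_integrable[OF that] in \<open>auto simp: norm_mult\<close>)
   show ?thesis unfolding e1 product_integral[OF i[OF \<psi>i] i[OF \<kappa>]] fourier_lborel(1)[OF \<psi>i] by (simp only: ltr_def)
  qed
  then show ?thesis
   using inversion_convolution[OF rapid_inversion[OF d(1)] hi] unfolding d(2) by simp
 qed
 ultimately show "(\<lambda>n. \<integral>t. \<phi> t * (LBINT s. step_fun n \<psi> s * \<kappa> (t - s)) \<partial>lborel) \<longlonglongrightarrow>
   (LBINT \<xi>. inv_fourier \<phi> \<xi> * (fourier \<psi> \<xi> * ltr \<kappa> (- \<i> * of_real \<xi>)))"
  unfolding each by simp
qed

lemma AE_lborel_lebesgue: "(AE t in lebesgue. P t) \<Longrightarrow> (AE t in lborel. P t)"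
 by (simp add: AE_completion_iff)

lemma step_fun_sum: "step_fun n (\<lambda>t. \<Sum>k\<in>J. \<psi> k t *\<^sub>C y k) s = (\<Sum>k\<in>J. step_fun n (\<psi> k) s *\<^sub>C (y k :: 'y::complex_banach))"
 by (simp add: step_fun_def)

text \<open>
 The kernel estimate is available for step functions only. Sampling \<open>\<Sum> \<psi>\<^sub>k y\<^sub>k\<close> keeps the sup
 norm, and after testing with a functional everything converges by dominated convergence.
\<close>
lemma multiplier_test_bound_infty:
 fixes m :: "real \<Rightarrow> 'y::complex_banach \<Rightarrow> 'x::complex_banach" and \<phi> :: "'i \<Rightarrow> real \<Rightarrow> complex"
 assumes mb: "multiplier_bound_infty Y m C" and C: "0 < C"
  and cont: "\<And>u. u \<in> Y \<Longrightarrow> continuous_on UNIV (\<lambda>\<xi>. m \<xi> u)"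
  and Y: "0 \<in> Y" "\<And>u v. u \<in> Y \<Longrightarrow> v \<in> Y \<Longrightarrow> u + v \<in> Y" "\<And>c u. u \<in> Y \<Longrightarrow> c *\<^sub>C u \<in> Y"
  and \<phi>: "\<And>j. j \<in> I \<Longrightarrow> \<phi> j \<in> schwartz UNIV" and \<psi>: "\<And>k. k \<in> J \<Longrightarrow> \<psi> k \<in> schwartz UNIV"
  and y: "\<And>k. k \<in> J \<Longrightarrow> y k \<in> Y"
  and b: "(LBINT t. (\<Sum>j\<in>I. cmod (\<phi> j t))) \<le> b"
  and B: "0 < B" "\<And>t. norm (\<Sum>k\<in>J. \<psi> k t *\<^sub>C y k) \<le> B"
 shows "(\<Sum>j\<in>I. norm (Bochner (\<lambda>\<xi>. inv_fourier (\<phi> j) \<xi> *\<^sub>C (\<Sum>k\<in>J. fourier (\<psi> k) \<xi> *\<^sub>C m \<xi> (y k))))) \<le> 2 * b * (C * B)"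
proof -
 define f where "f t = (\<Sum>k\<in>J. \<psi> k t *\<^sub>C y k)" for t
 obtain K where K: "\<forall>t. bounded_clinear_on Y (K t)" "strongly_measurable_on Y K"
   "\<forall>u\<in>Y. (\<lambda>t. K t u) \<in> Lp_fun 1 UNIV \<and> (\<forall>\<xi>. m \<xi> u = fourier (\<lambda>t. K t u) \<xi>)"
   "\<forall>f. simple_function lebesgue f \<and> (\<forall>t. f t \<in> Y) \<longrightarrow>
     Lp_norm \<infinity> (\<lambda>t. Bochner (\<lambda>s. K (t - s) (f s))) \<le> ennreal C * Lp_norm \<infinity> f"
  using mb unfolding multiplier_bound_infty_def by (elim exE conjE)
 have Ks: "smeas (\<lambda>t. K t u)" if "u \<in> Y" for u
  using K(2) that by (simp add: strongly_measurable_on_def strongly_measurable_smeas)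
 have Kb: "bint (\<lambda>t. K t u)" if u: "u \<in> Y" for u
 proof -
  have "Lp_norm 1 (\<lambda>t. K t u) < \<infinity>" using K(3) u by (simp add: Lp_fun_def)
  then have "(\<integral>\<^sup>+t. ennreal (norm (K t u)) \<partial>lebesgue) < \<infinity>"
   unfolding Lp_norm_def by (auto simp: Let_def less_top split: if_splits)
  then show ?thesis using Ks[OF u] by (simp add: bint_def)
 qed
 have Kexp: "bint (\<lambda>t. exp (- (\<i> * of_real \<xi> * of_real t)) *\<^sub>C K t u)" if u: "u \<in> Y" for u \<xi>
 proof (rule bintI[OF smeas_scaleC[OF _ Ks[OF u]] bint_norm_integrable[OF Kb[OF u]]])
  show "smeas (\<lambda>t. exp (- (\<i> * of_real \<xi> * of_real t)))" by (rule smeas_borel') measurable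
 qed (simp add: norm_scaleC)
 define c where "c u = (\<integral>t. norm (K t u) \<partial>lebesgue)" for u
 have mbnd: "norm (m \<xi> u) \<le> c u" if u: "u \<in> Y" for u \<xi>
  using Bochner_norm_le[OF Kexp[OF u, of \<xi>]] K(3) u by (simp add: fourier_def norm_scaleC c_def)
 have \<psi>i: "integrable lborel (\<psi> k)" if "k \<in> J" for k by (rule schwartz_integrable[OF \<psi>[OF that]])
 have \<phi>i: "integrable lborel (\<phi> j)" if "j \<in> I" for j by (rule schwartz_integrable[OF \<phi>[OF that]])
 have fm: "fourier (\<psi> k) \<in> borel_measurable borel" if "k \<in> J" for k
  using fourier_borel[OF \<psi>i[OF that], of "- \<i>"] unfolding fourier_lborel(1)[OF \<psi>i[OF that], symmetric] .
 have fb: "cmod (fourier (\<psi> k) \<xi>) \<le> (LBINT t. cmod (\<psi> k t))" if "k \<in> J" for k \<xi>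
  unfolding fourier_lborel(1)[OF \<psi>i[OF that]] by (rule fourier_bounded[OF \<psi>i[OF that]]) simp
 have ii: "integrable lborel (inv_fourier (\<phi> j))" if j: "j \<in> I" for j
 proof -
  obtain d where d: "rapid d" "d 0 = \<phi> j" using schwartz_rapid[OF \<phi>[OF j]] by (elim exE conjE)
  show ?thesis using rapid_inversion(1)[OF d(1)] unfolding d(2) .
 qed
 have im: "inv_fourier (\<phi> j) \<in> borel_measurable borel" if "j \<in> I" for j
  using borel_measurable_integrable[OF ii[OF that]] by simp
 let ?\<Lambda> = "\<lambda>j \<xi>. inv_fourier (\<phi> j) \<xi> *\<^sub>C (\<Sum>k\<in>J. fourier (\<psi> k) \<xi> *\<^sub>C m \<xi> (y k))"
 have \<Lambda>b: "bint (?\<Lambda> j)" if j: "j \<in> I" for j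
 proof (rule bintI[where k="\<lambda>\<xi>. (\<Sum>k\<in>J. (LBINT t. cmod (\<psi> k t)) * c (y k)) * cmod (inv_fourier (\<phi> j) \<xi>)"])
  show "smeas (?\<Lambda> j)"
  proof (intro smeas_scaleC smeas_sum)
   show "smeas (\<lambda>\<xi>. m \<xi> (y k))" if "k \<in> J" for k
    by (rule smeas_isCont) (use cont[OF y[OF that]] in \<open>simp add: continuous_on_eq_continuous_at\<close>)
  qed (use im fm j in \<open>auto intro!: smeas_borel'\<close>)
  have "integrable lebesgue (inv_fourier (\<phi> j))" using ii[OF j] lebesgue_lborel(2)[OF im[OF j]] by simp
  then show "integrable lebesgue (\<lambda>\<xi>. (\<Sum>k\<in>J. (LBINT t. cmod (\<psi> k t)) * c (y k)) * cmod (inv_fourier (\<phi> j) \<xi>))"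
   by (intro integrable_mult_right integrable_norm)
  have "norm (?\<Lambda> j \<xi>) \<le> (\<Sum>k\<in>J. (LBINT t. cmod (\<psi> k t)) * c (y k)) * cmod (inv_fourier (\<phi> j) \<xi>)" for \<xi>
  proof -
   have "norm (\<Sum>k\<in>J. fourier (\<psi> k) \<xi> *\<^sub>C m \<xi> (y k)) \<le> (\<Sum>k\<in>J. norm (fourier (\<psi> k) \<xi> *\<^sub>C m \<xi> (y k)))" by (rule norm_sum)
   also have "\<dots> \<le> (\<Sum>k\<in>J. (LBINT t. cmod (\<psi> k t)) * c (y k))"
    unfolding norm_scaleC by (intro sum_mono mult_mono fb mbnd y) auto
   finally show ?thesis unfolding norm_scaleC by (simp add: mult.commute mult_left_mono)
  qed
  then show "AE \<xi> in lebesgue. norm (?\<Lambda> j \<xi>) \<le> (\<Sum>k\<in>J. (LBINT t. cmod (\<psi> k t)) * c (y k)) * cmod (inv_fourier (\<phi> j) \<xi>)" by simp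
 qed
 have "\<forall>j. \<exists>l. bounded_clinear_on UNIV l \<and> (\<forall>x. cmod (l x) \<le> norm x) \<and> l (Bochner (?\<Lambda> j)) = of_real (norm (Bochner (?\<Lambda> j)))"
 proof
  fix j
  obtain l where "bounded_clinear_on UNIV l" "\<forall>x. cmod (l x) \<le> norm x" "l (Bochner (?\<Lambda> j)) = of_real (norm (Bochner (?\<Lambda> j)))"
   by (rule norming_functional)
  then show "\<exists>l. bounded_clinear_on UNIV l \<and> (\<forall>x. cmod (l x) \<le> norm x) \<and> l (Bochner (?\<Lambda> j)) = of_real (norm (Bochner (?\<Lambda> j)))"
   by (intro exI[of _ l] conjI)
 qed
 then obtain l where l': "\<forall>j. bounded_clinear_on UNIV (l j) \<and> (\<forall>x. cmod (l j x) \<le> norm x) \<and>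
   l j (Bochner (?\<Lambda> j)) = of_real (norm (Bochner (?\<Lambda> j)))" unfolding choice_iff by (elim exE)
 then have l: "\<And>j. bounded_clinear_on UNIV (l j)" "\<And>j x. cmod (l j x) \<le> norm x"
  "\<And>j. l j (Bochner (?\<Lambda> j)) = of_real (norm (Bochner (?\<Lambda> j)))" by simp_all
 have "\<exists>g. integrable lborel g \<and> (u \<in> Y \<longrightarrow> (AE t in lebesgue. l j (K t u) = g t))" for j u
 proof (cases "u \<in> Y")
  case True
  then show ?thesis using borel_version[OF functional_Bochner(1)[OF Kb[OF True] l(1)[of j]]] by simp
 next
  case False then show ?thesis by (intro exI[of _ "\<lambda>t. 0"]) simp
 qed
 then have "\<forall>j u. \<exists>g. integrable lborel g \<and> (u \<in> Y \<longrightarrow> (AE t in lebesgue. l j (K t u) = g t))" by (intro allI)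
 then obtain \<kappa> where "\<forall>j u. integrable lborel (\<kappa> j u) \<and> (u \<in> Y \<longrightarrow> (AE t in lebesgue. l j (K t u) = \<kappa> j u t))"
  unfolding choice_iff by (elim exE)
 then have \<kappa>: "\<And>j u. integrable lborel (\<kappa> j u)" "\<And>j u. u \<in> Y \<Longrightarrow> AE t in lebesgue. l j (K t u) = \<kappa> j u t"
  by simp_all
 have \<kappa>m: "\<kappa> j u \<in> borel_measurable borel" for j u using borel_measurable_integrable[OF \<kappa>(1)] by simp
 have lm: "l j (m \<xi> u) = ltr (\<kappa> j u) (- \<i> * of_real \<xi>)" if u: "u \<in> Y" for j u \<xi>
 proof -
  have "l j (m \<xi> u) = (\<integral>t. l j (exp (- (\<i> * of_real \<xi> * of_real t)) *\<^sub>C K t u) \<partial>lebesgue)"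
   using functional_Bochner(2)[OF Kexp[OF u] l(1)] K(3) u by (simp add: fourier_def)
  also have "\<dots> = (\<integral>t. exp (- (\<i> * of_real \<xi> * of_real t)) * \<kappa> j u t \<partial>lebesgue)"
  proof (rule integral_cong_AE)
   show "(\<lambda>t. l j (exp (- (\<i> * of_real \<xi> * of_real t)) *\<^sub>C K t u)) \<in> borel_measurable lebesgue"
    by (rule borel_measurable_integrable[OF functional_Bochner(1)[OF Kexp[OF u] l(1)]])
   have "(\<lambda>t. exp (- (\<i> * of_real \<xi> * of_real t)) * \<kappa> j u t) \<in> borel_measurable lborel" using \<kappa>m by measurable
   then show "(\<lambda>t. exp (- (\<i> * of_real \<xi> * of_real t)) * \<kappa> j u t) \<in> borel_measurable lebesgue" by (rule measurable_completion)
   show "AE t in lebesgue. l j (exp (- (\<i> * of_real \<xi> * of_real t)) *\<^sub>C K t u) = exp (- (\<i> * of_real \<xi> * of_real t)) * \<kappa> j u t"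
    using \<kappa>(2)[OF u] by eventually_elim (simp add: bcl_mult[OF l(1)])
  qed
  also have "\<dots> = (LBINT t. exp (- (\<i> * of_real \<xi> * of_real t)) * \<kappa> j u t)"
   by (rule lebesgue_lborel(1)) (use \<kappa>m in measurable)
  finally show ?thesis by (simp add: ltr_def)
 qed
 define P where "P n j t = (\<Sum>k\<in>J. \<integral>s. step_fun n (\<psi> k) s * \<kappa> j (y k) (t - s) \<partial>lborel)" for n j t
 have Q: "integrable lborel (\<lambda>t. \<phi> j t * (LBINT s. step_fun n (\<psi> k) s * \<kappa> j (y k) (t - s)))" if "j \<in> I" "k \<in> J" for n j k
  by (rule step_convolution(1)[OF \<phi> \<psi> \<kappa>(1)]) (use that in auto)
 have Pi: "integrable lborel (\<lambda>t. \<phi> j t * P n j t)" if "j \<in> I" for n j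
  unfolding P_def sum_distrib_left by (rule Bochner_Integration.integrable_sum) (rule Q[OF that])
 have lim: "(\<lambda>n. \<integral>t. \<phi> j t * P n j t \<partial>lborel) \<longlonglongrightarrow> of_real (norm (Bochner (?\<Lambda> j)))" if j: "j \<in> I" for j
 proof -
  have i0: "integrable lborel (\<lambda>\<xi>. inv_fourier (\<phi> j) \<xi> * (fourier (\<psi> k) \<xi> * ltr (\<kappa> j (y k)) (- \<i> * of_real \<xi>)))" if k: "k \<in> J" for k
  proof (rule integrable_dom[OF integrable_mult_left[OF ii[OF j],
    of "of_real ((LBINT t. cmod (\<psi> k t)) * (LBINT t. cmod (\<kappa> j (y k) t)))"]])
   note [measurable] = im[OF j] fm[OF k] fourier_borel[OF \<kappa>(1)[of j "y k"], of "- \<i>"]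
   show "(\<lambda>\<xi>. inv_fourier (\<phi> j) \<xi> * (fourier (\<psi> k) \<xi> * ltr (\<kappa> j (y k)) (- \<i> * of_real \<xi>))) \<in> borel_measurable lborel" by measurable
   have nn: "0 \<le> (LBINT t. cmod (\<psi> k t)) * (LBINT t. cmod (\<kappa> j (y k) t))" by simp
   have "norm (inv_fourier (\<phi> j) \<xi> * (fourier (\<psi> k) \<xi> * ltr (\<kappa> j (y k)) (- \<i> * of_real \<xi>))) \<le>
     norm (inv_fourier (\<phi> j) \<xi> * of_real ((LBINT t. cmod (\<psi> k t)) * (LBINT t. cmod (\<kappa> j (y k) t))))" for \<xi>
    unfolding norm_mult norm_of_real abs_of_nonneg[OF nn]
    by (intro mult_left_mono mult_mono fb[OF k] fourier_bounded \<kappa>(1)) auto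
   then show "AE \<xi> in lborel. norm (inv_fourier (\<phi> j) \<xi> * (fourier (\<psi> k) \<xi> * ltr (\<kappa> j (y k)) (- \<i> * of_real \<xi>))) \<le>
     norm (inv_fourier (\<phi> j) \<xi> * of_real ((LBINT t. cmod (\<psi> k t)) * (LBINT t. cmod (\<kappa> j (y k) t))))" by simp
  qed
  have "(\<lambda>n. \<Sum>k\<in>J. \<integral>t. \<phi> j t * (LBINT s. step_fun n (\<psi> k) s * \<kappa> j (y k) (t - s)) \<partial>lborel) \<longlonglongrightarrow>
   (\<Sum>k\<in>J. \<integral>\<xi>. inv_fourier (\<phi> j) \<xi> * (fourier (\<psi> k) \<xi> * ltr (\<kappa> j (y k)) (- \<i> * of_real \<xi>)) \<partial>lborel)"
   by (intro tendsto_sum step_convolution(2) \<phi> \<psi> \<kappa>(1) j)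
  moreover have "(\<Sum>k\<in>J. \<integral>t. \<phi> j t * (LBINT s. step_fun n (\<psi> k) s * \<kappa> j (y k) (t - s)) \<partial>lborel) = (LBINT t. \<phi> j t * P n j t)" for n
   unfolding P_def sum_distrib_left by (rule Bochner_Integration.integral_sum[symmetric]) (rule Q[OF j])
  moreover have "(\<Sum>k\<in>J. \<integral>\<xi>. inv_fourier (\<phi> j) \<xi> * (fourier (\<psi> k) \<xi> * ltr (\<kappa> j (y k)) (- \<i> * of_real \<xi>)) \<partial>lborel) =
    of_real (norm (Bochner (?\<Lambda> j)))"
  proof -
   let ?g = "\<lambda>\<xi>. \<Sum>k\<in>J. inv_fourier (\<phi> j) \<xi> * (fourier (\<psi> k) \<xi> * ltr (\<kappa> j (y k)) (- \<i> * of_real \<xi>))"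
   have gi: "integrable lborel ?g" by (rule Bochner_Integration.integrable_sum) (rule i0)
   have "of_real (norm (Bochner (?\<Lambda> j))) = (\<integral>\<xi>. l j (?\<Lambda> j \<xi>) \<partial>lebesgue)"
    using functional_Bochner(2)[OF \<Lambda>b[OF j] l(1)[of j]] unfolding l(3) .
   also have "\<dots> = (\<integral>\<xi>. ?g \<xi> \<partial>lebesgue)"
   proof (rule integral_eqI[OF refl])
    fix \<xi>
    have "l j (?\<Lambda> j \<xi>) = inv_fourier (\<phi> j) \<xi> * (\<Sum>k\<in>J. fourier (\<psi> k) \<xi> * l j (m \<xi> (y k)))"
     unfolding bcl_mult[OF l(1)] bcl_sum[OF l(1)] ..
    also have "\<dots> = ?g \<xi>" unfolding sum_distrib_left by (intro sum.cong refl) (simp only: lm[OF y])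
    finally show "l j (?\<Lambda> j \<xi>) = ?g \<xi>" .
   qed
   also have "\<dots> = (LBINT \<xi>. ?g \<xi>)"
    by (rule lebesgue_lborel(1)) (use borel_measurable_integrable[OF gi] in simp)
   also have "\<dots> = (\<Sum>k\<in>J. \<integral>\<xi>. inv_fourier (\<phi> j) \<xi> * (fourier (\<psi> k) \<xi> * ltr (\<kappa> j (y k)) (- \<i> * of_real \<xi>)) \<partial>lborel)"
    by (rule Bochner_Integration.integral_sum) (rule i0)
   finally show ?thesis by simp
  qed
  ultimately show ?thesis by simp
 qed
 have Pb: "AE t in lborel. cmod (P n j t) \<le> 2 * (C * B)" for n j
 proof -
  let ?f = "step_fun n f"
  have S: "(\<Sum>k\<in>J. c k *\<^sub>C y k) \<in> Y" for c by (intro sum_in_subspace Y y)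
  have fY: "?f t \<in> Y" for t by (simp add: step_fun_def f_def S Y(1))
  have "norm (?f t) \<le> B" for t using B by (simp add: step_fun_def f_def)
  then have "Lp_norm \<infinity> ?f \<le> ennreal B" unfolding Lp_norm_def by (auto intro!: Inf_lower ennreal_leI)
  then have "ennreal C * Lp_norm \<infinity> ?f \<le> ennreal C * ennreal B" by (rule mult_left_mono) simp
  moreover have "Lp_norm \<infinity> (\<lambda>t. Bochner (\<lambda>s. K (t - s) (?f s))) \<le> ennreal C * Lp_norm \<infinity> ?f"
   using K(4) by (elim allE[of _ ?f] mp) (simp add: simple_step_fun fY)
  ultimately have "Lp_norm \<infinity> (\<lambda>t. Bochner (\<lambda>s. K (t - s) (?f s))) \<le> ennreal (C * B)"
   using C B by (simp add: ennreal_mult)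
  then have "AE t in lebesgue. norm (Bochner (\<lambda>s. K (t - s) (?f s))) \<le> 2 * (C * B)"
   by (rule Lp_norm_infinityD) (use C B in simp)
  then have ae: "AE t in lborel. norm (Bochner (\<lambda>s. K (t - s) (?f s))) \<le> 2 * (C * B)" by (rule AE_lborel_lebesgue)
  have "P n j t = l j (Bochner (\<lambda>s. K (t - s) (?f s)))" for t
  proof -
   have Kf: "K (t - s) (?f s) = (\<Sum>k\<in>J. step_fun n (\<psi> k) s *\<^sub>C K (t - s) (y k))" for s
    unfolding f_def step_fun_sum by (rule bounded_clinear_on_sum[OF _ Y y]) (use K(1) in auto)
   have \<sigma>m: "step_fun n (\<psi> k) \<in> borel_measurable borel" if "k \<in> J" for k
   proof -
    note [measurable] = borel_measurable_integrable[OF \<psi>i[OF that], simplified]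
    show ?thesis unfolding step_fun_def grid_def by measurable
   qed
   have bk: "bint (\<lambda>s. step_fun n (\<psi> k) s *\<^sub>C K (t - s) (y k))" if k: "k \<in> J" for k
   proof -
    obtain d where d: "rapid d" "d 0 = \<psi> k" using schwartz_rapid[OF \<psi>[OF k]] by (elim exE conjE)
    obtain E where E: "0 \<le> E" "\<forall>t. cmod (d 0 t) \<le> E * inverse (1 + t\<^sup>2)" by (rule rapid_bound[OF d(1)])
    have "cmod (\<psi> k v) \<le> E" for v
    proof -
     have "inverse (1 + v\<^sup>2) \<le> 1" by (simp add: inverse_le_1_iff)
     from mult_left_mono[OF this E(1)] have "E * inverse (1 + v\<^sup>2) \<le> E" by simp
     then show ?thesis using E(2)[rule_format, of v] unfolding d(2) by linarith
    qed
    then have Eb: "cmod (step_fun n (\<psi> k) s) \<le> E" for s using E(1) by (simp add: step_fun_def)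
    show ?thesis
    proof (rule bintI)
     show "smeas (\<lambda>s. step_fun n (\<psi> k) s *\<^sub>C K (t - s) (y k))"
      by (rule smeas_scaleC[OF smeas_borel'[OF \<sigma>m[OF k]] smeas_reflect[OF Ks[OF y[OF k]]]])
     show "integrable lebesgue (\<lambda>s. E * norm (K (t - s) (y k)))"
      by (rule integrable_mult_right[OF integrable_reflect[OF bint_norm_integrable[OF Kb[OF y[OF k]]]]])
     show "AE s in lebesgue. norm (step_fun n (\<psi> k) s *\<^sub>C K (t - s) (y k)) \<le> E * norm (K (t - s) (y k))"
      unfolding norm_scaleC by (intro AE_I2 mult_right_mono Eb) simp
    qed
   qed
   have Bs: "Bochner (\<lambda>s. \<Sum>k\<in>J. step_fun n (\<psi> k) s *\<^sub>C K (t - s) (y k)) =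
     (\<Sum>k\<in>J. Bochner (\<lambda>s. step_fun n (\<psi> k) s *\<^sub>C K (t - s) (y k)))"
    by (rule Bochner_sum) (rule bk)
   have "l j (Bochner (\<lambda>s. K (t - s) (?f s))) = (\<Sum>k\<in>J. l j (Bochner (\<lambda>s. step_fun n (\<psi> k) s *\<^sub>C K (t - s) (y k))))"
    unfolding Kf Bs bcl_sum[OF l(1)] ..
   also have "\<dots> = P n j t" unfolding P_def
   proof (rule sum.cong[OF refl])
    fix k assume k: "k \<in> J"
    have "l j (Bochner (\<lambda>s. step_fun n (\<psi> k) s *\<^sub>C K (t - s) (y k))) =
      (\<integral>s. l j (step_fun n (\<psi> k) s *\<^sub>C K (t - s) (y k)) \<partial>lebesgue)"
     by (rule functional_Bochner(2)[OF bk[OF k] l(1)])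
    also have "\<dots> = (\<integral>s. step_fun n (\<psi> k) s * \<kappa> j (y k) (t - s) \<partial>lebesgue)"
    proof (rule integral_cong_AE)
     show "(\<lambda>s. l j (step_fun n (\<psi> k) s *\<^sub>C K (t - s) (y k))) \<in> borel_measurable lebesgue"
      by (rule borel_measurable_integrable[OF functional_Bochner(1)[OF bk[OF k] l(1)]])
     have "(\<lambda>s. step_fun n (\<psi> k) s * \<kappa> j (y k) (t - s)) \<in> borel_measurable lborel"
      using \<sigma>m[OF k] \<kappa>m by measurable
     then show "(\<lambda>s. step_fun n (\<psi> k) s * \<kappa> j (y k) (t - s)) \<in> borel_measurable lebesgue" by (rule measurable_completion)
     show "AE s in lebesgue. l j (step_fun n (\<psi> k) s *\<^sub>C K (t - s) (y k)) = step_fun n (\<psi> k) s * \<kappa> j (y k) (t - s)"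
      using AE_reflect[where t=t, OF \<kappa>(2)[OF y[OF k], of j]] by (rule eventually_mono) (simp add: bcl_mult[OF l(1)])
    qed
    also have "\<dots> = (LBINT s. step_fun n (\<psi> k) s * \<kappa> j (y k) (t - s))"
     by (rule lebesgue_lborel(1)) (use \<sigma>m[OF k] \<kappa>m in measurable)
    finally show "l j (Bochner (\<lambda>s. step_fun n (\<psi> k) s *\<^sub>C K (t - s) (y k))) =
      (LBINT s. step_fun n (\<psi> k) s * \<kappa> j (y k) (t - s))" .
   qed
   finally show ?thesis by simp
  qed
  then show ?thesis using ae by (auto intro: order_trans[OF l(2)])
 qed
 have bound: "norm (\<Sum>j\<in>I. \<integral>t. \<phi> j t * P n j t \<partial>lborel) \<le> 2 * b * (C * B)" for n
 proof -
  have "norm (\<Sum>j\<in>I. \<integral>t. \<phi> j t * P n j t \<partial>lborel) \<le> (\<Sum>j\<in>I. norm (LBINT t. \<phi> j t * P n j t))" by (rule norm_sum)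
  also have "\<dots> \<le> (\<Sum>j\<in>I. (LBINT t. cmod (\<phi> j t) * (2 * (C * B))))"
  proof (rule sum_mono)
   fix j assume j: "j \<in> I"
   have "norm (LBINT t. \<phi> j t * P n j t) \<le> (LBINT t. norm (\<phi> j t * P n j t))" by (rule integral_norm_bound)
   also have "\<dots> \<le> (LBINT t. cmod (\<phi> j t) * (2 * (C * B)))"
   proof (rule integral_mono_AE)
    show "AE t in lborel. norm (\<phi> j t * P n j t) \<le> cmod (\<phi> j t) * (2 * (C * B))"
     using Pb[of n j] by (rule eventually_mono) (simp add: norm_mult mult_left_mono)
   qed (use Pi[OF j] \<phi>i[OF j] in \<open>auto intro!: integrable_norm\<close>)
   finally show "norm (LBINT t. \<phi> j t * P n j t) \<le> (LBINT t. cmod (\<phi> j t) * (2 * (C * B)))" .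
  qed
  also have "\<dots> = (LBINT t. (\<Sum>j\<in>I. cmod (\<phi> j t))) * (2 * (C * B))"
   by (simp add: sum_distrib_right Bochner_Integration.integral_sum[OF integrable_norm[OF \<phi>i]])
  also have "\<dots> \<le> b * (2 * (C * B))" by (rule mult_right_mono[OF b]) (use C B in simp)
  finally show ?thesis by (simp add: mult_ac)
 qed
 have "(\<lambda>n. \<Sum>j\<in>I. \<integral>t. \<phi> j t * P n j t \<partial>lborel) \<longlonglongrightarrow> (\<Sum>j\<in>I. of_real (norm (Bochner (?\<Lambda> j))))"
  by (intro tendsto_sum lim)
 then have "norm (\<Sum>j\<in>I. complex_of_real (norm (Bochner (?\<Lambda> j)))) \<le> 2 * b * (C * B)"
  by (rule Lim_bounded[OF tendsto_norm]) (use bound in auto)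
 moreover have "norm (\<Sum>j\<in>I. complex_of_real (norm (Bochner (?\<Lambda> j)))) = (\<Sum>j\<in>I. norm (Bochner (?\<Lambda> j)))"
  unfolding of_real_sum[symmetric] norm_of_real by (rule abs_of_nonneg) (simp add: sum_nonneg)
 ultimately show ?thesis by simp
qed

lemma multiplier_test_bound:
 fixes m :: "real \<Rightarrow> 'y::complex_banach \<Rightarrow> 'x::complex_banach"
 assumes mb: "multiplier_bound p q Y m C" and pq: "1 \<le> p" "p \<le> q" and C: "0 < C"
  and cont: "\<And>u. u \<in> Y \<Longrightarrow> continuous_on UNIV (\<lambda>\<xi>. m \<xi> u)"
  and Y: "0 \<in> Y" "\<And>u v. u \<in> Y \<Longrightarrow> v \<in> Y \<Longrightarrow> u + v \<in> Y" "\<And>c u. u \<in> Y \<Longrightarrow> c *\<^sub>C u \<in> Y"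
  and \<phi>: "\<And>j. j \<in> I \<Longrightarrow> \<phi> j \<in> schwartz UNIV" and \<psi>: "\<And>k. k \<in> J \<Longrightarrow> \<psi> k \<in> schwartz UNIV"
  and y: "\<And>k. k \<in> J \<Longrightarrow> y k \<in> Y"
  and b: "\<And>t. (\<Sum>j\<in>I. cmod (\<phi> j t)) \<le> b" "(LBINT t. (\<Sum>j\<in>I. cmod (\<phi> j t))) \<le> b"
  and B: "0 < B" "\<And>t. norm (\<Sum>k\<in>J. \<psi> k t *\<^sub>C y k) \<le> B" "(\<integral>t. norm (\<Sum>k\<in>J. \<psi> k t *\<^sub>C y k) \<partial>lebesgue) \<le> B"
 shows "(\<Sum>j\<in>I. norm (Bochner (\<lambda>\<xi>. inv_fourier (\<phi> j) \<xi> *\<^sub>C (\<Sum>k\<in>J. fourier (\<psi> k) \<xi> *\<^sub>C m \<xi> (y k))))) \<le> 2 * b * (C * B)"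
proof (cases "p = \<infinity>")
 case True
 then have "multiplier_bound_infty Y m C" using mb by (simp add: multiplier_bound_def)
 then show ?thesis
  by (rule multiplier_test_bound_infty[OF _ C cont Y]) (erule \<phi> \<psi> y | rule b B | assumption)+
next
 case False
 show ?thesis
  by (rule multiplier_test_bound_finite[OF mb pq False C Y]) (erule \<phi> \<psi> y | rule b B | assumption)+
qed

lemma onorm_on_bound:
 assumes F: "bounded_clinear_on Y F" and u: "u \<in> Y"
 shows "norm (F u) \<le> onorm_on Y F * norm u"
proof (cases "u = 0")
 case True
 have "F (0 *\<^sub>C u) = 0 *\<^sub>C F u" using F u unfolding bounded_clinear_on_def by blast
 then show ?thesis using True by simp
next
 case False
 obtain C where C: "\<forall>x\<in>Y. norm (F x) \<le> C * norm x" using F by (auto simp: bounded_clinear_on_def)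
 have "norm (F x) / norm x \<le> max C 0" if "x \<in> Y" for x
 proof (cases "x = 0")
  case False
  have "norm (F x) \<le> max C 0 * norm x" using C that by (meson max.cobounded1 mult_right_mono norm_ge_zero order_trans)
  then show ?thesis using False by (simp add: divide_le_eq)
 qed simp
 then have "bdd_above ((\<lambda>x. norm (F x) / norm x) ` Y)" by (intro bdd_aboveI2)
 then have "norm (F u) / norm u \<le> onorm_on Y F" unfolding onorm_on_def by (rule cSUP_upper[OF u])
 then show ?thesis using False by (simp add: divide_le_eq)
qed

text \<open>
 For \<open>p = \<infinity>\<close> the symbol is the Fourier transform of an integrable function
 and hence bounded. Otherwise moderate growth is part of the hypothesis, and its real exponent is
 rounded up.
\<close>
lemma multiplier_moderate:
 fixes m :: "real \<Rightarrow> 'y::complex_banach \<Rightarrow> 'x::complex_banach"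
 assumes mb: "multiplier_bound p q Y m C"
  and cont: "continuous_on UNIV (\<lambda>\<xi>. m \<xi> u)" and u: "u \<in> Y"
 shows "\<exists>k h. integrable lborel h \<and> (\<forall>\<xi>. norm (m \<xi> u) \<le> (1 + \<bar>\<xi>\<bar>) ^ k * h \<xi>)"
proof (cases "p = \<infinity>")
 case True
 then have "multiplier_bound_infty Y m C" using mb by (simp add: multiplier_bound_def)
 then obtain K where K: "strongly_measurable_on Y K"
   "\<forall>u\<in>Y. (\<lambda>t. K t u) \<in> Lp_fun 1 UNIV \<and> (\<forall>\<xi>. m \<xi> u = fourier (\<lambda>t. K t u) \<xi>)"
  unfolding multiplier_bound_infty_def by (elim exE conjE)
 have Ks: "smeas (\<lambda>t. K t u)" using K(1) u by (simp add: strongly_measurable_on_def strongly_measurable_smeas)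
 have "Lp_norm 1 (\<lambda>t. K t u) < \<infinity>" using K(2) u by (simp add: Lp_fun_def)
 then have "(\<integral>\<^sup>+t. ennreal (norm (K t u)) \<partial>lebesgue) < \<infinity>"
  unfolding Lp_norm_def by (auto simp: Let_def less_top split: if_splits)
 then have Kb: "bint (\<lambda>t. K t u)" using Ks by (simp add: bint_def)
 have Kexp: "bint (\<lambda>t. exp (- (\<i> * of_real \<xi> * of_real t)) *\<^sub>C K t u)" for \<xi>
 proof (rule bintI[OF smeas_scaleC[OF _ Ks] bint_norm_integrable[OF Kb]])
  show "smeas (\<lambda>t. exp (- (\<i> * of_real \<xi> * of_real t)))" by (rule smeas_borel') measurable
 qed (simp add: norm_scaleC)
 define c where "c = (\<integral>t. norm (K t u) \<partial>lebesgue)"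
 have mbnd: "norm (m \<xi> u) \<le> c" for \<xi>
  using Bochner_norm_le[OF Kexp[of \<xi>]] K(2) u by (simp add: fourier_def norm_scaleC c_def)
 have "norm (m \<xi> u) \<le> (1 + \<bar>\<xi>\<bar>) ^ 2 * (c * inverse (1 + \<xi>\<^sup>2))" for \<xi>
 proof -
  have p: "0 < 1 + \<xi>\<^sup>2" by (auto intro: add_pos_nonneg)
  have c0: "0 \<le> c" by (simp add: c_def)
  have "1 + \<xi>\<^sup>2 \<le> (1 + \<bar>\<xi>\<bar>) ^ 2" by (simp add: power2_sum)
  then have "c * (1 + \<xi>\<^sup>2) \<le> c * (1 + \<bar>\<xi>\<bar>) ^ 2" by (rule mult_left_mono[OF _ c0])
  then have "c \<le> (1 + \<bar>\<xi>\<bar>) ^ 2 * (c * inverse (1 + \<xi>\<^sup>2))" using p by (simp add: field_simps)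
  then show ?thesis using mbnd[of \<xi>] by linarith
 qed
 moreover have "integrable lborel (\<lambda>\<xi>::real. c * inverse (1 + \<xi>\<^sup>2))" by (intro integrable_mult_right integrable_inverse_square)
 ultimately show ?thesis by blast
next
 case False
 then have "moderate_growth Y m" and lin: "\<And>\<xi>. bounded_clinear_on Y (m \<xi>)"
  using mb by (simp_all add: multiplier_bound_def multiplier_bound_finite_def)
 then obtain \<beta> h where h: "0 < \<beta>" "integrable lebesgue h" "\<forall>\<xi>. (1 + \<bar>\<xi>\<bar>) powr (- \<beta>) * onorm_on Y (m \<xi>) \<le> h \<xi>"
  unfolding moderate_growth_def by (elim exE conjE)
 define k where "k = nat \<lceil>\<beta>\<rceil>"
 define g where "g \<xi> = norm (m \<xi> u) * inverse ((1 + \<bar>\<xi>\<bar>) ^ k)" for \<xi>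
 have p: "0 < (1 + \<bar>\<xi>\<bar>) ^ k" for \<xi> :: real by (rule zero_less_power) simp
 have gm: "g \<in> borel_measurable borel"
  unfolding g_def by (intro borel_measurable_continuous_onI continuous_intros cont) (simp_all add: p less_imp_neq[symmetric])
 have "integrable lebesgue g"
 proof (rule integrable_dom[OF integrable_mult_left[OF h(2), of "norm u"]])
  show "g \<in> borel_measurable lebesgue" by (rule measurable_completion) (use gm in simp)
  have "norm (g \<xi>) \<le> norm (h \<xi> * norm u)" for \<xi>
  proof -
   have "inverse ((1 + \<bar>\<xi>\<bar>) ^ k) = (1 + \<bar>\<xi>\<bar>) powr (- real k)" by (simp add: powr_minus powr_realpow)
   also have "\<dots> \<le> (1 + \<bar>\<xi>\<bar>) powr (- \<beta>)"
    by (rule powr_mono) (use h(1) in \<open>auto simp: k_def real_nat_ceiling_ge\<close>)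
   finally have i: "inverse ((1 + \<bar>\<xi>\<bar>) ^ k) \<le> (1 + \<bar>\<xi>\<bar>) powr (- \<beta>)" .
   have "g \<xi> \<le> norm (m \<xi> u) * (1 + \<bar>\<xi>\<bar>) powr (- \<beta>)" unfolding g_def by (rule mult_left_mono[OF i]) simp
   also have "\<dots> \<le> (onorm_on Y (m \<xi>) * norm u) * (1 + \<bar>\<xi>\<bar>) powr (- \<beta>)"
    by (intro mult_right_mono onorm_on_bound lin u) simp
   also have "\<dots> = ((1 + \<bar>\<xi>\<bar>) powr (- \<beta>) * onorm_on Y (m \<xi>)) * norm u" by simp
   also have "\<dots> \<le> h \<xi> * norm u" by (rule mult_right_mono) (use h in auto)
   finally have "g \<xi> \<le> h \<xi> * norm u" .
   moreover have "0 \<le> g \<xi>" by (simp add: g_def)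
   ultimately show ?thesis by simp
  qed
  then show "AE \<xi> in lebesgue. norm (g \<xi>) \<le> norm (h \<xi> * norm u)" by simp
 qed
 then have gi: "integrable lborel g" using lebesgue_lborel(2)[OF gm] by simp
 have "norm (m \<xi> u) \<le> (1 + \<bar>\<xi>\<bar>) ^ k * g \<xi>" for \<xi> using p[of \<xi>] by (simp add: g_def field_simps)
 then show ?thesis using gi by blast
qed

section \<open>From multiplier bounds to growth of the semigroup\<close>

lemma multiplier_bound_mono:
 assumes "multiplier_bound p q Y m C" "C \<le> C'"
 shows "multiplier_bound p q Y m C'"
proof -
 have le: "ennreal C * v \<le> ennreal C' * v" for v by (intro mult_right_mono ennreal_leI assms(2)) simp
 have "multiplier_bound_finite p q Y m C'" if *: "multiplier_bound_finite p q Y m C"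
 proof -
  note F = *[unfolded multiplier_bound_finite_def]
  from F obtain S where S: "\<forall>f\<in>Lp_fun p Y. S f \<in> Lp_fun q UNIV \<and> Lp_norm q (S f) \<le> ennreal C * Lp_norm p f"
    "\<forall>f\<in>Lp_fun p Y. \<forall>g\<in>Lp_fun p Y. AE t in lebesgue. S (\<lambda>s. f s + g s) t = S f t + S g t"
    "\<forall>c. \<forall>f\<in>Lp_fun p Y. AE t in lebesgue. S (\<lambda>s. c *\<^sub>C f s) t = c *\<^sub>C S f t"
    "\<forall>f\<in>schwartz Y. represents_distr (S f) (multiplier_distr m f)" by (elim exE conjE)
  have "\<forall>f\<in>Lp_fun p Y. S f \<in> Lp_fun q UNIV \<and> Lp_norm q (S f) \<le> ennreal C' * Lp_norm p f"
   using S(1) by (auto intro: order_trans[OF _ le])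
  then show ?thesis unfolding multiplier_bound_finite_def using F S by (intro conjI exI[of _ S]) simp_all
 qed
 moreover have "multiplier_bound_infty Y m C'" if *: "multiplier_bound_infty Y m C"
 proof -
  from * obtain K where K: "\<forall>t. bounded_clinear_on Y (K t)" "strongly_measurable_on Y K"
    "\<forall>y\<in>Y. (\<lambda>t. K t y) \<in> Lp_fun 1 UNIV \<and> (\<forall>\<xi>. m \<xi> y = fourier (\<lambda>t. K t y) \<xi>)"
    "\<forall>f. simple_function lebesgue f \<and> (\<forall>t. f t \<in> Y) \<longrightarrow>
      Lp_norm \<infinity> (\<lambda>t. Bochner (\<lambda>s. K (t - s) (f s))) \<le> ennreal C * Lp_norm \<infinity> f"
   unfolding multiplier_bound_infty_def by (elim exE conjE)
  have "\<forall>f. simple_function lebesgue f \<and> (\<forall>t. f t \<in> Y) \<longrightarrow>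
      Lp_norm \<infinity> (\<lambda>t. Bochner (\<lambda>s. K (t - s) (f s))) \<le> ennreal C' * Lp_norm \<infinity> f"
   by (intro allI impI order_trans[OF _ le]) (erule K(4)[rule_format])
  then show ?thesis unfolding multiplier_bound_infty_def using K by (intro exI[of _ K] conjI)
 qed
 ultimately show ?thesis using assms unfolding multiplier_bound_def by auto
qed

lemma shear_product:
 fixes f g :: "real \<Rightarrow> 'a::{real_normed_field, banach, second_countable_topology}"
 assumes f: "integrable lborel f" and g: "integrable lborel g"
 shows "integrable (lborel2) (\<lambda>z. g (fst z + snd z) * f (fst z))"
  "(\<integral>z. g (fst z + snd z) * f (fst z) \<partial>lborel2) = (LBINT t. g t) * (LBINT s. f s)"
proof -
 note [measurable] = borel_measurable_integrable[OF f, simplified] borel_measurable_integrable[OF g, simplified]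
 have i: "integrable lborel (\<lambda>u. g (s + u))" for s using lborel_integrable_real_affine[OF g, of 1 s] by simp
 have v: "(LBINT u. h (s + u)) = (LBINT t. h t)" for h :: "real \<Rightarrow> 'b::{banach, second_countable_topology}" and s
  using lborel_integral_real_affine[of 1 h s] by simp
 show *: "integrable (lborel2) (\<lambda>z. g (fst z + snd z) * f (fst z))"
 proof (rule pair_integrableI)
  show "(\<lambda>z. g (fst z + snd z) * f (fst z)) \<in> borel_measurable (borel \<Otimes>\<^sub>M borel)" by measurable
  show "integrable lborel (\<lambda>u. g (fst (s, u) + snd (s, u)) * f (fst (s, u)))" for s using i[of s] by simp
  have "(LBINT u. norm (g (fst (s, u) + snd (s, u)) * f (fst (s, u)))) = (LBINT t. norm (g t)) * norm (f s)" for s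
   using v[of "\<lambda>t. norm (g t)" s] by (simp add: norm_mult)
  then show "integrable lborel (\<lambda>s. \<integral>u. norm (g (fst (s, u) + snd (s, u)) * f (fst (s, u))) \<partial>lborel)"
   using f by simp
 qed
 have "(\<integral>z. g (fst z + snd z) * f (fst z) \<partial>lborel2) = (LBINT s. (LBINT u. g (s + u) * f s))"
  using lborel_pair.integral_fst'[OF *] unfolding fst_conv snd_conv by (rule sym)
 then show "(\<integral>z. g (fst z + snd z) * f (fst z) \<partial>lborel2) = (LBINT t. g t) * (LBINT s. f s)"
  by (simp add: v)
qed

text \<open>
 The fractional domain is represented by a bounded operator \<open>J\<close> that commutes with the
 semigroup, and \<open>N a\<close> is the given bound for the multiplier on the line \<open>Re z =
 a\<close>.
\<close>
locale resolvent_multiplier = C0_generator T D A M w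
 for T :: "real \<Rightarrow> 'x::complex_banach \<Rightarrow> 'x" and D A M w +
 fixes J :: "'x \<Rightarrow> 'x" and p q :: ennreal and N :: "real \<Rightarrow> real"
 assumes reg: "\<And>z. 0 < Re z \<Longrightarrow> regular z"
  and J_bcl: "bounded_clinear_on UNIV J" and J_commute: "\<And>t z. 0 \<le> t \<Longrightarrow> T t (J z) = J (T t z)"
  and pq: "1 \<le> p" "p \<le> q" and N_pos: "\<And>a. 0 < a \<Longrightarrow> 0 < N a" and N_antimono: "\<And>a s. 0 < a \<Longrightarrow> a \<le> s \<Longrightarrow> N s \<le> N a"
  and mult: "\<And>a. 0 < a \<Longrightarrow> multiplier_bound p q (range (\<lambda>z. (J z, z))) (\<lambda>\<xi>. R (Complex a \<xi>) \<circ> fst) (N a)"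
begin

abbreviation Y :: "('x \<times> 'x) set" where "Y \<equiv> range (\<lambda>z. (J z, z))"

lemma Y_subspace: "0 \<in> Y" "u \<in> Y \<Longrightarrow> v \<in> Y \<Longrightarrow> u + v \<in> Y" "u \<in> Y \<Longrightarrow> c *\<^sub>C u \<in> Y"
proof -
 have J: "J (x + y) = J x + J y" "J (c *\<^sub>C x) = c *\<^sub>C J x" for x y using J_bcl by (auto simp: bounded_clinear_on_def)
 show "0 \<in> Y" using bcl_zero[OF J_bcl] by (auto simp: zero_prod_def image_iff)
 show "u \<in> Y \<Longrightarrow> v \<in> Y \<Longrightarrow> u + v \<in> Y" by (auto simp: image_iff J)
 show "u \<in> Y \<Longrightarrow> c *\<^sub>C u \<in> Y" by (auto simp: image_iff J scaleC_prod_def)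
qed

lemma T_Y: "0 \<le> t \<Longrightarrow> y \<in> Y \<Longrightarrow> (T t (fst y), T t (snd y)) \<in> Y"
 by (auto simp: J_commute)

lemma R_line_continuous: "0 < a \<Longrightarrow> continuous_on UNIV (\<lambda>\<xi>. R (Complex a \<xi>) x)"
proof -
 assume a: "0 < a"
 have "isCont (\<lambda>\<xi>. R (Complex a \<xi>) x) \<xi>" for \<xi>
  unfolding isCont_def
 proof (rule R_tendsto)
  show "regular (Complex a \<xi>)" by (rule reg) (use a in simp)
  show "((\<lambda>\<xi>. Complex a \<xi>) \<longlongrightarrow> Complex a \<xi>) (at \<xi>)" unfolding Complex_eq by (intro tendsto_intros)
  show "\<forall>\<^sub>F \<eta> in at \<xi>. regular (Complex a \<eta>)" by (rule always_eventually) (use a reg in simp)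
 qed simp
 then show ?thesis by (simp add: continuous_on_eq_continuous_at)
qed

lemma R_moderate:
 assumes "0 < a" "y \<in> Y"
 shows "\<exists>k h. integrable lborel h \<and> (\<forall>\<xi>. norm (R (Complex a \<xi>) (fst y)) \<le> (1 + \<bar>\<xi>\<bar>) ^ k * h \<xi>)"
 using multiplier_moderate[OF mult[OF assms(1)] _ assms(2)] R_line_continuous[OF assms(1)] by (simp add: o_def)

text \<open>
 A windowed average of the resolvent is a pairing of functions whose transform is the window.
 Translating the window only modulates them, so the bounds do not depend on its position.
\<close>
lemma window_bound:
 assumes d: "ccinf d" and a: "0 < a" and y: "y \<in> Y" and l: "bounded_clinear_on UNIV (l :: 'x \<Rightarrow> complex)"
 shows "\<exists>K. \<forall>s\<in>{a..b}. \<forall>S. cmod (LBINT \<xi>. d 0 (\<xi> - S) * d 0 (\<xi> - S) * l (R (Complex s \<xi>) (fst y))) \<le> K"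
proof -
 obtain \<phi> \<eta> c where c: "0 \<le> c" and win: "\<forall>S::real. \<phi> S \<in> schwartz UNIV \<and> \<eta> S \<in> schwartz UNIV \<and>
   (\<forall>\<xi>. inv_fourier (\<phi> S) \<xi> = d 0 (\<xi> - S)) \<and> (\<forall>\<xi>. fourier (\<eta> S) \<xi> = d 0 (\<xi> - S)) \<and>
   (\<forall>t. cmod (\<phi> S t) \<le> c * inverse (1 + t\<^sup>2)) \<and> (\<forall>t. cmod (\<eta> S t) \<le> c * inverse (1 + t\<^sup>2))"
  using fourier_windows[OF d] by (elim exE conjE)
 obtain L where L: "0 \<le> L" "\<forall>x. norm (l x) \<le> L * norm x" by (rule bcl_bound[OF l])
 let ?i = "LBINT t. inverse (1 + (t::real)\<^sup>2)"
 have i0: "0 \<le> ?i" by (simp add: add_nonneg_nonneg)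
 define e where "e = c * (1 + ?i)"
 have e0: "0 \<le> e" using c i0 by (simp add: e_def)
 define B where "B = e * norm y + 1"
 have B0: "0 < B" using e0 by (simp add: B_def add_nonneg_pos)
 have decay: "cmod f \<le> e" if "cmod f \<le> c * inverse (1 + t\<^sup>2)" for f and t :: real
 proof -
  have "inverse (1 + t\<^sup>2) \<le> 1 + ?i" using i0 by (smt (verit) inverse_le_1_iff zero_le_power2)
  from mult_left_mono[OF this c] show ?thesis using that by (simp add: e_def)
 qed
 have int: "(LBINT t. cmod (f t)) \<le> e" if f: "\<forall>t. cmod (f t) \<le> c * inverse (1 + t\<^sup>2)" "integrable lborel f" for f
 proof -
  have "(LBINT t. cmod (f t)) \<le> (LBINT t. c * inverse (1 + t\<^sup>2))"
   by (rule integral_mono) (use f integrable_inverse_square in auto)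
  also have "\<dots> \<le> e" using c by (simp add: e_def distrib_left)
  finally show ?thesis .
 qed
 have "cmod (LBINT \<xi>. d 0 (\<xi> - S) * d 0 (\<xi> - S) * l (R (Complex s \<xi>) (fst y))) \<le> L * (2 * e * (N a * B))"
  if s: "s \<in> {a..b}" for s S
 proof -
  have s0: "0 < s" using s a by simp
  have W: "\<phi> S \<in> schwartz UNIV" "\<eta> S \<in> schwartz UNIV" "\<And>\<xi>. inv_fourier (\<phi> S) \<xi> = d 0 (\<xi> - S)" "\<And>\<xi>. fourier (\<eta> S) \<xi> = d 0 (\<xi> - S)"
   "\<And>t. cmod (\<phi> S t) \<le> c * inverse (1 + t\<^sup>2)" "\<And>t. cmod (\<eta> S t) \<le> c * inverse (1 + t\<^sup>2)"
   using win by simp_all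
  note \<phi>i = schwartz_integrable[OF W(1)] and \<eta>i = schwartz_integrable[OF W(2)]
  let ?F = "\<lambda>\<xi>. d 0 (\<xi> - S) *\<^sub>C d 0 (\<xi> - S) *\<^sub>C R (Complex s \<xi>) (fst y)"
  have "(\<Sum>j\<in>{()}. norm (Bochner (\<lambda>\<xi>. inv_fourier (\<phi> S) \<xi> *\<^sub>C (\<Sum>k\<in>{()}. fourier (\<eta> S) \<xi> *\<^sub>C (R (Complex s \<xi>) \<circ> fst) y)))) \<le> 2 * e * (N s * B)"
  proof (rule multiplier_test_bound[OF mult[OF s0] pq N_pos[OF s0]])
   show "continuous_on UNIV (\<lambda>\<xi>. (R (Complex s \<xi>) \<circ> fst) u)" for u using R_line_continuous[OF s0] by (simp add: o_def)
   show "(\<Sum>j\<in>{()}. cmod (\<phi> S t)) \<le> e" for t using decay[OF W(5)] by simp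
   show "(LBINT t. (\<Sum>j\<in>{()}. cmod (\<phi> S t))) \<le> e" using int[OF _ \<phi>i] W(5) by simp
   show "norm (\<Sum>k\<in>{()}. \<eta> S t *\<^sub>C y) \<le> B" for t
    using mult_right_mono[OF decay[OF W(6)[of t]], of "norm y"] by (simp add: norm_scaleC B_def)
   have "(\<integral>t. norm (\<eta> S t *\<^sub>C y) \<partial>lebesgue) = (LBINT t. norm (\<eta> S t *\<^sub>C y))"
    unfolding norm_scaleC by (rule lebesgue_lborel(1)) (use borel_measurable_integrable[OF \<eta>i] in simp)
   also have "\<dots> = (LBINT t. cmod (\<eta> S t)) * norm y" by (simp add: norm_scaleC)
   also have "\<dots> \<le> e * norm y" by (rule mult_right_mono) (use int[OF _ \<eta>i] W(6) in auto)
   finally show "(\<integral>t. norm (\<Sum>k\<in>{()}. \<eta> S t *\<^sub>C y) \<partial>lebesgue) \<le> B" by (simp add: B_def)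
  qed (use Y_subspace W y B0 in auto)
  then have nb: "norm (Bochner ?F) \<le> 2 * e * (N s * B)" by (simp add: W)
  have Rc: "continuous_on UNIV (\<lambda>\<xi>. R (Complex s \<xi>) (fst y))" by (rule R_line_continuous[OF s0])
  have sd: "ccinf (\<lambda>n t. of_real (1 ^ n) * d n (- S + 1 * t))" by (rule ccinf_affine[OF d]) simp
  have sc: "isCont (\<lambda>\<xi>. d 0 (\<xi> - S)) \<xi>" for \<xi> using ccinf_isCont[OF sd, where n=0 and t=\<xi>] by simp
  have sc': "continuous_on UNIV (\<lambda>\<xi>. d 0 (\<xi> - S))" using sc by (simp add: continuous_on_eq_continuous_at)
  have bF: "bint ?F"
  proof (rule bintI)
   show "smeas ?F"
    by (intro smeas_scaleC smeas_isCont AE_I2 sc) (use Rc in \<open>simp add: continuous_on_eq_continuous_at\<close>)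
   have "integrable lborel (\<lambda>\<xi>. (d 0 (\<xi> - S) * of_real (norm (R (Complex s \<xi>) (fst y)))) * (of_real (1 ^ 0) * d 0 (- S + 1 * \<xi>)))"
    by (rule ccinf_weighted_integrable[OF sd]) (intro continuous_intros sc' Rc)
   then have i: "integrable lborel (\<lambda>\<xi>. cmod ((d 0 (\<xi> - S) * of_real (norm (R (Complex s \<xi>) (fst y)))) * d 0 (\<xi> - S)))"
    using integrable_norm by simp
   then show "integrable lebesgue (\<lambda>\<xi>. cmod ((d 0 (\<xi> - S) * of_real (norm (R (Complex s \<xi>) (fst y)))) * d 0 (\<xi> - S)))"
    using lebesgue_lborel(2)[OF borel_measurable_integrable[OF i, simplified]] by simp
  qed (simp add: norm_scaleC norm_mult mult_ac)
  have "(LBINT \<xi>. d 0 (\<xi> - S) * d 0 (\<xi> - S) * l (R (Complex s \<xi>) (fst y))) = (LBINT \<xi>. l (?F \<xi>))"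
   by (simp add: bcl_mult[OF l] mult.assoc)
  also have "\<dots> = (\<integral>\<xi>. l (?F \<xi>) \<partial>lebesgue)"
  proof (rule lebesgue_lborel(1)[symmetric])
   have "continuous_on UNIV (\<lambda>\<xi>. l (R (Complex s \<xi>) (fst y)))"
    using Rc unfolding continuous_on_def by (auto intro: bcl_tendsto[OF l])
   then show "(\<lambda>\<xi>. l (?F \<xi>)) \<in> borel_measurable borel"
    unfolding bcl_mult[OF l] by (intro borel_measurable_continuous_onI continuous_on_mult sc')
  qed
  also have "\<dots> = l (Bochner ?F)" by (rule functional_Bochner(2)[OF bF l, symmetric])
  finally have eq: "(LBINT \<xi>. d 0 (\<xi> - S) * d 0 (\<xi> - S) * l (R (Complex s \<xi>) (fst y))) = l (Bochner ?F)" .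
  have "cmod (l (Bochner ?F)) \<le> L * norm (Bochner ?F)" by (rule L(2)[rule_format])
  also have "\<dots> \<le> L * (2 * e * (N s * B))" by (rule mult_left_mono[OF nb L(1)])
  also have "\<dots> \<le> L * (2 * e * (N a * B))"
   by (intro mult_left_mono mult_right_mono N_antimono) (use L e0 B0 a s in auto)
  finally show ?thesis unfolding eq .
 qed
 then show ?thesis by blast
qed

text \<open>
 The distribution \<open>T\<^sub>m(\<psi> x)\<close> for \<open>m \<xi> = (a + \<i> \<xi> +
 A)\<^sup>-\<^sup>1\<close>, tested against \<open>\<phi>\<close>.
\<close>
definition paired :: "real \<Rightarrow> (real \<Rightarrow> complex) \<Rightarrow> (real \<Rightarrow> complex) \<Rightarrow> 'x \<Rightarrow> 'x" where
 "paired a \<phi> \<psi> x = Bochner (\<lambda>\<xi>. inv_fourier \<phi> \<xi> *\<^sub>C fourier \<psi> \<xi> *\<^sub>C R (Complex a \<xi>) x)"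

lemma paired_bint:
 assumes d: "ccinf d" and e: "ccinf e" and a: "0 < a" and y: "y \<in> Y"
 shows "bint (\<lambda>\<xi>. inv_fourier (d 0) \<xi> *\<^sub>C fourier (e 0) \<xi> *\<^sub>C R (Complex a \<xi>) (fst y))"
proof -
 obtain k h where h: "integrable lborel h" "\<forall>\<xi>. norm (R (Complex a \<xi>) (fst y)) \<le> (1 + \<bar>\<xi>\<bar>) ^ k * h \<xi>"
  using R_moderate[OF a y] by (elim exE conjE)
 obtain C1 where C1: "0 \<le> C1" "\<forall>z. \<bar>Re z\<bar> \<le> 0 \<longrightarrow> cmod (ltr (d 0) z) * (1 + \<bar>Im z\<bar>) ^ k \<le> C1"
  using ltr_decay_strip[OF d, of 0 0 k] by (elim exE conjE)
 obtain C2 where C2: "0 \<le> C2" "\<forall>z. \<bar>Re z\<bar> \<le> 0 \<longrightarrow> cmod (ltr (e 0) z) \<le> C2"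
  using ltr_bound_strip[OF e, of 0 0] by (elim exE conjE)
 note di = ccinf_integrable[OF d, of 0] and ei = ccinf_integrable[OF e, of 0]
 have fe: "fourier (e 0) \<xi> = ltr (e 0) (- \<i> * of_real \<xi>)" for \<xi> by (rule fourier_lborel(1)[OF ei])
 have fd: "inv_fourier (d 0) \<xi> = (1 / (2 * pi)) *\<^sub>R ltr (d 0) (\<i> * of_real \<xi>)" for \<xi> by (rule fourier_lborel(2)[OF di])
 have hm: "h \<in> borel_measurable borel" using borel_measurable_integrable[OF h(1)] by simp
 have smd: "smeas (\<lambda>\<xi>. inv_fourier (d 0) \<xi>)" unfolding fd
  using fourier_borel[OF di, of \<i>] by (intro smeas_borel') measurable
 have sme: "smeas (\<lambda>\<xi>. fourier (e 0) \<xi>)" unfolding fe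
  using fourier_borel[OF ei, of "- \<i>"] by (intro smeas_borel')
 show ?thesis
 proof (rule bintI[where k="\<lambda>\<xi>. (C1 * C2) * h \<xi>"])
  show "smeas (\<lambda>\<xi>. inv_fourier (d 0) \<xi> *\<^sub>C fourier (e 0) \<xi> *\<^sub>C R (Complex a \<xi>) (fst y))"
   by (intro smeas_scaleC smd sme smeas_isCont AE_I2) (use R_line_continuous[OF a] in \<open>simp add: continuous_on_eq_continuous_at\<close>)
  show "integrable lebesgue (\<lambda>\<xi>. (C1 * C2) * h \<xi>)" using h(1) lebesgue_lborel(2)[OF hm] by simp
  have "norm (inv_fourier (d 0) \<xi> *\<^sub>C fourier (e 0) \<xi> *\<^sub>C R (Complex a \<xi>) (fst y)) \<le> (C1 * C2) * h \<xi>" for \<xi>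
  proof -
   have "0 \<le> (1 + \<bar>\<xi>\<bar>) ^ k * h \<xi>" by (rule order_trans[OF norm_ge_zero h(2)[rule_format]])
   moreover have "0 < (1 + \<bar>\<xi>\<bar>) ^ k" by (rule zero_less_power) simp
   ultimately have h0: "0 \<le> h \<xi>" by (auto simp: zero_le_mult_iff)
   have i: "cmod (inv_fourier (d 0) \<xi>) \<le> cmod (ltr (d 0) (\<i> * of_real \<xi>))"
   proof -
    have "1 / (2 * pi) \<le> 1" using pi_gt3 by simp
    from mult_right_mono[OF this, of "cmod (ltr (d 0) (\<i> * of_real \<xi>))"] show ?thesis by (simp add: fd)
   qed
   have "norm (inv_fourier (d 0) \<xi> *\<^sub>C fourier (e 0) \<xi> *\<^sub>C R (Complex a \<xi>) (fst y)) =
     cmod (inv_fourier (d 0) \<xi>) * (cmod (fourier (e 0) \<xi>) * norm (R (Complex a \<xi>) (fst y)))" by (simp add: norm_scaleC)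
   also have "\<dots> \<le> cmod (ltr (d 0) (\<i> * of_real \<xi>)) * (C2 * ((1 + \<bar>\<xi>\<bar>) ^ k * h \<xi>))"
    by (intro mult_mono i) (use C2 h fe in auto)
   also have "\<dots> = (cmod (ltr (d 0) (\<i> * of_real \<xi>)) * (1 + \<bar>\<xi>\<bar>) ^ k) * (C2 * h \<xi>)" by simp
   also have "\<dots> \<le> C1 * (C2 * h \<xi>)"
    using C1(2)[rule_format, of "\<i> * of_real \<xi>"] C2(1) h0 by (intro mult_right_mono) auto
   finally show ?thesis by (simp add: mult.assoc)
  qed
  then show "AE \<xi> in lebesgue. norm (inv_fourier (d 0) \<xi> *\<^sub>C fourier (e 0) \<xi> *\<^sub>C R (Complex a \<xi>) (fst y)) \<le> (C1 * C2) * h \<xi>" by simp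
 qed
qed

text \<open>
 In weak form, \<open>T\<^sub>m\<close> is convolution with \<open>e\<^bsup>-au\<^esup>
 T(u)\<close>, although this kernel need not be integrable.
\<close>
lemma functional_paired:
 assumes d: "ccinf d" and e: "ccinf e" and a: "0 < a" and y: "y \<in> Y" and l: "bounded_clinear_on UNIV (l :: 'x \<Rightarrow> complex)"
 shows "l (paired a (d 0) (e 0) (fst y)) =
  (\<integral>z. d 0 (fst z + snd z) * (e 0 (fst z) * (exp (- of_real (a * snd z)) * l (Tp (snd z) (fst y)))) \<partial>lborel2)"
proof -
 obtain L where L: "0 \<le> L" "\<forall>x. norm (l x) \<le> L * norm x" by (rule bcl_bound[OF l])
 note pb = paired_bint[OF d e a y]
 note di = ccinf_integrable[OF d, of 0] and ei = ccinf_integrable[OF e, of 0]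
 have fe: "fourier (e 0) \<xi> = ltr (e 0) (- \<i> * of_real \<xi>)" for \<xi> by (rule fourier_lborel(1)[OF ei])
 have fd: "inv_fourier (d 0) \<xi> = (1 / (2 * pi)) *\<^sub>R ltr (d 0) (\<i> * of_real \<xi>)" for \<xi> by (rule fourier_lborel(2)[OF di])
 have Rl: "(\<lambda>\<xi>. l (R (Complex a \<xi>) (fst y))) \<in> borel_measurable borel"
  using R_line_continuous[OF a] unfolding continuous_on_def
  by (intro borel_measurable_continuous_onI) (auto simp: continuous_on_def intro: bcl_tendsto[OF l])
 have "l (paired a (d 0) (e 0) (fst y)) = (\<integral>\<xi>. l (inv_fourier (d 0) \<xi> *\<^sub>C fourier (e 0) \<xi> *\<^sub>C R (Complex a \<xi>) (fst y)) \<partial>lebesgue)"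
  unfolding paired_def by (rule functional_Bochner(2)[OF pb l])
 also have "\<dots> = (\<integral>\<xi>. inv_fourier (d 0) \<xi> * (fourier (e 0) \<xi> * l (R (Complex a \<xi>) (fst y))) \<partial>lebesgue)"
  unfolding bcl_mult[OF l] ..
 also have "\<dots> = (LBINT \<xi>. inv_fourier (d 0) \<xi> * (fourier (e 0) \<xi> * l (R (Complex a \<xi>) (fst y))))"
  unfolding fe fd
  by (intro lebesgue_lborel(1) borel_measurable_times borel_measurable_scaleR borel_measurable_const fourier_borel di ei Rl)
 also have "\<dots> = (\<integral>z. d 0 (fst z + snd z) * (e 0 (fst z) * (exp (- of_real (a * snd z)) * l (Tp (snd z) (fst y)))) \<partial>lborel2)"
 proof (rule transform_identity[where r="\<lambda>z. l (R z (fst y))" and g="\<lambda>u. l (Tp u (fst y))" and K="L * (M * norm (fst y))" and w=w, OF d e a])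
  show "(\<lambda>z. l (R z (fst y))) holomorphic_on {z. 0 < Re z}"
   by (rule R_holomorphic[OF _ _ l]) (auto simp: open_halfspace_Re_gt reg)
  show "(\<lambda>u. l (Tp u (fst y))) \<in> borel_measurable borel" by (rule Tp_borel[OF l])
  show "cmod (l (Tp u (fst y))) \<le> indicator {0..} u * (L * (M * norm (fst y)) * exp (w * u))" for u
  proof -
   have "cmod (l (Tp u (fst y))) \<le> L * norm (Tp u (fst y))" by (rule L(2)[rule_format])
   also have "\<dots> \<le> L * (indicator {0..} u * (M * exp (w * u) * norm (fst y)))" by (rule mult_left_mono[OF Tp_norm_le L(1)])
   finally show ?thesis by (simp add: mult_ac)
  qed
  show "l (R z (fst y)) = (LBINT u. exp (- z * of_real u) * l (Tp u (fst y)))" if z: "w < Re z" for z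
  proof -
   have "l (R z (fst y)) = (\<integral>u. l (exp (- z * of_real u) *\<^sub>C Tp u (fst y)) \<partial>lebesgue)"
    unfolding regular_lap(2)[OF z] lap_def by (rule functional_Bochner(2)[OF lap_bint[OF z] l])
   also have "\<dots> = (\<integral>u. exp (- z * of_real u) * l (Tp u (fst y)) \<partial>lebesgue)" unfolding bcl_mult[OF l] ..
   also have "\<dots> = (LBINT u. exp (- z * of_real u) * l (Tp u (fst y)))"
    using Tp_borel[OF l, of "fst y"] by (intro lebesgue_lborel(1)) measurable
   finally show ?thesis .
  qed
  show "\<exists>k h. integrable lborel h \<and> (\<forall>\<xi>. cmod (l (R (Complex s \<xi>) (fst y))) \<le> (1 + \<bar>\<xi>\<bar>) ^ k * h \<xi>)" if s: "0 < s" for s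
  proof -
   obtain k h where h: "integrable lborel h" "\<forall>\<xi>. norm (R (Complex s \<xi>) (fst y)) \<le> (1 + \<bar>\<xi>\<bar>) ^ k * h \<xi>"
    using R_moderate[OF s y] by (elim exE conjE)
   have "cmod (l (R (Complex s \<xi>) (fst y))) \<le> (1 + \<bar>\<xi>\<bar>) ^ k * (L * h \<xi>)" for \<xi>
   proof -
    have "cmod (l (R (Complex s \<xi>) (fst y))) \<le> L * norm (R (Complex s \<xi>) (fst y))" by (rule L(2)[rule_format])
    also have "\<dots> \<le> L * ((1 + \<bar>\<xi>\<bar>) ^ k * h \<xi>)" by (rule mult_left_mono[OF h(2)[rule_format] L(1)])
    finally show ?thesis by (simp add: mult_ac)
   qed
   then show ?thesis using h(1) by (intro exI[of _ k] exI[of _ "\<lambda>\<xi>. L * h \<xi>"]) auto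
  qed
  show "\<exists>K. \<forall>s\<in>{a..b}. \<forall>S. cmod (LBINT \<xi>. f 0 (\<xi> - S) * f 0 (\<xi> - S) * l (R (Complex s \<xi>) (fst y))) \<le> K"
   if "ccinf f" for f b by (rule window_bound[OF that a y l])
 qed
 finally show ?thesis .
qed

end

lemma (in C0_generator) bounded_on_interval: "\<exists>K\<ge>1. \<forall>t x. 0 \<le> t \<longrightarrow> t \<le> b \<longrightarrow> norm (T t x) \<le> K * norm x"
proof (intro exI[of _ "max 1 (M * exp (\<bar>w\<bar> * \<bar>b\<bar>))"] conjI allI impI)
 fix t x assume t: "0 \<le> t" "t \<le> b"
 have "w * t \<le> \<bar>w\<bar> * \<bar>b\<bar>" using t by (smt (verit) abs_ge_self mult_mono abs_ge_zero)
 then have "M * exp (w * t) \<le> max 1 (M * exp (\<bar>w\<bar> * \<bar>b\<bar>))"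
  using mult_left_mono[OF _ M_nonneg, of "exp (w * t)" "exp (\<bar>w\<bar> * \<bar>b\<bar>)"] by simp
 then show "norm (T t x) \<le> max 1 (M * exp (\<bar>w\<bar> * \<bar>b\<bar>)) * norm x"
  by (rule order_trans[OF growth[OF t(1)] mult_right_mono]) simp
qed simp

text \<open>A scaled bump \<open>r \<mapsto> \<beta>(c + n r)\<close> is again an admissible test function.\<close>
lemma ccinf_rescale:
 assumes "ccinf d" "b \<noteq> 0"
 obtains e where "ccinf e" "e 0 = (\<lambda>t. d 0 (a + b * t))"
 using ccinf_affine[OF assms] by (rule that) simp

text \<open>At each point at most one of the translates is nonzero.\<close>
lemma disjoint_bumps_le:
 fixes \<beta> :: "real \<Rightarrow> real"
 assumes "\<And>t. 0 \<le> \<beta> t \<and> \<beta> t \<le> 1" "\<And>t. t \<notin> {0<..<1} \<Longrightarrow> \<beta> t = 0" "\<And>k. k < n \<Longrightarrow> 0 \<le> a k \<and> a k \<le> K" "0 \<le> K"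
 shows "(\<Sum>k<n. \<beta> (v - real k) * a k) \<le> K"
proof (cases "\<exists>k<n. \<beta> (v - real k) \<noteq> 0")
 case True
 then obtain k where k: "k < n" "\<beta> (v - real k) \<noteq> 0" by auto
 have z: "\<beta> (v - real i) = 0" if "i \<noteq> k" for i
 proof -
  have "v - real k \<in> {0<..<1}" using assms(2) k(2) by blast
  moreover have "real i + 1 \<le> real k \<or> real k + 1 \<le> real i" using that by linarith
  ultimately have "v - real i \<notin> {0<..<1}" by auto
  then show ?thesis by (rule assms(2))
 qed
 have "(\<Sum>k<n. \<beta> (v - real k) * a k) = (\<Sum>i\<in>{k}. \<beta> (v - real i) * a i)"
  by (rule sum.mono_neutral_right) (use k z in auto)
 also have "\<dots> = \<beta> (v - real k) * a k" by simp
 also have "\<dots> \<le> 1 * K" by (rule mult_mono) (use assms(1)[of "v - real k"] assms(3)[OF k(1)] in auto)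
 finally show ?thesis by simp
next
 case False
 then show ?thesis using assms(4) by (simp add: sum.neutral)
qed

context resolvent_multiplier
begin

text \<open>
 The unit intervals \<open>[0,1]\<close> and \<open>[t-1,t]\<close> are cut into \<open>n\<close> cells. A piece of the orbit that starts
 in cell \<open>k\<close> with \<open>T(k/n)x\<close> and is read off in the \<open>j\<close>-th cell from the right and then moved on by
 \<open>T(j/n)\<close> has travelled for a time in \<open>[t-2/n,t]\<close>. So a weighted sum of \<open>n\<^sup>2\<close> such pairings
 reproduces \<open>T(t)x\<close> up to the oscillation of the orbit, while the multiplier bound controls the
 whole sum, because input and test functions have disjoint supports. No estimate of a single
 pairing would do, since its weight is only of order \<open>n\<^sup>-\<^sup>2\<close>.
\<close>
lemma orbit_bound:
 fixes \<beta> :: "real \<Rightarrow> real"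
 assumes dB: "ccinf dB" "dB 0 = (\<lambda>t. of_real (\<beta> t))" and \<beta>: "\<And>t. 0 \<le> \<beta> t \<and> \<beta> t \<le> 1" "\<And>t. t \<notin> {0<..<1} \<Longrightarrow> \<beta> t = 0"
  and K: "1 \<le> K" "\<And>s x. 0 \<le> s \<Longrightarrow> s \<le> 1 \<Longrightarrow> norm (T s x) \<le> K * norm x"
  and t: "2 < t" and y: "y \<in> Y" "y \<noteq> 0" and \<epsilon>: "0 < \<epsilon>"
 shows "exp (- 1) * (LBINT s. \<beta> s)\<^sup>2 * (norm (T t (fst y)) - \<epsilon>) \<le> 2 * K\<^sup>2 * N (1 / t) * norm y"
proof -
 define I where "I = (LBINT s. \<beta> s)"
 have \<beta>i: "integrable lborel \<beta>"
  using integrable_Re[OF ccinf_integrable[OF dB(1), of 0]] by (simp add: dB(2))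
 have \<beta>m[measurable]: "\<beta> \<in> borel_measurable borel" using borel_measurable_integrable[OF \<beta>i] by simp
 have I0: "0 \<le> I" unfolding I_def using \<beta> by (simp add: integral_nonneg)
 have I1: "I \<le> 1"
 proof -
  have "I \<le> (LBINT s. indicator {0..1::real} s)" unfolding I_def
  proof (rule integral_mono[OF \<beta>i])
   show "integrable lborel (indicator {0..1::real} :: real \<Rightarrow> real)" by (simp add: integrable_indicator_iff)
   show "\<beta> s \<le> indicator {0..1} s" for s using \<beta>(1)[of s] \<beta>(2)[of s] by (cases "s \<in> {0..1}") auto
  qed
  then show ?thesis by simp
 qed
 define x where "x = fst y"
 let ?a = "1 / t"
 have a: "0 < ?a" using t by simp
 have "t \<in> {0..}" using t by simp
 from T_continuous_on[of x, unfolded continuous_on_iff, rule_format, OF this \<epsilon>]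
 obtain \<delta> where "0 < \<delta>" "\<forall>s\<in>{0..}. dist s t < \<delta> \<longrightarrow> dist (T s x) (T t x) < \<epsilon>" by (elim exE conjE)
 then have \<delta>: "0 < \<delta>" "\<And>s. 0 \<le> s \<Longrightarrow> \<bar>s - t\<bar> < \<delta> \<Longrightarrow> norm (T s x - T t x) < \<epsilon>"
  by (simp_all add: dist_real_def dist_norm)
 obtain n :: nat where n: "0 < n" "2 / real n < \<delta>"
 proof -
  obtain n :: nat where m: "2 / \<delta> < real n" using reals_Archimedean2 by blast
  moreover have "0 < 2 / \<delta>" using \<delta>(1) by simp
  ultimately have p: "0 < real n" by linarith
  have "2 < real n * \<delta>" using m \<delta>(1) by (simp add: pos_divide_less_eq)
  then have "2 / real n < \<delta>" using p by (simp add: pos_divide_less_eq mult.commute)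
  then show ?thesis using p by (intro that[of n]) simp_all
 qed
 have n': "0 < real n" using n by simp
 define \<phi> where "\<phi> j r = \<beta> (real n * (t - r) - real j)" for j :: nat and r
 define \<psi> where "\<psi> k s = \<beta> (real n * s - real k)" for k :: nat and s
 define yk where "yk k = (T (real k / real n) (fst y), T (real k / real n) (snd y))" for k :: nat
 have cell: "0 \<le> real k / real n \<and> real k / real n \<le> 1" if "k < n" for k using that n by simp
 have yY: "yk k \<in> Y" for k unfolding yk_def by (rule T_Y[OF _ y(1)]) simp
 have yn: "norm (yk k) \<le> K * norm y" if "k < n" for k
 proof -
  have "norm (T (real k / real n) (fst y)) \<le> K * norm (fst y)" "norm (T (real k / real n) (snd y)) \<le> K * norm (snd y)"
   using K(2) cell[OF that] by simp_all
  then have "(norm (T (real k / real n) (fst y)))\<^sup>2 + (norm (T (real k / real n) (snd y)))\<^sup>2 \<le> (K * norm (fst y))\<^sup>2 + (K * norm (snd y))\<^sup>2"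
   by (intro add_mono power_mono) auto
  then have "norm (yk k) \<le> sqrt ((K * norm (fst y))\<^sup>2 + (K * norm (snd y))\<^sup>2)" by (simp add: yk_def norm_prod_def)
  also have "\<dots> = K * norm y"
   using K(1) by (simp add: norm_prod_def power_mult_distrib real_sqrt_mult flip: distrib_left)
  finally show ?thesis .
 qed
 have "\<forall>j. \<exists>e. ccinf e \<and> e 0 = (\<lambda>r. of_real (\<phi> j r))"
 proof
  fix j
  obtain e where "ccinf e" "e 0 = (\<lambda>r. dB 0 ((real n * t - real j) + (- real n) * r))"
   by (rule ccinf_rescale[OF dB(1), of "- real n" "real n * t - real j"]) (use n in auto)
  then show "\<exists>e. ccinf e \<and> e 0 = (\<lambda>r. of_real (\<phi> j r))" by (intro exI[of _ e]) (simp add: dB(2) \<phi>_def algebra_simps)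
 qed
 then obtain d\<phi> where "\<forall>j. ccinf (d\<phi> j) \<and> d\<phi> j 0 = (\<lambda>r. of_real (\<phi> j r))" unfolding choice_iff by (elim exE)
 then have d\<phi>: "\<And>j. ccinf (d\<phi> j)" "\<And>j. d\<phi> j 0 = (\<lambda>r. of_real (\<phi> j r))" by simp_all
 have "\<forall>k. \<exists>e. ccinf e \<and> e 0 = (\<lambda>s. of_real (\<psi> k s))"
 proof
  fix k
  obtain e where "ccinf e" "e 0 = (\<lambda>r. dB 0 (- real k + real n * r))"
   by (rule ccinf_rescale[OF dB(1), of "real n" "- real k"]) (use n in auto)
  then show "\<exists>e. ccinf e \<and> e 0 = (\<lambda>s. of_real (\<psi> k s))" by (intro exI[of _ e]) (simp add: dB(2) \<psi>_def algebra_simps)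
 qed
 then obtain d\<psi> where "\<forall>k. ccinf (d\<psi> k) \<and> d\<psi> k 0 = (\<lambda>s. of_real (\<psi> k s))" unfolding choice_iff by (elim exE)
 then have d\<psi>: "\<And>k. ccinf (d\<psi> k)" "\<And>k. d\<psi> k 0 = (\<lambda>s. of_real (\<psi> k s))" by simp_all
 have \<phi>1: "integrable lborel (\<phi> j)" "(LBINT r. \<phi> j r) = I / real n" for j
 proof -
  have e: "\<phi> j r = \<beta> ((real n * t - real j) + (- real n) * r)" for r by (simp add: \<phi>_def algebra_simps)
  show "integrable lborel (\<phi> j)" unfolding e using lborel_integrable_real_affine[OF \<beta>i, of "- real n" "real n * t - real j"] n by simp
  have "I = \<bar>- real n\<bar> *\<^sub>R (LBINT r. \<beta> ((real n * t - real j) + (- real n) * r))"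
   unfolding I_def by (rule lborel_integral_real_affine) (use n in simp)
  then show "(LBINT r. \<phi> j r) = I / real n" unfolding e using n' by (simp add: field_simps)
 qed
 have \<psi>1: "integrable lborel (\<psi> k)" "(LBINT s. \<psi> k s) = I / real n" for k
 proof -
  have e: "\<psi> k s = \<beta> (- real k + real n * s)" for s by (simp add: \<psi>_def algebra_simps)
  show "integrable lborel (\<psi> k)" unfolding e using lborel_integrable_real_affine[OF \<beta>i, of "real n" "- real k"] n by simp
  have "I = \<bar>real n\<bar> *\<^sub>R (LBINT s. \<beta> (- real k + real n * s))"
   unfolding I_def by (rule lborel_integral_real_affine) (use n in simp)
  then show "(LBINT s. \<psi> k s) = I / real n" unfolding e using n' by (simp add: field_simps)
 qed
 have \<phi>0: "0 \<le> \<phi> j r" "0 \<le> \<psi> j r" for j r unfolding \<phi>_def \<psi>_def using \<beta>(1) by auto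
 have \<phi>m[measurable]: "\<phi> j \<in> borel_measurable borel" "\<psi> j \<in> borel_measurable borel" for j
  unfolding \<phi>_def \<psi>_def by measurable
 define B where "B = K * norm y"
 have B0: "0 < B" using K(1) y(2) by (simp add: B_def)
 define \<Lambda> where "\<Lambda> j = (\<Sum>k<n. paired ?a (d\<phi> j 0) (d\<psi> k 0) (fst (yk k)))" for j
 have total: "(\<Sum>j<n. norm (\<Lambda> j)) \<le> 2 * 1 * (N ?a * B)"
 proof -
  have e: "\<Lambda> j = Bochner (\<lambda>\<xi>. inv_fourier (d\<phi> j 0) \<xi> *\<^sub>C (\<Sum>k<n. fourier (d\<psi> k 0) \<xi> *\<^sub>C (R (Complex ?a \<xi>) \<circ> fst) (yk k)))" for j
   unfolding \<Lambda>_def paired_def bcl_sum[OF bcl_scaleC_const] o_def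
   by (rule Bochner_sum[symmetric]) (rule paired_bint[OF d\<phi>(1) d\<psi>(1) a yY])
  have nf: "norm (\<Sum>k<n. d\<psi> k 0 s *\<^sub>C yk k) \<le> (\<Sum>k<n. \<psi> k s * norm (yk k))" for s
  proof -
   have "norm (\<Sum>k<n. d\<psi> k 0 s *\<^sub>C yk k) \<le> (\<Sum>k<n. norm (d\<psi> k 0 s *\<^sub>C yk k))" by (rule norm_sum)
   also have "\<dots> = (\<Sum>k<n. \<psi> k s * norm (yk k))" using \<phi>0 by (simp add: norm_scaleC d\<psi>(2))
   finally show ?thesis .
  qed
  show ?thesis unfolding e
  proof (rule multiplier_test_bound[OF mult[OF a] pq N_pos[OF a]])
   show "continuous_on UNIV (\<lambda>\<xi>. (R (Complex ?a \<xi>) \<circ> fst) u)" for u using R_line_continuous[OF a] by (simp add: o_def)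
   show "(\<Sum>j<n. cmod (d\<phi> j 0 r)) \<le> 1" for r
   proof -
    have "(\<Sum>j<n. cmod (d\<phi> j 0 r)) = (\<Sum>j<n. \<phi> j r * 1)" by (simp add: d\<phi>(2) abs_of_nonneg[OF \<phi>0(1)])
    also have "\<dots> \<le> 1" unfolding \<phi>_def by (rule disjoint_bumps_le[where K=1]) (use \<beta> in auto)
    finally show ?thesis .
   qed
   have "(LBINT r. (\<Sum>j<n. cmod (d\<phi> j 0 r))) = (\<Sum>j<n. (LBINT r. \<phi> j r))"
    using \<phi>1(1) by (simp add: d\<phi>(2) abs_of_nonneg[OF \<phi>0(1)])
   also have "\<dots> = I" using n by (simp add: \<phi>1(2))
   finally show "(LBINT r. (\<Sum>j<n. cmod (d\<phi> j 0 r))) \<le> 1" using I1 by simp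
   show "norm (\<Sum>k<n. d\<psi> k 0 s *\<^sub>C yk k) \<le> B" for s
   proof -
    have "(\<Sum>k<n. \<psi> k s * norm (yk k)) \<le> B"
     unfolding \<psi>_def by (rule disjoint_bumps_le[where K=B]) (use \<beta> yn B0 in \<open>auto simp: B_def\<close>)
    then show ?thesis using nf[of s] by linarith
   qed
   have i: "integrable lborel (\<lambda>s. \<Sum>k<n. \<psi> k s * norm (yk k))" using \<psi>1(1) by simp
   have im: "(\<lambda>s. \<Sum>k<n. \<psi> k s * norm (yk k)) \<in> borel_measurable borel" by measurable
   have "(\<integral>s. norm (\<Sum>k<n. d\<psi> k 0 s *\<^sub>C yk k) \<partial>lebesgue) \<le> (\<integral>s. (\<Sum>k<n. \<psi> k s * norm (yk k)) \<partial>lebesgue)"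
   proof (rule integral_mono')
    show "integrable lebesgue (\<lambda>s. \<Sum>k<n. \<psi> k s * norm (yk k))"
     using i lebesgue_lborel(2)[OF im] by simp
   qed (use nf \<phi>0 in \<open>auto intro!: sum_nonneg\<close>)
   also have "\<dots> = (LBINT s. (\<Sum>k<n. \<psi> k s * norm (yk k)))"
    by (rule lebesgue_lborel(1)[OF im])
   also have "\<dots> = (\<Sum>k<n. (I / real n) * norm (yk k))" using \<psi>1 by simp
   also have "\<dots> \<le> (\<Sum>k<n. (I / real n) * B)"
    by (intro sum_mono mult_left_mono) (use yn I0 in \<open>auto simp: B_def\<close>)
   also have "\<dots> = I * B" using n by simp
   also have "\<dots> \<le> B" using I1 B0 by simp
   finally show "(\<integral>s. norm (\<Sum>k<n. d\<psi> k 0 s *\<^sub>C yk k) \<partial>lebesgue) \<le> B" .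
  qed (use Y_subspace yY B0 ccinf_schwartz[OF d\<phi>(1)] ccinf_schwartz[OF d\<psi>(1)] in auto)
 qed
 obtain l where l: "bounded_clinear_on UNIV l" "\<forall>v. cmod (l v) \<le> norm v" "l (T t x) = of_real (norm (T t x))"
  by (rule norming_functional)
 have lj: "bounded_clinear_on UNIV (\<lambda>v. l (T (real j / real n) v))" for j
  by (rule bcl_compose[OF l(1) T_bcl]) simp
 define \<rho> where "\<rho> j k z = \<phi> j (fst z + snd z) * \<psi> k (fst z) * exp (- (?a * snd z))" for j k and z :: "real \<times> real"
 define W where "W = (\<Sum>j<n. \<Sum>k<n. (\<integral>z. \<rho> j k z \<partial>lborel2))"
 have supp: "0 \<le> snd z \<and> snd z \<le> t \<and> t - 2 / real n \<le> snd z + real j / real n + real k / real n \<and>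
   snd z + real j / real n + real k / real n \<le> t"
  if nz: "\<phi> j (fst z + snd z) * \<psi> k (fst z) \<noteq> 0" and jk: "j < n" "k < n" for j k and z :: "real \<times> real"
 proof -
  have "\<phi> j (fst z + snd z) \<noteq> 0" "\<psi> k (fst z) \<noteq> 0" using nz by auto
  then have "real n * (t - (fst z + snd z)) - real j \<in> {0<..<1}" "real n * fst z - real k \<in> {0<..<1}"
   using \<beta>(2) unfolding \<phi>_def \<psi>_def by blast+
  then have b: "real j / real n \<le> t - (fst z + snd z)" "t - (fst z + snd z) \<le> real j / real n + 1 / real n"
   "real k / real n \<le> fst z" "fst z \<le> real k / real n + 1 / real n"
   using n' by (auto simp: field_simps)
  have c: "real j / real n + 1 / real n \<le> 1" "real k / real n + 1 / real n \<le> 1" "0 \<le> real j / real n" "0 \<le> real k / real n"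
   using jk n' by (auto simp: field_simps)
  have "2 / real n = 1 / real n + 1 / real n" by simp
  then show ?thesis using b c t by linarith
 qed
 have \<rho>0: "0 \<le> \<rho> j k z" for j k z unfolding \<rho>_def using \<phi>0 by simp
 have sp: "integrable (lborel2) (\<lambda>z. \<phi> j (fst z + snd z) * \<psi> k (fst z))"
  "(\<integral>z. \<phi> j (fst z + snd z) * \<psi> k (fst z) \<partial>lborel2) = (I / real n) * (I / real n)" for j k
  using shear_product[OF \<psi>1(1)[of k] \<phi>1(1)[of j]] by (simp_all add: \<phi>1 \<psi>1)
 have \<rho>m[measurable]: "\<rho> j k \<in> borel_measurable (lborel2)" for j k unfolding \<rho>_def by measurable
 have \<rho>i: "integrable (lborel2) (\<rho> j k)" if "j < n" "k < n" for j k
 proof (rule integrable_dom[OF sp(1)[of j k]])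
  have "norm (\<rho> j k z) \<le> norm (\<phi> j (fst z + snd z) * \<psi> k (fst z))" for z
  proof (cases "\<phi> j (fst z + snd z) * \<psi> k (fst z) = 0")
   case False
   have "exp (- (?a * snd z)) \<le> 1" using supp[OF False that] t by simp
   from mult_left_mono[OF this, of "\<phi> j (fst z + snd z) * \<psi> k (fst z)"] show ?thesis
    using \<phi>0 \<rho>0 by (simp add: \<rho>_def abs_mult)
  qed (auto simp: \<rho>_def)
  then show "AE z in lborel2. norm (\<rho> j k z) \<le> norm (\<phi> j (fst z + snd z) * \<psi> k (fst z))" by simp
 qed simp
 have W: "exp (- 1) * I\<^sup>2 \<le> W"
 proof -
  have "exp (- 1) * ((I / real n) * (I / real n)) \<le> (\<integral>z. \<rho> j k z \<partial>lborel2)" if jk: "j < n" "k < n" for j k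
  proof -
   have "exp (- 1) * ((I / real n) * (I / real n)) = (\<integral>z. exp (- 1) * (\<phi> j (fst z + snd z) * \<psi> k (fst z)) \<partial>lborel2)"
    using sp(2)[of j k] by simp
   also have "\<dots> \<le> (\<integral>z. \<rho> j k z \<partial>lborel2)"
   proof (rule integral_mono[OF integrable_mult_right[OF sp(1)] \<rho>i[OF jk]])
    fix z :: "real \<times> real"
    show "exp (- 1) * (\<phi> j (fst z + snd z) * \<psi> k (fst z)) \<le> \<rho> j k z"
    proof (cases "\<phi> j (fst z + snd z) * \<psi> k (fst z) = 0")
     case False
     have "exp (- 1) \<le> exp (- (?a * snd z))" using supp[OF False jk] t by simp
     from mult_right_mono[OF this, of "\<phi> j (fst z + snd z) * \<psi> k (fst z)"] show ?thesis
      using \<phi>0 by (simp add: \<rho>_def mult_ac)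
    qed (auto simp: \<rho>_def)
   qed
   finally show ?thesis .
  qed
  then have "(\<Sum>j<n. \<Sum>k<n. exp (- 1) * ((I / real n) * (I / real n))) \<le> W"
   unfolding W_def by (intro sum_mono) auto
  then show ?thesis using n by (simp add: power2_eq_square field_simps)
 qed
 have near: "cmod (of_real (\<integral>z. \<rho> j k z \<partial>lborel2) * of_real (norm (T t x)) -
   l (T (real j / real n) (paired ?a (d\<phi> j 0) (d\<psi> k 0) (fst (yk k))))) \<le> (\<integral>z. \<rho> j k z \<partial>lborel2) * \<epsilon>"
  if jk: "j < n" "k < n" for j k
 proof -
  let ?g = "\<lambda>u. l (T (real j / real n) (Tp u (fst (yk k))))"
  define D' where "D' z = complex_of_real (\<rho> j k z) * (of_real (norm (T t x)) - ?g (snd z))" for z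
  have gm: "?g \<in> borel_measurable borel" by (rule Tp_borel[OF lj])
  have D'm: "D' \<in> borel_measurable (lborel2)" unfolding D'_def using gm by measurable
  have D'b: "cmod (D' z) \<le> \<rho> j k z * \<epsilon>" for z
  proof (cases "\<rho> j k z = 0")
   case False
   then have nz: "\<phi> j (fst z + snd z) * \<psi> k (fst z) \<noteq> 0" by (auto simp: \<rho>_def)
   note S = supp[OF nz jk]
   let ?s = "snd z + real j / real n + real k / real n"
   have "T (real j / real n) (Tp (snd z) (fst (yk k))) = T ?s x"
   proof -
    have "Tp (snd z) (fst (yk k)) = T (snd z + real k / real n) x"
     using S by (simp add: Tp_nonneg yk_def x_def T_add)
    then have "T (real j / real n) (Tp (snd z) (fst (yk k))) = T (real j / real n + (snd z + real k / real n)) x"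
     using S by (simp add: T_add)
    then show ?thesis by (simp add: add_ac)
   qed
   then have "of_real (norm (T t x)) - ?g (snd z) = l (T t x - T ?s x)"
    unfolding l(3)[symmetric] bcl_diff[OF l(1)] by simp
   also have "cmod (l (T t x - T ?s x)) \<le> \<epsilon>"
   proof -
    have "0 \<le> ?s" using S by simp
    moreover have "\<bar>?s - t\<bar> < \<delta>" using S n(2) by simp
    ultimately have "norm (T ?s x - T t x) < \<epsilon>" by (rule \<delta>(2))
    then show ?thesis using l(2)[rule_format, of "T t x - T ?s x"] by (simp add: norm_minus_commute)
   qed
   finally have "cmod (of_real (norm (T t x)) - ?g (snd z)) \<le> \<epsilon>" .
   from mult_left_mono[OF this \<rho>0[of j k z]] show ?thesis using \<rho>0[of j k z] by (simp add: D'_def norm_mult)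
  qed (auto simp: D'_def)
  have \<rho>\<epsilon>: "integrable (lborel2) (\<lambda>z. \<rho> j k z * \<epsilon>)" by (rule integrable_mult_left[OF \<rho>i[OF jk]])
  have D'i: "integrable (lborel2) D'"
  proof (rule integrable_dom[OF \<rho>\<epsilon> D'm])
   show "AE z in lborel2. norm (D' z) \<le> norm (\<rho> j k z * \<epsilon>)"
    using D'b by (intro AE_I2) (rule order_trans, assumption, simp)
  qed
  have ci: "integrable (lborel2) (\<lambda>z. complex_of_real (\<rho> j k z) * of_real (norm (T t x)))"
   by (intro integrable_mult_left integrable_of_real \<rho>i jk)
  have "l (T (real j / real n) (paired ?a (d\<phi> j 0) (d\<psi> k 0) (fst (yk k)))) =
    (\<integral>z. complex_of_real (\<rho> j k z) * of_real (norm (T t x)) - D' z \<partial>lborel2)"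
   unfolding functional_paired[OF d\<phi>(1) d\<psi>(1) a yY lj]
   by (rule integral_eqI[OF refl])
    (simp add: D'_def \<rho>_def d\<phi>(2) d\<psi>(2) algebra_simps exp_of_real[symmetric])
  also have "\<dots> = of_real (\<integral>z. \<rho> j k z \<partial>lborel2) * of_real (norm (T t x)) - (\<integral>z. D' z \<partial>lborel2)"
   using Bochner_Integration.integral_diff[OF ci D'i] by simp
  finally have "of_real (\<integral>z. \<rho> j k z \<partial>lborel2) * of_real (norm (T t x)) -
   l (T (real j / real n) (paired ?a (d\<phi> j 0) (d\<psi> k 0) (fst (yk k)))) = (\<integral>z. D' z \<partial>lborel2)" by simp
  moreover have "cmod (\<integral>z. D' z \<partial>lborel2) \<le> (\<integral>z. \<rho> j k z * \<epsilon> \<partial>lborel2)"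
   by (rule order_trans[OF integral_norm_bound integral_mono[OF integrable_norm[OF D'i] \<rho>\<epsilon> D'b]])
  ultimately show ?thesis by simp
 qed
 define G where "G = (\<Sum>j<n. \<Sum>k<n. l (T (real j / real n) (paired ?a (d\<phi> j 0) (d\<psi> k 0) (fst (yk k)))))"
 have "cmod (of_real W * of_real (norm (T t x)) - G) \<le> W * \<epsilon>"
 proof -
  have "of_real W * of_real (norm (T t x)) - G = (\<Sum>j<n. \<Sum>k<n. (of_real (\<integral>z. \<rho> j k z \<partial>lborel2) * of_real (norm (T t x)) -
   l (T (real j / real n) (paired ?a (d\<phi> j 0) (d\<psi> k 0) (fst (yk k))))))"
   unfolding W_def G_def of_real_sum sum_distrib_right sum_subtractf ..
  also have "cmod \<dots> \<le> (\<Sum>j<n. \<Sum>k<n. (\<integral>z. \<rho> j k z \<partial>lborel2) * \<epsilon>)"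
   by (intro sum_norm_le near) auto
  finally show ?thesis unfolding W_def sum_distrib_right .
 qed
 moreover have "cmod G \<le> K * (2 * (N ?a * B))"
 proof -
  have "G = (\<Sum>j<n. l (T (real j / real n) (\<Lambda> j)))"
   unfolding G_def \<Lambda>_def by (intro sum.cong refl bcl_sum[OF lj, symmetric])
  also have "cmod \<dots> \<le> (\<Sum>j<n. K * norm (\<Lambda> j))"
  proof (rule sum_norm_le)
   fix j assume "j \<in> {..<n}"
   then show "cmod (l (T (real j / real n) (\<Lambda> j))) \<le> K * norm (\<Lambda> j)"
    using l(2)[rule_format, of "T (real j / real n) (\<Lambda> j)"] K(2)[of "real j / real n" "\<Lambda> j"] cell[of j] by simp
  qed
  also have "\<dots> \<le> K * (2 * (N ?a * B))"
   unfolding sum_distrib_left[symmetric] by (rule mult_left_mono) (use total K(1) in auto)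
  finally show ?thesis .
 qed
 ultimately have "W * norm (T t x) \<le> W * \<epsilon> + K * (2 * (N ?a * B))"
 proof -
  assume 1: "cmod (of_real W * of_real (norm (T t x)) - G) \<le> W * \<epsilon>" and 2: "cmod G \<le> K * (2 * (N ?a * B))"
  have "W * norm (T t x) \<le> cmod (of_real W * of_real (norm (T t x)))" by (simp add: norm_mult mult_right_mono)
  also have "\<dots> \<le> cmod (of_real W * of_real (norm (T t x)) - G) + cmod G"
   using norm_triangle_ineq[of "of_real W * of_real (norm (T t x)) - G" G] by simp
  finally show ?thesis using 1 2 by linarith
 qed
 then have fin: "W * (norm (T t x) - \<epsilon>) \<le> 2 * K\<^sup>2 * N ?a * norm y"
  by (simp add: B_def right_diff_distrib power2_eq_square mult_ac)
 have rhs0: "0 \<le> 2 * K\<^sup>2 * N ?a * norm y" using N_pos[OF a] by (intro mult_nonneg_nonneg) auto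
 have "exp (- 1) * I\<^sup>2 * (norm (T t x) - \<epsilon>) \<le> 2 * K\<^sup>2 * N ?a * norm y"
 proof (cases "norm (T t x) \<le> \<epsilon>")
  case True
  then have "exp (- 1) * I\<^sup>2 * (norm (T t x) - \<epsilon>) \<le> 0" by (intro mult_nonneg_nonpos) auto
  then show ?thesis using rhs0 by linarith
 next
  case False
  then have "exp (- 1) * I\<^sup>2 * (norm (T t x) - \<epsilon>) \<le> W * (norm (T t x) - \<epsilon>)" by (intro mult_right_mono W) auto
  then show ?thesis using fin by linarith
 qed
 then show ?thesis by (simp add: I_def x_def)
qed

lemma onorm_on_le:
 assumes "\<And>y. y \<in> Y \<Longrightarrow> norm (F y) \<le> c * norm y" "0 \<le> c"
 shows "onorm_on Y F \<le> c"
 unfolding onorm_on_def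
proof (rule cSUP_least)
 show "norm (F y) / norm y \<le> c" if "y \<in> Y" for y
  using assms(1)[OF that] assms(2) by (cases "y = 0") (simp_all add: divide_le_eq)
qed simp

text \<open>
 With \<open>a = 1 / t\<close> the damping \<open>e\<^bsup>-au\<^esup>\<close> stays above
 \<open>e\<^sup>-\<^sup>1\<close> for \<open>u \<le> t\<close>. Times up to 2 are covered by local
 boundedness of the semigroup.
\<close>
lemma semigroup_bound:
 assumes N: "\<And>a. N a = C * (a powr (- \<alpha>) + 1) + 1" and C: "0 \<le> C"
 shows "\<exists>C\<ge>0. \<forall>t\<ge>0. onorm_on Y (T t \<circ> fst) \<le> C * (t powr \<alpha> + 1)"
proof -
 obtain K where K: "1 \<le> K" "\<forall>t x. 0 \<le> t \<longrightarrow> t \<le> 2 \<longrightarrow> norm (T t x) \<le> K * norm x"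
  using bounded_on_interval[of 2] by (elim exE conjE)
 obtain d and \<beta> :: "real \<Rightarrow> real" where d: "ccinf d" "d 0 = (\<lambda>t. of_real (\<beta> t))"
  and \<beta>: "\<forall>t. 0 \<le> \<beta> t \<and> \<beta> t \<le> 1" "\<forall>t. t \<notin> {0<..<1} \<longrightarrow> \<beta> t = 0" "\<forall>t\<in>{0<..<1}. 0 < \<beta> t"
  by (rule smooth_bump)
 define I where "I = (LBINT s. \<beta> s)"
 have \<beta>i: "integrable lborel \<beta>"
  using integrable_Re[OF ccinf_integrable[OF d(1), of 0]] by (simp add: d(2))
 have "I \<noteq> 0"
 proof
  assume "I = 0"
  then have "AE s in lborel. \<beta> s = 0"
   unfolding I_def using integral_nonneg_eq_0_iff_AE[OF \<beta>i] \<beta>(1) by simp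
  then have "AE s in lborel. s \<notin> {0<..<1::real}"
  proof (rule eventually_mono)
   fix s assume "\<beta> s = 0" then show "s \<notin> {0<..<1}" using \<beta>(3) by force
  qed
  then have "{0<..<1::real} \<in> null_sets lborel" by (simp add: AE_iff_null_sets)
  then show False by (simp add: null_sets_def)
 qed
 define c where "c = exp (- 1) * I\<^sup>2"
 have c: "0 < c" using \<open>I \<noteq> 0\<close> by (simp add: c_def)
 define E where "E = K + 2 * K\<^sup>2 / c * (C + 1)"
 have EK: "K \<le> E" using c C by (simp add: E_def)
 have E0: "0 \<le> E" using EK K(1) by simp
 have "norm (T t (fst y)) \<le> E * (t powr \<alpha> + 1) * norm y" if t: "0 \<le> t" and y: "y \<in> Y" for t y
 proof (cases "t \<le> 2 \<or> y = 0")
  case True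
  have "norm (T t (fst y)) \<le> K * norm (fst y)"
  proof (cases "y = 0")
   case True then show ?thesis using bcl_zero[OF T_bcl[OF t]] by simp
  qed (use True t K(2) in simp)
  also have "\<dots> \<le> K * norm y" using norm_fst_le[of "fst y" "snd y"] K(1) by (intro mult_left_mono) auto
  also have "\<dots> \<le> E * (t powr \<alpha> + 1) * norm y"
  proof (rule mult_right_mono)
   have "K * 1 \<le> E * (t powr \<alpha> + 1)" by (rule mult_mono[OF EK]) (use E0 in auto)
   then show "K \<le> E * (t powr \<alpha> + 1)" by simp
  qed simp
  finally show ?thesis .
 next
  case False
  then have t2: "2 < t" and y0: "y \<noteq> 0" by auto
  have "c * norm (T t (fst y)) \<le> 2 * K\<^sup>2 * N (1 / t) * norm y"
  proof (rule field_le_epsilon)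
   fix e :: real assume e: "0 < e"
   have "c * (norm (T t (fst y)) - e / c) \<le> 2 * K\<^sup>2 * N (1 / t) * norm y"
    unfolding c_def I_def
    by (rule orbit_bound[OF d _ _ K(1) _ t2 y y0]) (use \<beta> K(2) e c in \<open>auto simp: c_def I_def\<close>)
   then show "c * norm (T t (fst y)) \<le> 2 * K\<^sup>2 * N (1 / t) * norm y + e"
    using c by (simp add: right_diff_distrib)
  qed
  also have "\<dots> \<le> 2 * K\<^sup>2 * ((C + 1) * (t powr \<alpha> + 1)) * norm y"
  proof (intro mult_right_mono mult_left_mono)
   have "(1 / t) powr (- \<alpha>) = t powr \<alpha>" using t2 by (simp add: powr_minus powr_divide)
   then show "N (1 / t) \<le> (C + 1) * (t powr \<alpha> + 1)" unfolding N by (simp add: algebra_simps)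
  qed auto
  finally have "norm (T t (fst y)) \<le> (2 * K\<^sup>2 / c * (C + 1)) * (t powr \<alpha> + 1) * norm y"
   using c by (simp add: field_simps)
  also have "\<dots> \<le> E * (t powr \<alpha> + 1) * norm y"
   by (intro mult_right_mono) (use K(1) in \<open>auto simp: E_def add_nonneg_nonneg\<close>)
  finally show ?thesis .
 qed
 then have "\<forall>t\<ge>0. onorm_on Y (T t \<circ> fst) \<le> E * (t powr \<alpha> + 1)"
  by (intro allI impI onorm_on_le) (use E0 in \<open>auto simp: add_nonneg_nonneg\<close>)
 then show ?thesis using E0 by blast
qed

end

section \<open>From growth of the semigroup to multiplier bounds\<close>

text \<open>
 From \<open>ln s \<le> s - 1\<close> with \<open>s = a t / \<alpha>\<close>; the maximum is at
 \<open>s = 1\<close>.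
\<close>
lemma powr_times_exp_le:
 fixes \<alpha> :: real
 assumes "0 \<le> \<alpha>"
 shows "\<exists>k\<ge>0. \<forall>a>0. \<forall>t\<ge>0. exp (- (a * t)) * t powr \<alpha> \<le> k * a powr (- \<alpha>)"
proof (cases "\<alpha> = 0")
 case True
 then show ?thesis by (intro exI[of _ 1]) auto
next
 case False
 then have p: "0 < \<alpha>" using assms by simp
 have "exp (- (a * t)) * t powr \<alpha> \<le> (\<alpha> powr \<alpha>) * a powr (- \<alpha>)" if a: "0 < a" and t: "0 \<le> t" for a t
 proof (cases "t = 0")
  case False
  then have t: "0 < t" using t by simp
  have "ln (a * t / \<alpha>) \<le> a * t / \<alpha> - 1" by (rule ln_le_minus_one) (use a t p in simp)
  then have "\<alpha> * ln (a * t / \<alpha>) \<le> a * t - \<alpha>" using p by (simp add: field_simps)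
  then have "(a * t / \<alpha>) powr \<alpha> \<le> exp (a * t)" using a t p by (simp add: powr_def)
  then have "exp (- (a * t)) * (a * t / \<alpha>) powr \<alpha> \<le> exp (- (a * t)) * exp (a * t)" by (rule mult_left_mono) simp
  then have "exp (- (a * t)) * (a * t / \<alpha>) powr \<alpha> \<le> 1" by (simp add: exp_minus)
  then show ?thesis using a t p by (simp add: powr_divide powr_mult powr_minus field_simps)
 qed (use p a in simp)
 then show ?thesis by (intro exI[of _ "\<alpha> powr \<alpha>"]) auto
qed

lemma bcl_fst: "bounded_clinear_on UNIV (fst :: 'a::complex_banach \<times> 'b::complex_banach \<Rightarrow> 'a)"
 unfolding bounded_clinear_on_def
 by (auto simp: scaleC_prod_def intro!: exI[of _ 1] norm_fst_le)

lemma Lp_norm_1: "Lp_norm 1 f = (\<integral>\<^sup>+t. ennreal (norm (f t)) \<partial>lebesgue)"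
 unfolding Lp_norm_def by (simp add: Let_def less_top)

lemma bint_Lp_fun: "f \<in> Lp_fun 1 Y \<Longrightarrow> bint f"
 by (simp add: Lp_fun_def bint_def Lp_norm_1 strongly_measurable_smeas)

lemma lebesgue_inverse_square: "integrable lebesgue (\<lambda>t::real. inverse (1 + t\<^sup>2))"
proof -
 have "(\<lambda>t::real. inverse (1 + t\<^sup>2)) \<in> borel_measurable borel" by measurable
 from lebesgue_lborel(2)[OF this] show ?thesis using integrable_inverse_square by simp
qed

lemma bcl_subset:
 fixes F :: "'a::complex_banach \<Rightarrow> 'b::complex_banach"
 assumes F: "bounded_clinear_on UNIV F" shows "bounded_clinear_on Y F"
proof -
 obtain K where "\<forall>x. norm (F x) \<le> K * norm x" by (rule bcl_bound[OF F])
 then have "\<exists>C. \<forall>x\<in>Y. norm (F x) \<le> C * norm x" by (intro exI[of _ K]) simp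
 then show ?thesis using F unfolding bounded_clinear_on_def by simp
qed

lemma schwartz_bint:
 fixes f :: "real \<Rightarrow> 'y::complex_banach"
 assumes "f \<in> schwartz Y"
 shows "bint f" "f \<in> Lp_fun 1 Y" "isCont f t"
proof -
 obtain d where d: "d 0 = f" "\<forall>n t. (d n has_vector_derivative d (Suc n) t) (at t)"
  "\<forall>n k. \<exists>C. \<forall>t. \<bar>t\<bar> ^ k * norm (d n t) \<le> C" and Y: "\<forall>t. f t \<in> Y"
  using assms unfolding schwartz_def by blast
 show c: "isCont f t" for t
 proof -
  have "(d 0 has_vector_derivative d (Suc 0) t) (at t)" using d(2) by blast
  from has_vector_derivative_continuous[OF this] show ?thesis unfolding d(1) .
 qed
 obtain C0 where "\<forall>t. \<bar>t\<bar> ^ 0 * norm (d 0 t) \<le> C0" using d(3) by blast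
 then have C0: "\<forall>t. \<bar>t\<bar> ^ 0 * norm (f t) \<le> C0" unfolding d(1) .
 obtain C2 where "\<forall>t. \<bar>t\<bar> ^ 2 * norm (d 0 t) \<le> C2" using d(3) by blast
 then have C2: "\<forall>t. \<bar>t\<bar> ^ 2 * norm (f t) \<le> C2" unfolding d(1) .
 have le: "norm (f t) \<le> (C0 + C2) * inverse (1 + t\<^sup>2)" for t
 proof -
  have p: "0 < 1 + t\<^sup>2" by (auto intro: add_pos_nonneg)
  have "norm (f t) * (1 + t\<^sup>2) \<le> C0 + C2" using C0[rule_format, of t] C2[rule_format, of t] by (simp add: algebra_simps)
  then show ?thesis using p by (simp add: field_simps)
 qed
 show b: "bint f"
 proof (rule bintI)
  show "smeas f" by (rule smeas_isCont) (use c in simp)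
  show "integrable lebesgue (\<lambda>t. (C0 + C2) * inverse (1 + t\<^sup>2))"
   by (rule integrable_mult_right[OF lebesgue_inverse_square])
 qed (use le in simp)
 show "f \<in> Lp_fun 1 Y" using b Y by (simp add: Lp_fun_def Lp_norm_1 bint_def strongly_measurable_smeas)
qed

text \<open>
 The solution operator of the evolution equation, convolution with the kernel \<open>e\<^bsup>-au\<^esup> T(u)\<close>, is the
 operator with symbol \<open>(a + i\<xi> + A)\<^sup>-\<^sup>1\<close>. A pointwise bound on the kernel makes it bounded from
 \<open>L\<^sup>1\<close> to \<open>L\<^sup>\<infinity>\<close>.
\<close>
locale polynomial_orbits = C0_generator T D A M w
 for T :: "real \<Rightarrow> 'x::complex_banach \<Rightarrow> 'x" and D A M w +
 fixes Y :: "('x \<times> 'x) set" and C \<alpha> a k :: real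
 assumes reg: "\<And>z. 0 < Re z \<Longrightarrow> regular z"
  and Y_0: "0 \<in> Y" and \<alpha>: "0 \<le> \<alpha>" and C: "0 \<le> C" and a: "0 < a"
  and orbit: "\<And>t y. 0 \<le> t \<Longrightarrow> y \<in> Y \<Longrightarrow> norm (T t (fst y)) \<le> C * (t powr \<alpha> + 1) * norm y"
  and k: "0 \<le> k" "\<And>t. 0 \<le> t \<Longrightarrow> exp (- (a * t)) * t powr \<alpha> \<le> k * a powr (- \<alpha>)"
begin

definition L :: real where "L = C * (k + 1) * (a powr (- \<alpha>) + 1)"

lemma L_nonneg: "0 \<le> L" unfolding L_def using C k(1) by (simp add: add_nonneg_nonneg)

definition ker :: "real \<Rightarrow> 'x \<Rightarrow> 'x" where "ker u x = exp (- (a * u)) *\<^sub>R Tp u x"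

text \<open>
 A majorant for the kernel as an operator from \<open>Y\<close> to \<open>X\<close>, bounded and
 integrable.
\<close>
definition wt :: "real \<Rightarrow> real" where "wt u = indicator {0..} u * (exp (- (a * u)) * (C * (u powr \<alpha> + 1)))"

lemma ker_wt: "y \<in> Y \<Longrightarrow> norm (ker u (fst y)) \<le> wt u * norm y"
proof (cases "0 \<le> u")
 case True
 assume "y \<in> Y"
 from mult_left_mono[OF orbit[OF True this], of "exp (- (a * u))"] show ?thesis
  using True by (simp add: ker_def wt_def Tp_nonneg mult_ac)
qed (simp add: ker_def wt_def Tp_neg)

lemma wt_nonneg: "0 \<le> wt u" unfolding wt_def using C by (simp add: add_nonneg_nonneg)

lemma wt_le: "wt u \<le> L"
proof (cases "0 \<le> u")
 case True
 have "exp (- (a * u)) * u powr \<alpha> + exp (- (a * u)) \<le> k * a powr (- \<alpha>) + 1"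
  by (rule add_mono[OF k(2)[OF True]]) (use True a in simp)
 also have "\<dots> \<le> (k + 1) * (a powr (- \<alpha>) + 1)" using k(1) by (simp add: algebra_simps)
 finally have "C * (exp (- (a * u)) * u powr \<alpha> + exp (- (a * u))) \<le> C * ((k + 1) * (a powr (- \<alpha>) + 1))" by (rule mult_left_mono[OF _ C])
 then show ?thesis using True by (simp add: wt_def L_def algebra_simps)
qed (simp add: wt_def L_nonneg)

lemma wt_integrable: "integrable lborel wt"
proof -
 have "integrable lborel (\<lambda>t. C * (indicator {0..} t * (t powr (\<alpha> + 1 - 1) * exp (- a * t))) + C * (indicator {0..} t * exp (- a * t)))"
  using gamma_kernel_integral[of "\<alpha> + 1" a] exp_kernel_integrable[OF a] a \<alpha>
  by (intro Bochner_Integration.integrable_add integrable_mult_right) (auto simp: has_bochner_integral_iff)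
 moreover have "(\<lambda>t. C * (indicator {0..} t * (t powr (\<alpha> + 1 - 1) * exp (- a * t))) + C * (indicator {0..} t * exp (- a * t))) = wt"
  by (auto simp: wt_def fun_eq_iff algebra_simps)
 ultimately show ?thesis by simp
qed

lemma wt_borel [measurable]: "wt \<in> borel_measurable borel" using borel_measurable_integrable[OF wt_integrable] by simp

definition ka :: real where "ka = (LBINT u. wt u)"

lemma ka_nonneg: "0 \<le> ka" unfolding ka_def using wt_nonneg by (simp add: integral_nonneg)

lemma exp_Tp_ker: "exp (- Complex a \<xi> * of_real t) *\<^sub>C Tp t x = exp (- (\<i> * of_real \<xi> * of_real t)) *\<^sub>C ker t x"
proof -
 have "- Complex a \<xi> * of_real t = - (\<i> * of_real \<xi> * of_real t) + of_real (- (a * t))" by (simp add: complex_eq_iff)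
 then show ?thesis unfolding ker_def scaleR_scaleC scaleC_scaleC by (simp only: exp_add exp_of_real)
qed

lemma resolvent_kernel:
 assumes y: "y \<in> Y"
 shows "bint (\<lambda>t. exp (- (\<i> * of_real \<xi> * of_real t)) *\<^sub>C ker t (fst y))"
  "R (Complex a \<xi>) (fst y) = Bochner (\<lambda>t. exp (- (\<i> * of_real \<xi> * of_real t)) *\<^sub>C ker t (fst y))"
  "norm (R (Complex a \<xi>) (fst y)) \<le> ka * norm y"
proof -
 have i: "integrable lebesgue (\<lambda>t. wt t * norm y)"
  using wt_integrable lebesgue_lborel(2)[OF wt_borel] by simp
 have le: "norm (exp (- (\<i> * of_real \<xi> * of_real t)) *\<^sub>C ker t (fst y)) \<le> wt t * norm y" for t
  using ker_wt[OF y] by (simp add: norm_scaleC)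
 show b: "bint (\<lambda>t. exp (- (\<i> * of_real \<xi> * of_real t)) *\<^sub>C ker t (fst y))"
  by (rule bintI[OF _ i]) (use smeas_lap[of "Complex a \<xi>" "fst y"] le in \<open>simp_all only: exp_Tp_ker AE_I2\<close>)
 show e: "R (Complex a \<xi>) (fst y) = Bochner (\<lambda>t. exp (- (\<i> * of_real \<xi> * of_real t)) *\<^sub>C ker t (fst y))"
  unfolding exp_Tp_ker[symmetric] lap_def[symmetric]
  by (rule R_eq_lap) (use a reg b in \<open>simp_all only: exp_Tp_ker complex.sel\<close>)
 have "norm (R (Complex a \<xi>) (fst y)) \<le> (\<integral>t. norm (exp (- (\<i> * of_real \<xi> * of_real t)) *\<^sub>C ker t (fst y)) \<partial>lebesgue)"
  unfolding e by (rule Bochner_norm_le[OF b])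
 also have "\<dots> \<le> (\<integral>t. wt t * norm y \<partial>lebesgue)" by (rule integral_mono[OF bint_norm_integrable[OF b] i le])
 also have "\<dots> = ka * norm y" unfolding ka_def using lebesgue_lborel(1)[OF wt_borel] by simp
 finally show "norm (R (Complex a \<xi>) (fst y)) \<le> ka * norm y" .
qed

definition S :: "(real \<Rightarrow> 'x \<times> 'x) \<Rightarrow> real \<Rightarrow> 'x" where
 "S f t = Bochner (\<lambda>s. ker (t - s) (fst (f s)))"

lemma S_smeas:
 fixes f :: "real \<Rightarrow> 'x \<times> 'x"
 assumes f: "smeas f" shows "smeas (\<lambda>s. ker (t - s) (fst (f s)))"
 unfolding ker_def
proof (rule smeas_scaleR)
 show "smeas (\<lambda>s. exp (- (a * (t - s))))" by (rule smeas_borel') measurable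
 have "AE s in lebesgue. t - s \<noteq> 0" using AE_neq[of t] by (rule eventually_mono) simp
 then show "smeas (\<lambda>s. Tp (t - s) (fst (f s)))"
  by (intro smeas_Tp smeas_linear[OF bounded_linear_fst f] smeas_borel') measurable
qed

lemma S_bint:
 assumes f: "bint f" "\<And>s. f s \<in> Y"
 shows "bint (\<lambda>s. ker (t - s) (fst (f s)))" "norm (S f t) \<le> L * (\<integral>s. norm (f s) \<partial>lebesgue)"
proof -
 have i: "integrable lebesgue (\<lambda>s. L * norm (f s))" by (intro integrable_mult_right bint_norm_integrable f)
 have le: "norm (ker (t - s) (fst (f s))) \<le> L * norm (f s)" for s
  by (rule order_trans[OF ker_wt[OF f(2)] mult_right_mono[OF wt_le]]) simp
 show b: "bint (\<lambda>s. ker (t - s) (fst (f s)))"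
  by (rule bintI[OF S_smeas[OF bint_smeas[OF f(1)]] i]) (use le in simp)
 have "norm (S f t) \<le> (\<integral>s. norm (ker (t - s) (fst (f s))) \<partial>lebesgue)" unfolding S_def by (rule Bochner_norm_le[OF b])
 also have "\<dots> \<le> (\<integral>s. L * norm (f s) \<partial>lebesgue)" by (rule integral_mono[OF bint_norm_integrable[OF b] i le])
 finally show "norm (S f t) \<le> L * (\<integral>s. norm (f s) \<partial>lebesgue)" by simp
qed

text \<open>
 Strong measurability of \<open>S f\<close> is obtained from continuity, by dominated convergence.
\<close>
lemma S_isCont:
 assumes f: "bint f" "\<And>s. f s \<in> Y"
 shows "isCont (S f) t"
proof (unfold continuous_at_sequentially, intro allI impI)
 fix \<tau> :: "nat \<Rightarrow> real" assume \<tau>: "\<tau> \<longlonglongrightarrow> t"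
 have "(\<lambda>n. S f (\<tau> n)) \<longlonglongrightarrow> S f t" unfolding S_def
 proof (rule Bochner_dominated_convergence)
  show "integrable lebesgue (\<lambda>s. L * norm (f s))" by (intro integrable_mult_right bint_norm_integrable f)
  show "AE s in lebesgue. norm (ker (\<tau> n - s) (fst (f s))) \<le> L * norm (f s)" for n
   by (intro AE_I2 order_trans[OF ker_wt[OF f(2)] mult_right_mono[OF wt_le]]) simp
  show "AE s in lebesgue. (\<lambda>n. ker (\<tau> n - s) (fst (f s))) \<longlonglongrightarrow> ker (t - s) (fst (f s))"
   using AE_neq[of t]
  proof (rule eventually_mono)
   fix s assume s: "s \<noteq> t"
   have "(\<lambda>n. (\<tau> n - s, fst (f s))) \<longlonglongrightarrow> (t - s, fst (f s))" by (intro tendsto_intros \<tau>)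
   from isCont_tendsto_compose[OF Tp_isCont this] s
   have "(\<lambda>n. Tp (\<tau> n - s) (fst (f s))) \<longlonglongrightarrow> Tp (t - s) (fst (f s))" by simp
   then show "(\<lambda>n. ker (\<tau> n - s) (fst (f s))) \<longlonglongrightarrow> ker (t - s) (fst (f s))"
    unfolding ker_def by (intro tendsto_intros \<tau>)
  qed
 qed (rule S_smeas[OF bint_smeas[OF f(1)]])+
 then show "(S f \<circ> \<tau>) \<longlonglongrightarrow> S f t" by (simp add: o_def)
qed

lemma ker_linear: "ker u (x + y) = ker u x + ker u y" "ker u (c *\<^sub>C x) = c *\<^sub>C ker u x"
proof -
 have T: "Tp u (x + y) = Tp u x + Tp u y" "Tp u (c *\<^sub>C x) = c *\<^sub>C Tp u x" using Tp_bcl[of u] by (auto simp: bounded_clinear_on_def)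
 show "ker u (x + y) = ker u x + ker u y" "ker u (c *\<^sub>C x) = c *\<^sub>C ker u x"
  unfolding ker_def T scaleR_scaleC by (simp_all add: scaleC_add_right scaleC_scaleC mult.commute)
qed

text \<open>
 Under a functional both sides become the double integral of \<open>\<phi> (s + u)\<close> against
 the kernel applied to \<open>f s\<close>, one directly, the other by Fourier inversion.
\<close>
lemma S_represents:
 assumes f: "f \<in> schwartz Y"
 shows "represents_distr (S f) (multiplier_distr (\<lambda>\<xi>. R (Complex a \<xi>) \<circ> fst) f)"
 unfolding represents_distr_def
proof
 fix \<phi> :: "real \<Rightarrow> complex" assume \<phi>: "\<phi> \<in> schwartz UNIV"
 note fb = schwartz_bint(1)[OF f]
 have fY: "f s \<in> Y" for s using f by (simp add: schwartz_def)
 have fc: "isCont f s" for s by (rule schwartz_bint(3)[OF f])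
 note \<phi>i = schwartz_integrable[OF \<phi>]
 have \<phi>m[measurable]: "\<phi> \<in> borel_measurable borel" using borel_measurable_integrable[OF \<phi>i] by simp
 obtain d where d: "rapid d" "d 0 = \<phi>" using schwartz_rapid[OF \<phi>] by (elim exE conjE)
 note inv = rapid_inversion[OF d(1), unfolded d(2)]
 have im: "inv_fourier \<phi> \<in> borel_measurable borel" using borel_measurable_integrable[OF inv(1)] by simp
 define F where "F = (\<integral>s. norm (f s) \<partial>lebesgue)"
 have F0: "0 \<le> F" by (simp add: F_def)
 have ebint: "bint (\<lambda>s. exp (- (\<i> * of_real \<xi> * of_real s)) *\<^sub>C f s)" for \<xi>
  by (rule bintI[OF smeas_scaleC[OF smeas_borel' bint_smeas[OF fb]] bint_norm_integrable[OF fb]]) (simp_all add: norm_scaleC)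
 have FT: "fst (fourier f \<xi>) = Bochner (\<lambda>s. exp (- (\<i> * of_real \<xi> * of_real s)) *\<^sub>C fst (f s))" for \<xi>
  unfolding fourier_def using Bochner_bcl[OF bcl_fst ebint] by (simp add: scaleC_prod_def)
 have e1bint: "bint (\<lambda>s. exp (- (\<i> * of_real \<xi> * of_real s)) *\<^sub>C fst (f s))" for \<xi>
  using bint_bcl[OF bcl_fst ebint] by (simp add: scaleC_prod_def)
 have ra: "regular (Complex a \<xi>)" for \<xi> by (rule reg) (use a in simp)
 have RF: "R (Complex a \<xi>) (fst (fourier f \<xi>)) = Bochner (\<lambda>s. exp (- (\<i> * of_real \<xi> * of_real s)) *\<^sub>C R (Complex a \<xi>) (fst (f s)))"
  and Rb: "bint (\<lambda>s. exp (- (\<i> * of_real \<xi> * of_real s)) *\<^sub>C R (Complex a \<xi>) (fst (f s)))" for \<xi>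
 proof -
  have sc: "R (Complex a \<xi>) (c *\<^sub>C x) = c *\<^sub>C R (Complex a \<xi>) x" for c x
   using regular_bcl[OF ra] by (simp add: bounded_clinear_on_def)
  show "R (Complex a \<xi>) (fst (fourier f \<xi>)) = Bochner (\<lambda>s. exp (- (\<i> * of_real \<xi> * of_real s)) *\<^sub>C R (Complex a \<xi>) (fst (f s)))"
   unfolding FT Bochner_bcl[OF regular_bcl[OF ra] e1bint, symmetric] sc ..
  show "bint (\<lambda>s. exp (- (\<i> * of_real \<xi> * of_real s)) *\<^sub>C R (Complex a \<xi>) (fst (f s)))"
  proof -
   have "bint (\<lambda>s. R (Complex a \<xi>) (exp (- (\<i> * of_real \<xi> * of_real s)) *\<^sub>C fst (f s)))"
    by (rule bint_bcl[OF regular_bcl[OF ra] e1bint])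
   then show ?thesis unfolding sc .
  qed
 qed
 have RFb: "norm (R (Complex a \<xi>) (fst (fourier f \<xi>))) \<le> ka * F" for \<xi>
 proof -
  have "norm (R (Complex a \<xi>) (fst (fourier f \<xi>))) \<le> (\<integral>s. norm (exp (- (\<i> * of_real \<xi> * of_real s)) *\<^sub>C R (Complex a \<xi>) (fst (f s))) \<partial>lebesgue)"
   unfolding RF by (rule Bochner_norm_le[OF Rb])
  also have "\<dots> \<le> (\<integral>s. ka * norm (f s) \<partial>lebesgue)"
   by (rule integral_mono[OF bint_norm_integrable[OF Rb] integrable_mult_right[OF bint_norm_integrable[OF fb]]])
    (use resolvent_kernel(3)[OF fY] in \<open>simp add: norm_scaleC\<close>)
  finally show ?thesis by (simp add: F_def)
 qed
 have RFs: "smeas (\<lambda>\<xi>. R (Complex a \<xi>) (fst (fourier f \<xi>)))"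
 proof (intro smeas_isCont AE_I2, unfold continuous_at_sequentially, intro allI impI)
  fix \<xi> and \<tau> :: "nat \<Rightarrow> real" assume \<tau>: "\<tau> \<longlonglongrightarrow> \<xi>"
  have "(\<lambda>n. R (Complex a (\<tau> n)) (fst (fourier f (\<tau> n)))) \<longlonglongrightarrow> R (Complex a \<xi>) (fst (fourier f \<xi>))"
  proof (rule R_tendsto[OF ra])
   show "(\<lambda>n. Complex a (\<tau> n)) \<longlonglongrightarrow> Complex a \<xi>" unfolding Complex_eq by (intro tendsto_intros \<tau>)
   have "(\<lambda>n. fourier f (\<tau> n)) \<longlonglongrightarrow> fourier f \<xi>" unfolding fourier_def
   proof (rule Bochner_dominated_convergence[OF _ _ bint_norm_integrable[OF fb]])
    show "smeas (\<lambda>t. exp (- (\<i> * of_real (\<tau> n) * of_real t)) *\<^sub>C f t)" for n by (rule bint_smeas[OF ebint])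
    show "smeas (\<lambda>t. exp (- (\<i> * of_real \<xi> * of_real t)) *\<^sub>C f t)" by (rule bint_smeas[OF ebint])
    show "AE t in lebesgue. (\<lambda>n. exp (- (\<i> * of_real (\<tau> n) * of_real t)) *\<^sub>C f t) \<longlonglongrightarrow> exp (- (\<i> * of_real \<xi> * of_real t)) *\<^sub>C f t"
     by (intro AE_I2 tendsto_scaleC tendsto_intros \<tau>)
   qed (simp add: norm_scaleC)
   then show "(\<lambda>n. fst (fourier f (\<tau> n))) \<longlonglongrightarrow> fst (fourier f \<xi>)" by (rule tendsto_fst)
  qed (use ra in simp)
  then show "((\<lambda>\<xi>. R (Complex a \<xi>) (fst (fourier f \<xi>))) \<circ> \<tau>) \<longlonglongrightarrow> R (Complex a \<xi>) (fst (fourier f \<xi>))" by (simp add: o_def)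
 qed
 let ?r = "\<lambda>\<xi>. inv_fourier \<phi> \<xi> *\<^sub>C R (Complex a \<xi>) (fst (fourier f \<xi>))"
 have rb: "bint ?r"
 proof (rule bintI)
  show "smeas ?r" by (rule smeas_scaleC[OF smeas_borel'[OF im] RFs])
  show "integrable lebesgue (\<lambda>\<xi>. cmod (inv_fourier \<phi> \<xi>) * (ka * F))"
   using inv(1) lebesgue_lborel(2)[OF im] by (intro integrable_mult_left integrable_norm) simp
  show "AE \<xi> in lebesgue. norm (?r \<xi>) \<le> cmod (inv_fourier \<phi> \<xi>) * (ka * F)"
   unfolding norm_scaleC by (intro AE_I2 mult_left_mono RFb) simp
 qed
 let ?l = "\<lambda>t. \<phi> t *\<^sub>C S f t"
 have lb: "bint ?l"
 proof (rule bintI)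
  show "smeas ?l" by (intro smeas_scaleC smeas_borel'[OF \<phi>m] smeas_isCont AE_I2 S_isCont fb fY)
  show "integrable lebesgue (\<lambda>t. cmod (\<phi> t) * (L * F))"
   using \<phi>i lebesgue_lborel(2)[OF \<phi>m] by (intro integrable_mult_left integrable_norm) simp
  show "AE t in lebesgue. norm (?l t) \<le> cmod (\<phi> t) * (L * F)"
   unfolding norm_scaleC by (intro AE_I2 mult_left_mono) (use S_bint(2)[OF fb fY] in \<open>simp_all add: F_def\<close>)
 qed
 have main: "(\<integral>t. l (?l t) \<partial>lebesgue) = l (Bochner ?r)" if l: "bounded_clinear_on UNIV l" for l :: "'x \<Rightarrow> complex"
 proof -
  obtain B where B: "0 \<le> B" "\<forall>x. norm (l x) \<le> B * norm x" by (rule bcl_bound[OF l])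
  define h where "h z = l (ker (snd z) (fst (f (fst z))))" for z :: "real \<times> real"
  have hm[measurable]: "h \<in> borel_measurable (borel \<Otimes>\<^sub>M borel)"
  proof -
   have "isCont (\<lambda>z. l (exp (- (a * snd z)) *\<^sub>R T (max (snd z) 0) (fst (f (fst z))))) z" for z :: "real \<times> real"
    unfolding isCont_def
   proof (intro bcl_tendsto[OF l] tendsto_scaleR T_tendsto tendsto_intros)
    show "((\<lambda>z. f (fst z)) \<longlongrightarrow> f (fst z)) (at z)"
     by (rule isCont_tendsto_compose[OF fc]) (intro tendsto_intros)
    show "\<forall>\<^sub>F i in at z. 0 \<le> max (snd i) 0" by simp
   qed simp
   then have "(\<lambda>z. l (exp (- (a * snd z)) *\<^sub>R T (max (snd z) 0) (fst (f (fst z))))) \<in> borel_measurable borel"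
    by (intro borel_measurable_continuous_onI continuous_at_imp_continuous_on ballI)
   then have "(\<lambda>z. l (exp (- (a * snd z)) *\<^sub>R T (max (snd z) 0) (fst (f (fst z))))) \<in> borel_measurable (borel \<Otimes>\<^sub>M borel)"
    by (simp add: borel_prod)
   then have "(\<lambda>z. indicator {0..} (snd z) * l (exp (- (a * snd z)) *\<^sub>R T (max (snd z) 0) (fst (f (fst z))))) \<in> borel_measurable (borel \<Otimes>\<^sub>M borel)"
    by measurable
   moreover have "(\<lambda>z. indicator {0..} (snd z) * l (exp (- (a * snd z)) *\<^sub>R T (max (snd z) 0) (fst (f (fst z))))) = h"
    by (auto simp: h_def ker_def Tp_def indicator_def fun_eq_iff bcl_zero[OF l])
   ultimately show ?thesis by simp
  qed
  have fn: "integrable lborel (\<lambda>s. norm (f s))"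
  proof -
   have "continuous_on UNIV f" using fc by (simp add: continuous_on_eq_continuous_at)
   then have "(\<lambda>s. norm (f s)) \<in> borel_measurable borel"
    by (intro borel_measurable_continuous_onI continuous_on_norm)
   from lebesgue_lborel(2)[OF this] show ?thesis using bint_norm_integrable[OF fb] by simp
  qed
  have hb: "cmod (h z) \<le> B * (norm (f (fst z)) * wt (snd z))" for z
  proof -
   have "cmod (h z) \<le> B * norm (ker (snd z) (fst (f (fst z))))" unfolding h_def by (rule B(2)[rule_format])
   also have "\<dots> \<le> B * (wt (snd z) * norm (f (fst z)))" by (rule mult_left_mono[OF ker_wt[OF fY] B(1)])
   finally show ?thesis by (simp add: mult.commute)
  qed
  have hi: "integrable (lborel2) h"
  proof (rule integrable_dom[OF integrable_mult_right[OF product_integrable[OF fn wt_integrable], of B]])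
   show "h \<in> borel_measurable (lborel2)" by measurable
   have "norm (h z) \<le> norm (B * (case z of (x, y) \<Rightarrow> norm (f x) * wt y))" for z
    using hb[of z] by (simp add: split_beta)
   then show "AE z in lborel2. norm (h z) \<le> norm (B * (case z of (x, y) \<Rightarrow> norm (f x) * wt y))" by simp
  qed
  obtain E where E: "0 \<le> E" "\<forall>t. cmod (d 0 t) \<le> E * inverse (1 + t\<^sup>2)" by (rule rapid_bound[OF d(1)])
  have \<phi>b: "cmod (\<phi> t) \<le> E" for t
  proof -
   have "inverse (1 + t\<^sup>2) \<le> 1" by (simp add: inverse_le_1_iff)
   from mult_left_mono[OF this E(1)] have "E * inverse (1 + t\<^sup>2) \<le> E" by simp
   then show ?thesis using E(2)[rule_format, of t] unfolding d(2) by linarith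
  qed
  have h1: "integrable lborel (\<lambda>u. h (s, u))" for s
  proof (rule integrable_dom[OF integrable_mult_right[OF wt_integrable, of "B * norm (f s)"]])
   show "(\<lambda>u. h (s, u)) \<in> borel_measurable lborel" by measurable
   have "norm (h (s, u)) \<le> norm (B * norm (f s) * wt u)" for u using hb[of "(s, u)"] by (simp add: mult.assoc)
   then show "AE u in lborel. norm (h (s, u)) \<le> norm (B * norm (f s) * wt u)" by simp
  qed
  have left: "(\<integral>t. l (?l t) \<partial>lebesgue) = (\<integral>z. \<phi> (fst z + snd z) * h z \<partial>lborel2)"
  proof -
   have S1: "l (S f t) = (LBINT s. h (s, t - s))" for t
   proof -
    have "l (S f t) = (\<integral>s. h (s, t - s) \<partial>lebesgue)"
     unfolding S_def h_def fst_conv snd_conv by (rule functional_Bochner(2)[OF S_bint(1)[OF fb fY] l])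
    also have "\<dots> = (LBINT s. h (s, t - s))" by (rule lebesgue_lborel(1)) measurable
    finally show ?thesis .
   qed
   have cv: "integrable (lborel2) (\<lambda>(s, t). \<phi> t * h (s, t - s))"
   proof (rule integrable_dom[OF integrable_mult_right[OF convolution_integrable[OF fn wt_integrable], of "E * B"]])
    show "(\<lambda>(s, t). \<phi> t * h (s, t - s)) \<in> borel_measurable (lborel2)" by measurable
    have "norm (\<phi> t * h (s, t - s)) \<le> norm (E * B * (norm (f s) * wt (t - s)))" for s t
    proof -
     have "norm (\<phi> t * h (s, t - s)) \<le> E * (B * (norm (f s) * wt (t - s)))"
      unfolding norm_mult using hb[of "(s, t - s)"] by (intro mult_mono \<phi>b) (use E in auto)
     then show ?thesis by (simp add: mult.assoc)
    qed
    then show "AE z in lborel2. norm (case z of (s, t) \<Rightarrow> \<phi> t * h (s, t - s)) \<le>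
      norm (E * B * (case z of (x, y) \<Rightarrow> norm (f x) * wt (y - x)))" by (simp add: split_beta)
   qed
   have ph: "integrable (lborel2) (\<lambda>z. \<phi> (fst z + snd z) * h z)"
   proof (rule integrable_dom[OF integrable_mult_right[OF hi, of "of_real E"]])
    show "(\<lambda>z. \<phi> (fst z + snd z) * h z) \<in> borel_measurable (lborel2)" by measurable
    show "AE z in lborel2. norm (\<phi> (fst z + snd z) * h z) \<le> norm (of_real E * h z)"
     unfolding norm_mult using \<phi>b E(1) by (intro AE_I2 mult_right_mono) auto
   qed
   have "(\<integral>t. l (?l t) \<partial>lebesgue) = (\<integral>t. \<phi> t * (LBINT s. h (s, t - s)) \<partial>lebesgue)"
    unfolding bcl_mult[OF l] S1 ..
   also have "\<dots> = (LBINT t. \<phi> t * (LBINT s. h (s, t - s)))" by (rule lebesgue_lborel(1)) measurable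
   also have "\<dots> = (LBINT t. (LBINT s. \<phi> t * h (s, t - s)))" by simp
   also have "\<dots> = (LBINT s. (LBINT t. \<phi> t * h (s, t - s)))" by (rule pair_swap_integral[OF cv])
   also have "\<dots> = (LBINT s. (LBINT u. \<phi> (s + u) * h (s, u)))"
   proof (rule integral_eqI[OF refl])
    fix s show "(LBINT t. \<phi> t * h (s, t - s)) = (LBINT u. \<phi> (s + u) * h (s, u))"
     using lborel_integral_real_affine[of 1 "\<lambda>t. \<phi> t * h (s, t - s)" s] by simp
   qed
   also have "\<dots> = (\<integral>z. \<phi> (fst z + snd z) * h z \<partial>lborel2)"
    using lborel_pair.integral_fst'[OF ph] unfolding fst_conv snd_conv .
   finally show ?thesis .
  qed
  have right: "l (R (Complex a \<xi>) (fst (fourier f \<xi>))) =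
    (\<integral>z. exp (- \<i> * of_real \<xi> * of_real (fst z + snd z)) * h z \<partial>lborel2)" for \<xi>
  proof -
   have eh: "integrable (lborel2) (\<lambda>z. exp (- \<i> * of_real \<xi> * of_real (fst z + snd z)) * h z)"
   proof (rule integrable_dom[OF hi])
    show "(\<lambda>z. exp (- \<i> * of_real \<xi> * of_real (fst z + snd z)) * h z) \<in> borel_measurable (lborel2)" by measurable
   qed (simp add: norm_mult)
   have lR: "l (R (Complex a \<xi>) (fst (f s))) = (LBINT u. exp (- (\<i> * of_real \<xi> * of_real u)) * h (s, u))" for s
   proof -
    have "l (R (Complex a \<xi>) (fst (f s))) = (\<integral>u. exp (- (\<i> * of_real \<xi> * of_real u)) * h (s, u) \<partial>lebesgue)"
     unfolding resolvent_kernel(2)[OF fY] functional_Bochner(2)[OF resolvent_kernel(1)[OF fY] l] bcl_mult[OF l] h_def fst_conv snd_conv ..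
    also have "\<dots> = (LBINT u. exp (- (\<i> * of_real \<xi> * of_real u)) * h (s, u))" by (rule lebesgue_lborel(1)) measurable
    finally show ?thesis .
   qed
   have "l (R (Complex a \<xi>) (fst (fourier f \<xi>))) =
     (\<integral>s. exp (- (\<i> * of_real \<xi> * of_real s)) * (LBINT u. exp (- (\<i> * of_real \<xi> * of_real u)) * h (s, u)) \<partial>lebesgue)"
    unfolding RF functional_Bochner(2)[OF Rb l] bcl_mult[OF l] lR ..
   also have "\<dots> = (LBINT s. exp (- (\<i> * of_real \<xi> * of_real s)) * (LBINT u. exp (- (\<i> * of_real \<xi> * of_real u)) * h (s, u)))"
    by (rule lebesgue_lborel(1)) measurable
   also have "\<dots> = (LBINT s. (LBINT u. exp (- \<i> * of_real \<xi> * of_real (s + u)) * h (s, u)))"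
   proof (rule integral_eqI[OF refl])
    fix s
    have "exp (- \<i> * of_real \<xi> * of_real (s + u)) * h (s, u) = exp (- (\<i> * of_real \<xi> * of_real s)) * (exp (- (\<i> * of_real \<xi> * of_real u)) * h (s, u))" for u
     unfolding of_real_add distrib_left exp_add by (simp add: mult_ac)
    then show "exp (- (\<i> * of_real \<xi> * of_real s)) * (LBINT u. exp (- (\<i> * of_real \<xi> * of_real u)) * h (s, u)) =
     (LBINT u. exp (- \<i> * of_real \<xi> * of_real (s + u)) * h (s, u))" by (simp only: integral_mult_right_zero)
   qed
   also have "\<dots> = (\<integral>z. exp (- \<i> * of_real \<xi> * of_real (fst z + snd z)) * h z \<partial>lborel2)"
    using lborel_pair.integral_fst'[OF eh] unfolding fst_conv snd_conv .
   finally show ?thesis .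
  qed
  have rm: "(\<lambda>\<xi>. inv_fourier \<phi> \<xi> * (\<integral>z. exp (- \<i> * of_real \<xi> * of_real (fst z + snd z)) * h z \<partial>lborel2)) \<in> borel_measurable borel"
   using im by measurable
  have "l (Bochner ?r) = (\<integral>\<xi>. inv_fourier \<phi> \<xi> * (\<integral>z. exp (- \<i> * of_real \<xi> * of_real (fst z + snd z)) * h z \<partial>lborel2) \<partial>lebesgue)"
   unfolding functional_Bochner(2)[OF rb l] bcl_mult[OF l] right ..
  also have "\<dots> = (LBINT \<xi>. inv_fourier \<phi> \<xi> * (\<integral>z. exp (- \<i> * of_real \<xi> * of_real (fst z + snd z)) * h z \<partial>lborel2))"
   by (rule lebesgue_lborel(1)[OF rm])
  also have "\<dots> = (\<integral>z. \<phi> (fst z + snd z) * h z \<partial>lborel2)" by (rule inversion_convolution[OF inv hi])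
  finally show ?thesis using left by simp
 qed
 show "Bochner (\<lambda>t. \<phi> t *\<^sub>C S f t) = multiplier_distr (\<lambda>\<xi>. R (Complex a \<xi>) \<circ> fst) f \<phi>"
  unfolding multiplier_distr_def o_def by (rule Bochner_eqI[OF lb main])
qed

lemma resolvent_multiplier_bound:
 "multiplier_bound 1 \<infinity> Y (\<lambda>\<xi>. R (Complex a \<xi>) \<circ> fst) L"
proof -
 have ra: "regular (Complex a \<xi>)" for \<xi> by (rule reg) (use a in simp)
 have lin: "bounded_clinear_on Y (R (Complex a \<xi>) \<circ> fst)" for \<xi>
  unfolding o_def by (rule bcl_subset[OF bcl_compose[OF regular_bcl[OF ra] bcl_fst]])
 have meas: "strongly_measurable_on Y (\<lambda>\<xi>. R (Complex a \<xi>) \<circ> fst)"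
  unfolding strongly_measurable_on_def strongly_measurable_smeas o_def
 proof (intro ballI smeas_isCont AE_I2, unfold isCont_def, rule R_tendsto[OF ra])
  show "((\<lambda>\<xi>. Complex a \<xi>) \<longlongrightarrow> Complex a \<xi>) (at \<xi>)" for \<xi> unfolding Complex_eq by (intro tendsto_intros)
 qed (use ra in simp_all)
 have mod: "moderate_growth Y (\<lambda>\<xi>. R (Complex a \<xi>) \<circ> fst)"
  unfolding moderate_growth_def
 proof (intro exI[of _ 2] conjI exI[of _ "\<lambda>\<xi>. ka * inverse (1 + \<xi>\<^sup>2)"] allI)
  show "integrable lebesgue (\<lambda>\<xi>. ka * inverse (1 + \<xi>\<^sup>2))"
   by (rule integrable_mult_right[OF lebesgue_inverse_square])
  fix \<xi> :: real
  have o: "onorm_on Y (R (Complex a \<xi>) \<circ> fst) \<le> ka" unfolding onorm_on_def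
  proof (rule cSUP_least)
   show "norm ((R (Complex a \<xi>) \<circ> fst) y) / norm y \<le> ka" if "y \<in> Y" for y
    using resolvent_kernel(3)[OF that] ka_nonneg by (cases "y = 0") (simp_all add: divide_le_eq)
  qed (use Y_0 in auto)
  have "(1 + \<bar>\<xi>\<bar>) powr (- 2) = inverse ((1 + \<bar>\<xi>\<bar>)\<^sup>2)" by (simp add: powr_minus powr_numeral)
  then have i: "(1 + \<bar>\<xi>\<bar>) powr (- 2) \<le> inverse (1 + \<xi>\<^sup>2)" using inverse_power2_le[of \<xi>] by simp
  have "(1 + \<bar>\<xi>\<bar>) powr (- 2) * onorm_on Y (R (Complex a \<xi>) \<circ> fst) \<le> (1 + \<bar>\<xi>\<bar>) powr (- 2) * ka" by (rule mult_left_mono[OF o]) simp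
  also have "\<dots> \<le> inverse (1 + \<xi>\<^sup>2) * ka" by (rule mult_right_mono[OF i ka_nonneg])
  finally show "(1 + \<bar>\<xi>\<bar>) powr (- 2) * onorm_on Y (R (Complex a \<xi>) \<circ> fst) \<le> ka * inverse (1 + \<xi>\<^sup>2)" by (simp add: mult.commute)
 qed simp
 have Sb: "S f \<in> Lp_fun \<infinity> UNIV \<and> Lp_norm \<infinity> (S f) \<le> ennreal L * Lp_norm 1 f" if f: "f \<in> Lp_fun 1 Y" for f
 proof -
  have fY: "\<And>s. f s \<in> Y" using f by (simp add: Lp_fun_def)
  note b = bint_Lp_fun[OF f]
  have n: "Lp_norm 1 f = ennreal (\<integral>s. norm (f s) \<partial>lebesgue)"
   unfolding Lp_norm_1 by (rule nn_integral_eq_integral[OF bint_norm_integrable[OF b]]) simp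
  have "Lp_norm \<infinity> (S f) \<le> ennreal (L * (\<integral>s. norm (f s) \<partial>lebesgue))"
   unfolding Lp_norm_def using S_bint(2)[OF b fY] by (auto intro!: Inf_lower ennreal_leI)
  then have le: "Lp_norm \<infinity> (S f) \<le> ennreal L * Lp_norm 1 f" unfolding n using L_nonneg by (simp add: ennreal_mult)
  then have "Lp_norm \<infinity> (S f) < \<infinity>" unfolding n using L_nonneg by (simp add: ennreal_mult[symmetric] order_le_less_trans[OF _ ennreal_less_top])
  moreover have "strongly_measurable (S f)"
   unfolding strongly_measurable_smeas by (intro smeas_isCont AE_I2 S_isCont b fY)
  ultimately show ?thesis using le by (simp add: Lp_fun_def)
 qed
 have add: "S (\<lambda>s. f s + g s) t = S f t + S g t" if f: "f \<in> Lp_fun 1 Y" and g: "g \<in> Lp_fun 1 Y" for f g t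
  unfolding S_def fst_add ker_linear
  by (rule Bochner_add) (rule S_bint(1)[OF bint_Lp_fun]; use f g in \<open>auto simp: Lp_fun_def\<close>)+
 have scale: "S (\<lambda>s. c *\<^sub>C f s) t = c *\<^sub>C S f t" if f: "f \<in> Lp_fun 1 Y" for c f t
 proof -
  have "bint (\<lambda>s. ker (t - s) (fst (f s)))" by (rule S_bint(1)[OF bint_Lp_fun[OF f]]) (use f in \<open>auto simp: Lp_fun_def\<close>)
  then show ?thesis unfolding S_def using Bochner_scaleC by (simp add: scaleC_prod_def ker_linear)
 qed
 show ?thesis
  unfolding multiplier_bound_def multiplier_bound_finite_def
  using L_nonneg lin meas mod Sb add scale S_represents by (auto intro!: exI[of _ S])
qed

end

section \<open>The equivalence\<close>

theorem corollary3p13: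
 fixes T :: "real \<Rightarrow> 'x::complex_banach \<Rightarrow> 'x"
  and D :: "'x set" and A :: "'x \<Rightarrow> 'x"
  and \<alpha> \<gamma> \<omega> :: real
 assumes "\<exists>x :: 'x. x \<noteq> 0"
  and "C0_semigroup T"
  and "is_generator T D (\<lambda>x. - A x)"
  and "{z. Re z < 0} \<subseteq> resolvent_set D A"
  and "0 \<le> \<alpha>" and "0 \<le> \<gamma>"
  and "growth_bound T < ereal \<omega>"
 defines "X\<^sub>\<gamma> \<equiv> frac_space D (\<lambda>x. \<omega> *\<^sub>R x + A x) \<gamma>"
 shows "(\<exists>C\<ge>0. \<forall>t\<ge>0. onorm_on X\<^sub>\<gamma> (T t \<circ> fst) \<le> C * (t powr \<alpha> + 1)) \<longleftrightarrow>
     (\<exists>p q :: ennreal. 1 \<le> p \<and> p \<le> q \<and>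
      (\<exists>C'\<ge>0. \<forall>a>0.
        (\<lambda>\<xi>. shift_inverse D A (Complex a \<xi>) \<circ> fst) \<in> fourier_multipliers p q X\<^sub>\<gamma> \<and>
        multiplier_norm p q X\<^sub>\<gamma> (\<lambda>\<xi>. shift_inverse D A (Complex a \<xi>) \<circ> fst)
         \<le> C' * (a powr (- \<alpha>) + 1)))"
proof -
 obtain w M where w: "w < \<omega>" and M: "\<forall>t\<ge>0. onorm (T t) \<le> M * exp (w * t)"
  using assms(7) unfolding growth_bound_def Inf_less_iff by auto
 have growth: "norm (T t x) \<le> max M 0 * exp (w * t) * norm x" if t: "0 \<le> t" for t x
 proof -
  have "bounded_clinear_on UNIV (T t)" using assms(2) t by (simp add: C0_semigroup_def)
  then have "norm (T t x) \<le> onorm (T t) * norm x" by (intro onorm bcl_bounded_linear)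
  also have "\<dots> \<le> (M * exp (w * t)) * norm x" by (rule mult_right_mono) (use M t in auto)
  also have "\<dots> \<le> max M 0 * exp (w * t) * norm x" by (intro mult_right_mono) auto
  finally show ?thesis .
 qed
 interpret C0_generator T D A "max M 0" w
  by unfold_locales (use assms(2,3) growth in auto)
 have reg: "regular z" if "0 < Re z" for z
  by (rule regular_resolvent_set) (use assms(4) that in auto)
 define J where "J = neg_frac_power D (\<lambda>x. \<omega> *\<^sub>R x + A x) \<gamma>"
 note J = neg_frac_power_facts[OF assms(6) w, folded J_def]
 have X: "X\<^sub>\<gamma> = range (\<lambda>z. (J z, z))"
  unfolding X\<^sub>\<gamma>_def J_def by (rule frac_space_eq[OF assms(6) w])
 have X0: "0 \<in> X\<^sub>\<gamma>" unfolding X using bcl_zero[OF J(1)] by (auto simp: zero_prod_def image_iff)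
 have nonneg: "0 \<le> C" if "multiplier_bound p q X\<^sub>\<gamma> m C" for p q C and m :: "real \<Rightarrow> 'x \<times> 'x \<Rightarrow> 'x"
  using that by (simp add: multiplier_bound_def)
 show ?thesis
 proof
  assume "\<exists>C\<ge>0. \<forall>t\<ge>0. onorm_on X\<^sub>\<gamma> (T t \<circ> fst) \<le> C * (t powr \<alpha> + 1)"
  then obtain C where C: "0 \<le> C" "\<forall>t\<ge>0. onorm_on X\<^sub>\<gamma> (T t \<circ> fst) \<le> C * (t powr \<alpha> + 1)" by (elim exE conjE)
  have orbit: "norm (T t (fst y)) \<le> C * (t powr \<alpha> + 1) * norm y" if t: "0 \<le> t" and y: "y \<in> X\<^sub>\<gamma>" for t y
  proof -
   have "bounded_clinear_on X\<^sub>\<gamma> (T t \<circ> fst)"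
    unfolding o_def by (rule bcl_subset[OF bcl_compose[OF T_bcl[OF t] bcl_fst]])
   from onorm_on_bound[OF this y] have "norm (T t (fst y)) \<le> onorm_on X\<^sub>\<gamma> (T t \<circ> fst) * norm y" by simp
   also have "\<dots> \<le> C * (t powr \<alpha> + 1) * norm y" by (rule mult_right_mono) (use C t in auto)
   finally show ?thesis .
  qed
  obtain k where k: "0 \<le> k" "\<forall>a>0. \<forall>t\<ge>0. exp (- (a * t)) * t powr \<alpha> \<le> k * a powr (- \<alpha>)"
   using powr_times_exp_le[OF assms(5)] by (elim exE conjE)
  have mb: "multiplier_bound 1 \<infinity> X\<^sub>\<gamma> (\<lambda>\<xi>. R (Complex a \<xi>) \<circ> fst) (C * (k + 1) * (a powr (- \<alpha>) + 1))" if a: "0 < a" for a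
  proof -
   interpret P: polynomial_orbits T D A "max M 0" w X\<^sub>\<gamma> C \<alpha> a k
    by unfold_locales (use reg X0 assms(5) C(1) a orbit k in auto)
   show ?thesis using P.resolvent_multiplier_bound unfolding P.L_def .
  qed
  have "multiplier_norm 1 \<infinity> X\<^sub>\<gamma> (\<lambda>\<xi>. R (Complex a \<xi>) \<circ> fst) \<le> C * (k + 1) * (a powr (- \<alpha>) + 1)" if a: "0 < a" for a
   unfolding multiplier_norm_def by (rule cInf_lower) (use mb[OF a] nonneg in \<open>auto intro!: bdd_belowI[of _ 0]\<close>)
  then show "\<exists>p q :: ennreal. 1 \<le> p \<and> p \<le> q \<and> (\<exists>C'\<ge>0. \<forall>a>0.
    (\<lambda>\<xi>. R (Complex a \<xi>) \<circ> fst) \<in> fourier_multipliers p q X\<^sub>\<gamma> \<and>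
    multiplier_norm p q X\<^sub>\<gamma> (\<lambda>\<xi>. R (Complex a \<xi>) \<circ> fst) \<le> C' * (a powr (- \<alpha>) + 1))"
   using C(1) k(1) mb unfolding fourier_multipliers_def
   by (intro exI[of _ 1] exI[of _ \<infinity>] conjI exI[of _ "C * (k + 1)"]) auto
 next
  assume "\<exists>p q :: ennreal. 1 \<le> p \<and> p \<le> q \<and> (\<exists>C'\<ge>0. \<forall>a>0.
    (\<lambda>\<xi>. R (Complex a \<xi>) \<circ> fst) \<in> fourier_multipliers p q X\<^sub>\<gamma> \<and>
    multiplier_norm p q X\<^sub>\<gamma> (\<lambda>\<xi>. R (Complex a \<xi>) \<circ> fst) \<le> C' * (a powr (- \<alpha>) + 1))"
  then obtain p q C' where pq: "1 \<le> p" "p \<le> q" and C': "0 \<le> C'" and m: "\<forall>a>0.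
    (\<lambda>\<xi>. R (Complex a \<xi>) \<circ> fst) \<in> fourier_multipliers p q X\<^sub>\<gamma> \<and>
    multiplier_norm p q X\<^sub>\<gamma> (\<lambda>\<xi>. R (Complex a \<xi>) \<circ> fst) \<le> C' * (a powr (- \<alpha>) + 1)"
   by (elim exE conjE)
  (* The infimum defining the multiplier norm need not be attained, hence the summand 1. *)
  define N where "N a = C' * (a powr (- \<alpha>) + 1) + 1" for a
  have mult: "multiplier_bound p q X\<^sub>\<gamma> (\<lambda>\<xi>. R (Complex a \<xi>) \<circ> fst) (N a)" if a: "0 < a" for a
  proof -
   let ?S = "{C. multiplier_bound p q X\<^sub>\<gamma> (\<lambda>\<xi>. R (Complex a \<xi>) \<circ> fst) C}"
   have ne: "?S \<noteq> {}" using m a by (auto simp: fourier_multipliers_def)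
   have "Inf ?S < N a" using m[rule_format, OF a] unfolding multiplier_norm_def N_def by linarith
   then obtain C where "C \<in> ?S" "C < N a" using cInf_lessD[OF ne] by blast
   then show ?thesis by (auto intro: multiplier_bound_mono)
  qed
  interpret P: resolvent_multiplier T D A "max M 0" w J p q N
  proof unfold_locales
   show "0 < N a" if "0 < a" for a using C' by (simp add: N_def add_nonneg_pos)
   show "N s \<le> N a" if "0 < a" "a \<le> s" for a s
   proof -
    have "s powr (- \<alpha>) \<le> a powr (- \<alpha>)" by (rule powr_mono2') (use that assms(5) in auto)
    then show ?thesis unfolding N_def using C' by (intro add_right_mono mult_left_mono) auto
   qed
  qed (use reg J pq mult in \<open>auto simp: X\<close>)
  show "\<exists>C\<ge>0. \<forall>t\<ge>0. onorm_on X\<^sub>\<gamma> (T t \<circ> fst) \<le> C * (t powr \<alpha> + 1)"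
   unfolding X by (rule P.semigroup_bound[OF N_def C'])
 qed
qed

end
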